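(* Let $X=G/K$ be a compact irreducible Riemannian symmetric space and let $(\mu_t,t\ge0)$ be a $K$-bi-invariant convolution semigroup of probability measures on $G$. (1) For all $t\ge0$, $\pi\in\widehat G$, $1\le i,j\le d_\pi$, $$P_t\pi_{ij}=\begin{cases}e^{-t\overline{\chi_\pi}}\,\pi_{ij}&\text{if } i=1 \text{ and } \pi\in\widehat G_s,\\ 0&\text{otherwise.}\end{cases}$$ (2) If $\mu_t$ has a continuous density for all $t>0$, then for all $t>0$ the operator $P_t$ is trace-class in $L^2(G)$ and its trace is given by $$\mathrm{Tr}(P_t)=\sum_{\pi\in\widehat G_s}d_\pi e^{-t\chi_\pi}.$$
   Context: $X=G/K$ is a compact (globally Riemannian) symmetric space, with $G$ a compact connected Lie group (the identity component of the isometry group of $X$) and $K$ a closed subgroup, the stabiliser of the point $o=eK$; $(G,K)$ is then a compact Gelfand pair. Irreducible means that $\mathrm{Ad}(K)$ acts irreducibly on $\mathfrak p=\mathfrak g\ominus\mathfrak k$, where $\mathfrak g,\mathfrak k$ are the Lie algebras of $G,K$. Haar measures are normalised to mass one, and densities on $G$ are with respect to Haar measure. A convolution semigroup is a family of probability measures with $\mu_{s+t}=\mu_s*\mu_t$ for all $s,t\ge0$ and $\mu_t\to\mu_0$ weakly as $t\to0$; it is $K$-bi-invariant if each $\mu_t$ is invariant under left and right translations by $K$, and then $\mu_0=m_K$, the normalised Haar measure of $K$ viewed as a measure on $G$. $P_tf(g)=\int_Gf(gh)\,\mu_t(dh)$ for $f\in L^2(G)$. $\widehat G$ is the unitary dual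 of $G$ (one representative $\pi$ on a space $V_\pi$ fixed per class), $d_\pi=\dim V_\pi$, and $\widehat G_s$ is the set of spherical $\pi$, i.e. those having a non-zero $K$-fixed vector, which is then unique up to scalars. For each $\pi$ fix an orthonormal basis $e_1^\pi,\dots,e_{d_\pi}^\pi$ of $V_\pi$, with $e_1^\pi$ a unit $K$-fixed vector if $\pi\in\widehat G_s$. The inner product is linear in its first slot; $\pi_{ij}(g)=\langle\pi(g)e_i^\pi,e_j^\pi\rangle$, and for $\pi\in\widehat G_s$, $\phi_\pi(g)=\langle e_1^\pi,\pi(g)e_1^\pi\rangle$. $\chi_\pi\in\mathbb C$ ($\pi\in\widehat G_s$) is the characteristic exponent of the semigroup: $\int_G\phi_\pi\,d\mu_t=e^{-t\chi_\pi}$ for all $t\ge0$. (Gangolli's known Lévy–Khintchine formula expresses it as $\chi_\pi=a\kappa_\pi+\int_G(1-\phi_\pi(g))\,\nu(dg)$ with $a\ge0$, $\nu$ a $K$-bi-invariant Lévy measure on $G$, and $\Delta\phi_\pi=-\kappa_\pi\phi_\pi$, where $\Delta$ is the Laplace–Beltrami operator of an $\mathrm{Ad}$-invariant Riemannian metric on $G$ compatible with that of $X$.) *)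

theory Defs
  imports
    "HOL-Probability.Probability"
    "HOL-Algebra.Group"
    "Jordan_Normal_Form.VS_Connect"
begin

section \<open>Smooth manifolds, Lie groups and Riemannian manifolds\<close>

text \<open>\<open>Ck_on k S f\<close> is only used for open \<open>S\<close>, where \<open>at x within S\<close> is \<open>at x\<close>.\<close>

primrec Ck_on ::
  "nat \<Rightarrow> 'a::euclidean_space set \<Rightarrow> ('a \<Rightarrow> 'b::real_normed_vector) \<Rightarrow> bool" where
  "Ck_on 0 S = (\<lambda>f. continuous_on S f)"
| "Ck_on (Suc k) S =
     (\<lambda>f. f differentiable_on S \<and> (\<forall>v. Ck_on k S (\<lambda>x. frechet_derivative f (at x) v)))"

definition smooth_on ::
  "'a::euclidean_space set \<Rightarrow> ('a \<Rightarrow> 'b::real_normed_vector) \<Rightarrow> bool" where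
  "smooth_on S f \<longleftrightarrow> (\<forall>k. Ck_on k S f)"

type_synonym ('p, 'e) chart = "'p set \<times> ('p \<Rightarrow> 'e)"

definition chart_on :: "'p topology \<Rightarrow> ('p, 'e::euclidean_space) chart \<Rightarrow> bool" where
  "chart_on T c \<longleftrightarrow>
     openin T (fst c) \<and> open (snd c ` fst c) \<and>
     homeomorphic_map (subtopology T (fst c)) (top_of_set (snd c ` fst c)) (snd c)"

definition chart_inv :: "('p, 'e) chart \<Rightarrow> 'e \<Rightarrow> 'p" where
  "chart_inv c = inv_into (fst c) (snd c)"

definition smooth_manifold :: "'p topology \<Rightarrow> ('p, 'e::euclidean_space) chart set \<Rightarrow> bool" where
  "smooth_manifold T A \<longleftrightarrow>
     Hausdorff_space T \<and> second_countable T \<and>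
     (\<forall>c\<in>A. chart_on T c) \<and> \<Union> (fst ` A) = topspace T \<and>
     (\<forall>c\<in>A. \<forall>d\<in>A. smooth_on (snd c ` (fst c \<inter> fst d)) (snd d \<circ> chart_inv c))"

definition smooth_map ::
  "'p topology \<Rightarrow> ('p, 'e::euclidean_space) chart set \<Rightarrow>
   'q topology \<Rightarrow> ('q, 'f::euclidean_space) chart set \<Rightarrow> ('p \<Rightarrow> 'q) \<Rightarrow> bool" where
  "smooth_map T A T' A' f \<longleftrightarrow>
     continuous_map T T' f \<and>
     (\<forall>c\<in>A. \<forall>d\<in>A'. smooth_on (snd c ` {p \<in> fst c. f p \<in> fst d}) (snd d \<circ> f \<circ> chart_inv c))"

definition prod_atlas ::
  "('p, 'e) chart set \<Rightarrow> ('q, 'f) chart set \<Rightarrow> ('p \<times> 'q, 'e \<times> 'f) chart set" where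
  "prod_atlas A A' = {(fst c \<times> fst d, map_prod (snd c) (snd d)) |c d. c \<in> A \<and> d \<in> A'}"

definition lie_group ::
  "('g, 'b) monoid_scheme \<Rightarrow> 'g topology \<Rightarrow> ('g, 'f::euclidean_space) chart set \<Rightarrow> bool" where
  "lie_group G T A \<longleftrightarrow>
     group G \<and> topspace T = carrier G \<and> smooth_manifold T A \<and>
     smooth_map (prod_topology T T) (prod_atlas A A) T A (\<lambda>(x, y). x \<otimes>\<^bsub>G\<^esub> y) \<and>
     smooth_map T A T A (\<lambda>x. inv\<^bsub>G\<^esub> x)"

text \<open>A tangent vector at \<open>p\<close> is represented by its coordinates in the charts around \<open>p\<close>.
  A Riemannian metric is therefore a family of local expressions \<open>\<rho> c x v w\<close>, for a chart \<open>c\<close>,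
  a point \<open>x\<close> of its image and coordinate vectors \<open>v\<close>, \<open>w\<close>, that transforms
  as a covariant 2-tensor under change of chart.\<close>

type_synonym ('p, 'e) local_metric = "('p, 'e) chart \<Rightarrow> 'e \<Rightarrow> 'e \<Rightarrow> 'e \<Rightarrow> real"

definition local_derivative ::
  "('p, 'e::real_normed_vector) chart \<Rightarrow> ('q, 'f::real_normed_vector) chart \<Rightarrow>
   ('p \<Rightarrow> 'q) \<Rightarrow> 'p \<Rightarrow> 'e \<Rightarrow> 'f" where
  "local_derivative c d f p = frechet_derivative (snd d \<circ> f \<circ> chart_inv c) (at (snd c p))"

definition inner_product_form :: "('v::real_vector \<Rightarrow> 'v \<Rightarrow> real) \<Rightarrow> bool" where
  "inner_product_form B \<longleftrightarrow>
     bilinear B \<and> (\<forall>v w. B v w = B w v) \<and> (\<forall>v. v \<noteq> 0 \<longrightarrow> 0 < B v v)"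

definition riemannian_manifold ::
  "'p topology \<Rightarrow> ('p, 'e::euclidean_space) chart set \<Rightarrow> ('p, 'e) local_metric \<Rightarrow> bool" where
  "riemannian_manifold T A \<rho> \<longleftrightarrow>
     smooth_manifold T A \<and>
     (\<forall>c\<in>A. (\<forall>x\<in>snd c ` fst c. inner_product_form (\<rho> c x)) \<and>
            (\<forall>v w. smooth_on (snd c ` fst c) (\<lambda>x. \<rho> c x v w))) \<and>
     (\<forall>c\<in>A. \<forall>d\<in>A. \<forall>p\<in>fst c \<inter> fst d. \<forall>v w.
        \<rho> c (snd c p) v w =
        \<rho> d (snd d p) (local_derivative c d id p v) (local_derivative c d id p w))"

section \<open>Riemannian symmetric spaces and their isometry groups\<close>

text \<open>From here on the manifold is a whole type, with its class topology.\<close>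

definition isometry ::
  "('x::topological_space, 'e::euclidean_space) chart set \<Rightarrow> ('x, 'e) local_metric \<Rightarrow>
   ('x \<Rightarrow> 'x) \<Rightarrow> bool" where
  "isometry A \<rho> f \<longleftrightarrow>
     bij f \<and> smooth_map euclidean A euclidean A f \<and>
     smooth_map euclidean A euclidean A (inv_into UNIV f) \<and>
     (\<forall>c\<in>A. \<forall>d\<in>A. \<forall>p\<in>fst c. f p \<in> fst d \<longrightarrow>
        (\<forall>v w. \<rho> c (snd c p) v w =
               \<rho> d (snd d (f p)) (local_derivative c d f p v) (local_derivative c d f p w)))"

definition riemannian_symmetric_space ::
  "('x::topological_space, 'e::euclidean_space) chart set \<Rightarrow> ('x, 'e) local_metric \<Rightarrow> bool" where
  "riemannian_symmetric_space A \<rho> \<longleftrightarrow>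
     riemannian_manifold euclidean A \<rho> \<and> connected (UNIV :: 'x set) \<and>
     (\<forall>p. \<exists>s. isometry A \<rho> s \<and> s \<circ> s = id \<and> s p = p \<and>
          (\<exists>U. open U \<and> p \<in> U \<and> (\<forall>q\<in>U. s q = q \<longrightarrow> q = p)))"

definition compact_open_topology ::
  "('x::topological_space \<Rightarrow> 'y::topological_space) topology" where
  "compact_open_topology =
     topology_generated_by {{f. f ` C \<subseteq> U} |C U. compact C \<and> open U}"

definition isometry_component ::
  "('x::topological_space, 'e::euclidean_space) chart set \<Rightarrow> ('x, 'e) local_metric \<Rightarrow>
   ('x \<Rightarrow> 'x) monoid" where
  "isometry_component A \<rho> =
     \<lparr>carrier =
        connected_component_of_set (subtopology compact_open_topology (Collect (isometry A \<rho>))) id,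
      mult = (\<circ>), one = id\<rparr>"

text \<open>The Lie algebra of the Lie group \<open>G\<close> is its tangent space at \<open>\<one>\<close>, read in a chart \<open>c\<close>
  around \<open>\<one>\<close>; so it is the whole coordinate space of \<open>c\<close>. The Lie algebra of a closed subgroup
  consists of the velocities of its one-parameter subgroups.\<close>

definition subgroup_lie_algebra ::
  "('g, 'b) monoid_scheme \<Rightarrow> 'g topology \<Rightarrow> ('g, 'f::euclidean_space) chart \<Rightarrow> 'g set \<Rightarrow> 'f set" where
  "subgroup_lie_algebra G T c H =
     {v. \<exists>\<gamma>. continuous_map euclideanreal T \<gamma> \<and> (\<forall>s t. \<gamma> (s + t) = \<gamma> s \<otimes>\<^bsub>G\<^esub> \<gamma> t) \<and>
             range \<gamma> \<subseteq> H \<and> ((snd c \<circ> \<gamma>) has_vector_derivative v) (at 0)}"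

definition Ad ::
  "('g, 'b) monoid_scheme \<Rightarrow> ('g, 'f::euclidean_space) chart \<Rightarrow> 'g \<Rightarrow> 'f \<Rightarrow> 'f" where
  "Ad G c g = local_derivative c c (\<lambda>h. g \<otimes>\<^bsub>G\<^esub> h \<otimes>\<^bsub>G\<^esub> inv\<^bsub>G\<^esub> g) \<one>\<^bsub>G\<^esub>"

text \<open>\<open>B\<close> is the \<open>Ad G\<close>-invariant inner product for which \<open>\<pp>\<close> is the orthogonal complement of
  \<open>\<kk>\<close>. Neither \<open>B\<close> nor the chart matters: every such \<open>\<pp>\<close> is isomorphic to the quotient of the Lie
  algebras as an \<open>Ad K\<close>-module.\<close>

definition irreducible_pair ::
  "('g, 'b) monoid_scheme \<Rightarrow> 'g topology \<Rightarrow> ('g, 'f::euclidean_space) chart set \<Rightarrow> 'g set \<Rightarrow> bool" where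
  "irreducible_pair G T A K \<longleftrightarrow>
     (\<exists>c\<in>A. \<exists>B. \<one>\<^bsub>G\<^esub> \<in> fst c \<and> inner_product_form B \<and>
        (\<forall>g\<in>carrier G. \<forall>v w. B (Ad G c g v) (Ad G c g w) = B v w) \<and>
        (let \<kk> = subgroup_lie_algebra G T c K; \<pp> = {v. \<forall>w\<in>\<kk>. B v w = 0} in
           \<pp> \<noteq> {0} \<and>
           (\<forall>W. Real_Vector_Spaces.subspace W \<and> W \<subseteq> \<pp> \<and> (\<forall>k\<in>K. Ad G c k ` W \<subseteq> W) \<longrightarrow>
              W = {0} \<or> W = \<pp>)))"

section \<open>Haar measures and convolution semigroups\<close>

definition borel_of :: "'g topology \<Rightarrow> 'g measure" where
  "borel_of T = sigma (topspace T) {U. openin T U}"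

definition borel_prob :: "'g topology \<Rightarrow> 'g measure \<Rightarrow> bool" where
  "borel_prob T M \<longleftrightarrow> prob_space M \<and> sets M = sets (borel_of T)"

text \<open>The normalised Haar measure of the closed subgroup \<open>H\<close>, as a measure on \<open>G\<close>.\<close>

definition normalised_haar ::
  "('g, 'b) monoid_scheme \<Rightarrow> 'g topology \<Rightarrow> 'g set \<Rightarrow> 'g measure \<Rightarrow> bool" where
  "normalised_haar G T H M \<longleftrightarrow>
     borel_prob T M \<and> emeasure M H = 1 \<and> (\<forall>h\<in>H. distr M M (\<lambda>x. h \<otimes>\<^bsub>G\<^esub> x) = M)"

definition convolve ::
  "('g, 'b) monoid_scheme \<Rightarrow> 'g topology \<Rightarrow> 'g measure \<Rightarrow> 'g measure \<Rightarrow> 'g measure" where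
  "convolve G T M N = distr (M \<Otimes>\<^sub>M N) (borel_of T) (\<lambda>(x, y). x \<otimes>\<^bsub>G\<^esub> y)"

definition convolution_semigroup ::
  "('g, 'b) monoid_scheme \<Rightarrow> 'g topology \<Rightarrow> (real \<Rightarrow> 'g measure) \<Rightarrow> bool" where
  "convolution_semigroup G T \<mu> \<longleftrightarrow>
     (\<forall>t\<ge>0. borel_prob T (\<mu> t)) \<and>
     (\<forall>s\<ge>0. \<forall>t\<ge>0. \<mu> (s + t) = convolve G T (\<mu> s) (\<mu> t)) \<and>
     (\<forall>f. continuous_map T euclideanreal f \<and> bounded (f ` topspace T) \<longrightarrow>
        ((\<lambda>t. \<integral>x. f x \<partial>\<mu> t) \<longlongrightarrow> (\<integral>x. f x \<partial>\<mu> 0)) (at_right 0))"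

definition bi_invariant ::
  "('g, 'b) monoid_scheme \<Rightarrow> 'g set \<Rightarrow> 'g measure \<Rightarrow> bool" where
  "bi_invariant G K M \<longleftrightarrow>
     (\<forall>k\<in>K. distr M M (\<lambda>x. k \<otimes>\<^bsub>G\<^esub> x) = M \<and> distr M M (\<lambda>x. x \<otimes>\<^bsub>G\<^esub> k) = M)"

definition has_continuous_density :: "'g topology \<Rightarrow> 'g measure \<Rightarrow> 'g measure \<Rightarrow> bool" where
  "has_continuous_density T m M \<longleftrightarrow>
     (\<exists>f. continuous_map T euclideanreal f \<and> (\<forall>x\<in>topspace T. 0 \<le> f x) \<and>
          M = density m (\<lambda>x. ennreal (f x)))"

definition transition_op ::
  "('g, 'b) monoid_scheme \<Rightarrow> (real \<Rightarrow> 'g measure) \<Rightarrow> real \<Rightarrow> ('g \<Rightarrow> complex) \<Rightarrow> 'g \<Rightarrow> complex" where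
  "transition_op G \<mu> t f = (\<lambda>g. \<integral>h. f (g \<otimes>\<^bsub>G\<^esub> h) \<partial>\<mu> t)"

section \<open>The unitary dual\<close>

text \<open>Irreducible unitary representations of a compact group are finite-dimensional, so each is
  realised on \<open>V\<^sub>\<pi> = \<complex>\<^sup>d\<close>. The product \<open>v \<bullet>c w\<close> is conjugate-linear in \<open>w\<close>. In finite dimension,
  strong continuity is continuity of the matrix entries.\<close>

definition unitary_rep ::
  "('g, 'b) monoid_scheme \<Rightarrow> 'g topology \<Rightarrow> nat \<Rightarrow> ('g \<Rightarrow> complex mat) \<Rightarrow> bool" where
  "unitary_rep G T n \<pi> \<longleftrightarrow>
     (\<forall>g\<in>carrier G. \<pi> g \<in> carrier_mat n n) \<and> \<pi> \<one>\<^bsub>G\<^esub> = 1\<^sub>m n \<and>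
     (\<forall>g\<in>carrier G. \<forall>h\<in>carrier G. \<pi> (g \<otimes>\<^bsub>G\<^esub> h) = \<pi> g * \<pi> h) \<and>
     (\<forall>g\<in>carrier G. \<forall>v\<in>carrier_vec n. \<forall>w\<in>carrier_vec n.
        (\<pi> g *\<^sub>v v) \<bullet>c (\<pi> g *\<^sub>v w) = v \<bullet>c w) \<and>
     (\<forall>i<n. \<forall>j<n. continuous_map T euclidean (\<lambda>g. \<pi> g $$ (i, j)))"

definition irreducible_unitary_rep ::
  "('g, 'b) monoid_scheme \<Rightarrow> 'g topology \<Rightarrow> nat \<Rightarrow> ('g \<Rightarrow> complex mat) \<Rightarrow> bool" where
  "irreducible_unitary_rep G T n \<pi> \<longleftrightarrow>
     unitary_rep G T n \<pi> \<and> n > 0 \<and>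
     (\<forall>W. VectorSpace.subspace class_ring W (module_vec TYPE(complex) n) \<and>
          (\<forall>g\<in>carrier G. \<forall>w\<in>W. \<pi> g *\<^sub>v w \<in> W) \<longrightarrow>
          W = {0\<^sub>v n} \<or> W = carrier_vec n)"

definition rep_dim :: "('g, 'b) monoid_scheme \<Rightarrow> ('g \<Rightarrow> complex mat) \<Rightarrow> nat" where
  "rep_dim G \<pi> = dim_row (\<pi> \<one>\<^bsub>G\<^esub>)"

definition unitarily_equivalent ::
  "('g, 'b) monoid_scheme \<Rightarrow> ('g \<Rightarrow> complex mat) \<Rightarrow> ('g \<Rightarrow> complex mat) \<Rightarrow> bool" where
  "unitarily_equivalent G \<pi> \<pi>' \<longleftrightarrow>
     rep_dim G \<pi> = rep_dim G \<pi>' \<and>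
     (\<exists>U\<in>carrier_mat (rep_dim G \<pi>) (rep_dim G \<pi>).
        (\<forall>v\<in>carrier_vec (rep_dim G \<pi>). \<forall>w\<in>carrier_vec (rep_dim G \<pi>).
           (U *\<^sub>v v) \<bullet>c (U *\<^sub>v w) = v \<bullet>c w) \<and>
        (\<forall>g\<in>carrier G. U * \<pi> g = \<pi>' g * U))"

text \<open>A system of representatives, exactly one for each class.\<close>

definition is_unitary_dual ::
  "('g, 'b) monoid_scheme \<Rightarrow> 'g topology \<Rightarrow> ('g \<Rightarrow> complex mat) set \<Rightarrow> bool" where
  "is_unitary_dual G T D \<longleftrightarrow>
     (\<forall>\<pi>\<in>D. irreducible_unitary_rep G T (rep_dim G \<pi>) \<pi>) \<and>
     (\<forall>n \<pi>. irreducible_unitary_rep G T n \<pi> \<longrightarrow> (\<exists>!\<pi>'\<in>D. unitarily_equivalent G \<pi> \<pi>'))"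

definition fixed_vector :: "'g set \<Rightarrow> ('g \<Rightarrow> complex mat) \<Rightarrow> complex vec \<Rightarrow> bool" where
  "fixed_vector K \<pi> v \<longleftrightarrow> (\<forall>k\<in>K. \<pi> k *\<^sub>v v = v)"

definition spherical ::
  "('g, 'b) monoid_scheme \<Rightarrow> 'g set \<Rightarrow> ('g \<Rightarrow> complex mat) \<Rightarrow> bool" where
  "spherical G K \<pi> \<longleftrightarrow>
     (\<exists>v\<in>carrier_vec (rep_dim G \<pi>). v \<noteq> 0\<^sub>v (rep_dim G \<pi>) \<and> fixed_vector K \<pi> v)"

text \<open>The bases are indexed from 1; \<open>e \<pi> i\<close> is only relevant for \<open>1 \<le> i \<le> rep_dim G \<pi>\<close>.\<close>

definition adapted_bases ::
  "('g, 'b) monoid_scheme \<Rightarrow> 'g set \<Rightarrow> ('g \<Rightarrow> complex mat) set \<Rightarrow>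
   (('g \<Rightarrow> complex mat) \<Rightarrow> nat \<Rightarrow> complex vec) \<Rightarrow> bool" where
  "adapted_bases G K D e \<longleftrightarrow>
     (\<forall>\<pi>\<in>D.
        (\<forall>i\<in>{1..rep_dim G \<pi>}. e \<pi> i \<in> carrier_vec (rep_dim G \<pi>)) \<and>
        (\<forall>i\<in>{1..rep_dim G \<pi>}. \<forall>j\<in>{1..rep_dim G \<pi>}.
           e \<pi> i \<bullet>c e \<pi> j = (if i = j then 1 else 0)) \<and>
        (spherical G K \<pi> \<longrightarrow> fixed_vector K \<pi> (e \<pi> 1)))"

definition matrix_coeff ::
  "(('g \<Rightarrow> complex mat) \<Rightarrow> nat \<Rightarrow> complex vec) \<Rightarrow> ('g \<Rightarrow> complex mat) \<Rightarrow> nat \<Rightarrow> nat \<Rightarrow>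
   'g \<Rightarrow> complex" where
  "matrix_coeff e \<pi> i j g = (\<pi> g *\<^sub>v e \<pi> i) \<bullet>c e \<pi> j"

definition spherical_fun ::
  "(('g \<Rightarrow> complex mat) \<Rightarrow> nat \<Rightarrow> complex vec) \<Rightarrow> ('g \<Rightarrow> complex mat) \<Rightarrow> 'g \<Rightarrow> complex" where
  "spherical_fun e \<pi> g = e \<pi> 1 \<bullet>c (\<pi> g *\<^sub>v e \<pi> 1)"

section \<open>Trace-class operators on \<open>L\<^sup>2\<close>\<close>

text \<open>Elements of \<open>L\<^sup>2(M)\<close> are represented by functions, and operators by maps on functions.
  A map that is linear almost everywhere and bounded respects equality almost everywhere, so it
  induces a bounded operator on the Hilbert space of classes.\<close>

definition L2 :: "'a measure \<Rightarrow> ('a \<Rightarrow> complex) set" where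
  "L2 M = {f \<in> borel_measurable M. integrable M (\<lambda>x. (cmod (f x))\<^sup>2)}"

definition L2_inner :: "'a measure \<Rightarrow> ('a \<Rightarrow> complex) \<Rightarrow> ('a \<Rightarrow> complex) \<Rightarrow> complex" where
  "L2_inner M f g = (\<integral>x. f x * cnj (g x) \<partial>M)"

definition L2_norm :: "'a measure \<Rightarrow> ('a \<Rightarrow> complex) \<Rightarrow> real" where
  "L2_norm M f = sqrt (\<integral>x. (cmod (f x))\<^sup>2 \<partial>M)"

definition L2_orthonormal_basis :: "'a measure \<Rightarrow> ('a \<Rightarrow> complex) set \<Rightarrow> bool" where
  "L2_orthonormal_basis M E \<longleftrightarrow>
     E \<subseteq> L2 M \<and> (\<forall>f\<in>E. \<forall>g\<in>E. L2_inner M f g = (if f = g then 1 else 0)) \<and>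
     (\<forall>f\<in>L2 M. (\<forall>g\<in>E. L2_inner M f g = 0) \<longrightarrow> (AE x in M. f x = 0))"

definition L2_bounded_operator ::
  "'a measure \<Rightarrow> (('a \<Rightarrow> complex) \<Rightarrow> 'a \<Rightarrow> complex) \<Rightarrow> bool" where
  "L2_bounded_operator M P \<longleftrightarrow>
     (\<forall>f\<in>L2 M. P f \<in> L2 M) \<and>
     (\<forall>f\<in>L2 M. \<forall>g\<in>L2 M. \<forall>a b.
        AE x in M. P (\<lambda>y. a * f y + b * g y) x = a * P f x + b * P g x) \<and>
     (\<exists>C. \<forall>f\<in>L2 M. L2_norm M (P f) \<le> C * L2_norm M f)"

text \<open>\<open>S\<close> is the modulus \<open>|P|\<close>, the unique positive operator with \<open>S\<^sup>2 = P\<^sup>*P\<close>.\<close>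

definition L2_modulus ::
  "'a measure \<Rightarrow> (('a \<Rightarrow> complex) \<Rightarrow> 'a \<Rightarrow> complex) \<Rightarrow> (('a \<Rightarrow> complex) \<Rightarrow> 'a \<Rightarrow> complex) \<Rightarrow> bool"
  where
  "L2_modulus M P S \<longleftrightarrow>
     L2_bounded_operator M S \<and> (\<forall>f\<in>L2 M. L2_inner M (S f) f \<in> \<real>\<^sub>\<ge>\<^sub>0) \<and>
     (\<forall>f\<in>L2 M. \<forall>g\<in>L2 M. L2_inner M (S (S f)) g = L2_inner M (P f) (P g))"

definition L2_trace_class ::
  "'a measure \<Rightarrow> (('a \<Rightarrow> complex) \<Rightarrow> 'a \<Rightarrow> complex) \<Rightarrow> bool" where
  "L2_trace_class M P \<longleftrightarrow>
     L2_bounded_operator M P \<and>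
     (\<exists>S. L2_modulus M P S \<and>
          (\<forall>E. L2_orthonormal_basis M E \<longrightarrow> (\<lambda>f. L2_inner M (S f) f) summable_on E))"

definition L2_has_trace ::
  "'a measure \<Rightarrow> (('a \<Rightarrow> complex) \<Rightarrow> 'a \<Rightarrow> complex) \<Rightarrow> complex \<Rightarrow> bool" where
  "L2_has_trace M P c \<longleftrightarrow>
     (\<forall>E. L2_orthonormal_basis M E \<longrightarrow> ((\<lambda>f. L2_inner M (P f) f) has_sum c) E)"

end

theory Submission
  imports Defs "Jordan_Normal_Form.Spectral_Radius"
begin

text \<open>Conjugation by the symmetry at \<open>x\<^sub>0\<close> is an involution \<open>\<sigma>\<close> of \<open>G\<close>. Squaring is a local homeomorphism
  at \<open>\<one>\<close>, so an element near \<open>\<one>\<close> factors as \<open>p h\<close> with \<open>\<sigma>(p) = p\<inverse>\<close> and \<open>\<sigma>(h) = h\<close>; the fixed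
  point \<open>x\<^sub>0\<close> being isolated, \<open>h \<in> K\<close>, whence \<open>\<sigma>(g) \<in> K g\<inverse> K\<close> near \<open>\<one>\<close>. Matrix coefficients on a
  connected group satisfy unique continuation, so \<open>\<langle>\<pi>(\<sigma>(g))u, v\<rangle> = \<langle>\<pi>(g\<inverse>)u, v\<rangle>\<close> for all \<open>g\<close> and all
  \<open>K\<close>-fixed \<open>u\<close>, \<open>v\<close>. Gelfand's trick then makes the space of \<open>K\<close>-fixed vectors at most
  one-dimensional, and \<open>\<integral> \<pi>(h) \<mu>\<^sub>t(dh)\<close>, which maps into that space and vanishes on its complement, is
  a multiple of the projection onto it. This is (1).

  For (2), Bessel's inequality for the density of \<open>\<mu>\<^bsub>t/2\<^esub>\<close> gives
  \<open>\<Sum>\<^sub>\<pi> d\<^sub>\<pi> |e\<^bsup>-t\<chi>\<^esup>| < \<infinity>\<close>. By the Peter--Weyl theorem, the density of \<open>\<mu>\<^sub>t\<close> is the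
  uniformly convergent sum of \<open>d\<^sub>\<pi> e\<^bsup>-t\<chi>*\<^esup> \<phi>\<^sub>\<pi>\<close>, where \<open>\<chi>*\<close> is the conjugate of \<open>\<chi> = \<chi>\<^sub>\<pi>\<close>. So
  \<open>P\<^sub>t\<close> acts as \<open>e\<^bsup>-t\<chi>*\<^esup>\<close> on the span of \<open>\<pi>\<^bsub>11\<^esub>, \<dots>, \<pi>\<^bsub>1d\<^esub>\<close>, its modulus as \<open>|e\<^bsup>-t\<chi>*\<^esup>|\<close>,
  and both kill the complement of these spans; the trace is real, as the value of the density at \<open>\<one>\<close>.\<close>

text \<open>What shapes the argument is that \<sigma>(g) \<in> K g^-1 K is wanted for all g, while
  the charts give it only near the identity. The global route, the Cartan decomposition, rests on
  geodesics and maximal flats. Only matrix coefficients are ever evaluated at \<sigma>(g) and g^-1,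
  however, and these span a finite-dimensional translation-invariant space; this finiteness takes
  the place of analyticity. Likewise a square root, which asks only for the derivative of the
  product at the identity, takes the place of the exponential map.

  The time t/2 enters because Bessel's inequality bounds squares: it yields the sum of d |e^(-t
  \<chi>/2)|^2, and the square is |e^(-t \<chi>)|. The eigenvalues of the transition operator carry
  the conjugate of \<chi> because the spherical function is the conjugate of the coefficient with
  indices 1, 1. The trace formula carries \<chi> itself; the two sums agree as a whole, by reality,
  though in general not term by term.\<close>

unbundle no vec_syntax

section \<open>Calculus of smooth maps and composition of isometries\<close>

text \<open>\<open>frechet_derivative\<close> is a choice among all derivatives, so two functions
  with the same set of derivatives get the same choice, even at points where that set is
  empty.\<close>

lemma frechet_derivative_cong_open:
  assumes "open S" "x \<in> S" "\<And>y. y \<in> S \<Longrightarrow> f y = g y"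
  shows "frechet_derivative f (at x) = frechet_derivative g (at x)"
proof -
  have "(f has_derivative D) (at x) \<longleftrightarrow> (g has_derivative D) (at x)" for D
    using assms has_derivative_transform_within_open[of f D x UNIV S g]
      has_derivative_transform_within_open[of g D x UNIV S f] by auto
  then show ?thesis
    by (simp add: frechet_derivative_def)
qed

lemma Ck_on_cong:
  assumes "open S" "\<And>y. y \<in> S \<Longrightarrow> f y = g y" "Ck_on k S f"
  shows "Ck_on k S g"
  using assms(2,3)
proof (induction k arbitrary: f g)
  case 0
  then show ?case
    using continuous_on_cong[of S S f g] by auto
next
  case (Suc k)
  have "g differentiable_on S"
    unfolding differentiable_on_eq_differentiable_at[OF assms(1)]
  proof
    fix x assume x: "x \<in> S"
    then have "f differentiable (at x)"
      using Suc.prems assms(1) by (auto simp: differentiable_on_eq_differentiable_at)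
    then obtain D where "(f has_derivative D) (at x)"
      by (auto simp: differentiable_def)
    then have "(g has_derivative D) (at x)"
      using has_derivative_transform_within_open[of f D x UNIV S g] x assms(1) Suc.prems by auto
    then show "g differentiable (at x)"
      by (rule differentiableI)
  qed
  moreover have "Ck_on k S (\<lambda>x. frechet_derivative g (at x) v)" for v
    using Suc.IH[of "\<lambda>x. frechet_derivative f (at x) v" "\<lambda>x. frechet_derivative g (at x) v"]
      frechet_derivative_cong_open[OF assms(1), of _ f g] Suc.prems by auto
  ultimately show ?case
    by simp
qed

lemma Ck_on_subset:
  assumes "open T" "T \<subseteq> S" "Ck_on k S f"
  shows "Ck_on k T f"
  using assms(3)
proof (induction k arbitrary: f)
  case 0
  then show ?case
    using assms continuous_on_subset by auto
next
  case (Suc k)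
  then show ?case
    using assms differentiable_on_subset by auto
qed

lemma Ck_on_Suc_imp: "Ck_on (Suc k) S f \<Longrightarrow> Ck_on k S f"
  by (induction k arbitrary: f) (auto simp: differentiable_imp_continuous_on)

text \<open>A composite of smooth maps can be differentiated by the chain rule only on pieces that
  pass through one intermediate chart; this glues the pieces.\<close>

lemma Ck_on_local:
  assumes "open S" "\<And>x. x \<in> S \<Longrightarrow> \<exists>U. open U \<and> x \<in> U \<and> U \<subseteq> S \<and> Ck_on k U f"
  shows "Ck_on k S f"
  using assms(2)
proof (induction k arbitrary: f)
  case 0
  then show ?case
    by (auto simp: continuous_on_eq_continuous_at[OF assms(1)])
      (metis continuous_on_eq_continuous_at)
next
  case (Suc k)
  have "f differentiable (at x)" if "x \<in> S" for x
    using Suc.prems[OF that] by (auto simp: differentiable_on_eq_differentiable_at)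
  then have "f differentiable_on S"
    by (simp add: differentiable_at_imp_differentiable_on)
  moreover have "Ck_on k S (\<lambda>x. frechet_derivative f (at x) v)" for v
    using Suc.prems by (intro Suc.IH) fastforce
  ultimately show ?case
    by simp
qed

lemma Ck_on_const: "Ck_on k S (\<lambda>x. c)"
  by (induction k arbitrary: c) (auto simp: frechet_derivative_const)

lemma Ck_on_bounded_linear:
  assumes "bounded_linear h" "open S" "Ck_on k S f"
  shows "Ck_on k S (\<lambda>x. h (f x))"
  using assms(3)
proof (induction k arbitrary: f)
  case 0
  then show ?case
    using assms(1) bounded_linear.continuous_on by auto
next
  case (Suc k)
  have d: "f differentiable (at x)" if "x \<in> S" for x
    using Suc.prems that assms(2) by (auto simp: differentiable_on_eq_differentiable_at)
  have D: "((\<lambda>x. h (f x)) has_derivative (\<lambda>v. h (frechet_derivative f (at x) v))) (at x)"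
    if "x \<in> S" for x
    using bounded_linear.has_derivative[OF assms(1)] d[OF that]
    by (simp add: frechet_derivative_works)
  then have "(\<lambda>x. h (f x)) differentiable_on S"
    by (meson differentiable_at_imp_differentiable_on differentiableI)
  moreover have "Ck_on k S (\<lambda>x. frechet_derivative (\<lambda>x. h (f x)) (at x) v)" for v
    by (rule Ck_on_cong[OF assms(2) _ Suc.IH[of "\<lambda>x. frechet_derivative f (at x) v"]])
      (use Suc.prems frechet_derivative_at[OF D] in \<open>auto dest: fun_cong\<close>)
  ultimately show ?case
    by simp
qed

lemma Ck_on_add:
  assumes "open S" "Ck_on k S f" "Ck_on k S g"
  shows "Ck_on k S (\<lambda>x. f x + g x)"
  using assms(2,3)
proof (induction k arbitrary: f g)
  case 0
  then show ?case
    by (auto intro: continuous_intros)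
next
  case (Suc k)
  have D: "((\<lambda>x. f x + g x) has_derivative
      (\<lambda>v. frechet_derivative f (at x) v + frechet_derivative g (at x) v)) (at x)"
    if "x \<in> S" for x
    using Suc.prems that assms(1)
    by (auto simp: differentiable_on_eq_differentiable_at frechet_derivative_works
        intro: has_derivative_add)
  then have "(\<lambda>x. f x + g x) differentiable_on S"
    by (meson differentiable_at_imp_differentiable_on differentiableI)
  moreover have "Ck_on k S (\<lambda>x. frechet_derivative (\<lambda>x. f x + g x) (at x) v)" for v
    by (rule Ck_on_cong[OF assms(1) _ Suc.IH[of "\<lambda>x. frechet_derivative f (at x) v"
          "\<lambda>x. frechet_derivative g (at x) v"]])
      (use Suc.prems frechet_derivative_at[OF D] in \<open>auto dest: fun_cong\<close>)
  ultimately show ?case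
    by simp
qed

lemma Ck_on_scaleR:
  fixes f :: "'a::euclidean_space \<Rightarrow> real"
  assumes "open S" "Ck_on k S f" "Ck_on k S g"
  shows "Ck_on k S (\<lambda>x. f x *\<^sub>R g x)"
  using assms(2,3)
proof (induction k arbitrary: f g)
  case 0
  then show ?case
    by (auto intro: continuous_intros)
next
  case (Suc k)
  have D: "((\<lambda>x. f x *\<^sub>R g x) has_derivative
      (\<lambda>v. f x *\<^sub>R frechet_derivative g (at x) v + frechet_derivative f (at x) v *\<^sub>R g x)) (at x)"
    if "x \<in> S" for x
    using Suc.prems that assms(1)
    by (auto simp: differentiable_on_eq_differentiable_at frechet_derivative_works
        intro: has_derivative_scaleR)
  then have "(\<lambda>x. f x *\<^sub>R g x) differentiable_on S"
    by (meson differentiable_at_imp_differentiable_on differentiableI)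
  moreover have "Ck_on k S (\<lambda>x. frechet_derivative (\<lambda>x. f x *\<^sub>R g x) (at x) v)" for v
  proof (rule Ck_on_cong[OF assms(1)])
    show "f x *\<^sub>R frechet_derivative g (at x) v + frechet_derivative f (at x) v *\<^sub>R g x =
        frechet_derivative (\<lambda>x. f x *\<^sub>R g x) (at x) v" if "x \<in> S" for x
      using frechet_derivative_at[OF D[OF that]] by (auto dest: fun_cong)
    show "Ck_on k S (\<lambda>x. f x *\<^sub>R frechet_derivative g (at x) v +
        frechet_derivative f (at x) v *\<^sub>R g x)"
      by (intro Ck_on_add assms Suc.IH) (use Suc.prems Ck_on_Suc_imp in auto)
  qed
  ultimately show ?case
    by simp
qed

lemma Ck_on_sum:
  assumes "open S" "finite I" "\<And>i. i \<in> I \<Longrightarrow> Ck_on k S (f i)"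
  shows "Ck_on k S (\<lambda>x. \<Sum>i\<in>I. f i x)"
  using assms(2,3) by (induction I) (auto intro: Ck_on_add assms(1) Ck_on_const)

text \<open>By the chain rule the derivative of \<open>g \<circ> f\<close> applies a derivative of
  \<open>g\<close> to a vector that itself varies with x. Expanding this vector in
  \<open>Basis\<close> splits the result into scalar coefficients times partial derivatives of
  \<open>g\<close> composed with \<open>f\<close>, and the induction hypothesis covers the
  latter.\<close>

lemma Ck_on_compose:
  fixes f :: "'a::euclidean_space \<Rightarrow> 'b::euclidean_space" and g :: "'b \<Rightarrow> 'c::real_normed_vector"
  assumes "open S" "open S'" "f ` S \<subseteq> S'" "Ck_on k S f" "Ck_on k S' g"
  shows "Ck_on k S (g \<circ> f)"
  using assms(4,5)
proof (induction k arbitrary: g)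
  case 0
  then show ?case
    by (auto simp del: o_apply intro: continuous_on_compose continuous_on_subset[OF _ assms(3)])
next
  case (Suc k)
  have D: "((g \<circ> f) has_derivative
      (frechet_derivative g (at (f x)) \<circ> frechet_derivative f (at x))) (at x)"
    if "x \<in> S" for x
    using Suc.prems that assms(1-3)
    by (intro diff_chain_at)
      (auto simp: differentiable_on_eq_differentiable_at frechet_derivative_works)
  then have "(g \<circ> f) differentiable_on S"
    by (meson differentiable_at_imp_differentiable_on differentiableI)
  moreover have "Ck_on k S (\<lambda>x. frechet_derivative (g \<circ> f) (at x) v)" for v
  proof (rule Ck_on_cong[OF assms(1)])
    show "(\<Sum>b\<in>Basis. (frechet_derivative f (at x) v \<bullet> b) *\<^sub>R
        ((\<lambda>y. frechet_derivative g (at y) b) \<circ> f) x) = frechet_derivative (g \<circ> f) (at x) v"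
      if "x \<in> S" for x
    proof -
      have "linear (frechet_derivative g (at (f x)))"
        using Suc.prems that assms(2,3)
        by (intro linear_frechet_derivative) (auto simp: differentiable_on_eq_differentiable_at)
      then have "frechet_derivative g (at (f x)) (frechet_derivative f (at x) v) =
        (\<Sum>b\<in>Basis. (frechet_derivative f (at x) v \<bullet> b) *\<^sub>R frechet_derivative g (at (f x)) b)"
        by (subst euclidean_representation[symmetric]) (simp add: linear_sum linear_scale)
      then show ?thesis
        by (simp flip: frechet_derivative_at[OF D[OF that]])
    qed
    have "Ck_on k S (\<lambda>x. frechet_derivative f (at x) v \<bullet> b)" for b
      by (rule Ck_on_bounded_linear[OF bounded_linear_inner_left assms(1)]) (use Suc.prems in auto)
    moreover have "Ck_on k S ((\<lambda>y. frechet_derivative g (at y) b) \<circ> f)" for b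
      by (rule Suc.IH[OF Ck_on_Suc_imp]) (use Suc.prems in auto)
    ultimately show "Ck_on k S (\<lambda>x. \<Sum>b\<in>Basis. (frechet_derivative f (at x) v \<bullet> b) *\<^sub>R
        ((\<lambda>y. frechet_derivative g (at y) b) \<circ> f) x)"
      by (intro Ck_on_sum Ck_on_scaleR assms(1) finite_Basis)
  qed
  ultimately show ?case
    by (metis Ck_on.simps(2))
qed

section \<open>Charts and smooth maps between manifolds\<close>

lemma chart_on_inj: "chart_on T c \<Longrightarrow> inj_on (snd c) (fst c)"
  unfolding chart_on_def by (metis homeomorphic_imp_injective_map inf_absorb2 openin_subset topspace_subtopology)

lemma chart_inv_f: "chart_on T c \<Longrightarrow> p \<in> fst c \<Longrightarrow> chart_inv c (snd c p) = p"
  by (simp add: chart_inv_def chart_on_inj)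

lemma chart_image_open:
  assumes "chart_on T c" "openin T W" "W \<subseteq> fst c"
  shows "open (snd c ` W)"
proof -
  have "openin (subtopology T (fst c)) W"
    using assms openin_subset openin_subtopology_alt by fastforce
  then have "openin (top_of_set (snd c ` fst c)) (snd c ` W)"
    using assms(1) homeomorphic_imp_open_map unfolding chart_on_def open_map_def by blast
  then show ?thesis
    using assms(1) unfolding chart_on_def using openin_open_trans by blast
qed

lemma openin_chart_preimage:
  assumes "chart_on T c" "chart_on T' d" "continuous_map T T' f"
  shows "openin T {p \<in> fst c. f p \<in> fst d}"
proof -
  have "{p \<in> fst c. f p \<in> fst d} = fst c \<inter> {p \<in> topspace T. f p \<in> fst d}"
    using assms(1) openin_subset[of T "fst c"] unfolding chart_on_def by auto
  then show ?thesis
    using assms unfolding chart_on_def by (simp add: openin_Int openin_continuous_map_preimage)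
qed

lemma smooth_map_compose:
  assumes "smooth_manifold T A" "smooth_manifold T' A'" "smooth_manifold T'' A''"
    and f: "smooth_map T A T' A' f" and g: "smooth_map T' A' T'' A'' g"
  shows "smooth_map T A T'' A'' (g \<circ> f)"
  unfolding smooth_map_def smooth_on_def
proof (intro conjI ballI allI)
  have fc: "continuous_map T T' f" and gc: "continuous_map T' T'' g"
    using f g by (auto simp: smooth_map_def)
  then show gf: "continuous_map T T'' (g \<circ> f)"
    by (rule continuous_map_compose)
  fix c d k assume c: "c \<in> A" and d: "d \<in> A''"
  have C: "chart_on T c" "chart_on T'' d"
    using assms c d by (auto simp: smooth_manifold_def)
  let ?S = "snd c ` {p \<in> fst c. (g \<circ> f) p \<in> fst d}"
  show "Ck_on k ?S (snd d \<circ> (g \<circ> f) \<circ> chart_inv c)"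
  proof (rule Ck_on_local)
    show "open ?S"
      by (rule chart_image_open[OF C(1) openin_chart_preimage[OF C gf]]) auto
    fix x assume "x \<in> ?S"
    then obtain p where p: "p \<in> fst c" "g (f p) \<in> fst d" "x = snd c p"
      by auto
    have "p \<in> topspace T"
      using p(1) C(1) openin_subset unfolding chart_on_def by blast
    then have "f p \<in> topspace T'"
      using fc by (auto simp: continuous_map_def)
    then have "f p \<in> \<Union> (fst ` A')"
      using assms(2) by (simp add: smooth_manifold_def)
    then obtain c' where c': "c' \<in> A'" "f p \<in> fst c'"
      by blast
    then have C': "chart_on T' c'"
      using assms by (auto simp: smooth_manifold_def)
    \<comment> \<open>On \<open>W\<close> the intermediate chart \<open>c'\<close> and the target
      chart \<open>d\<close> are both available, so the local expressions can be composed
      there.\<close>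
    define W where "W = {p \<in> fst c. f p \<in> fst c'} \<inter> {p \<in> fst c. (g \<circ> f) p \<in> fst d}"
    have U: "open (snd c ` W)"
      using openin_chart_preimage[OF C(1) C' fc] openin_chart_preimage[OF C gf]
      by (intro chart_image_open[OF C(1)]) (auto simp: W_def)
    have inv: "chart_inv c (snd c q) = q" if "q \<in> W" for q
      using that chart_inv_f[OF C(1)] by (auto simp: W_def)
    have k1: "Ck_on k (snd c ` W) (snd c' \<circ> f \<circ> chart_inv c)"
      by (rule Ck_on_subset[OF U, of "snd c ` {p \<in> fst c. f p \<in> fst c'}"])
        (use f c c' in \<open>auto simp: W_def smooth_map_def smooth_on_def\<close>)
    have k2: "Ck_on k (snd c' ` {q \<in> fst c'. g q \<in> fst d}) (snd d \<circ> g \<circ> chart_inv c')"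
      using g c' d by (auto simp: smooth_map_def smooth_on_def)
    have "Ck_on k (snd c ` W) ((snd d \<circ> g \<circ> chart_inv c') \<circ> (snd c' \<circ> f \<circ> chart_inv c))"
      by (rule Ck_on_compose[OF U _ _ k1 k2])
        (use inv chart_image_open[OF C' openin_chart_preimage[OF C' C(2) gc]] in \<open>auto simp: W_def\<close>)
    then have "Ck_on k (snd c ` W) (snd d \<circ> (g \<circ> f) \<circ> chart_inv c)"
      by (rule Ck_on_cong[OF U, rotated])
        (use inv chart_inv_f[OF C'] in \<open>auto simp: W_def\<close>)
    then show "\<exists>U. open U \<and> x \<in> U \<and> U \<subseteq> ?S \<and> Ck_on k U (snd d \<circ> (g \<circ> f) \<circ> chart_inv c)"
      using U p c' by (intro exI[of _ "snd c ` W"]) (auto simp: W_def)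
  qed
qed

lemma smooth_map_local_differentiable:
  assumes "smooth_manifold T A" "smooth_manifold T' A'" "smooth_map T A T' A' f"
    "c \<in> A" "d \<in> A'" "p \<in> fst c" "f p \<in> fst d"
  shows "(snd d \<circ> f \<circ> chart_inv c) differentiable (at (snd c p))"
proof -
  have C: "chart_on T c" "chart_on T' d" "continuous_map T T' f"
    using assms by (auto simp: smooth_manifold_def smooth_map_def)
  have "open (snd c ` {p \<in> fst c. f p \<in> fst d})"
    by (rule chart_image_open[OF C(1) openin_chart_preimage[OF C]]) auto
  moreover have "Ck_on (Suc 0) (snd c ` {p \<in> fst c. f p \<in> fst d}) (snd d \<circ> f \<circ> chart_inv c)"
    using assms by (auto simp: smooth_map_def smooth_on_def simp del: Ck_on.simps)
  ultimately show ?thesis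
    using assms by (auto simp: differentiable_on_eq_differentiable_at)
qed

lemma local_derivative_compose:
  assumes "smooth_manifold T A" "smooth_manifold T' A'" "smooth_manifold T'' A''"
    and "smooth_map T A T' A' f" "smooth_map T' A' T'' A'' g"
    and "c \<in> A" "c' \<in> A'" "d \<in> A''" "p \<in> fst c" "f p \<in> fst c'" "g (f p) \<in> fst d"
  shows "local_derivative c d (g \<circ> f) p v = local_derivative c' d g (f p) (local_derivative c c' f p v)"
proof -
  have C: "chart_on T c" "chart_on T' c'" and fc: "continuous_map T T' f"
    using assms by (auto simp: smooth_manifold_def smooth_map_def)
  let ?S = "snd c ` {p \<in> fst c. f p \<in> fst c'}"
  have inv: "chart_inv c (snd c p) = p" "chart_inv c' (snd c' (f p)) = f p"
    using chart_inv_f[OF C(1)] chart_inv_f[OF C(2)] assms by auto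
  have S: "open ?S"
    by (rule chart_image_open[OF C(1) openin_chart_preimage[OF C fc]]) auto
  have "((snd c' \<circ> f \<circ> chart_inv c) has_derivative local_derivative c c' f p) (at (snd c p))"
    "((snd d \<circ> g \<circ> chart_inv c') has_derivative local_derivative c' d g (f p))
      (at ((snd c' \<circ> f \<circ> chart_inv c) (snd c p)))"
    using smooth_map_local_differentiable[of T A T' A' f c c' p]
      smooth_map_local_differentiable[of T' A' T'' A'' g c' d "f p"] assms inv
    by (auto simp: frechet_derivative_works local_derivative_def)
  then have "((snd d \<circ> g \<circ> chart_inv c') \<circ> (snd c' \<circ> f \<circ> chart_inv c) has_derivative
      local_derivative c' d g (f p) \<circ> local_derivative c c' f p) (at (snd c p))"
    by (rule diff_chain_at)
  \<comment> \<open>The two expressions agree only where \<open>f\<close> lands in the domain of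
    \<open>c'\<close>, because \<open>chart_inv c'\<close> inverts \<open>c'\<close> only
    there.\<close>
  moreover have "frechet_derivative (snd d \<circ> (g \<circ> f) \<circ> chart_inv c) (at (snd c p)) =
      frechet_derivative ((snd d \<circ> g \<circ> chart_inv c') \<circ> (snd c' \<circ> f \<circ> chart_inv c)) (at (snd c p))"
    by (rule frechet_derivative_cong_open[OF S])
      (use assms chart_inv_f[OF C(1)] chart_inv_f[OF C(2)] in auto)
  ultimately show ?thesis
    by (simp add: local_derivative_def frechet_derivative_at[symmetric])
qed

text \<open>It makes conjugation by a symmetry act on isometries. The metric condition mentions
  charts at source and target only, so a chart around \<open>f p\<close> is inserted and the local
  derivatives are chained through it.\<close>

lemma isometry_compose:
  assumes M: "smooth_manifold euclidean A" and f: "isometry A \<rho> f" and g: "isometry A \<rho> g"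
  shows "isometry A \<rho> (g \<circ> f)"
  unfolding isometry_def
proof (intro conjI ballI impI allI)
  show "bij (g \<circ> f)"
    using f g by (simp add: isometry_def bij_comp)
  show "smooth_map euclidean A euclidean A (g \<circ> f)"
    using f g by (intro smooth_map_compose[OF M M M]) (auto simp: isometry_def)
  have "inv_into UNIV (g \<circ> f) = inv_into UNIV f \<circ> inv_into UNIV g"
    using f g by (simp add: isometry_def o_inv_distrib)
  then show "smooth_map euclidean A euclidean A (inv_into UNIV (g \<circ> f))"
    using f g by (simp, intro smooth_map_compose[OF M M M]) (auto simp: isometry_def)
  fix c d p v w
  assume c: "c \<in> A" "d \<in> A" "p \<in> fst c" "(g \<circ> f) p \<in> fst d"
  have "f p \<in> \<Union> (fst ` A)"
    using M by (simp add: smooth_manifold_def)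
  then obtain c' where c': "c' \<in> A" "f p \<in> fst c'"
    by blast
  have L: "local_derivative c d (g \<circ> f) p u = local_derivative c' d g (f p) (local_derivative c c' f p u)" for u
    using f g c c' by (intro local_derivative_compose[OF M M M]) (auto simp: isometry_def)
  have "\<rho> c (snd c p) v w = \<rho> c' (snd c' (f p)) (local_derivative c c' f p v) (local_derivative c c' f p w)"
    using f c c' by (auto simp: isometry_def)
  also have "\<dots> = \<rho> d (snd d (g (f p))) (local_derivative c d (g \<circ> f) p v) (local_derivative c d (g \<circ> f) p w)"
    using g c c' by (auto simp: isometry_def L)
  finally show "\<rho> c (snd c p) v w = \<rho> d (snd d ((g \<circ> f) p)) (local_derivative c d (g \<circ> f) p v)
      (local_derivative c d (g \<circ> f) p w)"
    by simp
qed

section \<open>Square roots near the identity of a Lie group\<close>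

lemma openin_chart_vimage:
  assumes c: "chart_on T c" and "open W"
  shows "openin T {p \<in> fst c. snd c p \<in> W}"
proof -
  have "continuous_map (subtopology T (fst c)) (top_of_set (snd c ` fst c)) (snd c)"
    using c by (simp add: chart_on_def homeomorphic_imp_continuous_map)
  then have "continuous_map (subtopology T (fst c)) euclidean (snd c)"
    by (simp add: continuous_map_in_subtopology)
  then have "openin (subtopology T (fst c)) {p \<in> topspace (subtopology T (fst c)). snd c p \<in> W}"
    using \<open>open W\<close> by (intro openin_continuous_map_preimage) auto
  moreover have "topspace (subtopology T (fst c)) = fst c"
    using c openin_subset[of T "fst c"] by (auto simp: chart_on_def)
  ultimately show ?thesis
    using c openin_trans_full[of T "fst c"] by (simp add: chart_on_def del: topspace_subtopology)
qed

text \<open>Along either factor the product at the identity is the identity map, so by linearity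
  squaring has derivative v \<mapsto> 2v there and the inverse function theorem applies. Openness is
  recorded for all smaller sets \<open>W\<close> because square roots will be wanted inside a
  prescribed neighbourhood.\<close>

lemma lie_group_square_local_homeo:
  fixes G :: "('g, 'b) monoid_scheme" and A :: "('g, 'f::euclidean_space) chart set"
  assumes "lie_group G T A"
  obtains V where "openin T V" "\<one>\<^bsub>G\<^esub> \<in> V" "inj_on (\<lambda>x. x \<otimes>\<^bsub>G\<^esub> x) V"
    "\<And>W. openin T W \<Longrightarrow> W \<subseteq> V \<Longrightarrow> openin T ((\<lambda>x. x \<otimes>\<^bsub>G\<^esub> x) ` W)"
proof -
  interpret group G
    using assms by (simp add: lie_group_def)
  have top: "topspace T = carrier G" and M: "smooth_manifold T A"
    and mult: "smooth_map (prod_topology T T) (prod_atlas A A) T A (\<lambda>(x, y). x \<otimes>\<^bsub>G\<^esub> y)"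
    using assms by (auto simp: lie_group_def)
  have "\<one>\<^bsub>G\<^esub> \<in> \<Union> (fst ` A)"
    using M top by (simp add: smooth_manifold_def)
  then obtain c where c: "c \<in> A" "\<one>\<^bsub>G\<^esub> \<in> fst c"
    by blast
  define U \<phi> \<psi> where "U = fst c" and "\<phi> = snd c" and "\<psi> = chart_inv c"
  have C: "chart_on T c"
    using M c by (simp add: smooth_manifold_def)
  have UG: "U \<subseteq> carrier G"
    using C top openin_subset unfolding chart_on_def U_def by metis
  have \<psi>\<phi>: "\<psi> (\<phi> p) = p" if "p \<in> U" for p
    using chart_inv_f[OF C] that by (simp add: U_def \<phi>_def \<psi>_def)
  define f where "f z = \<phi> (\<psi> (fst z) \<otimes>\<^bsub>G\<^esub> \<psi> (snd z))" for z
  define S where "S = map_prod \<phi> \<phi> ` {z \<in> U \<times> U. fst z \<otimes>\<^bsub>G\<^esub> snd z \<in> U}"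
  have S: "(x, y) \<in> S \<longleftrightarrow> x \<in> \<phi> ` U \<and> y \<in> \<phi> ` U \<and> \<psi> x \<otimes>\<^bsub>G\<^esub> \<psi> y \<in> U" for x y
    unfolding S_def using \<psi>\<phi> by force
  have openS: "open S"
    unfolding open_subopen[of S]
  proof
    fix z assume z: "z \<in> S"
    obtain x y where xy: "z = (x, y)"
      by fastforce
    obtain p q where p: "p \<in> U" "x = \<phi> p" and q: "q \<in> U" "y = \<phi> q" and pq: "p \<otimes>\<^bsub>G\<^esub> q \<in> U"
      using z xy S \<psi>\<phi> by fastforce
    have "openin (prod_topology T T) {z \<in> topspace (prod_topology T T). (\<lambda>(x, y). x \<otimes>\<^bsub>G\<^esub> y) z \<in> U}"
      using mult C by (intro openin_continuous_map_preimage[of _ T])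
        (auto simp: smooth_map_def chart_on_def U_def)
    moreover have "(p, q) \<in> {z \<in> topspace (prod_topology T T). (\<lambda>(x, y). x \<otimes>\<^bsub>G\<^esub> y) z \<in> U}"
      using p q pq UG top by auto
    ultimately obtain P Q where PQ: "openin T P" "openin T Q" "p \<in> P" "q \<in> Q"
      "P \<times> Q \<subseteq> {z \<in> topspace (prod_topology T T). (\<lambda>(x, y). x \<otimes>\<^bsub>G\<^esub> y) z \<in> U}"
      unfolding openin_prod_topology_alt by meson
    have U: "openin T U"
      using C by (simp add: chart_on_def U_def)
    have "open (\<phi> ` (P \<inter> U) \<times> \<phi> ` (Q \<inter> U))"
      using chart_image_open[OF C] PQ U by (intro open_Times) (auto simp: U_def \<phi>_def)
    moreover have "z \<in> \<phi> ` (P \<inter> U) \<times> \<phi> ` (Q \<inter> U)"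
      using xy p q PQ by auto
    moreover have "\<phi> ` (P \<inter> U) \<times> \<phi> ` (Q \<inter> U) \<subseteq> S"
      using PQ(5) \<psi>\<phi> S by force
    ultimately show "\<exists>T. open T \<and> z \<in> T \<and> T \<subseteq> S"
      by blast
  qed
  let ?cc = "(U \<times> U, map_prod \<phi> \<phi>)"
  have inj: "inj_on (map_prod \<phi> \<phi>) (U \<times> U)"
    using chart_on_inj[OF C] by (simp add: map_prod_inj_on U_def \<phi>_def)
  have "?cc \<in> prod_atlas A A"
    using c unfolding prod_atlas_def U_def \<phi>_def by blast
  then have "smooth_on (snd ?cc ` {p \<in> fst ?cc. (\<lambda>(x, y). x \<otimes>\<^bsub>G\<^esub> y) p \<in> fst c})
      (snd c \<circ> (\<lambda>(x, y). x \<otimes>\<^bsub>G\<^esub> y) \<circ> chart_inv ?cc)"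
    using mult c(1) unfolding smooth_map_def by blast
  moreover have "snd ?cc ` {p \<in> fst ?cc. (\<lambda>(x, y). x \<otimes>\<^bsub>G\<^esub> y) p \<in> fst c} = S"
    by (simp add: S_def U_def case_prod_beta)
  ultimately have "Ck_on (Suc 0) S (snd c \<circ> (\<lambda>(x, y). x \<otimes>\<^bsub>G\<^esub> y) \<circ> chart_inv ?cc)"
    unfolding smooth_on_def by (simp del: Ck_on.simps)
  then have Cf: "Ck_on (Suc 0) S f"
  proof (rule Ck_on_cong[OF openS, rotated])
    fix z assume "z \<in> S"
    then obtain p q where pq: "p \<in> U" "q \<in> U" "z = map_prod \<phi> \<phi> (p, q)"
      by (auto simp: S_def)
    then have "chart_inv ?cc z = (p, q)"
      using inv_into_f_f[OF inj, of "(p, q)"] by (simp add: chart_inv_def)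
    then show "(snd c \<circ> (\<lambda>(x, y). x \<otimes>\<^bsub>G\<^esub> y) \<circ> chart_inv ?cc) z = f z"
      using pq \<psi>\<phi> by (simp add: f_def \<phi>_def)
  qed
  define S1 where "S1 = {x. (x, x) \<in> S}"
  have S1: "open S1"
    unfolding S1_def using open_vimage[OF openS, of "\<lambda>x. (x, x)"]
    by (simp add: vimage_def continuous_intros)
  define Df where "Df x v = frechet_derivative f (at (x, x)) (v, v)" for x v
  have fD: "(f has_derivative frechet_derivative f (at z)) (at z)" if "z \<in> S" for z
    using Cf that openS
    by (auto simp: differentiable_on_eq_differentiable_at frechet_derivative_works)
  have sqD: "((\<lambda>x. f (x, x)) has_derivative Df x) (at x)" if "x \<in> S1" for x
  proof -
    have "((\<lambda>x. (x, x)) has_derivative (\<lambda>v. (v, v))) (at x)"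
      by (auto intro!: derivative_eq_intros)
    from diff_chain_at[OF this fD] that show ?thesis
      by (simp add: S1_def Df_def[abs_def] o_def)
  qed
  have bl: "bounded_linear (Df x)" if "x \<in> S1" for x
    using sqD[OF that] has_derivative_bounded_linear by blast
  define f' where "f' x = Blinfun (Df x)" for x
  have f': "blinfun_apply (f' x) = Df x" if "x \<in> S1" for x
    using bl[OF that] by (simp add: f'_def bounded_linear_Blinfun_apply)
  \<comment> \<open>In finite dimension, continuity in the operator norm follows from continuity
    along each basis vector, which \<open>Ck_on (Suc 0)\<close> supplies.\<close>
  have contf': "continuous_on S1 f'"
  proof (rule continuous_on_blinfun_componentwise)
    fix i :: 'f
    have "continuous_on S (\<lambda>z. frechet_derivative f (at z) (i, i))"
      using Cf by auto
    then have "continuous_on S1 (\<lambda>x. Df x i)"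
      unfolding Df_def by (rule continuous_on_compose2) (auto simp: S1_def intro: continuous_intros)
    then show "continuous_on S1 (\<lambda>x. f' x i)"
      using f' by (simp cong: continuous_on_cong)
  qed
  define x0 where "x0 = \<phi> \<one>\<^bsub>G\<^esub>"
  have oneU: "\<one>\<^bsub>G\<^esub> \<in> U"
    using c by (simp add: U_def)
  then have x0: "x0 \<in> S1" "\<psi> x0 = \<one>\<^bsub>G\<^esub>"
    using \<psi>\<phi> by (auto simp: S1_def S x0_def)
  have openU: "open (\<phi> ` U)"
    using C by (simp add: chart_on_def U_def \<phi>_def)
  \<comment> \<open>The inclusions of the two factors are treated together; along each of them
    \<open>f\<close> is locally the identity because \<open>\<psi> x0\<close> is the unit.\<close>
  have idD: "frechet_derivative f (at (x0, x0)) (h v) = v"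
    if h: "h = (\<lambda>v. (v, 0)) \<or> h = (\<lambda>v. (0, v))" for h v
  proof -
    have "((\<lambda>x. (x, x0)) has_derivative (\<lambda>v. (v, 0))) (at x0)"
      "(Pair x0 has_derivative Pair 0) (at x0)"
      by (auto intro!: derivative_eq_intros)
    then obtain k where k: "(k has_derivative h) (at x0)" "k x0 = (x0, x0)"
        "k = (\<lambda>x. (x, x0)) \<or> k = Pair x0"
      using h by metis
    then have "((f \<circ> k) has_derivative (frechet_derivative f (at (x0, x0)) \<circ> h)) (at x0)"
      using diff_chain_at[of k h x0 f] fD[of "(x0, x0)"] x0 by (simp add: S1_def)
    moreover have "((f \<circ> k) has_derivative id) (at x0)"
    proof (rule has_derivative_transform_within_open[of id])
      show "id x = (f \<circ> k) x" if "x \<in> \<phi> ` U" for x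
        using that UG \<psi>\<phi> x0 k(3) by (auto simp: f_def)
      show "x0 \<in> \<phi> ` U"
        using oneU by (simp add: x0_def)
    qed (use openU in auto)
    ultimately have "frechet_derivative f (at (x0, x0)) \<circ> h = id"
      by (rule has_derivative_unique)
    then show ?thesis
      by (metis comp_apply id_apply)
  qed
  have Dfx0: "Df x0 v = 2 *\<^sub>R v" for v
  proof -
    have "linear (frechet_derivative f (at (x0, x0)))"
      using fD[of "(x0, x0)"] x0 has_derivative_linear by (auto simp: S1_def)
    from linear_add[OF this, of "(v, 0)" "(0, v)"] show ?thesis
      using idD[of "\<lambda>v. (v, 0)"] idD[of "\<lambda>v. (0, v)"] by (simp add: Df_def scaleR_2)
  qed
  \<comment> \<open>The inverse function theorem asks for an inverse of the derivative at
    \<open>x0\<close>; half the identity inverts doubling.\<close>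
  have "((1/2) *\<^sub>R id_blinfun) o\<^sub>L f' x0 = id_blinfun"
    by (rule blinfun_eqI) (simp add: f' x0 Dfx0 scaleR_blinfun.rep_eq)
  then obtain U' V' g where g: "open U'" "U' \<subseteq> S1" "x0 \<in> U'" "open V'"
    and hom: "homeomorphism U' V' (\<lambda>x. f (x, x)) g"
  proof (rule inverse_function_theorem[OF S1 _ contf' x0(1), of "\<lambda>x. f (x, x)", rotated])
    show "((\<lambda>x. f (x, x)) has_derivative blinfun_apply (f' x)) (at x)" if "x \<in> S1" for x
      using sqD f' that by simp
  qed
  define V where "V = {p \<in> U. \<phi> p \<in> U'}"
  have V: "openin T V"
    using openin_chart_vimage[OF C g(1)] by (simp add: V_def U_def \<phi>_def)
  have sq: "\<phi> (p \<otimes>\<^bsub>G\<^esub> p) = f (\<phi> p, \<phi> p)" "p \<otimes>\<^bsub>G\<^esub> p \<in> U" if "p \<in> V" for p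
  proof -
    show "\<phi> (p \<otimes>\<^bsub>G\<^esub> p) = f (\<phi> p, \<phi> p)"
      using that \<psi>\<phi> by (simp add: f_def V_def)
    have "(\<phi> p, \<phi> p) \<in> S"
      using that g(2) by (auto simp: V_def S1_def)
    then show "p \<otimes>\<^bsub>G\<^esub> p \<in> U"
      using that \<psi>\<phi> by (simp add: S V_def)
  qed
  show thesis
  proof (rule that[OF V])
    show "\<one>\<^bsub>G\<^esub> \<in> V"
      using oneU g(3) by (simp add: V_def x0_def)
    show "inj_on (\<lambda>x. x \<otimes>\<^bsub>G\<^esub> x) V"
    proof (rule inj_onI)
      fix p q assume pq: "p \<in> V" "q \<in> V" "p \<otimes>\<^bsub>G\<^esub> p = q \<otimes>\<^bsub>G\<^esub> q"
      then have "\<phi> p = \<phi> q"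
        using sq(1)[of p] sq(1)[of q] homeomorphism_apply1[OF hom] unfolding V_def
        by (metis (mono_tags, lifting) mem_Collect_eq)
      then show "p = q"
        using pq \<psi>\<phi> unfolding V_def by (metis (mono_tags, lifting) mem_Collect_eq)
    qed
    fix W assume W: "openin T W" "W \<subseteq> V"
    have "open (\<phi> ` W)"
      using chart_image_open[OF C W(1)] W(2) by (auto simp: V_def U_def \<phi>_def)
    then have "openin (top_of_set U') (\<phi> ` W)"
      using W(2) by (intro openin_open_eq[THEN iffD2]) (auto simp: V_def g)
    then have "openin (top_of_set V') ((\<lambda>x. f (x, x)) ` \<phi> ` W)"
      using homeomorphism_imp_open_map[OF hom] by blast
    then have "open ((\<lambda>x. f (x, x)) ` \<phi> ` W)"
      using g(4) openin_open_trans by blast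
    then have "openin T {p \<in> U. \<phi> p \<in> (\<lambda>x. f (x, x)) ` \<phi> ` W}"
      using openin_chart_vimage[OF C] by (simp add: U_def \<phi>_def)
    moreover have "{p \<in> U. \<phi> p \<in> (\<lambda>x. f (x, x)) ` \<phi> ` W} = (\<lambda>x. x \<otimes>\<^bsub>G\<^esub> x) ` W"
    proof (intro Set.set_eqI iffI)
      fix p assume "p \<in> {p \<in> U. \<phi> p \<in> (\<lambda>x. f (x, x)) ` \<phi> ` W}"
      then obtain w where w: "w \<in> W" "p \<in> U" "\<phi> p = f (\<phi> w, \<phi> w)"
        by auto
      then have "p = w \<otimes>\<^bsub>G\<^esub> w"
        using sq[of w] W(2) \<psi>\<phi> by (metis subsetD)
      then show "p \<in> (\<lambda>x. x \<otimes>\<^bsub>G\<^esub> x) ` W"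
        using w by blast
    next
      fix p assume "p \<in> (\<lambda>x. x \<otimes>\<^bsub>G\<^esub> x) ` W"
      then show "p \<in> {p \<in> U. \<phi> p \<in> (\<lambda>x. f (x, x)) ` \<phi> ` W}"
        using sq W(2) by fastforce
    qed
    ultimately show "openin T ((\<lambda>x. x \<otimes>\<^bsub>G\<^esub> x) ` W)"
      by simp
  qed
qed

section \<open>Unique continuation and involutions of topological groups\<close>

text \<open>Relations that hold near a point form a subspace of a finite-dimensional coefficient
  space, so one member of the filter base \<open>\<U>\<close> serves all of them. Instead of
  choosing a basis, the induction eliminates \<open>f j\<close> by a relation in which its
  coefficient is non-zero, if there is one; otherwise every relation already lives on
  \<open>I\<close>.\<close>

lemma common_zero_set:
  fixes f :: "'i \<Rightarrow> 'g \<Rightarrow> complex"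
  assumes "finite I" and ne: "\<U> \<noteq> {}" and Int: "\<And>U V. U \<in> \<U> \<Longrightarrow> V \<in> \<U> \<Longrightarrow> U \<inter> V \<in> \<U>"
  shows "\<exists>U\<in>\<U>. \<forall>c. (\<exists>V\<in>\<U>. \<forall>x\<in>V. (\<Sum>i\<in>I. c i * f i x) = 0) \<longrightarrow> (\<forall>x\<in>U. (\<Sum>i\<in>I. c i * f i x) = 0)"
  using assms(1)
proof (induction I)
  case empty
  then show ?case
    using ne by auto
next
  case (insert j I)
  then obtain U where U: "U \<in> \<U>"
    "\<And>c V. V \<in> \<U> \<Longrightarrow> \<forall>x\<in>V. (\<Sum>i\<in>I. c i * f i x) = 0 \<Longrightarrow> \<forall>x\<in>U. (\<Sum>i\<in>I. c i * f i x) = 0"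
    by blast
  show ?case
  proof (cases "\<exists>c. c j \<noteq> 0 \<and> (\<exists>V\<in>\<U>. \<forall>x\<in>V. (\<Sum>i\<in>insert j I. c i * f i x) = 0)")
    case True
    then obtain d W where d: "d j \<noteq> 0" and W: "W \<in> \<U>" "\<And>x. x \<in> W \<Longrightarrow> (\<Sum>i\<in>insert j I. d i * f i x) = 0"
      by blast
    have fj: "f j x = (\<Sum>i\<in>I. - (d i / d j) * f i x)" if "x \<in> W" for x
    proof -
      have "d j * f j x + (\<Sum>i\<in>I. d i * f i x) = 0"
        using W(2)[OF that] insert by simp
      then have "f j x = - (\<Sum>i\<in>I. d i * f i x) / d j"
        using d by (simp add: field_simps eq_neg_iff_add_eq_0)
      then show ?thesis
        by (simp add: sum_negf sum_divide_distrib)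
    qed
    have eq: "(\<Sum>i\<in>insert j I. c i * f i x) = (\<Sum>i\<in>I. (c i - c j * (d i / d j)) * f i x)"
      if "x \<in> W" for c x
      using insert by (simp add: fj[OF that] left_diff_distrib sum_subtractf sum_distrib_left sum_negf mult.assoc)
    have "\<forall>x\<in>U \<inter> W. (\<Sum>i\<in>insert j I. c i * f i x) = 0"
      if V: "V \<in> \<U>" "\<forall>x\<in>V. (\<Sum>i\<in>insert j I. c i * f i x) = 0" for c V
    proof -
      have "\<forall>x\<in>V \<inter> W. (\<Sum>i\<in>I. (c i - c j * (d i / d j)) * f i x) = 0"
        using V(2) eq by (metis IntE)
      then have "\<forall>x\<in>U. (\<Sum>i\<in>I. (c i - c j * (d i / d j)) * f i x) = 0"
        using U(2)[of "V \<inter> W" "\<lambda>i. c i - c j * (d i / d j)"] Int[OF V(1) W(1)] by blast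
      then show ?thesis
        using eq by simp
    qed
    then show ?thesis
      using Int[OF U(1) W(1)] by blast
  next
    case False
    have "\<forall>x\<in>U. (\<Sum>i\<in>insert j I. c i * f i x) = 0"
      if V: "V \<in> \<U>" "\<forall>x\<in>V. (\<Sum>i\<in>insert j I. c i * f i x) = 0" for c V
    proof -
      have "c j = 0"
        using False V by blast
      then show ?thesis
        using insert U(2)[OF V(1), of c] V(2) by simp
    qed
    then show ?thesis
      using U(1) by blast
  qed
qed

locale topological_group = group G for G :: "('g, 'b) monoid_scheme" (structure) +
  fixes T :: "'g topology"
  assumes topspace_eq: "topspace T = carrier G"
    and continuous_mult: "continuous_map (prod_topology T T) T (\<lambda>(x, y). x \<otimes> y)"
    and continuous_inv: "continuous_map T T (\<lambda>x. inv x)"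
begin

lemma continuous_mult_fun:
  assumes "continuous_map X T f" "continuous_map X T g"
  shows "continuous_map X T (\<lambda>x. f x \<otimes> g x)"
proof -
  have "continuous_map X (prod_topology T T) (\<lambda>x. (f x, g x))"
    using assms by (simp add: continuous_map_pairedI)
  from continuous_map_compose[OF this continuous_mult] show ?thesis
    by (simp add: o_def)
qed

lemma continuous_inv_fun: "continuous_map X T f \<Longrightarrow> continuous_map X T (\<lambda>x. inv (f x))"
  using continuous_map_compose[OF _ continuous_inv] by (simp add: o_def)

lemma continuous_left_mult: "a \<in> carrier G \<Longrightarrow> continuous_map T T (\<lambda>x. a \<otimes> x)"
  by (intro continuous_mult_fun) (auto simp: topspace_eq)

lemma continuous_right_mult: "a \<in> carrier G \<Longrightarrow> continuous_map T T (\<lambda>x. x \<otimes> a)"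
  by (intro continuous_mult_fun) (auto simp: topspace_eq)

lemma openin_carrier: "openin T U \<Longrightarrow> U \<subseteq> carrier G"
  using openin_subset topspace_eq by metis

lemma openin_vimage: "continuous_map T T f \<Longrightarrow> openin T U \<Longrightarrow> openin T {x \<in> carrier G. f x \<in> U}"
  using openin_continuous_map_preimage[of T T f U] by (simp add: topspace_eq)

lemma openin_left_translate:
  assumes "a \<in> carrier G" "openin T U"
  shows "openin T ((\<lambda>x. a \<otimes> x) ` U)"
proof -
  have "(\<lambda>x. a \<otimes> x) ` U = {x \<in> carrier G. inv a \<otimes> x \<in> U}"
  proof (intro subset_antisym subsetI)
    fix x assume "x \<in> {x \<in> carrier G. inv a \<otimes> x \<in> U}"
    then show "x \<in> (\<lambda>x. a \<otimes> x) ` U"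
      using assms by (intro image_eqI[of _ _ "inv a \<otimes> x"]) (auto simp flip: m_assoc)
  next
    fix x assume "x \<in> (\<lambda>x. a \<otimes> x) ` U"
    then obtain u where u: "u \<in> U" "x = a \<otimes> u" "u \<in> carrier G"
      using openin_carrier[OF assms(2)] by auto
    then show "x \<in> {x \<in> carrier G. inv a \<otimes> x \<in> U}"
      using assms by (auto simp flip: m_assoc)
  qed
  then show ?thesis
    using openin_vimage[OF continuous_left_mult[of "inv a"] assms(2)] assms(1) by simp
qed

text \<open>The functions of a finite-dimensional translation-invariant space that vanish near the identity
  vanish on one common neighbourhood; so the set near which a function vanishes is closed.\<close>

lemma unique_continuation:
  fixes f :: "'i \<Rightarrow> 'g \<Rightarrow> complex"
  assumes conn: "connected_space T" and I: "finite I"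
    and trans: "\<And>a i. a \<in> carrier G \<Longrightarrow> i \<in> I \<Longrightarrow> \<exists>d. \<forall>g\<in>carrier G. f i (a \<otimes> g) = (\<Sum>j\<in>I. d j * f j g)"
    and W: "openin T W" "\<one> \<in> W" "\<forall>x\<in>W. (\<Sum>i\<in>I. c i * f i x) = 0"
    and g: "g \<in> carrier G"
  shows "(\<Sum>i\<in>I. c i * f i g) = 0"
proof -
  define F where "F x = (\<Sum>i\<in>I. c i * f i x)" for x
  have "\<exists>U\<in>{U. openin T U \<and> \<one> \<in> U}. \<forall>c. (\<exists>V\<in>{U. openin T U \<and> \<one> \<in> U}. \<forall>x\<in>V. (\<Sum>i\<in>I. c i * f i x) = 0)
     \<longrightarrow> (\<forall>x\<in>U. (\<Sum>i\<in>I. c i * f i x) = 0)"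
    using W(1,2) by (intro common_zero_set[OF I]) auto
  then obtain U where U: "openin T U" "\<one> \<in> U"
    "\<And>c V. openin T V \<Longrightarrow> \<one> \<in> V \<Longrightarrow> \<forall>x\<in>V. (\<Sum>i\<in>I. c i * f i x) = 0 \<Longrightarrow> \<forall>x\<in>U. (\<Sum>i\<in>I. c i * f i x) = 0"
    by blast
  \<comment> \<open>\<open>U\<close> does not depend on \<open>a\<close>: if \<open>F\<close>
    vanishes near \<open>a\<close>, its translate by \<open>a\<close>, again in the span, vanishes
    near the unit and hence on all of \<open>U\<close>.\<close>
  have vanish: "F (a \<otimes> x) = 0" if a: "a \<in> carrier G" "x \<in> U" "openin T V" "a \<in> V" "\<forall>y\<in>V. F y = 0" for a x V
  proof -
    obtain d where d: "\<And>i g. i \<in> I \<Longrightarrow> g \<in> carrier G \<Longrightarrow> f i (a \<otimes> g) = (\<Sum>j\<in>I. d i j * f j g)"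
      using trans[OF a(1)] by metis
    define e where "e j = (\<Sum>i\<in>I. c i * d i j)" for j
    have Fa: "F (a \<otimes> y) = (\<Sum>j\<in>I. e j * f j y)" if "y \<in> carrier G" for y
    proof -
      have "F (a \<otimes> y) = (\<Sum>i\<in>I. \<Sum>j\<in>I. c i * d i j * f j y)"
        using d that by (simp add: F_def sum_distrib_left mult.assoc)
      also have "\<dots> = (\<Sum>j\<in>I. e j * f j y)"
        by (subst sum.swap) (simp add: e_def sum_distrib_right)
      finally show ?thesis .
    qed
    have "openin T {y \<in> carrier G. a \<otimes> y \<in> V}"
      by (rule openin_vimage[OF continuous_left_mult]) (use a in auto)
    moreover have "\<one> \<in> {y \<in> carrier G. a \<otimes> y \<in> V}"
      using a by simp
    moreover have "\<forall>y\<in>{y \<in> carrier G. a \<otimes> y \<in> V}. (\<Sum>j\<in>I. e j * f j y) = 0"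
      using Fa a(5) by auto
    ultimately have "\<forall>y\<in>U. (\<Sum>j\<in>I. e j * f j y) = 0"
      by (rule U(3))
    then show ?thesis
      using Fa a(2) openin_carrier[OF U(1)] by auto
  qed
  define Z where "Z = {a \<in> carrier G. \<exists>V. openin T V \<and> a \<in> V \<and> (\<forall>y\<in>V. F y = 0)}"
  have "openin T Z"
  proof (subst openin_subopen, intro ballI)
    fix a assume "a \<in> Z"
    then obtain V where "openin T V" "a \<in> V" "\<forall>y\<in>V. F y = 0"
      by (auto simp: Z_def)
    then show "\<exists>V. openin T V \<and> a \<in> V \<and> V \<subseteq> Z"
      using openin_carrier by (intro exI[of _ V]) (auto simp: Z_def)
  qed
  moreover have "openin T (carrier G - Z)"
  proof (subst openin_subopen, intro ballI)
    fix a assume a: "a \<in> carrier G - Z"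
    \<comment> \<open>\<open>V\<close> consists of the \<open>b\<close> whose translate of
      \<open>U\<close> contains \<open>a\<close>. A point of \<open>Z\<close> in \<open>V\<close>
      would make \<open>F\<close> vanish on that translate, a neighbourhood of
      \<open>a\<close>.\<close>
    define V where "V = {b \<in> carrier G. inv b \<otimes> a \<in> U}"
    have "openin T V"
      unfolding V_def using a
      by (intro openin_vimage continuous_mult_fun continuous_inv_fun U) (auto simp: topspace_eq)
    moreover have "a \<in> V"
      using a U by (simp add: V_def)
    moreover have "b \<notin> Z" if b: "b \<in> V" for b
    proof
      assume "b \<in> Z"
      then obtain V' where V': "openin T V'" "b \<in> V'" "\<forall>y\<in>V'. F y = 0"
        by (auto simp: Z_def)
      have bc: "b \<in> carrier G" "inv b \<otimes> a \<in> U"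
        using b by (auto simp: V_def)
      have "\<forall>y\<in>(\<lambda>x. b \<otimes> x) ` U. F y = 0"
        using vanish[OF bc(1) _ V'] by auto
      moreover have "a \<in> (\<lambda>x. b \<otimes> x) ` U"
        using a bc by (intro image_eqI[of _ _ "inv b \<otimes> a"]) (auto simp flip: m_assoc)
      ultimately have "a \<in> Z"
        using openin_left_translate[OF bc(1) U(1)] a by (auto simp: Z_def)
      then show False
        using a by simp
    qed
    moreover have "V \<subseteq> carrier G"
      by (auto simp: V_def)
    ultimately show "\<exists>V. openin T V \<and> a \<in> V \<and> V \<subseteq> carrier G - Z"
      by (intro exI[of _ V]) auto
  qed
  moreover have "\<one> \<in> Z"
    using W by (auto simp: Z_def F_def)
  moreover have "Z \<subseteq> carrier G"
    by (auto simp: Z_def)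
  ultimately have "Z = carrier G"
    using conn[unfolded connected_space_clopen_in closedin_def topspace_eq] by blast
  then show ?thesis
    using g by (auto simp: Z_def F_def)
qed

text \<open>With \<open>p = \<surd>(g \<sigma>(g)\<inverse>)\<close> one has \<open>\<sigma>(p) = p\<inverse>\<close>, and \<open>h = p\<inverse> g\<close> is fixed by \<open>\<sigma>\<close>,
  so that \<open>\<sigma>(g) = p\<inverse> h = h g\<inverse> h\<close>.\<close>

lemma involution_local_inverse:
  assumes \<sigma>: "\<sigma> \<in> hom G G" "\<And>x. x \<in> carrier G \<Longrightarrow> \<sigma> (\<sigma> x) = x" "continuous_map T T \<sigma>"
    and V: "openin T V" "\<one> \<in> V" "inj_on (\<lambda>x. x \<otimes> x) V"
      "\<And>W. openin T W \<Longrightarrow> W \<subseteq> V \<Longrightarrow> openin T ((\<lambda>x. x \<otimes> x) ` W)"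
    and N: "openin T N" "\<one> \<in> N" "\<And>h. h \<in> N \<Longrightarrow> \<sigma> h = h \<Longrightarrow> h \<in> K"
  shows "\<exists>U. openin T U \<and> \<one> \<in> U \<and> (\<forall>g\<in>U. \<exists>k\<in>K. k \<in> carrier G \<and> \<sigma> g = k \<otimes> inv g \<otimes> k)"
proof -
  have \<sigma>c: "\<sigma> x \<in> carrier G" if "x \<in> carrier G" for x
    using \<sigma>(1) that by (auto simp: hom_def)
  have \<sigma>m: "\<sigma> (x \<otimes> y) = \<sigma> x \<otimes> \<sigma> y" if "x \<in> carrier G" "y \<in> carrier G" for x y
    using \<sigma>(1) that by (auto simp: hom_def)
  interpret \<sigma>: group_hom G G \<sigma>
    using \<sigma>(1) by (simp add: group_hom_def group_hom_axioms_def group_axioms)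
  have \<sigma>i: "\<sigma> (inv x) = inv (\<sigma> x)" if "x \<in> carrier G" for x
    using that by simp
  have "openin (prod_topology T T) {z \<in> topspace (prod_topology T T). (\<lambda>z. inv (fst z) \<otimes> snd z) z \<in> N}"
    by (intro openin_continuous_map_preimage[OF _ N(1)] continuous_mult_fun continuous_inv_fun
        continuous_map_fst continuous_map_snd)
  moreover have "(\<one>, \<one>) \<in> {z \<in> topspace (prod_topology T T). (\<lambda>z. inv (fst z) \<otimes> snd z) z \<in> N}"
    using N(2) by (simp add: topspace_eq)
  ultimately obtain P Q where PQ: "openin T P" "openin T Q" "\<one> \<in> P" "\<one> \<in> Q"
    "P \<times> Q \<subseteq> {z \<in> topspace (prod_topology T T). (\<lambda>z. inv (fst z) \<otimes> snd z) z \<in> N}"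
    unfolding openin_prod_topology_alt by meson
  \<comment> \<open>Both \<sigma>(p) and p^-1 must lie in \<open>V\<close>: they have the same
    square, and injectivity of squaring on \<open>V\<close> then identifies them. Membership of
    \<open>p\<close> in \<open>P\<close> and of \<open>g\<close> in \<open>Q\<close> puts
    \<open>inv p \<otimes> g\<close> into \<open>N\<close>.\<close>
  define W where "W = V \<inter> {x \<in> carrier G. inv x \<in> V} \<inter> {x \<in> carrier G. \<sigma> x \<in> V} \<inter> P"
  have W: "openin T W" "W \<subseteq> V" "\<one> \<in> W"
    unfolding W_def using V PQ \<sigma>.hom_one
    by (auto intro!: openin_Int openin_vimage continuous_inv \<sigma>(3))
  define U where "U = Q \<inter> {g \<in> carrier G. g \<otimes> inv (\<sigma> g) \<in> (\<lambda>x. x \<otimes> x) ` W}"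
  have "openin T U"
    unfolding U_def
    by (intro openin_Int PQ openin_vimage continuous_mult_fun continuous_inv_fun \<sigma>(3) V(4) W)
      simp
  moreover have "\<one> \<in> U"
    using PQ W(3) by (auto simp: U_def intro!: image_eqI[of _ _ \<one>])
  moreover have "\<exists>k\<in>K. k \<in> carrier G \<and> \<sigma> g = k \<otimes> inv g \<otimes> k" if g: "g \<in> U" for g
  proof -
    obtain p where p: "p \<in> W" "g \<otimes> inv (\<sigma> g) = p \<otimes> p" and gc: "g \<in> carrier G" "g \<in> Q"
      using g by (auto simp: U_def)
    have pc: "p \<in> carrier G" "p \<in> P" "inv p \<in> V" "\<sigma> p \<in> V"
      using p(1) openin_carrier[OF V(1)] by (auto simp: W_def)
    have "\<sigma> p \<otimes> \<sigma> p = \<sigma> (g \<otimes> inv (\<sigma> g))"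
      using p(2) pc by (simp add: \<sigma>m)
    also have "\<dots> = inv (g \<otimes> inv (\<sigma> g))"
      using gc by (simp add: \<sigma>m \<sigma>(2) inv_mult_group)
    also have "\<dots> = inv p \<otimes> inv p"
      using p(2) pc by (simp add: inv_mult_group)
    finally have \<sigma>p: "\<sigma> p = inv p"
      using inj_onD[OF V(3)] pc by blast
    define h where "h = inv p \<otimes> g"
    have hc: "h \<in> carrier G" and gh: "g = p \<otimes> h"
      using pc gc by (auto simp: h_def simp flip: m_assoc)
    have "p \<otimes> h \<otimes> inv (\<sigma> g) = p \<otimes> p"
      using p(2) gh by simp
    then have "h \<otimes> inv (\<sigma> g) = p"
      using hc pc gc by (simp add: m_assoc)
    then have "h = p \<otimes> \<sigma> g"
      using hc pc gc by (metis \<sigma>c inv_closed inv_inv inv_solve_right)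
    moreover have "\<sigma> h = p \<otimes> \<sigma> g"
      using pc gc by (simp add: h_def \<sigma>m \<sigma>p)
    ultimately have \<sigma>h: "\<sigma> h = h"
      by simp
    have "(p, g) \<in> P \<times> Q"
      using pc gc by simp
    then have "h \<in> N"
      using PQ(5) by (auto simp: h_def)
    then have "h \<in> K"
      using N(3) \<sigma>h by simp
    moreover have "\<sigma> g = h \<otimes> inv g \<otimes> h"
    proof -
      have "\<sigma> g = inv p \<otimes> h"
        using gh pc hc \<sigma>h by (simp add: \<sigma>m \<sigma>p)
      also have "\<dots> = h \<otimes> (inv h \<otimes> inv p) \<otimes> h"
        using pc hc by (simp flip: m_assoc)
      finally show ?thesis
        using gh pc hc by (simp add: inv_mult_group)
    qed
    ultimately show ?thesis
      using hc by blast
  qed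
  ultimately show ?thesis
    by blast
qed

end

section \<open>The Hilbert space \<open>L\<^sup>2\<close>\<close>

lemma borel_measurable_cnj [measurable (raw)]:
  "f \<in> borel_measurable M \<Longrightarrow> (\<lambda>x. cnj (f x)) \<in> borel_measurable M"
  by (rule borel_measurable_continuous_on[of cnj]) (intro continuous_intros)

lemma L2D: "f \<in> L2 M \<Longrightarrow> f \<in> borel_measurable M" "f \<in> L2 M \<Longrightarrow> integrable M (\<lambda>x. (cmod (f x))\<^sup>2)"
  by (auto simp: L2_def)

lemma L2_mult_left:
  assumes "f \<in> L2 M"
  shows "(\<lambda>x. c * f x) \<in> L2 M"
  using L2D[OF assms] by (auto simp: L2_def norm_mult power_mult_distrib)

lemma L2_add:
  assumes "f \<in> L2 M" "g \<in> L2 M"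
  shows "(\<lambda>x. f x + g x) \<in> L2 M"
proof -
  have "(cmod (f x + g x))\<^sup>2 \<le> 2 * (cmod (f x))\<^sup>2 + 2 * (cmod (g x))\<^sup>2" for x
  proof -
    have "(cmod (f x + g x))\<^sup>2 \<le> (cmod (f x) + cmod (g x))\<^sup>2"
      by (simp add: norm_triangle_ineq power_mono)
    also have "\<dots> \<le> 2 * (cmod (f x))\<^sup>2 + 2 * (cmod (g x))\<^sup>2"
      using sum_squares_ge_zero[of "cmod (f x) - cmod (g x)" 0]
      by (simp add: power2_eq_square algebra_simps)
    finally show ?thesis .
  qed
  then have b: "norm ((cmod (f x + g x))\<^sup>2) \<le> norm (2 * (cmod (f x))\<^sup>2 + 2 * (cmod (g x))\<^sup>2)" for x
    using order_trans[OF _ abs_ge_self] by simp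
  have [measurable]: "f \<in> borel_measurable M" "g \<in> borel_measurable M"
    using assms L2D by auto
  have "integrable M (\<lambda>x. (cmod (f x + g x))\<^sup>2)"
  proof (rule Bochner_Integration.integrable_bound)
    show "integrable M (\<lambda>x. 2 * (cmod (f x))\<^sup>2 + 2 * (cmod (g x))\<^sup>2)"
      using L2D(2)[OF assms(1)] L2D(2)[OF assms(2)] by simp
    show "(\<lambda>x. (cmod (f x + g x))\<^sup>2) \<in> borel_measurable M"
      by measurable
  qed (use b in \<open>rule AE_I2\<close>)
  then show ?thesis
    using L2D[OF assms(1)] L2D[OF assms(2)] by (auto simp: L2_def)
qed

lemma L2_zero: "(\<lambda>x. 0) \<in> L2 M"
  by (simp add: L2_def)

lemma L2_sum: "(\<And>i. i \<in> I \<Longrightarrow> u i \<in> L2 M) \<Longrightarrow> (\<lambda>x. \<Sum>i\<in>I. c i * u i x) \<in> L2 M"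
  by (induction I rule: infinite_finite_induct) (auto intro!: L2_add L2_mult_left L2_zero)

lemma L2_diff: "f \<in> L2 M \<Longrightarrow> g \<in> L2 M \<Longrightarrow> (\<lambda>x. f x - g x) \<in> L2 M"
  using L2_add[of f M "\<lambda>x. -1 * g x"] L2_mult_left[of g M "-1"] by simp

lemma L2_cnj: "f \<in> L2 M \<Longrightarrow> (\<lambda>x. cnj (f x)) \<in> L2 M"
  by (auto simp: L2_def intro: borel_measurable_cnj)

lemma L2_inner_integrable:
  assumes "f \<in> L2 M" "g \<in> L2 M"
  shows "integrable M (\<lambda>x. f x * cnj (g x))"
proof (rule Bochner_Integration.integrable_bound[of M "\<lambda>x. (cmod (f x))\<^sup>2 + (cmod (g x))\<^sup>2"])
  have "2 * (cmod (f x) * cmod (g x)) \<le> (cmod (f x))\<^sup>2 + (cmod (g x))\<^sup>2" for x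
    using sum_squares_bound[of "cmod (f x)" "cmod (g x)"] by (simp add: mult.assoc)
  moreover have "0 \<le> cmod (f x) * cmod (g x)" for x
    by simp
  ultimately have "cmod (f x) * cmod (g x) \<le> (cmod (f x))\<^sup>2 + (cmod (g x))\<^sup>2" for x
    by (metis add_increasing mult_2 order_trans add_left_mono add.right_neutral)
  then show "AE x in M. norm (f x * cnj (g x)) \<le> norm ((cmod (f x))\<^sup>2 + (cmod (g x))\<^sup>2)"
    by (simp add: norm_mult)
qed (use L2D[OF assms(1)] L2D[OF assms(2)] in auto)

lemma L2_inner_cnj: "cnj (L2_inner M f g) = L2_inner M g f"
  unfolding L2_inner_def by (subst Bochner_Integration.integral_cnj[symmetric]) (simp add: mult.commute)

lemma L2_inner_add_left:
  assumes "f \<in> L2 M" "g \<in> L2 M" "h \<in> L2 M"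
  shows "L2_inner M (\<lambda>x. f x + g x) h = L2_inner M f h + L2_inner M g h"
  using L2_inner_integrable[OF assms(1,3)] L2_inner_integrable[OF assms(2,3)]
  by (simp add: L2_inner_def distrib_right)

lemma L2_inner_mult_left: "L2_inner M (\<lambda>x. c * f x) h = c * L2_inner M f h"
  by (simp add: L2_inner_def mult.assoc)

lemma L2_inner_sum_left:
  assumes "\<And>i. i \<in> I \<Longrightarrow> u i \<in> L2 M" "h \<in> L2 M"
  shows "L2_inner M (\<lambda>x. \<Sum>i\<in>I. c i * u i x) h = (\<Sum>i\<in>I. c i * L2_inner M (u i) h)"
  using assms(1)
proof (induction I rule: infinite_finite_induct)
  case (insert i I)
  then show ?case
    using assms(2)
    by (simp add: L2_inner_add_left L2_mult_left L2_sum L2_inner_mult_left)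
qed (auto simp: L2_inner_def)

lemma L2_inner_diff_left:
  assumes "f \<in> L2 M" "g \<in> L2 M" "h \<in> L2 M"
  shows "L2_inner M (\<lambda>x. f x - g x) h = L2_inner M f h - L2_inner M g h"
  using L2_inner_integrable[OF assms(1,3)] L2_inner_integrable[OF assms(2,3)]
  by (simp add: L2_inner_def left_diff_distrib)

lemma L2_inner_diff_right:
  assumes "f \<in> L2 M" "g \<in> L2 M" "h \<in> L2 M"
  shows "L2_inner M h (\<lambda>x. f x - g x) = L2_inner M h f - L2_inner M h g"
  using L2_inner_diff_left[OF assms] L2_inner_cnj by (metis complex_cnj_diff)

lemma L2_inner_mult_right: "L2_inner M h (\<lambda>x. c * f x) = cnj c * L2_inner M h f"
  using L2_inner_mult_left[of M c f h] L2_inner_cnj by (metis complex_cnj_mult)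

lemma L2_inner_sum_right:
  assumes "\<And>i. i \<in> I \<Longrightarrow> u i \<in> L2 M" "h \<in> L2 M"
  shows "L2_inner M h (\<lambda>x. \<Sum>i\<in>I. c i * u i x) = (\<Sum>i\<in>I. cnj (c i) * L2_inner M h (u i))"
proof -
  have "cnj (L2_inner M (\<lambda>x. \<Sum>i\<in>I. c i * u i x) h) = (\<Sum>i\<in>I. cnj (c i) * cnj (L2_inner M (u i) h))"
    using L2_inner_sum_left[of I u M h c] assms by simp
  then show ?thesis
    by (simp add: L2_inner_cnj)
qed

lemma L2_norm_nonneg: "0 \<le> L2_norm M f"
  by (simp add: L2_norm_def)

lemma L2_norm_power2: "(L2_norm M f)\<^sup>2 = (\<integral>x. (cmod (f x))\<^sup>2 \<partial>M)"
  by (simp add: L2_norm_def)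

lemma L2_inner_self: "L2_inner M f f = of_real ((L2_norm M f)\<^sup>2)"
  unfolding L2_norm_power2 L2_inner_def by (simp flip: complex_norm_square integral_complex_of_real del: of_real_power)

lemma L2_norm_power2_inner: "(L2_norm M f)\<^sup>2 = Re (L2_inner M f f)"
  by (simp add: L2_inner_self)

lemma L2_norm_minus_commute: "L2_norm M (\<lambda>x. f x - g x) = L2_norm M (\<lambda>x. g x - f x)"
  by (simp add: L2_norm_def norm_minus_commute)

lemma L2_norm_cong_AE:
  assumes "AE x in M. f x = g x" "f \<in> borel_measurable M" "g \<in> borel_measurable M"
  shows "L2_norm M f = L2_norm M g"
proof -
  have "(\<integral>x. (cmod (f x))\<^sup>2 \<partial>M) = (\<integral>x. (cmod (g x))\<^sup>2 \<partial>M)"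
    by (rule integral_cong_AE) (use assms in auto)
  then show ?thesis
    by (simp add: L2_norm_def)
qed

lemma L2_norm_eq_0_AE:
  assumes "f \<in> L2 M" "L2_norm M f = 0"
  shows "AE x in M. f x = 0"
proof -
  have "(\<integral>x. (cmod (f x))\<^sup>2 \<partial>M) = 0"
    using assms(2) by (simp add: L2_norm_def)
  then show ?thesis
    using integral_nonneg_eq_0_iff_AE[OF L2D(2)[OF assms(1)]] by simp
qed

lemma L2_norm_residual:
  assumes "finite I" "\<And>i. i \<in> I \<Longrightarrow> u i \<in> L2 M" "f \<in> L2 M"
    and on: "\<And>i j. i \<in> I \<Longrightarrow> j \<in> I \<Longrightarrow> L2_inner M (u i) (u j) = (if i = j then 1 else 0)"
  shows "(L2_norm M (\<lambda>x. f x - (\<Sum>i\<in>I. L2_inner M f (u i) * u i x)))\<^sup>2 =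
    (L2_norm M f)\<^sup>2 - (\<Sum>i\<in>I. (cmod (L2_inner M f (u i)))\<^sup>2)"
proof -
  define c where "c i = L2_inner M f (u i)" for i
  define s where "s x = (\<Sum>i\<in>I. c i * u i x)" for x
  have s: "s \<in> L2 M"
    unfolding s_def by (rule L2_sum) (use assms in auto)
  have "L2_inner M f s = (\<Sum>i\<in>I. cnj (c i) * c i)"
    unfolding s_def by (subst L2_inner_sum_right) (use assms in \<open>auto simp: c_def\<close>)
  also have "\<dots> = of_real (\<Sum>i\<in>I. (cmod (c i))\<^sup>2)"
    unfolding of_real_sum by (rule sum.cong) (auto simp: complex_norm_square mult.commute simp del: of_real_power)
  finally have fs: "L2_inner M f s = of_real (\<Sum>i\<in>I. (cmod (c i))\<^sup>2)" .
  have us: "L2_inner M (u i) s = cnj (c i)" if "i \<in> I" for i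
    unfolding s_def using assms that
    by (subst L2_inner_sum_right) (auto simp: on if_distrib cong: if_cong sum.cong)
  have "L2_inner M s s = (\<Sum>i\<in>I. c i * L2_inner M (u i) s)"
    unfolding s_def[abs_def] by (subst L2_inner_sum_left) (use assms s in \<open>auto simp: s_def[abs_def]\<close>)
  also have "\<dots> = of_real (\<Sum>i\<in>I. (cmod (c i))\<^sup>2)"
    unfolding of_real_sum by (rule sum.cong) (auto simp: complex_norm_square us simp del: of_real_power)
  finally have ss: "L2_inner M s s = of_real (\<Sum>i\<in>I. (cmod (c i))\<^sup>2)" .
  have sf: "L2_inner M s f = of_real (\<Sum>i\<in>I. (cmod (c i))\<^sup>2)"
    using arg_cong[OF fs, of cnj] by (simp only: L2_inner_cnj complex_cnj_complex_of_real)
  have "L2_inner M (\<lambda>x. f x - s x) (\<lambda>x. f x - s x) = L2_inner M f f - of_real (\<Sum>i\<in>I. (cmod (c i))\<^sup>2)"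
    using assms(3) s L2_diff[OF assms(3) s]
    by (simp add: L2_inner_diff_left L2_inner_diff_right fs ss sf)
  then have "Re (L2_inner M (\<lambda>x. f x - s x) (\<lambda>x. f x - s x)) = Re (L2_inner M f f) - (\<Sum>i\<in>I. (cmod (c i))\<^sup>2)"
    by (simp only: minus_complex.sel Re_complex_of_real)
  then show ?thesis
    unfolding L2_norm_power2_inner s_def[abs_def] c_def .
qed

lemma L2_bessel:
  assumes "finite I" "\<And>i. i \<in> I \<Longrightarrow> u i \<in> L2 M" "f \<in> L2 M"
    and "\<And>i j. i \<in> I \<Longrightarrow> j \<in> I \<Longrightarrow> L2_inner M (u i) (u j) = (if i = j then 1 else 0)"
  shows "(\<Sum>i\<in>I. (cmod (L2_inner M f (u i)))\<^sup>2) \<le> (L2_norm M f)\<^sup>2"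
proof -
  have "0 \<le> (L2_norm M f)\<^sup>2 - (\<Sum>i\<in>I. (cmod (L2_inner M f (u i)))\<^sup>2)"
    by (subst L2_norm_residual[OF assms, symmetric]) simp_all
  then show ?thesis
    by simp
qed

lemma L2_cauchy_schwarz:
  assumes "f \<in> L2 M" "g \<in> L2 M"
  shows "cmod (L2_inner M f g) \<le> L2_norm M f * L2_norm M g"
proof (cases "L2_norm M g = 0")
  case True
  then have "AE x in M. f x * cnj (g x) = 0"
    using L2_norm_eq_0_AE[OF assms(2)] by auto
  then have "L2_inner M f g = 0"
    unfolding L2_inner_def by (rule integral_eq_zero_AE)
  then show ?thesis
    by (simp add: True)
next
  case False
  \<comment> \<open>The Cauchy--Schwarz inequality is Bessel's inequality for this single unit
    vector.\<close>
  define u where "u x = of_real (1 / L2_norm M g) * g x" for x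
  have "L2_inner M u u = 1"
    using False unfolding u_def L2_inner_mult_left L2_inner_mult_right unfolding L2_inner_self
    by (simp add: field_simps power2_eq_square)
  moreover have "u \<in> L2 M"
    unfolding u_def[abs_def] by (rule L2_mult_left) fact
  ultimately have "(cmod (L2_inner M f u))\<^sup>2 \<le> (L2_norm M f)\<^sup>2"
    using L2_bessel[of "{u}" "\<lambda>v. v" M f] assms by auto
  then have "cmod (L2_inner M f u) \<le> L2_norm M f"
    using L2_norm_nonneg power2_le_imp_le by blast
  moreover have "cmod (L2_inner M f u) = cmod (L2_inner M f g) / L2_norm M g"
    unfolding u_def L2_inner_mult_right using L2_norm_nonneg[of M g] by (simp add: norm_divide)
  ultimately show ?thesis
    using False L2_norm_nonneg[of M g] by (simp add: divide_le_eq split: if_splits)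
qed

lemma L2_norm_triangle:
  assumes "f \<in> L2 M" "g \<in> L2 M"
  shows "L2_norm M (\<lambda>x. f x + g x) \<le> L2_norm M f + L2_norm M g"
proof (rule power2_le_imp_le)
  have "L2_inner M (\<lambda>x. f x + g x) (\<lambda>x. f x + g x) =
      L2_inner M f f + L2_inner M g g + (L2_inner M f g + cnj (L2_inner M f g))"
  proof -
    have "L2_inner M h (\<lambda>x. f x + g x) = L2_inner M h f + L2_inner M h g" if "h \<in> L2 M" for h
      using arg_cong[OF L2_inner_add_left[OF assms that], of cnj] by (simp add: L2_inner_cnj)
    then show ?thesis
      using assms by (simp add: L2_inner_add_left L2_add L2_inner_cnj)
  qed
  then have "(L2_norm M (\<lambda>x. f x + g x))\<^sup>2 = (L2_norm M f)\<^sup>2 + (L2_norm M g)\<^sup>2 + 2 * Re (L2_inner M f g)"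
    unfolding L2_norm_power2_inner by simp
  also have "Re (L2_inner M f g) \<le> L2_norm M f * L2_norm M g"
    using L2_cauchy_schwarz[OF assms] complex_Re_le_cmod order_trans by blast
  finally show "(L2_norm M (\<lambda>x. f x + g x))\<^sup>2 \<le> (L2_norm M f + L2_norm M g)\<^sup>2"
    by (simp add: power2_sum)
qed (simp add: L2_norm_nonneg)

lemma L2_norm_triangle_diff:
  assumes "f \<in> L2 M" "g \<in> L2 M" "h \<in> L2 M"
  shows "L2_norm M (\<lambda>x. f x - h x) \<le> L2_norm M (\<lambda>x. f x - g x) + L2_norm M (\<lambda>x. g x - h x)"
  using L2_norm_triangle[OF L2_diff[OF assms(1,2)] L2_diff[OF assms(2,3)]] by simp

section \<open>Square-integrable functions on a probability space\<close>

context prob_space begin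

lemma L2_const: "(\<lambda>x. c) \<in> L2 M"
  by (simp add: L2_def)

lemma L2_norm_const: "L2_norm M (\<lambda>x. c) = cmod c"
  by (simp add: L2_norm_def prob_space)

lemma L2_integrable:
  assumes "f \<in> L2 M"
  shows "integrable M f"
  using L2_inner_integrable[OF assms L2_const[of 1]] by simp

lemma L2_bounded:
  assumes "f \<in> borel_measurable M" "\<And>x. x \<in> space M \<Longrightarrow> cmod (f x) \<le> B"
  shows "f \<in> L2 M" "L2_norm M f \<le> \<bar>B\<bar>"
proof -
  have b: "(cmod (f x))\<^sup>2 \<le> \<bar>B\<bar>\<^sup>2" if "x \<in> space M" for x
    using assms(2)[OF that] by (intro power_mono) auto
  then have i: "integrable M (\<lambda>x. (cmod (f x))\<^sup>2)"
    using assms(1) by (intro integrable_const_bound[of _ "\<bar>B\<bar>\<^sup>2"]) auto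
  then show "f \<in> L2 M"
    using assms by (simp add: L2_def)
  have "(\<integral>x. (cmod (f x))\<^sup>2 \<partial>M) \<le> (\<integral>x. \<bar>B\<bar>\<^sup>2 \<partial>M)"
    by (rule integral_mono_AE) (use i b in auto)
  then show "L2_norm M f \<le> \<bar>B\<bar>"
    unfolding L2_norm_def by (intro real_le_lsqrt) (auto simp: prob_space)
qed

lemma L1_le_L2_norm:
  assumes "f \<in> L2 M"
  shows "(\<integral>x. cmod (f x) \<partial>M) \<le> L2_norm M f"
proof -
  have g: "(\<lambda>x. of_real (cmod (f x))) \<in> L2 M"
    using L2D[OF assms] by (auto simp: L2_def)
  have "L2_norm M (\<lambda>x. of_real (cmod (f x))) = L2_norm M f"
    by (simp add: L2_norm_def)
  then have "cmod (L2_inner M (\<lambda>x. of_real (cmod (f x))) (\<lambda>x. 1)) \<le> L2_norm M f"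
    using L2_cauchy_schwarz[OF g L2_const[of 1]] by (simp add: L2_norm_const)
  moreover have "L2_inner M (\<lambda>x. of_real (cmod (f x))) (\<lambda>x. 1) = of_real (\<integral>x. cmod (f x) \<partial>M)"
    by (simp add: L2_inner_def)
  ultimately show ?thesis
    by simp
qed

text \<open>On a probability space the L1 norm is at most the L2 norm, so geometric increments are
  absolutely summable almost everywhere. Fatou's lemma turns the pointwise limit into a limit in
  norm.\<close>

lemma L2_complete:
  assumes y: "\<And>n. y n \<in> L2 M" and d: "\<And>n. L2_norm M (\<lambda>x. y (Suc n) x - y n x) \<le> (1/2)^n"
  shows "\<exists>z\<in>L2 M. (\<lambda>n. L2_norm M (\<lambda>x. y n x - z x)) \<longlonglongrightarrow> 0"
proof -
  have [measurable]: "y n \<in> borel_measurable M" for n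
    using y L2D by blast
  have dm: "(\<lambda>x. y (Suc n) x - y n x) \<in> L2 M" for n
    by (intro L2_diff y)
  have "(\<integral>\<^sup>+x. (\<Sum>n. ennreal (cmod (y (Suc n) x - y n x))) \<partial>M) =
      (\<Sum>n. \<integral>\<^sup>+x. ennreal (cmod (y (Suc n) x - y n x)) \<partial>M)"
    by (rule nn_integral_suminf) simp
  also have "\<dots> = (\<Sum>n. ennreal (\<integral>x. cmod (y (Suc n) x - y n x) \<partial>M))"
    using L2_integrable[OF dm] by (subst nn_integral_eq_integral) auto
  also have "\<dots> \<le> (\<Sum>n. ennreal ((1/2)^n))"
    using order_trans[OF L1_le_L2_norm[OF dm] d] by (intro suminf_le ennreal_leI) auto
  also have "\<dots> = ennreal 2"
    using suminf_geometric[of "1/2 :: real"] by (subst suminf_ennreal2) (auto intro: summable_geometric)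
  finally have "(\<integral>\<^sup>+x. (\<Sum>n. ennreal (cmod (y (Suc n) x - y n x))) \<partial>M) \<noteq> \<infinity>"
    by (auto simp: top_unique)
  then have "AE x in M. (\<Sum>n. ennreal (cmod (y (Suc n) x - y n x))) \<noteq> \<infinity>"
    by (intro nn_integral_PInf_AE) auto
  then have conv: "AE x in M. convergent (\<lambda>n. y n x)"
  proof eventually_elim
    case (elim x)
    then have "summable (\<lambda>n. cmod (y (Suc n) x - y n x))"
      using summable_suminf_not_top[of "\<lambda>n. cmod (y (Suc n) x - y n x)"] by auto
    then have "summable (\<lambda>n. y (Suc n) x - y n x)"
      by (rule summable_norm_cancel)
    then have "convergent (\<lambda>n. \<Sum>i<n. y (Suc i) x - y i x)"
      by (simp add: summable_iff_convergent)
    then have "convergent (\<lambda>n. y n x - y 0 x)"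
      by (simp add: sum_lessThan_telescope[of "\<lambda>i. y i x"])
    then show ?case
      using convergent_add_const_right_iff[of "\<lambda>n. y n x" "- y 0 x"] by simp
  qed
  define z where "z x = lim (\<lambda>n. y n x)" for x
  have zm [measurable]: "z \<in> borel_measurable M"
    unfolding z_def[abs_def] by measurable
  have lim: "AE x in M. (\<lambda>n. y n x) \<longlonglongrightarrow> z x"
    using conv by eventually_elim (simp add: z_def convergent_LIMSEQ_iff)
  have dist: "L2_norm M (\<lambda>x. y n x - y (n + k) x) \<le> 2 * (1/2)^n" for n k
  proof -
    have "L2_norm M (\<lambda>x. y n x - y (n + k) x) \<le> (\<Sum>i<k. (1/2)^(n + i))"
    proof (induction k)
      case 0
      then show ?case
        by (simp add: L2_norm_def)
    next
      case (Suc k)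
      have "L2_norm M (\<lambda>x. y n x - y (n + Suc k) x) \<le>
          L2_norm M (\<lambda>x. y n x - y (n + k) x) + L2_norm M (\<lambda>x. y (n + k) x - y (n + Suc k) x)"
        by (rule L2_norm_triangle_diff) (rule y)+
      also have "L2_norm M (\<lambda>x. y (n + k) x - y (n + Suc k) x) \<le> (1/2)^(n + k)"
        using d[of "n + k"] by (subst L2_norm_minus_commute) simp
      finally show ?case
        using Suc by simp
    qed
    also have "\<dots> = (1/2)^n * (\<Sum>i<k. (1/2)^i)"
      by (simp add: sum_distrib_left power_add)
    also have "\<dots> \<le> (1/2)^n * 2"
      by (intro mult_left_mono, subst sum_gp_strict) simp_all
    finally show ?thesis
      by simp
  qed
  have bound: "(\<integral>\<^sup>+x. ennreal ((cmod (y n x - z x))\<^sup>2) \<partial>M) \<le> ennreal ((2 * (1/2)^n)\<^sup>2)" for n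
  proof -
    have "(\<integral>\<^sup>+x. ennreal ((cmod (y n x - z x))\<^sup>2) \<partial>M) =
        (\<integral>\<^sup>+x. liminf (\<lambda>k. ennreal ((cmod (y n x - y (n + k) x))\<^sup>2)) \<partial>M)"
    proof (rule nn_integral_cong_AE, use lim in eventually_elim)
      case (elim x)
      then have "(\<lambda>k. y (n + k) x) \<longlonglongrightarrow> z x"
        using LIMSEQ_ignore_initial_segment[of "\<lambda>n. y n x" "z x" n] by (simp add: add.commute)
      then have "(\<lambda>k. ennreal ((cmod (y n x - y (n + k) x))\<^sup>2)) \<longlonglongrightarrow> ennreal ((cmod (y n x - z x))\<^sup>2)"
        by (intro tendsto_intros tendsto_ennrealI)
      then show ?case
        by (rule lim_imp_Liminf[OF sequentially_bot, symmetric])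
    qed
    also have "\<dots> \<le> liminf (\<lambda>k. \<integral>\<^sup>+x. ennreal ((cmod (y n x - y (n + k) x))\<^sup>2) \<partial>M)"
      by (rule nn_integral_liminf) simp
    also have "\<dots> \<le> ennreal ((2 * (1/2)^n)\<^sup>2)"
    proof (rule Liminf_le[OF sequentially_bot], intro always_eventually allI)
      fix k
      have "(\<integral>\<^sup>+x. ennreal ((cmod (y n x - y (n + k) x))\<^sup>2) \<partial>M) = ennreal ((L2_norm M (\<lambda>x. y n x - y (n + k) x))\<^sup>2)"
        unfolding L2_norm_power2 by (intro nn_integral_eq_integral L2D(2) L2_diff y) auto
      also have "\<dots> \<le> ennreal ((2 * (1/2)^n)\<^sup>2)"
        using dist[of n k] L2_norm_nonneg by (intro ennreal_leI power_mono) auto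
      finally show "(\<integral>\<^sup>+x. ennreal ((cmod (y n x - y (n + k) x))\<^sup>2) \<partial>M) \<le> ennreal ((2 * (1/2)^n)\<^sup>2)" .
    qed
    finally show ?thesis .
  qed
  have diff: "(\<lambda>x. y n x - z x) \<in> L2 M" for n
  proof -
    have "(\<integral>\<^sup>+x. ennreal ((cmod (y n x - z x))\<^sup>2) \<partial>M) < \<infinity>"
      using le_less_trans[OF bound[of n]] by simp
    then have "integrable M (\<lambda>x. (cmod (y n x - z x))\<^sup>2)"
      by (intro integrableI_bounded) auto
    then show ?thesis
      by (simp add: L2_def)
  qed
  then have z: "z \<in> L2 M"
    using L2_diff[OF y[of 0] diff[of 0]] by simp
  have "L2_norm M (\<lambda>x. y n x - z x) \<le> 2 * (1/2)^n" for n
  proof -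
    have "ennreal ((L2_norm M (\<lambda>x. y n x - z x))\<^sup>2) \<le> ennreal ((2 * (1/2)^n)\<^sup>2)"
      using bound[of n] nn_integral_eq_integral[OF L2D(2)[OF diff[of n]]] unfolding L2_norm_power2 by simp
    then have "(L2_norm M (\<lambda>x. y n x - z x))\<^sup>2 \<le> (2 * (1/2)^n)\<^sup>2"
      by (subst (asm) ennreal_le_iff) auto
    then show ?thesis
      by (rule power2_le_imp_le) simp
  qed
  moreover have "(\<lambda>n. 2 * (1/2)^n :: real) \<longlonglongrightarrow> 0"
    using tendsto_mult_right_zero[OF LIMSEQ_power_zero[of "1/2 :: real"], of 2] by simp
  ultimately have "(\<lambda>n. L2_norm M (\<lambda>x. y n x - z x)) \<longlonglongrightarrow> 0"
    using tendsto_sandwich[of "\<lambda>_. 0" "\<lambda>n. L2_norm M (\<lambda>x. y n x - z x)" sequentially "\<lambda>n. 2 * (1/2)^n" 0]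
    by (simp add: L2_norm_nonneg)
  with z show ?thesis
    by blast
qed

end

text \<open>Fubini for unordered sums: the row sums \<open>w i\<close> are known, so absolute
  summability over the product reduces to that of \<open>cmod (c i) * w i\<close>. With squared
  coefficients as \<open>a\<close>, it exchanges the sum over an orthonormal basis with the sum over
  the dual in the trace.\<close>

lemma has_sum_weighted_swap:
  fixes c :: "'i \<Rightarrow> complex" and a :: "'i \<Rightarrow> 'e \<Rightarrow> real"
  assumes nonneg: "\<And>i e. i \<in> I \<Longrightarrow> e \<in> E \<Longrightarrow> 0 \<le> a i e"
    and s: "\<And>i. i \<in> I \<Longrightarrow> (a i has_sum w i) E"
    and summ: "(\<lambda>i. cmod (c i) * w i) summable_on I"
  shows "((\<lambda>e. \<Sum>\<^sub>\<infinity>i\<in>I. c i * of_real (a i e)) has_sum (\<Sum>\<^sub>\<infinity>i\<in>I. c i * of_real (w i))) E"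
proof -
  define g where "g = (\<lambda>(i, e). c i * complex_of_real (a i e))"
  have inner: "((\<lambda>e. norm (g (i, e))) has_sum cmod (c i) * w i) E" if i: "i \<in> I" for i
    using has_sum_cmult_right[OF s[OF i], of "cmod (c i)"] nonneg[OF i]
    by (subst has_sum_cong[of _ _ "\<lambda>e. cmod (c i) * a i e"]) (auto simp: g_def norm_mult)
  have w: "0 \<le> w i" if "i \<in> I" for i
    using has_sum_nonneg[OF s[OF that]] nonneg[OF that] by blast
  have "(\<lambda>p. norm (g p)) summable_on I \<times> E"
    unfolding Infinite_Sum.abs_summable_on_Sigma_iff
  proof (intro conjI ballI)
    show "(\<lambda>y. norm (g (i, y))) summable_on E" if "i \<in> I" for i
      using inner[OF that] summable_on_def by blast
    have "(\<lambda>i. norm (\<Sum>\<^sub>\<infinity>e\<in>E. norm (g (i, e)))) summable_on I \<longleftrightarrow> (\<lambda>i. cmod (c i) * w i) summable_on I"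
      by (rule summable_on_cong) (use infsumI[OF inner] w in auto)
    then show "(\<lambda>i. norm (\<Sum>\<^sub>\<infinity>e\<in>E. norm (g (i, e)))) summable_on I"
      using summ by simp
  qed
  then have gs: "g summable_on I \<times> E"
    by (rule Infinite_Sum.abs_summable_summable)
  have "infsum g (I \<times> E) = (\<Sum>\<^sub>\<infinity>i\<in>I. \<Sum>\<^sub>\<infinity>e\<in>E. g (i, e))"
    using infsum_Sigma_banach[OF gs] by simp
  also have "\<dots> = (\<Sum>\<^sub>\<infinity>i\<in>I. c i * of_real (w i))"
  proof (rule infsum_cong)
    fix i assume i: "i \<in> I"
    have "((\<lambda>e. c i * complex_of_real (a i e)) has_sum c i * of_real (w i)) E"
      by (intro has_sum_cmult_right has_sum_of_real s i)
    then show "(\<Sum>\<^sub>\<infinity>e\<in>E. g (i, e)) = c i * of_real (w i)"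
      by (auto simp: g_def intro: infsumI)
  qed
  finally have val: "infsum g (I \<times> E) = (\<Sum>\<^sub>\<infinity>i\<in>I. c i * of_real (w i))" .
  have hs: "((\<lambda>(e, i). g (i, e)) has_sum infsum g (I \<times> E)) (E \<times> I)"
  proof -
    have "((\<lambda>(e, i). g (i, e)) \<circ> prod.swap has_sum infsum g (I \<times> E)) (I \<times> E)"
      using has_sum_infsum[OF gs] by (simp add: o_def case_prod_unfold)
    then show ?thesis
      using has_sum_reindex[of prod.swap "I \<times> E" "\<lambda>(e, i). g (i, e)"] by (simp add: product_swap)
  qed
  then have "(\<lambda>(e, i). g (i, e)) summable_on E \<times> I"
    using summable_on_def by blast
  then have "(\<lambda>i. g (i, e)) summable_on I" if "e \<in> E" for e
    using summable_on_SigmaD1[of "\<lambda>e i. g (i, e)" E "\<lambda>_. I" e] that by simp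
  then have "((\<lambda>e. \<Sum>\<^sub>\<infinity>i\<in>I. g (i, e)) has_sum infsum g (I \<times> E)) E"
    using has_sum_SigmaD[OF hs, of "\<lambda>e. \<Sum>\<^sub>\<infinity>i\<in>I. g (i, e)"] by simp
  then show ?thesis
    unfolding val by (simp add: g_def)
qed

lemma L2_norm_sum_orthonormal:
  assumes "finite I" "\<And>i. i \<in> I \<Longrightarrow> u i \<in> L2 M"
    and on: "\<And>i j. i \<in> I \<Longrightarrow> j \<in> I \<Longrightarrow> L2_inner M (u i) (u j) = (if i = j then 1 else 0)"
  shows "(L2_norm M (\<lambda>x. \<Sum>i\<in>I. c i * u i x))\<^sup>2 = (\<Sum>i\<in>I. (cmod (c i))\<^sup>2)"
proof -
  define f where "f x = (\<Sum>i\<in>I. c i * u i x)" for x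
  have f: "f \<in> L2 M"
    unfolding f_def[abs_def] by (rule L2_sum) (use assms in auto)
  have fu: "L2_inner M f (u i) = c i" if "i \<in> I" for i
    unfolding f_def[abs_def] using assms that
    by (subst L2_inner_sum_left) (auto simp: on if_distrib cong: if_cong)
  have "(L2_norm M (\<lambda>x. f x - (\<Sum>i\<in>I. L2_inner M f (u i) * u i x)))\<^sup>2 =
    (L2_norm M f)\<^sup>2 - (\<Sum>i\<in>I. (cmod (L2_inner M f (u i)))\<^sup>2)"
    by (rule L2_norm_residual) (use assms f in auto)
  moreover have "(\<lambda>x. f x - (\<Sum>i\<in>I. L2_inner M f (u i) * u i x)) = (\<lambda>x. 0)"
    by (simp add: fu) (simp add: f_def)
  moreover have "L2_norm M (\<lambda>x. 0) = 0"
    by (simp add: L2_norm_def)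
  ultimately show ?thesis
    by (simp add: fu f_def[symmetric])
qed

text \<open>An \<open>L2_orthonormal_basis\<close> is only required to have trivial orthogonal
  complement, and it may be uncountable. The sum of squared coefficients is therefore exhausted
  along a sequence of finite sets; the partial expansions converge by completeness, and what remains
  of \<open>u\<close> is orthogonal to all of \<open>E\<close>.\<close>

lemma (in prob_space) L2_parseval:
  assumes E: "L2_orthonormal_basis M E" and u: "u \<in> L2 M"
  shows "((\<lambda>f. (cmod (L2_inner M u f))\<^sup>2) has_sum (L2_norm M u)\<^sup>2) E"
proof -
  have EL: "f \<in> L2 M" if "f \<in> E" for f
    using E that by (auto simp: L2_orthonormal_basis_def)
  have on: "L2_inner M f g = (if f = g then 1 else 0)" if "f \<in> E" "g \<in> E" for f g
    using E that by (auto simp: L2_orthonormal_basis_def)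
  define a where "a f = (cmod (L2_inner M u f))\<^sup>2" for f
  have bessel: "sum a F \<le> (L2_norm M u)\<^sup>2" if "finite F" "F \<subseteq> E" for F
    unfolding a_def by (rule L2_bessel) (use that EL on u in \<open>auto simp: subset_iff\<close>)
  have summ: "a summable_on E"
  proof (rule nonneg_bdd_above_summable_on)
    show "bdd_above (sum a ` {F. F \<subseteq> E \<and> finite F})"
      using bessel by (intro bdd_aboveI[of _ "(L2_norm M u)\<^sup>2"]) auto
  qed (simp add: a_def)
  define s where "s = infsum a E"
  have s_le: "sum a F \<le> s" if "finite F" "F \<subseteq> E" for F
    unfolding s_def by (rule finite_sum_le_infsum) (use summ that in \<open>auto simp: a_def\<close>)
  have s_norm: "s \<le> (L2_norm M u)\<^sup>2"
    unfolding s_def by (rule infsum_le_finite_sums) (use summ bessel in auto)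
  \<comment> \<open>The tolerance is the square of the bound \<open>(1/2)^n\<close> that
    \<open>L2_complete\<close> expects for the norms of the increments.\<close>
  have "\<exists>F. finite F \<and> F \<subseteq> E \<and> s - (1/4)^n \<le> sum a F" for n
  proof -
    obtain F where F: "finite F" "F \<subseteq> E" "dist (sum a F) s \<le> (1/4)^n"
      using infsum_finite_approximation[OF summ, of "(1/4)^n"] by (auto simp: s_def)
    then have "s - (1/4)^n \<le> sum a F"
      by (simp add: dist_real_def abs_le_iff)
    then show ?thesis
      using F by blast
  qed
  then obtain H where H: "\<And>n. finite (H n)" "\<And>n. H n \<subseteq> E" "\<And>n. s - (1/4)^n \<le> sum a (H n)"
    by metis
  define F where "F n = (\<Union>k\<le>n. H k)" for n
  have F: "finite (F n)" "F n \<subseteq> E" "F n \<subseteq> F (Suc n)" for n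
    using H by (auto simp: F_def intro: le_SucI)
  have Fs: "s - (1/4)^n \<le> sum a (F n)" for n
  proof -
    have "H n \<subseteq> F n"
      by (auto simp: F_def)
    then have "sum a (H n) \<le> sum a (F n)"
      by (intro sum_mono2 F) (auto simp: a_def)
    then show ?thesis
      using H(3)[of n] by simp
  qed
  define y where "y n x = (\<Sum>f\<in>F n. L2_inner M u f * f x)" for n x
  have y: "y n \<in> L2 M" for n
    unfolding y_def[abs_def] by (rule L2_sum) (use EL F in blast)
  have "L2_norm M (\<lambda>x. y (Suc n) x - y n x) \<le> (1/2)^n" for n
  proof (rule power2_le_imp_le)
    have "(\<lambda>x. y (Suc n) x - y n x) = (\<lambda>x. \<Sum>f\<in>F (Suc n) - F n. L2_inner M u f * f x)"
      using F by (simp add: y_def sum_diff)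
    then have "(L2_norm M (\<lambda>x. y (Suc n) x - y n x))\<^sup>2 = sum a (F (Suc n) - F n)"
      unfolding a_def using F
      by (simp, subst L2_norm_sum_orthonormal) (use EL on in \<open>auto simp: subset_iff\<close>)
    also have "\<dots> = sum a (F (Suc n)) - sum a (F n)"
      using F by (simp add: sum_diff)
    also have "\<dots> \<le> (1/4)^n"
      using s_le[OF F(1,2), of "Suc n"] Fs[of n] by simp
    also have "\<dots> = ((1/2)^n)\<^sup>2"
      by (simp add: power2_eq_square flip: power_mult_distrib)
    finally show "(L2_norm M (\<lambda>x. y (Suc n) x - y n x))\<^sup>2 \<le> ((1/2)^n)\<^sup>2" .
  qed simp
  then obtain z where z: "z \<in> L2 M" "(\<lambda>n. L2_norm M (\<lambda>x. y n x - z x)) \<longlonglongrightarrow> 0"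
    using L2_complete[of y] y by blast
  have "L2_inner M (\<lambda>x. u x - z x) f = 0" if f: "f \<in> E" for f
  proof -
    have "(L2_norm M f)\<^sup>2 = 1"
      using on[OF f f] by (simp add: L2_norm_power2_inner)
    then have fn: "L2_norm M f = 1"
      using power2_eq_iff_nonneg[of "L2_norm M f" 1] L2_norm_nonneg[of M f] by simp
    have "cmod (L2_inner M (\<lambda>x. u x - z x) f) \<le> (1/2)^n + L2_norm M (\<lambda>x. y n x - z x)" for n
    proof -
      have yf: "L2_inner M (y n) f = (if f \<in> F n then L2_inner M u f else 0)"
      proof -
        have "L2_inner M (y n) f = (\<Sum>h\<in>F n. L2_inner M u h * L2_inner M h f)"
          unfolding y_def[abs_def] by (rule L2_inner_sum_left) (use EL F(2) f in blast)+
        also have "\<dots> = (\<Sum>h\<in>F n. if h = f then L2_inner M u h else 0)"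
          by (rule sum.cong) (use on[OF _ f] F(2)[of n] in auto)
        finally show ?thesis
          using F(1)[of n] by simp
      qed
      have "cmod (L2_inner M (\<lambda>x. u x - y n x) f) \<le> (1/2)^n"
      proof (cases "f \<in> F n")
        case True
        then show ?thesis
          using u y EL[OF f] by (simp add: L2_inner_diff_left yf)
      next
        case False
        \<comment> \<open>Adding \<open>f\<close> to \<open>F n\<close> still cannot exceed
          \<open>s\<close>, so a coefficient that is left out is already small.\<close>
        have "a f + sum a (F n) \<le> s"
          using s_le[of "insert f (F n)"] False F(1,2)[of n] f by simp
        then have "a f \<le> (1/4)^n"
          using Fs[of n] by linarith
        also have "\<dots> = ((1/2)^n)\<^sup>2"
          by (simp add: power2_eq_square flip: power_mult_distrib)
        finally have "cmod (L2_inner M u f) \<le> (1/2)^n"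
          unfolding a_def by (rule power2_le_imp_le) simp
        then show ?thesis
          using False u y EL[OF f] by (simp add: L2_inner_diff_left yf)
      qed
      moreover have "cmod (L2_inner M (\<lambda>x. y n x - z x) f) \<le> L2_norm M (\<lambda>x. y n x - z x)"
        using L2_cauchy_schwarz[OF L2_diff[OF y z(1)] EL[OF f]] by (simp add: fn)
      moreover have "L2_inner M (\<lambda>x. u x - z x) f = L2_inner M (\<lambda>x. u x - y n x) f + L2_inner M (\<lambda>x. y n x - z x) f"
        using u y z EL[OF f] by (simp add: L2_inner_diff_left)
      ultimately show ?thesis
        using norm_triangle_mono by metis
    qed
    moreover have "(\<lambda>n. (1/2)^n + L2_norm M (\<lambda>x. y n x - z x)) \<longlonglongrightarrow> 0"
      using tendsto_add[OF LIMSEQ_power_zero[of "1/2::real"] z(2)] by simp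
    ultimately have "cmod (L2_inner M (\<lambda>x. u x - z x) f) \<le> 0"
      by (intro LIMSEQ_le_const) auto
    then show ?thesis
      by simp
  qed
  then have "AE x in M. u x - z x = 0"
    using E L2_diff[OF u z(1)] by (auto simp: L2_orthonormal_basis_def)
  then have "L2_norm M (\<lambda>x. u x - y n x) = L2_norm M (\<lambda>x. y n x - z x)" for n
    using L2D(1)[OF u] L2D(1)[OF z(1)] L2D(1)[OF y]
    by (subst L2_norm_minus_commute) (intro L2_norm_cong_AE, auto)
  then have "(\<lambda>n. (L2_norm M (\<lambda>x. u x - y n x))\<^sup>2) \<longlonglongrightarrow> 0"
    using tendsto_power[OF z(2), of 2] by simp
  moreover have "(L2_norm M u)\<^sup>2 - s \<le> (L2_norm M (\<lambda>x. u x - y n x))\<^sup>2" for n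
  proof -
    have "(L2_norm M (\<lambda>x. u x - y n x))\<^sup>2 = (L2_norm M u)\<^sup>2 - sum a (F n)"
      unfolding y_def a_def by (rule L2_norm_residual) (use F EL on u in \<open>auto simp: subset_iff\<close>)
    then show ?thesis
      using s_le[of "F n"] F by simp
  qed
  ultimately have "(L2_norm M u)\<^sup>2 - s \<le> 0"
    by (meson LIMSEQ_le_const)
  then have "s = (L2_norm M u)\<^sup>2"
    using s_norm by simp
  then show ?thesis
    using has_sum_infsum[OF summ] by (simp add: s_def a_def[abs_def])
qed

section \<open>Haar measure on a compact group\<close>

lemma space_borel_of [simp]: "space (borel_of T) = topspace T"
  by (simp add: borel_of_def space_measure_of_conv)

lemma sets_borel_of: "sets (borel_of T) = sigma_sets (topspace T) {U. openin T U}"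
  unfolding borel_of_def by (intro sets_measure_of) (auto dest: openin_subset)

lemma openin_sets_borel_of: "openin T U \<Longrightarrow> U \<in> sets (borel_of T)"
  by (simp add: sets_borel_of sigma_sets.Basic)

lemma continuous_map_measurable_borel_of:
  assumes "continuous_map T T' f"
  shows "f \<in> borel_of T \<rightarrow>\<^sub>M borel_of T'"
proof -
  have "f \<in> borel_of T \<rightarrow>\<^sub>M sigma (topspace T') {U. openin T' U}"
  proof (rule measurable_sigma_sets[of _ "topspace T'" "{U. openin T' U}"])
    show "sets (sigma (topspace T') {U. openin T' U}) = sigma_sets (topspace T') {U. openin T' U}"
      by (intro sets_measure_of) (auto dest: openin_subset)
    show "f \<in> space (borel_of T) \<rightarrow> topspace T'"
      using assms by (auto simp: continuous_map_def)
    fix U assume "U \<in> {U. openin T' U}"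
    then have "openin T {x \<in> topspace T. f x \<in> U}"
      using assms openin_continuous_map_preimage by blast
    moreover have "f -` U \<inter> space (borel_of T) = {x \<in> topspace T. f x \<in> U}"
      by auto
    ultimately show "f -` U \<inter> space (borel_of T) \<in> sets (borel_of T)"
      by (simp add: openin_sets_borel_of)
  qed (auto dest: openin_subset)
  then show ?thesis
    by (simp add: borel_of_def)
qed

lemma continuous_map_borel_measurable:
  fixes f :: "'a \<Rightarrow> 'b::topological_space"
  assumes "continuous_map T euclidean f"
  shows "f \<in> borel_measurable (borel_of T)"
proof (rule borel_measurableI)
  fix U :: "'b set" assume "open U"
  then have "openin T {x \<in> topspace T. f x \<in> U}"
    using assms by (intro openin_continuous_map_preimage) auto
  moreover have "f -` U \<inter> space (borel_of T) = {x \<in> topspace T. f x \<in> U}"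
    by auto
  ultimately show "f -` U \<inter> space (borel_of T) \<in> sets (borel_of T)"
    by (simp add: openin_sets_borel_of)
qed

text \<open>Second countability writes an open set of the product as a countable union of open
  rectangles. This makes the group product measurable for the product sigma-algebra, and so gives
  access to Fubini's theorem.\<close>

lemma openin_prod_sets:
  assumes "second_countable S" "second_countable T" "openin (prod_topology S T) W"
  shows "W \<in> sets (borel_of S \<Otimes>\<^sub>M borel_of T)"
proof -
  obtain B C where B: "countable B" "\<And>U. U \<in> B \<Longrightarrow> openin S U"
      "\<And>U x. openin S U \<Longrightarrow> x \<in> U \<Longrightarrow> \<exists>V\<in>B. x \<in> V \<and> V \<subseteq> U"
    and C: "countable C" "\<And>U. U \<in> C \<Longrightarrow> openin T U"
      "\<And>U x. openin T U \<Longrightarrow> x \<in> U \<Longrightarrow> \<exists>V\<in>C. x \<in> V \<and> V \<subseteq> U"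
    using assms(1,2) unfolding second_countable_def by metis
  define I where "I = {p \<in> B \<times> C. fst p \<times> snd p \<subseteq> W}"
  have "W = (\<Union>p\<in>I. fst p \<times> snd p)"
  proof (intro subset_antisym subsetI)
    fix z assume "z \<in> W"
    then obtain U V where UV: "openin S U" "openin T V" "fst z \<in> U" "snd z \<in> V" "U \<times> V \<subseteq> W"
      using assms(3) unfolding openin_prod_topology_alt by (metis prod.collapse)
    then obtain U' V' where "U' \<in> B" "fst z \<in> U'" "U' \<subseteq> U" "V' \<in> C" "snd z \<in> V'" "V' \<subseteq> V"
      using B(3) C(3) by meson
    then have "(U', V') \<in> I" "z \<in> fst (U', V') \<times> snd (U', V')"
      using UV(5) by (auto simp: I_def mem_Times_iff)
    then show "z \<in> (\<Union>p\<in>I. fst p \<times> snd p)"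
      by blast
  qed (auto simp: I_def)
  moreover have "countable I"
    by (rule countable_subset[of _ "B \<times> C"]) (use B(1) C(1) in \<open>auto simp: I_def\<close>)
  moreover have "fst p \<times> snd p \<in> sets (borel_of S \<Otimes>\<^sub>M borel_of T)" if "p \<in> I" for p
    using that B(2) C(2) by (intro pair_measureI openin_sets_borel_of) (auto simp: I_def)
  ultimately show ?thesis
    using sets.countable_UN'[of I "\<lambda>p. fst p \<times> snd p" "borel_of S \<Otimes>\<^sub>M borel_of T"] by auto
qed

lemma continuous_map_prod_measurable:
  assumes "second_countable S" "second_countable T" "continuous_map (prod_topology S T) T' f"
  shows "f \<in> borel_of S \<Otimes>\<^sub>M borel_of T \<rightarrow>\<^sub>M borel_of T'"
proof -
  have sp: "space (borel_of S \<Otimes>\<^sub>M borel_of T) = topspace (prod_topology S T)"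
    by (simp add: space_pair_measure)
  have "f \<in> borel_of S \<Otimes>\<^sub>M borel_of T \<rightarrow>\<^sub>M sigma (topspace T') {U. openin T' U}"
  proof (rule measurable_sigma_sets[of _ "topspace T'" "{U. openin T' U}"])
    show "sets (sigma (topspace T') {U. openin T' U}) = sigma_sets (topspace T') {U. openin T' U}"
      by (intro sets_measure_of) (auto dest: openin_subset)
    show "f \<in> space (borel_of S \<Otimes>\<^sub>M borel_of T) \<rightarrow> topspace T'"
      using assms(3) unfolding sp by (auto simp: continuous_map_def)
    fix U assume "U \<in> {U. openin T' U}"
    then have "openin (prod_topology S T) {x \<in> topspace (prod_topology S T). f x \<in> U}"
      using assms(3) openin_continuous_map_preimage by blast
    moreover have "f -` U \<inter> space (borel_of S \<Otimes>\<^sub>M borel_of T) = {x \<in> topspace (prod_topology S T). f x \<in> U}"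
      unfolding sp by auto
    ultimately show "f -` U \<inter> space (borel_of S \<Otimes>\<^sub>M borel_of T) \<in> sets (borel_of S \<Otimes>\<^sub>M borel_of T)"
      using openin_prod_sets[OF assms(1,2)] by simp
  qed (auto dest: openin_subset)
  then show ?thesis
    by (simp add: borel_of_def)
qed

locale compact_group = topological_group G T for G :: "('g, 'b) monoid_scheme" (structure) and T +
  assumes compact: "compact_space T" and second_countable: "second_countable T"
begin

abbreviation CC :: "('g \<Rightarrow> complex) set" where
  "CC \<equiv> {f. continuous_map T euclidean f}"

lemma mult_measurable:
  "(\<lambda>(x, y). x \<otimes> y) \<in> borel_of T \<Otimes>\<^sub>M borel_of T \<rightarrow>\<^sub>M borel_of T"
  by (rule continuous_map_prod_measurable[OF second_countable second_countable continuous_mult])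

lemma inv_measurable: "(\<lambda>x. inv x) \<in> borel_of T \<rightarrow>\<^sub>M borel_of T"
  by (rule continuous_map_measurable_borel_of[OF continuous_inv])

lemma left_measurable: "a \<in> carrier G \<Longrightarrow> (\<lambda>x. a \<otimes> x) \<in> borel_of T \<rightarrow>\<^sub>M borel_of T"
  by (intro continuous_map_measurable_borel_of continuous_left_mult)

lemma right_measurable: "a \<in> carrier G \<Longrightarrow> (\<lambda>x. x \<otimes> a) \<in> borel_of T \<rightarrow>\<^sub>M borel_of T"
  by (intro continuous_map_measurable_borel_of continuous_right_mult)

lemma borel_prob_space: "borel_prob T M \<Longrightarrow> space M = carrier G"
  unfolding borel_prob_def using sets_eq_imp_space_eq[of M "borel_of T"] topspace_eq by simp

lemma borel_prob_sets: "borel_prob T M \<Longrightarrow> sets M = sets (borel_of T)"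
  by (simp add: borel_prob_def)

lemma borel_prob_prob_space: "borel_prob T M \<Longrightarrow> prob_space M"
  by (simp add: borel_prob_def)

lemma measurable_borel_prob: "borel_prob T M \<Longrightarrow> measurable M N = measurable (borel_of T) N"
  by (intro measurable_cong_sets) (simp_all add: borel_prob_def)

lemma measurable_borel_prob2: "borel_prob T M \<Longrightarrow> measurable N M = measurable N (borel_of T)"
  by (intro measurable_cong_sets) (simp_all add: borel_prob_def)

lemma CC_measurable: "borel_prob T M \<Longrightarrow> f \<in> CC \<Longrightarrow> f \<in> borel_measurable M"
  by (simp add: continuous_map_borel_measurable measurable_borel_prob)

lemma CC_bounded:
  assumes "f \<in> CC"
  obtains B where "0 < B" "\<And>x. x \<in> carrier G \<Longrightarrow> cmod (f x) \<le> B"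
proof -
  have "compact (f ` carrier G)"
    using image_compactin[of T "topspace T" euclidean f] compact assms
    by (simp add: compact_space_def topspace_eq)
  then obtain B where "0 < B" "\<forall>y\<in>f ` carrier G. norm y \<le> B"
    using compact_imp_bounded bounded_pos by blast
  then show thesis
    using that by auto
qed

lemma CC_integrable:
  assumes M: "borel_prob T M" and f: "f \<in> CC"
  shows "integrable M f"
proof -
  interpret prob_space M
    using M by (rule borel_prob_prob_space)
  obtain B where "\<And>x. x \<in> carrier G \<Longrightarrow> cmod (f x) \<le> B"
    using CC_bounded[OF f] by blast
  then show ?thesis
    using borel_prob_space[OF M] by (intro integrable_const_bound[of _ B] CC_measurable[OF M f]) auto
qed

lemma CC_L2:
  assumes M: "borel_prob T M" and f: "f \<in> CC"
  shows "f \<in> L2 M"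
proof -
  interpret prob_space M
    using M by (rule borel_prob_prob_space)
  obtain B where B: "\<And>x. x \<in> carrier G \<Longrightarrow> cmod (f x) \<le> B"
    using CC_bounded[OF f] by blast
  show ?thesis
    by (rule L2_bounded(1)[OF CC_measurable[OF M f], of B]) (use B borel_prob_space[OF M] in auto)
qed

lemma CC_cnj: "f \<in> CC \<Longrightarrow> (\<lambda>x. cnj (f x)) \<in> CC"
  by (auto simp: continuous_map_atin intro: tendsto_cnj)

lemma CC_const: "(\<lambda>x. c) \<in> CC"
  by simp

lemma CC_mult: "f \<in> CC \<Longrightarrow> g \<in> CC \<Longrightarrow> (\<lambda>x. f x * g x) \<in> CC"
  by (auto simp: continuous_map_atin intro: tendsto_mult)

lemma CC_add: "f \<in> CC \<Longrightarrow> g \<in> CC \<Longrightarrow> (\<lambda>x. f x + g x) \<in> CC"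
  by (auto simp: continuous_map_atin intro: tendsto_add)

lemma CC_diff: "f \<in> CC \<Longrightarrow> g \<in> CC \<Longrightarrow> (\<lambda>x. f x - g x) \<in> CC"
  by (auto simp: continuous_map_atin intro: tendsto_diff)

lemma CC_sum: "(\<And>i. i \<in> I \<Longrightarrow> f i \<in> CC) \<Longrightarrow> (\<lambda>x. \<Sum>i\<in>I. f i x) \<in> CC"
  by (induction I rule: infinite_finite_induct) (auto intro!: CC_add[simplified])

lemma CC_comp: "f \<in> CC \<Longrightarrow> continuous_map T T h \<Longrightarrow> (\<lambda>x. f (h x)) \<in> CC"
  using continuous_map_compose[of T T h euclidean f] by (simp add: o_def)

lemma CC_cong: "f \<in> CC \<Longrightarrow> (\<And>x. x \<in> carrier G \<Longrightarrow> g x = f x) \<Longrightarrow> g \<in> CC"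
  using continuous_map_eq[of T euclidean f g] by (simp add: topspace_eq)

end

locale haar_group = compact_group G T for G :: "('g, 'b) monoid_scheme" (structure) and T +
  fixes m :: "'g measure"
  assumes haar: "normalised_haar G T (carrier G) m"
begin

lemma haar_borel_prob: "borel_prob T m"
  using haar by (simp add: normalised_haar_def)

sublocale prob_space m
  using haar_borel_prob by (rule borel_prob_prob_space)

lemmas haar_space = borel_prob_space[OF haar_borel_prob]
lemmas haar_measurable = measurable_borel_prob[OF haar_borel_prob]
lemmas haar_measurable2 = measurable_borel_prob2[OF haar_borel_prob]
lemmas haar_CC_measurable = CC_measurable[OF haar_borel_prob]
lemmas haar_CC_L2 = CC_L2[OF haar_borel_prob]
lemmas haar_CC_integrable = CC_integrable[OF haar_borel_prob]

lemma left_distr: "a \<in> carrier G \<Longrightarrow> distr m m (\<lambda>x. a \<otimes> x) = m"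
  using haar by (simp add: normalised_haar_def)

lemma left_meas: "a \<in> carrier G \<Longrightarrow> (\<lambda>x. a \<otimes> x) \<in> m \<rightarrow>\<^sub>M m"
  by (simp add: haar_measurable haar_measurable2 left_measurable)

lemma right_meas: "a \<in> carrier G \<Longrightarrow> (\<lambda>x. x \<otimes> a) \<in> m \<rightarrow>\<^sub>M m"
  by (simp add: haar_measurable haar_measurable2 right_measurable)

lemma inv_meas: "(\<lambda>x. inv x) \<in> m \<rightarrow>\<^sub>M m"
  by (simp add: haar_measurable haar_measurable2 inv_measurable)

lemma mult_meas: "(\<lambda>(x, y). x \<otimes> y) \<in> m \<Otimes>\<^sub>M m \<rightarrow>\<^sub>M m"
proof -
  have "sets (m \<Otimes>\<^sub>M m) = sets (borel_of T \<Otimes>\<^sub>M borel_of T)"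
    by (intro sets_pair_measure_cong borel_prob_sets haar_borel_prob)
  then have "measurable (m \<Otimes>\<^sub>M m) m = measurable (borel_of T \<Otimes>\<^sub>M borel_of T) (borel_of T)"
    by (rule measurable_cong_sets) (rule borel_prob_sets[OF haar_borel_prob])
  with mult_measurable show ?thesis
    by blast
qed

text \<open>Unimodularity: averaging \<open>1\<^sub>A(x y)\<close> over the Haar measure in \<open>y\<close> and its inverse image in \<open>x\<close>
  gives both measures of \<open>A\<close>.\<close>

lemma inv_distr: "distr m m (\<lambda>x. inv x) = m"
proof (rule measure_eqI)
  fix A assume "A \<in> sets (distr m m (\<lambda>x. inv x))"
  then have A [measurable]: "A \<in> sets m"
    by simp
  have xy [measurable]: "(\<lambda>(x, y). inv x \<otimes> y) \<in> m \<Otimes>\<^sub>M m \<rightarrow>\<^sub>M m"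
  proof -
    have [measurable]: "(\<lambda>x. inv x) \<in> m \<rightarrow>\<^sub>M m"
      by (rule inv_meas)
    have "(\<lambda>p. (inv (fst p), snd p)) \<in> m \<Otimes>\<^sub>M m \<rightarrow>\<^sub>M m \<Otimes>\<^sub>M m"
      by measurable
    from measurable_compose[OF this mult_meas] show ?thesis
      by (simp add: case_prod_beta')
  qed
  interpret pair_sigma_finite m m ..
  have c: "(\<integral>\<^sup>+ y. f (a \<otimes> y) \<partial>m) = (\<integral>\<^sup>+ y. f y \<partial>m)" if "a \<in> carrier G" "f \<in> borel_measurable m" for a and f :: "'g \<Rightarrow> ennreal"
    using nn_integral_distr[OF left_meas[OF that(1)], of f] left_distr[OF that(1)] that(2) by simp
  have "emeasure m A = (\<integral>\<^sup>+ x. emeasure m A \<partial>m)"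
    by (simp add: emeasure_space_1)
  also have "\<dots> = (\<integral>\<^sup>+ x. \<integral>\<^sup>+ y. indicator A (inv x \<otimes> y) \<partial>m \<partial>m)"
    by (rule nn_integral_cong) (simp add: haar_space c)
  also have "\<dots> = (\<integral>\<^sup>+ y. \<integral>\<^sup>+ x. indicator A (inv x \<otimes> y) \<partial>m \<partial>m)"
    by (rule Fubini') measurable
  also have "\<dots> = (\<integral>\<^sup>+ y. emeasure (distr m m (\<lambda>x. inv x)) A \<partial>m)"
  proof (rule nn_integral_cong)
    fix y assume "y \<in> space m"
    then have y: "y \<in> carrier G"
      by (simp add: haar_space)
    have [measurable]: "(\<lambda>x. indicator A (inv x) :: ennreal) \<in> borel_measurable m"
      using inv_meas by measurable
    have "(\<integral>\<^sup>+ x. indicator A (inv x \<otimes> y) \<partial>m) = (\<integral>\<^sup>+ x. indicator A (inv (inv y \<otimes> x)) \<partial>m)"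
      by (rule nn_integral_cong) (simp add: y haar_space inv_mult_group)
    also have "\<dots> = (\<integral>\<^sup>+ x. indicator A (inv x) \<partial>m)"
      using c[of "inv y" "\<lambda>x. indicator A (inv x)"] y by simp
    also have "\<dots> = (\<integral>\<^sup>+ x. indicator A x \<partial>distr m m (\<lambda>x. inv x))"
      by (subst nn_integral_distr[OF inv_meas]) auto
    finally show "(\<integral>\<^sup>+ x. indicator A (inv x \<otimes> y) \<partial>m) = emeasure (distr m m (\<lambda>x. inv x)) A"
      by simp
  qed
  also have "\<dots> = emeasure (distr m m (\<lambda>x. inv x)) A"
    by (simp add: emeasure_space_1)
  finally show "emeasure (distr m m (\<lambda>x. inv x)) A = emeasure m A" ..
qed simp

text \<open>Right translation is left translation conjugated by inversion, and the measure is
  invariant under both.\<close>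

lemma right_distr:
  assumes a: "a \<in> carrier G"
  shows "distr m m (\<lambda>x. x \<otimes> a) = m"
proof -
  have "distr m m (\<lambda>x. x \<otimes> a) = distr m m ((\<lambda>x. inv x) \<circ> ((\<lambda>x. inv a \<otimes> x) \<circ> (\<lambda>x. inv x)))"
    by (rule distr_cong) (use a in \<open>auto simp: haar_space inv_mult_group\<close>)
  also have "\<dots> = distr (distr (distr m m (\<lambda>x. inv x)) m (\<lambda>x. inv a \<otimes> x)) m (\<lambda>x. inv x)"
  proof -
    have a': "inv a \<in> carrier G"
      using a by simp
    have "distr (distr m m (\<lambda>x. inv x)) m (\<lambda>x. inv a \<otimes> x) = distr m m ((\<lambda>x. inv a \<otimes> x) \<circ> (\<lambda>x. inv x))"
      by (rule distr_distr[OF left_meas[OF a'] inv_meas])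
    then show ?thesis
      using distr_distr[OF inv_meas measurable_comp[OF inv_meas left_meas[OF a']]] by simp
  qed
  also have "\<dots> = m"
    using a by (simp add: inv_distr left_distr)
  finally show ?thesis .
qed

lemma integral_left: "a \<in> carrier G \<Longrightarrow> f \<in> borel_measurable m \<Longrightarrow> (\<integral>x. f (a \<otimes> x) \<partial>m) = (\<integral>x. f x \<partial>m)"
  for f :: "'g \<Rightarrow> 'c::{banach, second_countable_topology}"
  using integral_distr[OF left_meas, of a f] left_distr by simp

lemma integral_right: "a \<in> carrier G \<Longrightarrow> f \<in> borel_measurable m \<Longrightarrow> (\<integral>x. f (x \<otimes> a) \<partial>m) = (\<integral>x. f x \<partial>m)"
  for f :: "'g \<Rightarrow> 'c::{banach, second_countable_topology}"
  using integral_distr[OF right_meas, of a f] right_distr by simp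

lemma integral_inv: "f \<in> borel_measurable m \<Longrightarrow> (\<integral>x. f (inv x) \<partial>m) = (\<integral>x. f x \<partial>m)"
  for f :: "'g \<Rightarrow> 'c::{banach, second_countable_topology}"
  using integral_distr[OF inv_meas, of f] inv_distr by simp

lemma L2_left:
  assumes a: "a \<in> carrier G" and f: "f \<in> L2 m"
  shows "(\<lambda>x. f (a \<otimes> x)) \<in> L2 m" "L2_norm m (\<lambda>x. f (a \<otimes> x)) = L2_norm m f"
proof -
  have "integrable m (\<lambda>x. (cmod (f (a \<otimes> x)))\<^sup>2)"
    using integrable_distr[OF left_meas[OF a], of "\<lambda>x. (cmod (f x))\<^sup>2"] L2D[OF f] left_distr[OF a] by simp
  then show "(\<lambda>x. f (a \<otimes> x)) \<in> L2 m"
    using measurable_compose[OF left_meas[OF a] L2D(1)[OF f]] by (simp add: L2_def)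
  show "L2_norm m (\<lambda>x. f (a \<otimes> x)) = L2_norm m f"
    unfolding L2_norm_def using integral_left[OF a, of "\<lambda>x. (cmod (f x))\<^sup>2"] L2D[OF f] by simp
qed

lemma L2_inv:
  assumes f: "f \<in> L2 m"
  shows "(\<lambda>x. f (inv x)) \<in> L2 m" "L2_norm m (\<lambda>x. f (inv x)) = L2_norm m f"
proof -
  have "integrable m (\<lambda>x. (cmod (f (inv x)))\<^sup>2)"
    using integrable_distr[OF inv_meas, of "\<lambda>x. (cmod (f x))\<^sup>2"] L2D[OF f] inv_distr by simp
  then show "(\<lambda>x. f (inv x)) \<in> L2 m"
    using measurable_compose[OF inv_meas L2D(1)[OF f]] by (simp add: L2_def)
  show "L2_norm m (\<lambda>x. f (inv x)) = L2_norm m f"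
    unfolding L2_norm_def using integral_inv[of "\<lambda>x. (cmod (f x))\<^sup>2"] L2D[OF f] by simp
qed

text \<open>By compactness finitely many translates of \<open>U\<close> cover the group, and all of
  them have the measure of \<open>U\<close>.\<close>

lemma haar_open_pos:
  assumes U: "openin T U" "U \<noteq> {}"
  shows "emeasure m U > 0"
proof (rule ccontr)
  assume "\<not> emeasure m U > 0"
  then have U0: "emeasure m U = 0"
    by simp
  have UG: "U \<subseteq> carrier G"
    by (rule openin_carrier[OF U(1)])
  obtain u where u: "u \<in> U" "u \<in> carrier G"
    using U UG by blast
  let ?c = "(\<lambda>a. (\<lambda>x. a \<otimes> x) ` U) ` carrier G"
  have "carrier G \<subseteq> \<Union> ?c"
  proof
    fix g assume g: "g \<in> carrier G"
    then have "g = (g \<otimes> inv u) \<otimes> u"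
      using u by (simp add: m_assoc)
    then show "g \<in> \<Union> ?c"
      using u g by blast
  qed
  moreover have "openin T V" if "V \<in> ?c" for V
    using that openin_left_translate U by auto
  ultimately obtain F where F: "finite F" "F \<subseteq> ?c" "carrier G \<subseteq> \<Union> F"
    using compact unfolding compact_space_def compactin_def topspace_eq by meson
  have "emeasure m V = 0" if "V \<in> ?c" for V
  proof -
    from that obtain a where a: "a \<in> carrier G" "V = (\<lambda>x. a \<otimes> x) ` U"
      by blast
    have V: "V \<in> sets m"
      using openin_left_translate[OF a(1) U(1)] openin_sets_borel_of a(2)
      by (simp add: borel_prob_sets[OF haar_borel_prob])
    have "emeasure m V = emeasure (distr m m (\<lambda>x. a \<otimes> x)) V"
      using a by (simp add: left_distr)
    also have "\<dots> = emeasure m ((\<lambda>x. a \<otimes> x) -` V \<inter> space m)"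
      by (rule emeasure_distr[OF left_meas V]) (rule a)
    also have "(\<lambda>x. a \<otimes> x) -` V \<inter> space m = U"
      using a UG by (auto simp: haar_space)
    finally show ?thesis
      by (simp add: U0)
  qed
  moreover have "V \<in> sets m" if "V \<in> ?c" for V
    using that openin_left_translate U(1) openin_sets_borel_of
    by (auto simp: borel_prob_sets[OF haar_borel_prob])
  ultimately have "F \<subseteq> null_sets m"
    using F(2) by (auto simp: null_sets_def)
  then have "\<Union> F \<in> null_sets m"
    using F(1) null_sets_UN'[of F "\<lambda>x. x" m] countable_finite by auto
  then have "carrier G \<in> null_sets m"
    using F(3) null_sets_subset[of "\<Union> F" m "carrier G"] sets.top[of m] haar_space by simp
  then show False
    using emeasure_space_1 haar_space by auto
qed

text \<open>The set where \<open>f\<close> does not vanish is open, so if it is null it is empty.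
  This is the way back from L2 to identities at every point of the group.\<close>

lemma CC_norm_eq_0:
  assumes f: "f \<in> CC" and n: "L2_norm m f = 0" and x: "x \<in> carrier G"
  shows "f x = 0"
proof (rule ccontr)
  assume fx: "f x \<noteq> 0"
  define U where "U = {x \<in> carrier G. f x \<in> - {0}}"
  have "openin T U"
    unfolding U_def topspace_eq[symmetric]
    by (rule openin_continuous_map_preimage[of _ euclidean]) (use f in auto)
  then have "emeasure m U > 0"
    using haar_open_pos fx x by (auto simp: U_def)
  moreover have "AE x in m. f x = 0"
    by (rule L2_norm_eq_0_AE[OF haar_CC_L2[OF f] n])
  then have "emeasure m {x \<in> space m. \<not> (f x = 0)} = 0"
    using \<open>openin T U\<close> openin_sets_borel_of borel_prob_sets[OF haar_borel_prob]
    by (subst (asm) AE_iff_measurable[OF _ refl]) (auto simp: U_def haar_space)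
  ultimately show False
    by (simp add: U_def haar_space)
qed

end

section \<open>Convolution and power iteration\<close>

lemma norm_integral_le:
  fixes f :: "'a \<Rightarrow> 'b::{banach, second_countable_topology}"
  assumes "integrable M f" "integrable M g" "\<And>x. x \<in> space M \<Longrightarrow> norm (f x) \<le> g x"
  shows "norm (\<integral>x. f x \<partial>M) \<le> (\<integral>x. g x \<partial>M)"
proof -
  have "norm (\<integral>x. f x \<partial>M) \<le> (\<integral>x. norm (f x) \<partial>M)"
    by (rule integral_norm_bound)
  also have "\<dots> \<le> (\<integral>x. g x \<partial>M)"
    by (rule Bochner_Integration.integral_mono) (use assms in auto)
  finally show ?thesis .
qed

text \<open>Log-convexity makes the ratios increase to their supremum \<open>\<rho>\<close>, which
  gives the upper bound. If the lower bound failed at \<open>n\<close>, submultiplicativity along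
  multiples of \<open>Suc n\<close> would force a growth rate \<open>\<beta>\<close> below
  \<open>\<rho>\<close>, while the ratios eventually exceed any \<open>\<sigma> < \<rho>\<close>.
  The exponent \<open>Suc n\<close> reflects that in the application index n stands for the power n
  + 1.\<close>

lemma log_convex_submultiplicative_rate:
  fixes a :: "nat \<Rightarrow> real"
  assumes pos: "\<And>n. 0 < a n" and convex: "\<And>n. (a (Suc n))\<^sup>2 \<le> a n * a (Suc (Suc n))"
    and bdd: "\<And>n. a (Suc n) \<le> B * a n"
    and submult: "\<And>n k. a (Suc (n + k)) \<le> a n * a k"
  obtains \<rho> where "0 < \<rho>" "\<And>n. a (Suc n) \<le> \<rho> * a n" "\<And>n. \<rho> ^ Suc n \<le> a n"
proof -
  define r where "r n = a (Suc n) / a n" for n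
  have r_pos: "0 < r n" for n
    using pos by (simp add: r_def)
  have r_le: "r n \<le> B" for n
    using bdd[of n] pos[of n] by (simp add: r_def divide_le_eq)
  have "r n \<le> r (Suc n)" for n
    using convex[of n] pos[of n] pos[of "Suc n"]
    by (simp add: r_def field_simps power2_eq_square)
  then have r_mono: "r i \<le> r j" if "i \<le> j" for i j
    using that by (rule lift_Suc_mono_le)
  define \<rho> where "\<rho> = (SUP n. r n)"
  have bddr: "bdd_above (range r)"
    using r_le by (intro bdd_aboveI[of _ B]) auto
  have r\<rho>: "r n \<le> \<rho>" for n
    unfolding \<rho>_def by (rule cSUP_upper[OF _ bddr]) simp
  have \<rho>_pos: "0 < \<rho>"
    using r_pos[of 0] r\<rho>[of 0] by simp
  have up: "a (Suc n) \<le> \<rho> * a n" for n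
    using r\<rho>[of n] pos[of n] by (simp add: r_def divide_le_eq)
  have "\<rho> ^ Suc n \<le> a n" for n
  proof (rule ccontr)
    assume "\<not> \<rho> ^ Suc n \<le> a n"
    then have "a n < \<rho> ^ Suc n"
      by simp
    define \<beta> where "\<beta> = root (Suc n) (a n)"
    have \<beta>: "0 < \<beta>" "\<beta> ^ Suc n = a n"
      using pos[of n] real_root_pow_pos[of "Suc n" "a n"] by (simp_all add: \<beta>_def del: power_Suc)
    have "\<beta> < \<rho>"
      using \<open>a n < \<rho> ^ Suc n\<close> \<beta> \<rho>_pos power_less_imp_less_base[of \<beta> "Suc n" \<rho>] by simp
    then obtain \<sigma> where \<sigma>: "\<beta> < \<sigma>" "\<sigma> < \<rho>"
      using dense by blast
    then obtain M where M: "\<sigma> < r M"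
      unfolding \<rho>_def using less_cSUP_iff[OF _ bddr, of \<sigma>] by auto
    have \<sigma>_pos: "0 < \<sigma>"
      using \<beta> \<sigma> by simp
    have low: "a M * \<sigma> ^ j \<le> a (M + j)" for j
    proof (induction j)
      case (Suc j)
      have "\<sigma> \<le> r (M + j)"
        using M r_mono[of M "M + j"] by simp
      then have "\<sigma> * a (M + j) \<le> a (M + Suc j)"
        using pos[of "M + j"] by (simp add: r_def le_divide_eq)
      moreover have "\<sigma> * (a M * \<sigma> ^ j) \<le> \<sigma> * a (M + j)"
        using Suc \<sigma>_pos by simp
      ultimately show ?case
        by (simp add: mult_ac)
    qed simp
    \<comment> \<open>Each use of \<open>submult\<close> costs one factor \<open>a n\<close> and
      shifts the index by \<open>Suc n\<close>, not by \<open>n\<close>.\<close>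
    have hi: "a (n + k * Suc n) \<le> (a n) ^ Suc k" for k
    proof (induction k)
      case (Suc k)
      have "a (n + Suc k * Suc n) \<le> a n * a (n + k * Suc n)"
        using submult[of n "n + k * Suc n"] by (simp add: algebra_simps)
      also have "\<dots> \<le> a n * (a n) ^ Suc k"
        using Suc pos[of n] by (intro mult_left_mono) auto
      finally show ?case
        by simp
    qed simp
    \<comment> \<open>The two bounds meet at the common index \<open>n + k * Suc n = M + j\<close>.
      Dividing by the power of \<open>\<sigma>\<close> leaves a positive constant on the left and a
      null sequence on the right.\<close>
    have key: "a M / \<sigma> ^ Suc M \<le> ((\<beta> / \<sigma>) ^ Suc n) ^ Suc k" if k: "M \<le> k" for k
    proof -
      have "M \<le> n + k * Suc n"
        using k by (simp add: trans_le_add2)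
      then obtain j where j: "n + k * Suc n = M + j"
        using le_Suc_ex by blast
      then have e: "Suc M + j = Suc n * Suc k"
        by (simp add: mult.commute)
      have "a M * \<sigma> ^ j \<le> (\<beta> ^ Suc n) ^ Suc k"
        using low[of j] hi[of k] unfolding j \<beta>(2) by simp
      then have "a M * \<sigma> ^ j / \<sigma> ^ (Suc M + j) \<le> (\<beta> ^ Suc n) ^ Suc k / \<sigma> ^ (Suc n * Suc k)"
        unfolding e using \<sigma>_pos by (intro divide_right_mono) auto
      moreover have "(\<beta> ^ Suc n) ^ Suc k / \<sigma> ^ (Suc n * Suc k) = ((\<beta> / \<sigma>) ^ Suc n) ^ Suc k"
        by (simp only: power_mult power_divide)
      moreover have "a M * \<sigma> ^ j / \<sigma> ^ (Suc M + j) = a M / \<sigma> ^ Suc M"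
        using \<sigma>_pos by (simp add: power_add)
      ultimately show ?thesis
        by simp
    qed
    define \<theta> where "\<theta> = (\<beta> / \<sigma>) ^ Suc n"
    have "0 \<le> \<theta>" "\<theta> < 1"
      using \<beta>(1) \<sigma>(1) \<sigma>_pos power_less_one_iff[of "\<beta> / \<sigma>" "Suc n"] by (simp_all add: \<theta>_def del: power_Suc)
    then have "(\<lambda>k. \<theta> ^ Suc k) \<longlonglongrightarrow> 0"
      by (intro LIMSEQ_Suc LIMSEQ_power_zero) simp
    moreover have "0 < a M / \<sigma> ^ Suc M"
      using pos \<sigma>_pos by simp
    ultimately have "\<forall>\<^sub>F k in sequentially. \<theta> ^ Suc k < a M / \<sigma> ^ Suc M"
      by (rule order_tendstoD)
    then obtain k where "M \<le> k" "\<theta> ^ Suc k < a M / \<sigma> ^ Suc M"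
      unfolding eventually_sequentially by (metis linear)
    then show False
      using key[of k] by (simp add: \<theta>_def)
  qed
  from that[OF \<rho>_pos up this] show thesis .
qed

context haar_group begin

definition conv :: "('g \<Rightarrow> complex) \<Rightarrow> ('g \<Rightarrow> complex) \<Rightarrow> 'g \<Rightarrow> complex" where
  "conv a b x = (\<integral>h. a h * b (inv h \<otimes> x) \<partial>m)"

lemma L2_norm_cong: "(\<And>x. x \<in> carrier G \<Longrightarrow> f x = g x) \<Longrightarrow> L2_norm m f = L2_norm m g"
  unfolding L2_norm_def by (intro arg_cong[of _ _ sqrt] Bochner_Integration.integral_cong) (auto simp: haar_space)

lemma L2_inner_cong:
  "(\<And>x. x \<in> carrier G \<Longrightarrow> f x = f' x) \<Longrightarrow> (\<And>x. x \<in> carrier G \<Longrightarrow> g x = g' x) \<Longrightarrow>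
    L2_inner m f g = L2_inner m f' g'"
  unfolding L2_inner_def by (intro Bochner_Integration.integral_cong) (auto simp: haar_space)

lemma conv_cong:
  "(\<And>x. x \<in> carrier G \<Longrightarrow> f x = f' x) \<Longrightarrow> (\<And>x. x \<in> carrier G \<Longrightarrow> g x = g' x) \<Longrightarrow> x \<in> carrier G \<Longrightarrow>
    conv f g x = conv f' g' x"
  unfolding conv_def by (intro Bochner_Integration.integral_cong) (auto simp: haar_space)

lemma CC_inv_mult: "b \<in> CC \<Longrightarrow> x \<in> carrier G \<Longrightarrow> (\<lambda>h. b (inv h \<otimes> x)) \<in> CC"
  by (rule CC_comp, assumption, intro continuous_mult_fun continuous_inv_fun) (auto simp: topspace_eq)

lemma conv_inner: "conv a b x = L2_inner m a (\<lambda>h. cnj (b (inv h \<otimes> x)))"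
  by (simp add: conv_def L2_inner_def)

lemma L2_norm_inv_mult:
  assumes b: "b \<in> L2 m" and x: "x \<in> carrier G"
  shows "(\<lambda>h. b (inv h \<otimes> x)) \<in> L2 m" "L2_norm m (\<lambda>h. cnj (b (inv h \<otimes> x))) = L2_norm m b"
proof -
  have eq: "b (inv (inv x \<otimes> h)) = b (inv h \<otimes> x)" if "h \<in> carrier G" for h
    using that x by (simp add: inv_mult_group)
  have x': "inv x \<in> carrier G"
    using x by simp
  have "(\<lambda>h. b (inv (inv x \<otimes> h))) \<in> L2 m"
    by (rule L2_left(1)[OF x' L2_inv(1)[OF b]])
  moreover have "(\<lambda>h. b (inv (inv x \<otimes> h))) \<in> borel_measurable m \<longleftrightarrow> (\<lambda>h. b (inv h \<otimes> x)) \<in> borel_measurable m"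
    by (rule measurable_cong) (simp add: eq haar_space)
  moreover have "integrable m (\<lambda>h. (cmod (b (inv (inv x \<otimes> h))))\<^sup>2) \<longleftrightarrow> integrable m (\<lambda>h. (cmod (b (inv h \<otimes> x)))\<^sup>2)"
    by (rule Bochner_Integration.integrable_cong) (simp_all add: eq haar_space)
  ultimately show "(\<lambda>h. b (inv h \<otimes> x)) \<in> L2 m"
    by (simp add: L2_def)
  have "L2_norm m (\<lambda>h. cnj (b (inv h \<otimes> x))) = L2_norm m (\<lambda>h. b (inv (inv x \<otimes> h)))"
    unfolding L2_norm_def by (intro arg_cong[of _ _ sqrt] Bochner_Integration.integral_cong) (auto simp: haar_space eq)
  also have "\<dots> = L2_norm m b"
    using L2_left(2)[OF x' L2_inv(1)[OF b]] L2_inv(2)[OF b] by simp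
  finally show "L2_norm m (\<lambda>h. cnj (b (inv h \<otimes> x))) = L2_norm m b" .
qed

lemma conv_integrable:
  assumes "a \<in> L2 m" "b \<in> L2 m" "x \<in> carrier G"
  shows "integrable m (\<lambda>h. a h * b (inv h \<otimes> x))"
  using L2_inner_integrable[OF assms(1) L2_cnj[OF L2_norm_inv_mult(1)[OF assms(2,3)]]] by simp

text \<open>Cauchy--Schwarz, since the reflected translate of \<open>b\<close> has the norm of
  \<open>b\<close>. The bound is pointwise, so convolution with a fixed function turns convergence
  in L2 into uniform convergence.\<close>

lemma conv_bound:
  assumes "a \<in> L2 m" "b \<in> L2 m" "x \<in> carrier G"
  shows "cmod (conv a b x) \<le> L2_norm m a * L2_norm m b"
  unfolding conv_inner
  using L2_cauchy_schwarz[OF assms(1) L2_cnj[OF L2_norm_inv_mult(1)[OF assms(2,3)]]]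
  by (simp add: L2_norm_inv_mult(2)[OF assms(2,3)])

lemma conv_diff_left:
  assumes "a \<in> L2 m" "a' \<in> L2 m" "b \<in> L2 m" "x \<in> carrier G"
  shows "conv (\<lambda>x. a x - a' x) b x = conv a b x - conv a' b x"
  using conv_integrable[OF assms(1,3,4)] conv_integrable[OF assms(2,3,4)]
  by (simp add: conv_def left_diff_distrib)

lemma conv_mult_left: "conv (\<lambda>x. c * a x) b x = c * conv a b x"
  by (simp add: conv_def mult.assoc)

lemma CC_metric:
  "f \<in> CC \<longleftrightarrow> (\<forall>x\<in>carrier G. \<forall>\<epsilon>>0. \<exists>U. openin T U \<and> x \<in> U \<and> (\<forall>y\<in>U. dist (f y) (f x) < \<epsilon>))"
  using Met_TC.continuous_map_to_metric[of T f] by (simp add: topspace_eq dist_commute)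

lemma CC_uniform_limit:
  assumes "\<forall>\<^sub>F n in F. f n \<in> CC" "uniform_limit (carrier G) f l F" "F \<noteq> bot"
  shows "l \<in> CC"
  using Met_TC.continuous_map_uniform_limit[of T f F l] assms
  by (simp add: topspace_eq uniform_limit_iff)

text \<open>Since \<open>h\<close> ranges over a compact space, the tube lemma makes the continuity
  of \<open>b (inv h \<otimes> x)\<close> in \<open>x\<close> uniform in \<open>h\<close>; only the
  L1 norm of \<open>a\<close> then enters.\<close>

lemma conv_CC:
  assumes a: "a \<in> L2 m" and b: "b \<in> CC"
  shows "conv a b \<in> CC"
  unfolding CC_metric
proof (intro ballI allI impI)
  fix x0 :: 'g and \<epsilon> :: real assume x0: "x0 \<in> carrier G" and \<epsilon>: "0 < \<epsilon>"
  define A where "A = (\<integral>h. cmod (a h) \<partial>m)"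
  have A: "0 \<le> A"
    by (simp add: A_def)
  define \<delta> where "\<delta> = \<epsilon> / (A + 1)"
  have \<delta>: "0 < \<delta>" "A * \<delta> < \<epsilon>"
    using A \<epsilon> by (auto simp: \<delta>_def field_simps)
  define \<Phi> where "\<Phi> p = b (inv (fst p) \<otimes> snd p) - b (inv (fst p) \<otimes> x0)" for p
  define W where "W = {p \<in> topspace (prod_topology T T). \<Phi> p \<in> ball 0 \<delta>}"
  have c1: "continuous_map (prod_topology T T) euclidean (\<lambda>p. b (inv (fst p) \<otimes> snd p))"
    by (rule continuous_map_compose[of _ T _ _ b, unfolded o_def])
      (use b in \<open>auto intro!: continuous_mult_fun continuous_inv_fun continuous_map_fst continuous_map_snd\<close>)
  have c2: "continuous_map (prod_topology T T) euclidean (\<lambda>p. b (inv (fst p) \<otimes> x0))"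
    by (rule continuous_map_compose[of _ T _ _ b, unfolded o_def])
      (use b x0 in \<open>auto intro!: continuous_mult_fun continuous_inv_fun continuous_map_fst simp: topspace_eq\<close>)
  have "continuous_map (prod_topology T T) euclidean \<Phi>"
    using c1 c2 unfolding \<Phi>_def by (auto simp: continuous_map_atin intro: tendsto_diff)
  then have W: "openin (prod_topology T T) W"
    unfolding W_def by (rule openin_continuous_map_preimage) simp
  have "carrier G \<times> {x0} \<subseteq> W"
    using x0 \<delta> by (auto simp: W_def \<Phi>_def topspace_eq)
  then obtain U V where V: "openin T V" "x0 \<in> V" "carrier G \<subseteq> U" "U \<times> V \<subseteq> W"
    using tube_lemma_left[OF W, of "carrier G" x0] compact x0 by (auto simp: compact_space_def topspace_eq)
  have "dist (conv a b x) (conv a b x0) < \<epsilon>" if x: "x \<in> V" for x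
  proof -
    have xG: "x \<in> carrier G"
      using x V(1) openin_carrier by blast
    have small: "cmod (b (inv h \<otimes> x) - b (inv h \<otimes> x0)) \<le> \<delta>" if "h \<in> carrier G" for h
      using that x V(3,4) by (fastforce simp: W_def \<Phi>_def)
    have i: "integrable m (\<lambda>h. a h * b (inv h \<otimes> x))" "integrable m (\<lambda>h. a h * b (inv h \<otimes> x0))"
      using conv_integrable[OF a haar_CC_L2[OF b]] xG x0 by auto
    have "conv a b x - conv a b x0 = (\<integral>h. a h * (b (inv h \<otimes> x) - b (inv h \<otimes> x0)) \<partial>m)"
      using i by (simp add: conv_def right_diff_distrib)
    also have "cmod \<dots> \<le> (\<integral>h. cmod (a h) * \<delta> \<partial>m)"
    proof (rule norm_integral_le)
      show "integrable m (\<lambda>h. a h * (b (inv h \<otimes> x) - b (inv h \<otimes> x0)))"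
        using i by (simp add: right_diff_distrib)
      show "integrable m (\<lambda>h. cmod (a h) * \<delta>)"
        using L2_integrable[OF a] by simp
      show "norm (a h * (b (inv h \<otimes> x) - b (inv h \<otimes> x0))) \<le> cmod (a h) * \<delta>" if "h \<in> space m" for h
        using small[of h] that by (simp add: haar_space norm_mult mult_left_mono)
    qed
    also have "\<dots> = A * \<delta>"
      by (simp add: A_def)
    finally show ?thesis
      using \<delta> by (simp add: dist_norm)
  qed
  then show "\<exists>U. openin T U \<and> x0 \<in> U \<and> (\<forall>y\<in>U. dist (conv a b y) (conv a b x0) < \<epsilon>)"
    using V by blast
qed

lemma pair_integrable:
  fixes a :: "'g \<Rightarrow> complex"
  assumes a: "integrable m a" and f: "f \<in> borel_measurable (m \<Otimes>\<^sub>M m)"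
    and B: "\<And>h k. h \<in> carrier G \<Longrightarrow> k \<in> carrier G \<Longrightarrow> cmod (f (h, k)) \<le> B"
  shows "integrable (m \<Otimes>\<^sub>M m) (\<lambda>p. a (fst p) * f p)"
proof (rule Bochner_Integration.integrable_bound)
  have "integrable (m \<Otimes>\<^sub>M m) (\<lambda>p. a (fst p))"
    using integrable_distr[OF measurable_fst, of m m a] distr_pair_fst[of m] a
    by (simp add: prob_space_axioms)
  then show "integrable (m \<Otimes>\<^sub>M m) (\<lambda>p. a (fst p) * of_real B)"
    by simp
  show "(\<lambda>p. a (fst p) * f p) \<in> borel_measurable (m \<Otimes>\<^sub>M m)"
    using a f by measurable
  have "cmod (f p) \<le> \<bar>B\<bar>" if "p \<in> space (m \<Otimes>\<^sub>M m)" for p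
    using B[of "fst p" "snd p"] that by (auto simp: space_pair_measure haar_space)
  then show "AE p in m \<Otimes>\<^sub>M m. norm (a (fst p) * f p) \<le> norm (a (fst p) * of_real B)"
    by (intro AE_I2) (simp add: norm_mult mult_left_mono)
qed

lemma pair_swap_integral:
  fixes a :: "'g \<Rightarrow> complex"
  assumes "integrable m a" "f \<in> borel_measurable (m \<Otimes>\<^sub>M m)"
    and "\<And>h k. h \<in> carrier G \<Longrightarrow> k \<in> carrier G \<Longrightarrow> cmod (f (h, k)) \<le> B"
  shows "(\<integral>k. \<integral>h. a h * f (h, k) \<partial>m \<partial>m) = (\<integral>h. \<integral>k. a h * f (h, k) \<partial>m \<partial>m)"
proof -
  interpret pair_sigma_finite m m ..
  show ?thesis
    using Fubini_integral[of "\<lambda>h k. a h * f (h, k)"] pair_integrable[OF assms]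
    by (simp add: case_prod_unfold)
qed

lemma inv_mult_meas: "(\<lambda>p. inv (fst p) \<otimes> snd p) \<in> m \<Otimes>\<^sub>M m \<rightarrow>\<^sub>M m"
proof -
  have [measurable]: "(\<lambda>x. inv x) \<in> m \<rightarrow>\<^sub>M m"
    by (rule inv_meas)
  have "(\<lambda>p. (inv (fst p), snd p)) \<in> m \<Otimes>\<^sub>M m \<rightarrow>\<^sub>M m \<Otimes>\<^sub>M m"
    by measurable
  from measurable_compose[OF this mult_meas] show ?thesis
    by (simp add: case_prod_beta')
qed

lemma conv_assoc:
  assumes a: "a \<in> L2 m" and b: "b \<in> CC" and c: "c \<in> CC" and x: "x \<in> carrier G"
  shows "conv (conv a b) c x = conv a (conv b c) x"
proof -
  obtain B where B: "0 < B" "\<And>x. x \<in> carrier G \<Longrightarrow> cmod (b x) \<le> B"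
    using CC_bounded[OF b] by blast
  obtain C where C: "0 < C" "\<And>x. x \<in> carrier G \<Longrightarrow> cmod (c x) \<le> C"
    using CC_bounded[OF c] by blast
  define f where "f p = b (inv (fst p) \<otimes> snd p) * c (inv (snd p) \<otimes> x)" for p
  have [measurable]: "(\<lambda>p. b (inv (fst p) \<otimes> snd p)) \<in> borel_measurable (m \<Otimes>\<^sub>M m)"
    by (rule measurable_compose[OF inv_mult_meas haar_CC_measurable[OF b]])
  have [measurable]: "(\<lambda>k. c (inv k \<otimes> x)) \<in> borel_measurable m"
    by (rule haar_CC_measurable[OF CC_inv_mult[OF c x]])
  have fm: "f \<in> borel_measurable (m \<Otimes>\<^sub>M m)"
    unfolding f_def[abs_def] by measurable
  have fB: "cmod (f (h, k)) \<le> B * C" if "h \<in> carrier G" "k \<in> carrier G" for h k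
    unfolding f_def norm_mult fst_conv snd_conv
    by (intro mult_mono B(2) C(2)) (use that x B(1) in auto)
  have "conv (conv a b) c x = (\<integral>k. \<integral>h. a h * f (h, k) \<partial>m \<partial>m)"
    unfolding conv_def f_def by (simp add: mult.assoc flip: integral_mult_left_zero)
  also have "\<dots> = (\<integral>h. \<integral>k. a h * f (h, k) \<partial>m \<partial>m)"
    by (rule pair_swap_integral[OF L2_integrable[OF a] fm fB])
  also have "\<dots> = (\<integral>h. a h * conv b c (inv h \<otimes> x) \<partial>m)"
  proof (intro Bochner_Integration.integral_cong refl)
    fix h assume "h \<in> space m"
    then have h: "h \<in> carrier G" "inv h \<in> carrier G"
      by (auto simp: haar_space)
    have cm: "(\<lambda>k. b k * c (inv k \<otimes> (inv h \<otimes> x))) \<in> borel_measurable m"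
      using haar_CC_measurable[OF b] haar_CC_measurable[OF CC_inv_mult[OF c, of "inv h \<otimes> x"]] h x by auto
    have "conv b c (inv h \<otimes> x) = (\<integral>k. b (inv h \<otimes> k) * c (inv (inv h \<otimes> k) \<otimes> (inv h \<otimes> x)) \<partial>m)"
      unfolding conv_def by (rule integral_left[OF h(2) cm, symmetric])
    also have "\<dots> = (\<integral>k. f (h, k) \<partial>m)"
    proof (intro Bochner_Integration.integral_cong refl)
      fix k assume "k \<in> space m"
      then have k: "k \<in> carrier G"
        by (simp add: haar_space)
      have "inv (inv h \<otimes> k) \<otimes> (inv h \<otimes> x) = inv k \<otimes> x"
        using h k x by (simp add: inv_mult_group m_assoc) (simp flip: m_assoc)
      then show "b (inv h \<otimes> k) * c (inv (inv h \<otimes> k) \<otimes> (inv h \<otimes> x)) = f (h, k)"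
        by (simp add: f_def)
    qed
    finally show "(\<integral>k. a h * f (h, k) \<partial>m) = a h * conv b c (inv h \<otimes> x)"
      by simp
  qed
  finally show ?thesis
    by (simp add: conv_def)
qed

section \<open>Adjoints and convolution powers\<close>

definition adj :: "('g \<Rightarrow> complex) \<Rightarrow> 'g \<Rightarrow> complex" where
  "adj b x = cnj (b (inv x))"

lemma adj_CC: "b \<in> CC \<Longrightarrow> adj b \<in> CC"
  unfolding adj_def[abs_def] using CC_cnj CC_comp[OF _ continuous_inv] by blast

lemma conv_adjoint:
  assumes a: "a \<in> L2 m" and b: "b \<in> CC" and c: "c \<in> CC"
  shows "L2_inner m (conv a b) c = L2_inner m a (conv c (adj b))"
proof -
  obtain B where B: "0 < B" "\<And>x. x \<in> carrier G \<Longrightarrow> cmod (b x) \<le> B"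
    using CC_bounded[OF b] by blast
  obtain C where C: "0 < C" "\<And>x. x \<in> carrier G \<Longrightarrow> cmod (c x) \<le> C"
    using CC_bounded[OF c] by blast
  define f where "f p = b (inv (fst p) \<otimes> snd p) * cnj (c (snd p))" for p
  have [measurable]: "(\<lambda>p. b (inv (fst p) \<otimes> snd p)) \<in> borel_measurable (m \<Otimes>\<^sub>M m)"
    by (rule measurable_compose[OF inv_mult_meas haar_CC_measurable[OF b]])
  have [measurable]: "c \<in> borel_measurable m"
    by (rule haar_CC_measurable[OF c])
  have fm: "f \<in> borel_measurable (m \<Otimes>\<^sub>M m)"
    unfolding f_def[abs_def] by measurable
  have fB: "cmod (f (h, k)) \<le> B * C" if "h \<in> carrier G" "k \<in> carrier G" for h k
    unfolding f_def norm_mult fst_conv snd_conv complex_mod_cnj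
    by (intro mult_mono B(2) C(2)) (use that B(1) in auto)
  have "L2_inner m (conv a b) c = (\<integral>k. \<integral>h. a h * f (h, k) \<partial>m \<partial>m)"
    unfolding L2_inner_def conv_def f_def by (simp add: mult.assoc flip: integral_mult_left_zero)
  also have "\<dots> = (\<integral>h. \<integral>k. a h * f (h, k) \<partial>m \<partial>m)"
    by (rule pair_swap_integral[OF L2_integrable[OF a] fm fB])
  also have "\<dots> = L2_inner m a (conv c (adj b))"
    unfolding L2_inner_def
  proof (intro Bochner_Integration.integral_cong refl)
    fix h assume "h \<in> space m"
    then have h: "h \<in> carrier G"
      by (simp add: haar_space)
    have "cnj (conv c (adj b) h) = (\<integral>k. cnj (c k * adj b (inv k \<otimes> h)) \<partial>m)"
      unfolding conv_def by (rule Bochner_Integration.integral_cnj[symmetric])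
    also have "\<dots> = (\<integral>k. f (h, k) \<partial>m)"
      by (intro Bochner_Integration.integral_cong refl)
        (use h in \<open>simp add: adj_def f_def haar_space inv_mult_group\<close>)
    finally show "(\<integral>k. a h * f (h, k) \<partial>m) = a h * cnj (conv c (adj b) h)"
      by simp
  qed
  finally show ?thesis .
qed

text \<open>Indices are shifted: \<open>conv_power q n\<close> has n + 1 factors, as in general no
  continuous function is a unit for convolution.\<close>

primrec conv_power :: "('g \<Rightarrow> complex) \<Rightarrow> nat \<Rightarrow> 'g \<Rightarrow> complex" where
  "conv_power q 0 = q"
| "conv_power q (Suc n) = conv (conv_power q n) q"

lemma conv_power_CC: "q \<in> CC \<Longrightarrow> conv_power q n \<in> CC"
  by (induction n) (simp_all add: conv_CC[OF haar_CC_L2, simplified])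

lemma conv_power_add:
  assumes q: "q \<in> CC" and x: "x \<in> carrier G"
  shows "conv_power q (Suc (n + k)) x = conv (conv_power q n) (conv_power q k) x"
  using x
proof (induction k arbitrary: x)
  case (Suc k)
  have "conv_power q (Suc (n + Suc k)) x = conv (conv_power q (Suc (n + k))) q x"
    by simp
  also have "\<dots> = conv (conv (conv_power q n) (conv_power q k)) q x"
    by (rule conv_cong) (use Suc in auto)
  also have "\<dots> = conv (conv_power q n) (conv (conv_power q k) q) x"
    by (rule conv_assoc) (use haar_CC_L2[OF conv_power_CC[OF q]] conv_power_CC[OF q] q Suc.prems in auto)
  finally show ?case
    by simp
qed simp

text \<open>For self-adjoint \<open>q\<close>, factors move from one side of the inner product to
  the other, so its value depends only on the sum of the two indices.\<close>

lemma conv_power_inner: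
  assumes q: "q \<in> CC" and sa: "\<And>x. x \<in> carrier G \<Longrightarrow> adj q x = q x"
  shows "L2_inner m (conv_power q (n + j)) (conv_power q k) = L2_inner m (conv_power q n) (conv_power q (k + j))"
proof (induction j arbitrary: k)
  case (Suc j)
  have "L2_inner m (conv_power q (n + Suc j)) (conv_power q k) =
      L2_inner m (conv_power q (n + j)) (conv (conv_power q k) (adj q))"
    using conv_adjoint[OF haar_CC_L2 q conv_power_CC[OF q]] conv_power_CC[OF q] by simp
  also have "\<dots> = L2_inner m (conv_power q (n + j)) (conv_power q (Suc k))"
    by (rule L2_inner_cong) (auto intro: conv_cong sa)
  finally show ?case
    using Suc[of "Suc k"] by simp
qed simp

text \<open>For self-adjoint \<open>q\<close>, the rescaled even convolution powers of \<open>q\<close> converge to an eigenfunction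
  for the largest eigenvalue. Since \<open>q\<^sup>n(\<one>)\<close> is the trace of the \<open>n\<close>-th power, the limit is not \<open>0\<close>;
  so no compactness argument is needed.\<close>

lemma conv_eigenfunction:
  assumes q: "q \<in> CC" and sa: "\<And>x. x \<in> carrier G \<Longrightarrow> adj q x = q x"
    and nz: "L2_norm m q \<noteq> 0"
  obtains \<rho> v where "0 < \<rho>" "v \<in> CC" "L2_norm m v \<noteq> 0"
    "\<And>x. x \<in> carrier G \<Longrightarrow> conv v (conv q q) x = of_real \<rho> * v x"
proof -
  define Q where "Q = conv_power q"
  have QC: "Q n \<in> CC" for n
    unfolding Q_def by (rule conv_power_CC[OF q])
  have QL: "Q n \<in> L2 m" for n
    by (rule haar_CC_L2[OF QC])
  define a where "a n = (L2_norm m (Q n))\<^sup>2" for n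
  have inner: "L2_inner m (Q n) (Q k) = L2_inner m (Q i) (Q j)" if "n + k = i + j" for n k i j
  proof (cases "i \<le> n")
    case True
    then have "j = k + (n - i)" "n = i + (n - i)"
      using that by auto
    then show ?thesis
      using conv_power_inner[OF q sa, of i "n - i" k] by (simp add: Q_def)
  next
    case False
    then have "k = j + (i - n)" "i = n + (i - n)"
      using that by auto
    then show ?thesis
      using conv_power_inner[OF q sa, of n "i - n" j] by (simp add: Q_def)
  qed
  have a: "L2_inner m (Q n) (Q k) = of_real (a i)" if "n + k = 2 * i" for n k i
    using inner[of n k i i] that by (simp add: a_def L2_inner_self)
  \<comment> \<open>Written as a convolution, the power is bounded at every point by the product of
    the two L2 norms, and its own L2 norm is at most its supremum.\<close>
  have submult: "a (Suc (n + k)) \<le> a n * a k" for n k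
  proof -
    have b: "cmod (Q (Suc (n + k)) x) \<le> L2_norm m (Q n) * L2_norm m (Q k)" if "x \<in> space m" for x
      using conv_power_add[OF q, of x n k] conv_bound[OF QL QL, of x n k] that
      by (simp add: haar_space Q_def)
    have "L2_norm m (Q (Suc (n + k))) \<le> \<bar>L2_norm m (Q n) * L2_norm m (Q k)\<bar>"
      by (rule L2_bounded(2)[OF haar_CC_measurable[OF QC] b])
    then have "(L2_norm m (Q (Suc (n + k))))\<^sup>2 \<le> \<bar>L2_norm m (Q n) * L2_norm m (Q k)\<bar>\<^sup>2"
      by (rule power_mono) (rule L2_norm_nonneg)
    then show ?thesis
      by (simp add: a_def power_mult_distrib)
  qed
  have convex: "(a (Suc n))\<^sup>2 \<le> a n * a (Suc (Suc n))" for n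
  proof -
    have "L2_inner m (Q n) (Q (Suc (Suc n))) = of_real (a (Suc n))"
      by (rule a) simp
    then have "\<bar>a (Suc n)\<bar> \<le> L2_norm m (Q n) * L2_norm m (Q (Suc (Suc n)))"
      using L2_cauchy_schwarz[OF QL QL, of n "Suc (Suc n)"] by simp
    then have "\<bar>a (Suc n)\<bar>\<^sup>2 \<le> (L2_norm m (Q n) * L2_norm m (Q (Suc (Suc n))))\<^sup>2"
      by (rule power_mono) simp
    then show ?thesis
      by (simp add: a_def power_mult_distrib)
  qed
  have Qnz: "L2_norm m (Q n) \<noteq> 0" for n
  proof (induction n)
    case 0
    then show ?case
      using nz by (simp add: Q_def)
  next
    case (Suc n)
    show ?case
    proof (cases n)
      case 0
      show ?thesis
      proof
        assume "L2_norm m (Q (Suc n)) = 0"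
        then have "conv q q \<one> = 0"
          using CC_norm_eq_0[OF QC, of "Suc n" \<one>] 0 by (simp add: Q_def)
        \<comment> \<open>For self-adjoint \<open>q\<close> the value of the square at the unit is
          the squared norm of \<open>q\<close>. So the square does not vanish, and log-convexity
          passes this on to all later powers.\<close>
        moreover have "conv q q \<one> = L2_inner m q q"
          unfolding conv_inner
          by (rule L2_inner_cong) (use sa in \<open>auto simp: adj_def\<close>)
        ultimately show False
          using nz by (simp add: L2_inner_self)
      qed
    next
      case (Suc k)
      have "0 < (a (Suc k))\<^sup>2"
        using Suc.IH Suc by (simp add: a_def)
      then have "0 < a k * a (Suc (Suc k))"
        using convex[of k] by linarith
      then show ?thesis
        using Suc by (auto simp: a_def)
    qed
  qed
  have pos: "0 < a n" for n
    using Qnz[of n] by (simp add: a_def)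
  have bdd: "a (Suc n) \<le> a 0 * a n" for n
    using submult[of n 0] by (simp add: mult.commute)
  obtain \<rho> where \<rho>: "0 < \<rho>" "\<And>n. a (Suc n) \<le> \<rho> * a n" "\<And>n. \<rho> ^ Suc n \<le> a n"
    using log_convex_submultiplicative_rate[OF pos convex bdd submult] by blast
  \<comment> \<open>\<open>\<gamma>\<close> decreases and stays above \<open>\<rho>\<close>: its
    convergence makes the iterates Cauchy, and the lower bound keeps their limit from
    vanishing.\<close>
  define \<gamma> where "\<gamma> n = a n / \<rho> ^ n" for n
  have \<gamma>_dec: "\<gamma> (Suc n) \<le> \<gamma> n" for n
    using \<rho>(1) \<rho>(2)[of n] by (simp add: \<gamma>_def divide_simps mult.commute)
  have \<gamma>_ge: "\<rho> \<le> \<gamma> n" for n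
    using \<rho>(1) \<rho>(3)[of n] by (simp add: \<gamma>_def le_divide_eq)
  have "decseq \<gamma>"
    using \<gamma>_dec by (simp add: decseq_Suc_iff)
  then have "convergent \<gamma>"
    using \<gamma>_ge by (metis decseq_convergent convergent_def)
  then have \<gamma>_Cauchy: "Cauchy \<gamma>"
    by (rule convergent_Cauchy)
  \<comment> \<open>Even indices make every inner product of two iterates a value of
    \<open>\<gamma>\<close>; one iteration is convolution with \<open>conv q q\<close> followed by
    division by \<open>\<rho>\<close>.\<close>
  define v where "v k x = of_real (1 / \<rho> ^ k) * Q (2 * k) x" for k x
  have vC: "v k \<in> CC" for k
    using CC_mult[OF CC_const QC[of "2 * k"], of "of_real (1 / \<rho> ^ k)"] unfolding v_def[abs_def] by simp
  have vL: "v k \<in> L2 m" for k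
    by (rule haar_CC_L2[OF vC])
  have v_inner: "L2_inner m (v k) (v l) = of_real (\<gamma> (k + l))" for k l
  proof -
    have "L2_inner m (v k) (v l) = of_real (1 / \<rho> ^ k) * (cnj (of_real (1 / \<rho> ^ l)) * L2_inner m (Q (2 * k)) (Q (2 * l)))"
      unfolding v_def[abs_def] L2_inner_mult_left L2_inner_mult_right ..
    also have "L2_inner m (Q (2 * k)) (Q (2 * l)) = of_real (a (k + l))"
      by (rule a) simp
    finally show ?thesis
      by (simp add: \<gamma>_def power_add)
  qed
  have v_norm: "(L2_norm m (v k))\<^sup>2 = \<gamma> (2 * k)" for k
    unfolding L2_norm_power2_inner by (simp add: v_inner mult_2)
  have v_dist: "(L2_norm m (\<lambda>x. v k x - v l x))\<^sup>2 = \<gamma> (2 * k) - 2 * \<gamma> (k + l) + \<gamma> (2 * l)" for k l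
  proof -
    have "L2_inner m (\<lambda>x. v k x - v l x) (\<lambda>x. v k x - v l x) =
        L2_inner m (v k) (\<lambda>x. v k x - v l x) - L2_inner m (v l) (\<lambda>x. v k x - v l x)"
      by (intro L2_inner_diff_left vL L2_diff)
    also have "\<dots> = L2_inner m (v k) (v k) - L2_inner m (v k) (v l) - (L2_inner m (v l) (v k) - L2_inner m (v l) (v l))"
      by (simp only: L2_inner_diff_right[OF vL vL vL])
    also have "\<dots> = of_real (\<gamma> (2 * k) - 2 * \<gamma> (k + l) + \<gamma> (2 * l))"
      unfolding v_inner add.commute[of l k] mult_2[of k, symmetric] mult_2[of l, symmetric]
      by simp
    finally show ?thesis
      by (simp only: L2_norm_power2_inner Re_complex_of_real)
  qed
  have v_Cauchy: "\<exists>N. \<forall>k\<ge>N. \<forall>l\<ge>N. L2_norm m (\<lambda>x. v k x - v l x) < \<epsilon>" if "0 < \<epsilon>" for \<epsilon>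
  proof -
    obtain N where N: "\<And>i j. N \<le> i \<Longrightarrow> N \<le> j \<Longrightarrow> dist (\<gamma> i) (\<gamma> j) < \<epsilon>\<^sup>2 / 2"
      using metric_CauchyD[OF \<gamma>_Cauchy, of "\<epsilon>\<^sup>2 / 2"] \<open>0 < \<epsilon>\<close> by auto
    have "L2_norm m (\<lambda>x. v k x - v l x) < \<epsilon>" if "N \<le> k" "N \<le> l" for k l
    proof (rule power2_less_imp_less)
      have "dist (\<gamma> (2 * k)) (\<gamma> (k + l)) < \<epsilon>\<^sup>2 / 2" "dist (\<gamma> (2 * l)) (\<gamma> (k + l)) < \<epsilon>\<^sup>2 / 2"
        by (rule N; use that in simp)+
      then show "(L2_norm m (\<lambda>x. v k x - v l x))\<^sup>2 < \<epsilon>\<^sup>2"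
        unfolding v_dist dist_real_def by linarith
    qed (use \<open>0 < \<epsilon>\<close> in simp)
    then show ?thesis
      by blast
  qed
  define q2 where "q2 = conv q q"
  have q2C: "q2 \<in> CC" and q2L: "q2 \<in> L2 m"
    using conv_CC[OF haar_CC_L2[OF q] q] haar_CC_L2 by (auto simp: q2_def)
  have v_Suc: "of_real \<rho> * v (Suc k) x = conv (v k) q2 x" if "x \<in> carrier G" for k x
  proof -
    have "Q (2 * Suc k) x = conv (Q (2 * k)) q2 x"
      using conv_assoc[OF QL q q that, of "2 * k"] by (simp add: Q_def q2_def)
    moreover have "conv (v k) q2 x = of_real (1 / \<rho> ^ k) * conv (Q (2 * k)) q2 x"
      unfolding v_def[abs_def] by (rule conv_mult_left)
    ultimately show ?thesis
      using \<rho>(1) by (simp add: v_def)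
  qed
  define B where "B = L2_norm m q2"
  have B: "0 \<le> B"
    by (simp add: B_def L2_norm_nonneg)
  \<comment> \<open>Convolution with the fixed function \<open>q2\<close> upgrades the Cauchy
    property from L2 to uniform convergence, so that the limit is continuous.\<close>
  have step: "dist (v (Suc k) x) (v (Suc l) x) \<le> B / \<rho> * L2_norm m (\<lambda>x. v k x - v l x)"
    if x: "x \<in> carrier G" for k l x
  proof -
    have "of_real \<rho> * (v (Suc k) x - v (Suc l) x) = conv (\<lambda>x. v k x - v l x) q2 x"
      using v_Suc[OF x] by (simp add: right_diff_distrib conv_diff_left vL q2L x)
    then have "\<rho> * cmod (v (Suc k) x - v (Suc l) x) = cmod (conv (\<lambda>x. v k x - v l x) q2 x)"
      using \<rho>(1) by (metis abs_of_pos norm_mult norm_of_real)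
    also have "\<dots> \<le> L2_norm m (\<lambda>x. v k x - v l x) * B"
      unfolding B_def by (rule conv_bound[OF L2_diff[OF vL vL] q2L x])
    finally show ?thesis
      using \<rho>(1) by (simp add: dist_norm field_simps)
  qed
  have "uniformly_Cauchy_on (carrier G) (\<lambda>k. v (Suc k))"
  proof (rule uniformly_Cauchy_onI)
    fix \<epsilon> :: real assume \<epsilon>: "0 < \<epsilon>"
    have p: "0 < B / \<rho> + 1"
      using B \<rho>(1) by (simp add: add_nonneg_pos)
    then obtain N where N: "\<And>k l. N \<le> k \<Longrightarrow> N \<le> l \<Longrightarrow> L2_norm m (\<lambda>x. v k x - v l x) < \<epsilon> / (B / \<rho> + 1)"
      using v_Cauchy[of "\<epsilon> / (B / \<rho> + 1)"] \<epsilon> by auto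
    have "dist (v (Suc k) x) (v (Suc l) x) < \<epsilon>" if "x \<in> carrier G" "N \<le> k" "N \<le> l" for x k l
    proof -
      have "dist (v (Suc k) x) (v (Suc l) x) \<le> B / \<rho> * L2_norm m (\<lambda>x. v k x - v l x)"
        by (rule step[OF that(1)])
      also have "\<dots> \<le> (B / \<rho> + 1) * L2_norm m (\<lambda>x. v k x - v l x)"
        by (intro mult_right_mono L2_norm_nonneg) simp
      also have "\<dots> < \<epsilon>"
        using N[OF that(2,3)] p by (simp add: pos_less_divide_eq mult.commute)
      finally show ?thesis .
    qed
    then show "\<exists>M. \<forall>x\<in>carrier G. \<forall>k\<ge>M. \<forall>l\<ge>M. dist (v (Suc k) x) (v (Suc l) x) < \<epsilon>"
      by blast
  qed
  then obtain w where w: "uniform_limit (carrier G) (\<lambda>k. v (Suc k)) w sequentially"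
    using Cauchy_uniformly_convergent uniformly_convergent_on_def by blast
  have wC: "w \<in> CC"
    using CC_uniform_limit[OF always_eventually w] vC by simp
  have wL: "w \<in> L2 m"
    by (rule haar_CC_L2[OF wC])
  have wd: "(\<lambda>k. L2_norm m (\<lambda>x. v (Suc k) x - w x)) \<longlonglongrightarrow> 0"
  proof (rule LIMSEQ_I)
    fix \<epsilon> :: real assume \<epsilon>: "0 < \<epsilon>"
    have "\<forall>\<^sub>F k in sequentially. \<forall>x\<in>carrier G. dist (v (Suc k) x) (w x) < \<epsilon> / 2"
      using w half_gt_zero[OF \<epsilon>] unfolding uniform_limit_iff by blast
    then obtain N where N: "\<And>k x. N \<le> k \<Longrightarrow> x \<in> carrier G \<Longrightarrow> dist (v (Suc k) x) (w x) < \<epsilon> / 2"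
      unfolding eventually_sequentially by blast
    have "L2_norm m (\<lambda>x. v (Suc k) x - w x) \<le> \<bar>\<epsilon> / 2\<bar>" if "N \<le> k" for k
      by (rule L2_bounded(2)) (use L2D(1)[OF L2_diff[OF vL wL]] N[OF that] in \<open>auto simp: haar_space dist_norm less_imp_le\<close>)
    moreover have "\<bar>\<epsilon> / 2\<bar> < \<epsilon>"
      using \<epsilon> by simp
    ultimately have "L2_norm m (\<lambda>x. v (Suc k) x - w x) < \<epsilon>" if "N \<le> k" for k
      using le_less_trans that by blast
    then show "\<exists>N. \<forall>k\<ge>N. norm (L2_norm m (\<lambda>x. v (Suc k) x - w x) - 0) < \<epsilon>"
      by (auto simp: L2_norm_nonneg)
  qed
  have eig: "conv w q2 x = of_real \<rho> * w x" if x: "x \<in> carrier G" for x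
  proof -
    have "(\<lambda>k. conv (v (Suc k)) q2 x) \<longlonglongrightarrow> conv w q2 x"
    proof (rule Lim_null_comparison[THEN LIM_zero_cancel])
      have "norm (conv (v (Suc k)) q2 x - conv w q2 x) \<le> L2_norm m (\<lambda>x. v (Suc k) x - w x) * B" for k
        unfolding B_def using conv_bound[OF L2_diff[OF vL wL] q2L x] by (simp add: conv_diff_left vL wL q2L x)
      then show "\<forall>\<^sub>F k in sequentially. norm (conv (v (Suc k)) q2 x - conv w q2 x) \<le> L2_norm m (\<lambda>x. v (Suc k) x - w x) * B"
        by simp
      show "(\<lambda>k. L2_norm m (\<lambda>x. v (Suc k) x - w x) * B) \<longlonglongrightarrow> 0"
        using tendsto_mult_left_zero[OF wd] .
    qed
    moreover have "(\<lambda>k. conv (v (Suc k)) q2 x) \<longlonglongrightarrow> of_real \<rho> * w x"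
      unfolding v_Suc[OF x, symmetric]
      using LIMSEQ_Suc[OF tendsto_uniform_limitI[OF w x]] by (intro tendsto_mult_left)
    ultimately show ?thesis
      by (rule LIMSEQ_unique)
  qed
  have "L2_norm m w \<noteq> 0"
  proof
    assume w0: "L2_norm m w = 0"
    have "sqrt \<rho> \<le> L2_norm m (\<lambda>x. v (Suc k) x - w x)" for k
    proof -
      have "sqrt \<rho> \<le> L2_norm m (v (Suc k))"
        using v_norm[of "Suc k"] \<gamma>_ge[of "2 * Suc k"] by (intro real_le_lsqrt L2_norm_nonneg) simp
      also have "\<dots> \<le> L2_norm m (\<lambda>x. v (Suc k) x - w x) + L2_norm m w"
        using L2_norm_triangle[OF L2_diff[OF vL wL] wL] by simp
      finally show ?thesis
        using w0 by simp
    qed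
    then have "sqrt \<rho> \<le> 0"
      using LIMSEQ_le_const[OF wd] by blast
    then show False
      using \<rho>(1) by simp
  qed
  then show thesis
    using that[OF \<rho>(1) wC] eig by (simp add: q2_def)
qed

end

section \<open>Unitary matrix representations\<close>

lemma cip_sum: "v \<in> carrier_vec n \<Longrightarrow> w \<in> carrier_vec n \<Longrightarrow> v \<bullet>c w = (\<Sum>i<n. v $ i * cnj (w $ i))"
  for v w :: "complex vec"
  by (auto simp: scalar_prod_def atLeast0LessThan conjugate_complex_def intro!: sum.cong)

lemma cip_swap: "v \<in> carrier_vec n \<Longrightarrow> w \<in> carrier_vec n \<Longrightarrow> cnj (v \<bullet>c w) = w \<bullet>c v"
  for v w :: "complex vec"
  by (simp add: cip_sum mult.commute)

lemma cip_smult_left: "v \<in> carrier_vec n \<Longrightarrow> w \<in> carrier_vec n \<Longrightarrow> (c \<cdot>\<^sub>v v) \<bullet>c w = c * (v \<bullet>c w)"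
  for v w :: "complex vec"
  by (simp add: cip_sum sum_distrib_left mult.assoc)

lemma cip_smult_right: "v \<in> carrier_vec n \<Longrightarrow> w \<in> carrier_vec n \<Longrightarrow> v \<bullet>c (c \<cdot>\<^sub>v w) = cnj c * (v \<bullet>c w)"
  for v w :: "complex vec"
  by (simp add: cip_sum sum_distrib_left mult_ac)

lemma cip_unit_right: "v \<in> carrier_vec n \<Longrightarrow> i < n \<Longrightarrow> v \<bullet>c unit_vec n i = v $ i"
  for v :: "complex vec"
  by (simp add: cip_sum unit_vec_def if_distrib cong: if_cong)

lemma cip_eqI:
  fixes v w :: "complex vec"
  assumes "v \<in> carrier_vec n" "w \<in> carrier_vec n" "\<And>u. u \<in> carrier_vec n \<Longrightarrow> v \<bullet>c u = w \<bullet>c u"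
  shows "v = w"
proof (rule eq_vecI)
  fix i assume "i < dim_vec w"
  then show "v $ i = w $ i"
    using assms(3)[of "unit_vec n i"] cip_unit_right[OF assms(1), of i] cip_unit_right[OF assms(2), of i] assms(2)
    by auto
qed (use assms in auto)

lemma cip_self_0: "v \<in> carrier_vec n \<Longrightarrow> v \<bullet>c v = 0 \<Longrightarrow> v = 0\<^sub>v n"
  for v :: "complex vec"
  by simp

lemma cip_mat:
  fixes A :: "complex mat"
  assumes "A \<in> carrier_mat k n" "x \<in> carrier_vec n" "y \<in> carrier_vec k"
  shows "(A *\<^sub>v x) \<bullet>c y = (\<Sum>i<k. \<Sum>j<n. A $$ (i, j) * x $ j * cnj (y $ i))"
proof -
  have "(A *\<^sub>v x) $ i = (\<Sum>j<n. A $$ (i, j) * x $ j)" if "i < k" for i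
    using assms that by (auto simp: scalar_prod_def atLeast0LessThan intro!: sum.cong)
  then show ?thesis
    using assms by (simp add: cip_sum[of _ k] sum_distrib_right)
qed

lemma cip_mat_unit:
  fixes A :: "complex mat"
  assumes "A \<in> carrier_mat k n" "j < n" "i < k"
  shows "(A *\<^sub>v unit_vec n j) \<bullet>c unit_vec k i = A $$ (i, j)"
  using assms by (subst cip_unit_right) (auto simp: scalar_prod_def unit_vec_def if_distrib cong: if_cong)

lemma cip_mat_expand_left:
  fixes A :: "complex mat"
  assumes "A \<in> carrier_mat k n" "x \<in> carrier_vec n" "y \<in> carrier_vec k"
  shows "(A *\<^sub>v x) \<bullet>c y = (\<Sum>j<n. x $ j * ((A *\<^sub>v unit_vec n j) \<bullet>c y))"
proof -
  have "(A *\<^sub>v unit_vec n j) \<bullet>c y = (\<Sum>i<k. A $$ (i, j) * cnj (y $ i))" if "j < n" for j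
    using that by (subst cip_mat[OF assms(1) unit_vec_carrier assms(3)])
      (simp add: unit_vec_def if_distrib if_distribR cong: if_cong)
  then show ?thesis
    unfolding cip_mat[OF assms] by (subst sum.swap) (simp add: sum_distrib_left mult_ac)
qed

lemma mat_eq_cipI:
  fixes A B :: "complex mat"
  assumes "A \<in> carrier_mat k n" "B \<in> carrier_mat k n"
    "\<And>x y. x \<in> carrier_vec n \<Longrightarrow> y \<in> carrier_vec k \<Longrightarrow> (A *\<^sub>v x) \<bullet>c y = (B *\<^sub>v x) \<bullet>c y"
  shows "A = B"
proof (rule eq_matI)
  fix i j assume "i < dim_row B" "j < dim_col B"
  then show "A $$ (i, j) = B $$ (i, j)"
    using assms(3)[of "unit_vec n j" "unit_vec k i"] cip_mat_unit[OF assms(1)] cip_mat_unit[OF assms(2)] assms(2)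
    by auto
qed (use assms in auto)

definition madj :: "complex mat \<Rightarrow> complex mat" where
  "madj A = mat (dim_col A) (dim_row A) (\<lambda>(i, j). cnj (A $$ (j, i)))"

lemma madj_carrier [simp]: "A \<in> carrier_mat k n \<Longrightarrow> madj A \<in> carrier_mat n k"
  by (auto simp: madj_def)

lemma cip_madj:
  assumes "A \<in> carrier_mat k n" "x \<in> carrier_vec n" "y \<in> carrier_vec k"
  shows "(A *\<^sub>v x) \<bullet>c y = x \<bullet>c (madj A *\<^sub>v y)"
proof -
  have "madj A *\<^sub>v y \<in> carrier_vec n"
    using mult_mat_vec_carrier[OF madj_carrier[OF assms(1)] assms(3)] .
  then have "x \<bullet>c (madj A *\<^sub>v y) = cnj ((madj A *\<^sub>v y) \<bullet>c x)"
    using assms(2) by (rule cip_swap[symmetric])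
  also have "\<dots> = (\<Sum>j<n. \<Sum>i<k. A $$ (i, j) * cnj (y $ i) * x $ j)"
    using assms by (subst cip_mat[of _ n k]) (auto simp: madj_def intro!: sum.cong)
  also have "\<dots> = (A *\<^sub>v x) \<bullet>c y"
    unfolding cip_mat[OF assms] by (subst sum.swap) (simp add: mult_ac)
  finally show ?thesis ..
qed

lemma vec_subspace_iff:
  "VectorSpace.subspace class_ring W (module_vec TYPE(complex) n) \<longleftrightarrow>
     W \<subseteq> carrier_vec n \<and> 0\<^sub>v n \<in> W \<and> (\<forall>v\<in>W. \<forall>w\<in>W. v + w \<in> W) \<and> (\<forall>c. \<forall>v\<in>W. c \<cdot>\<^sub>v v \<in> W)"
proof -
  have "vectorspace class_ring (module_vec TYPE(complex) n)"
    by (rule vec_vs)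
  then show ?thesis
    using vectorspace.axioms(1)[of class_ring "module_vec TYPE(complex) n"]
    unfolding VectorSpace.subspace_def submodule_def by (auto simp: module_vec_simps class_ring_simps)
qed

lemma unitary_repD:
  assumes "unitary_rep G T n \<pi>"
  shows "\<And>g. g \<in> carrier G \<Longrightarrow> \<pi> g \<in> carrier_mat n n"
    and "\<pi> \<one>\<^bsub>G\<^esub> = 1\<^sub>m n"
    and "\<And>g h. g \<in> carrier G \<Longrightarrow> h \<in> carrier G \<Longrightarrow> \<pi> (g \<otimes>\<^bsub>G\<^esub> h) = \<pi> g * \<pi> h"
    and "\<And>g v w. g \<in> carrier G \<Longrightarrow> v \<in> carrier_vec n \<Longrightarrow> w \<in> carrier_vec n \<Longrightarrow>
      (\<pi> g *\<^sub>v v) \<bullet>c (\<pi> g *\<^sub>v w) = v \<bullet>c w"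
    and "\<And>i j. i < n \<Longrightarrow> j < n \<Longrightarrow> continuous_map T euclidean (\<lambda>g. \<pi> g $$ (i, j))"
  using assms by (auto simp: unitary_rep_def)

context topological_group begin

lemma rep_mult_vec:
  assumes "unitary_rep G T n \<pi>" "g \<in> carrier G" "h \<in> carrier G" "v \<in> carrier_vec n"
  shows "\<pi> (g \<otimes> h) *\<^sub>v v = \<pi> g *\<^sub>v (\<pi> h *\<^sub>v v)"
  using assoc_mult_mat_vec[OF unitary_repD(1)[OF assms(1,2)] unitary_repD(1)[OF assms(1,3)] assms(4)]
  by (simp add: unitary_repD(3)[OF assms(1-3)])

lemma rep_vec_carrier [simp]:
  assumes "unitary_rep G T n \<pi>" "g \<in> carrier G" "v \<in> carrier_vec n"
  shows "\<pi> g *\<^sub>v v \<in> carrier_vec n"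
  using unitary_repD(1)[OF assms(1,2)] assms(3) by auto

lemma rep_one_vec: "unitary_rep G T n \<pi> \<Longrightarrow> v \<in> carrier_vec n \<Longrightarrow> \<pi> \<one> *\<^sub>v v = v"
  by (simp add: unitary_repD(2))

lemma rep_inv_cip:
  assumes "unitary_rep G T n \<pi>" "g \<in> carrier G" "v \<in> carrier_vec n" "w \<in> carrier_vec n"
  shows "(\<pi> (inv g) *\<^sub>v v) \<bullet>c w = v \<bullet>c (\<pi> g *\<^sub>v w)"
proof -
  have "(\<pi> (inv g) *\<^sub>v v) \<bullet>c w = (\<pi> g *\<^sub>v (\<pi> (inv g) *\<^sub>v v)) \<bullet>c (\<pi> g *\<^sub>v w)"
    using assms by (simp add: unitary_repD(4)[OF assms(1)])
  also have "\<pi> g *\<^sub>v (\<pi> (inv g) *\<^sub>v v) = v"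
    using assms rep_mult_vec[OF assms(1,2) _ assms(3), of "inv g"] rep_one_vec[OF assms(1,3)] by simp
  finally show ?thesis .
qed

lemma rep_cip_continuous:
  assumes "unitary_rep G T n \<pi>" "v \<in> carrier_vec n" "w \<in> carrier_vec n"
  shows "continuous_map T euclidean (\<lambda>g. (\<pi> g *\<^sub>v v) \<bullet>c w)"
proof -
  have "continuous_map T euclidean (\<lambda>g. \<Sum>i<n. \<Sum>j<n. \<pi> g $$ (i, j) * v $ j * cnj (w $ i))"
    unfolding continuous_map_atin
    using unitary_repD(5)[OF assms(1)]
    by (auto simp: continuous_map_atin intro!: tendsto_sum tendsto_mult tendsto_const)
  then show ?thesis
    by (rule continuous_map_eq) (simp add: topspace_eq cip_mat[OF unitary_repD(1)[OF assms(1)] assms(2,3)])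
qed

section \<open>Schur's lemma\<close>

lemma schur_scalar:
  assumes irr: "irreducible_unitary_rep G T n \<pi>" and B: "B \<in> carrier_mat n n"
    and comm: "\<And>g. g \<in> carrier G \<Longrightarrow> B * \<pi> g = \<pi> g * B"
  obtains c where "B = c \<cdot>\<^sub>m 1\<^sub>m n"
proof -
  have rep: "unitary_rep G T n \<pi>" and n: "0 < n"
    using irr by (auto simp: irreducible_unitary_rep_def)
  obtain c where "eigenvalue B c"
    using spectrum_non_empty[OF B n] by (auto simp: spectrum_def)
  then obtain v where v: "v \<in> carrier_vec n" "v \<noteq> 0\<^sub>v n" "B *\<^sub>v v = c \<cdot>\<^sub>v v"
    using B by (auto simp: eigenvalue_def eigenvector_def)
  define W where "W = {w \<in> carrier_vec n. B *\<^sub>v w = c \<cdot>\<^sub>v w}"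
  have "VectorSpace.subspace class_ring W (module_vec TYPE(complex) n)"
    unfolding vec_subspace_iff W_def using B
    by (auto simp: mult_add_distrib_mat_vec smult_add_distrib_vec mult_mat_vec smult_smult_assoc mult.commute)
  moreover have "\<pi> g *\<^sub>v w \<in> W" if "g \<in> carrier G" "w \<in> W" for g w
  proof -
    have w: "w \<in> carrier_vec n" "B *\<^sub>v w = c \<cdot>\<^sub>v w"
      using that by (auto simp: W_def)
    have P: "\<pi> g \<in> carrier_mat n n"
      by (rule unitary_repD(1)[OF rep that(1)])
    have "B *\<^sub>v (\<pi> g *\<^sub>v w) = (B * \<pi> g) *\<^sub>v w"
      using B P w by (simp add: assoc_mult_mat_vec)
    also have "\<dots> = \<pi> g *\<^sub>v (B *\<^sub>v w)"
      using B P w by (simp add: comm[OF that(1)] assoc_mult_mat_vec)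
    also have "\<dots> = c \<cdot>\<^sub>v (\<pi> g *\<^sub>v w)"
      using P w by (simp add: mult_mat_vec)
    finally show ?thesis
      using P w by (simp add: W_def)
  qed
  ultimately have "W = {0\<^sub>v n} \<or> W = carrier_vec n"
    using irr unfolding irreducible_unitary_rep_def by blast
  then have W: "W = carrier_vec n"
    using v by (auto simp: W_def)
  have "B = c \<cdot>\<^sub>m 1\<^sub>m n"
  proof (rule eq_matI)
    fix i j assume "i < dim_row (c \<cdot>\<^sub>m 1\<^sub>m n :: complex mat)" "j < dim_col (c \<cdot>\<^sub>m 1\<^sub>m n :: complex mat)"
    then have ij: "i < n" "j < n"
      by auto
    have "unit_vec n j \<in> W"
      unfolding W by simp
    then have "B *\<^sub>v unit_vec n j = c \<cdot>\<^sub>v unit_vec n j"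
      by (simp add: W_def)
    then have "B $$ (i, j) = (c \<cdot>\<^sub>v unit_vec n j) \<bullet>c unit_vec n i"
      using cip_mat_unit[OF B ij(2,1)] by simp
    also have "\<dots> = (c \<cdot>\<^sub>v unit_vec n j) $ i"
      by (rule cip_unit_right) (use ij in auto)
    finally show "B $$ (i, j) = (c \<cdot>\<^sub>m 1\<^sub>m n) $$ (i, j)"
      using ij by simp
  qed (use B in auto)
  then show thesis
    using that by blast
qed

lemma rep_cip_inv:
  assumes "unitary_rep G T n \<pi>" "g \<in> carrier G" "v \<in> carrier_vec n" "w \<in> carrier_vec n"
  shows "v \<bullet>c (\<pi> (inv g) *\<^sub>v w) = (\<pi> g *\<^sub>v v) \<bullet>c w"
  using rep_inv_cip[OF assms(1) inv_closed[OF assms(2)] assms(3,4)] assms(2) by simp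

text \<open>With \<open>H\<close> the adjoint of \<open>A\<close>, both \<open>H * A\<close> and
  \<open>A * H\<close> commute with the representations and hence are scalar. The scalars coincide
  because \<open>A * H * A\<close> can be read in two ways and \<open>A\<close> has a non-zero
  entry. The common value is positive, so equal traces force equal dimensions, and dividing
  \<open>A\<close> by its square root gives a unitary.\<close>

lemma schur_unitary:
  assumes irr: "irreducible_unitary_rep G T n \<pi>" and irr': "irreducible_unitary_rep G T n' \<pi>'"
    and A: "A \<in> carrier_mat n' n" and nz: "A \<noteq> 0\<^sub>m n' n"
    and int: "\<And>g. g \<in> carrier G \<Longrightarrow> A * \<pi> g = \<pi>' g * A"
  obtains U where "n' = n" "U \<in> carrier_mat n n"
    "\<And>v w. v \<in> carrier_vec n \<Longrightarrow> w \<in> carrier_vec n \<Longrightarrow> (U *\<^sub>v v) \<bullet>c (U *\<^sub>v w) = v \<bullet>c w"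
    "\<And>g. g \<in> carrier G \<Longrightarrow> U * \<pi> g = \<pi>' g * U"
proof -
  have rep: "unitary_rep G T n \<pi>" and n: "0 < n" and rep': "unitary_rep G T n' \<pi>'"
    using irr irr' by (auto simp: irreducible_unitary_rep_def)
  define H where "H = madj A"
  have H: "H \<in> carrier_mat n n'"
    using A by (simp add: H_def)
  have P: "\<pi> g \<in> carrier_mat n n" "\<pi>' g \<in> carrier_mat n' n'" if "g \<in> carrier G" for g
    using unitary_repD(1)[OF rep that] unitary_repD(1)[OF rep' that] by auto
  have intv: "A *\<^sub>v (\<pi> g *\<^sub>v x) = \<pi>' g *\<^sub>v (A *\<^sub>v x)" if "g \<in> carrier G" "x \<in> carrier_vec n" for g x
    using assoc_mult_mat_vec[OF A P(1)[OF that(1)] that(2)] assoc_mult_mat_vec[OF P(2)[OF that(1)] A that(2)]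
      int[OF that(1)] by simp
  have HA: "(A *\<^sub>v x) \<bullet>c y = x \<bullet>c (H *\<^sub>v y)" if "x \<in> carrier_vec n" "y \<in> carrier_vec n'" for x y
    unfolding H_def by (rule cip_madj[OF A that])
  have HA': "(H *\<^sub>v y) \<bullet>c x = y \<bullet>c (A *\<^sub>v x)" if "x \<in> carrier_vec n" "y \<in> carrier_vec n'" for x y
  proof -
    have "cnj ((A *\<^sub>v x) \<bullet>c y) = cnj (x \<bullet>c (H *\<^sub>v y))"
      by (simp only: HA[OF that])
    then show ?thesis
      using that A H cip_swap[of "A *\<^sub>v x" n' y] cip_swap[of x n "H *\<^sub>v y"] by simp
  qed
  have Hint: "H * \<pi>' g = \<pi> g * H" if g: "g \<in> carrier G" for g
  proof (rule mat_eq_cipI)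
    fix y x :: "complex vec" assume yx: "y \<in> carrier_vec n'" "x \<in> carrier_vec n"
    have gi: "inv g \<in> carrier G"
      using g by simp
    have "((H * \<pi>' g) *\<^sub>v y) \<bullet>c x = (H *\<^sub>v (\<pi>' g *\<^sub>v y)) \<bullet>c x"
      using assoc_mult_mat_vec[OF H P(2)[OF g] yx(1)] by simp
    also have "\<dots> = (\<pi>' g *\<^sub>v y) \<bullet>c (A *\<^sub>v x)"
      by (rule HA') (use yx P[OF g] in auto)
    also have "\<dots> = y \<bullet>c (\<pi>' (inv g) *\<^sub>v (A *\<^sub>v x))"
      by (rule rep_cip_inv[OF rep' g, symmetric]) (use yx A in auto)
    also have "\<dots> = y \<bullet>c (A *\<^sub>v (\<pi> (inv g) *\<^sub>v x))"
      using intv[OF gi yx(2)] by simp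
    also have "\<dots> = (H *\<^sub>v y) \<bullet>c (\<pi> (inv g) *\<^sub>v x)"
      by (rule HA'[symmetric]) (use yx P[OF gi] in auto)
    also have "\<dots> = (\<pi> g *\<^sub>v (H *\<^sub>v y)) \<bullet>c x"
      by (rule rep_cip_inv[OF rep g]) (use yx H in auto)
    also have "\<dots> = ((\<pi> g * H) *\<^sub>v y) \<bullet>c x"
      using assoc_mult_mat_vec[OF P(1)[OF g] H yx(1)] by simp
    finally show "((H * \<pi>' g) *\<^sub>v y) \<bullet>c x = ((\<pi> g * H) *\<^sub>v y) \<bullet>c x" .
  qed (use P[OF g] H in auto)
  obtain c where c: "H * A = c \<cdot>\<^sub>m 1\<^sub>m n"
  proof (rule schur_scalar[OF irr])
    show "H * A * \<pi> g = \<pi> g * (H * A)" if g: "g \<in> carrier G" for g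
      using assoc_mult_mat[OF H A P(1)[OF g]] assoc_mult_mat[OF H P(2)[OF g] A]
        assoc_mult_mat[OF P(1)[OF g] H A] int[OF g] Hint[OF g] by simp
  qed (use A H in auto)
  obtain c' where c': "A * H = c' \<cdot>\<^sub>m 1\<^sub>m n'"
  proof (rule schur_scalar[OF irr'])
    show "A * H * \<pi>' g = \<pi>' g * (A * H)" if g: "g \<in> carrier G" for g
      using assoc_mult_mat[OF A H P(2)[OF g]] assoc_mult_mat[OF A P(1)[OF g] H]
        assoc_mult_mat[OF P(2)[OF g] A H] int[OF g] Hint[OF g] by simp
  qed (use A H in auto)
  have "\<exists>i j. i < n' \<and> j < n \<and> A $$ (i, j) \<noteq> 0"
  proof (rule ccontr)
    assume "\<not> ?thesis"
    then have "A = 0\<^sub>m n' n"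
      using A by (intro eq_matI) auto
    then show False
      using nz by simp
  qed
  then obtain i0 j0 where ij0: "i0 < n'" "j0 < n" "A $$ (i0, j0) \<noteq> 0"
    by blast
  have "c \<cdot>\<^sub>m A = A * (H * A)"
    unfolding c using A by (simp add: mult_smult_distrib[of A n' n "1\<^sub>m n" n])
  also have "\<dots> = (A * H) * A"
    using assoc_mult_mat[OF A H A] by simp
  also have "\<dots> = c' \<cdot>\<^sub>m A"
    unfolding c' using A by (simp add: mult_smult_assoc_mat[of "1\<^sub>m n'" n' n' A n])
  finally have "(c \<cdot>\<^sub>m A) $$ (i0, j0) = (c' \<cdot>\<^sub>m A) $$ (i0, j0)"
    by simp
  then have cc': "c = c'"
    using ij0 A by simp
  have HAd: "(H * A) $$ (j, j) = (\<Sum>i<n'. of_real ((cmod (A $$ (i, j)))\<^sup>2))" if "j < n" for j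
    using that A H by (auto simp: scalar_prod_def H_def madj_def atLeast0LessThan complex_norm_square mult.commute
        simp del: of_real_power intro!: sum.cong)
  have AHd: "(A * H) $$ (i, i) = (\<Sum>j<n. of_real ((cmod (A $$ (i, j)))\<^sup>2))" if "i < n'" for i
    using that A H by (auto simp: scalar_prod_def H_def madj_def atLeast0LessThan complex_norm_square mult.commute
        simp del: of_real_power intro!: sum.cong)
  define r where "r = (\<Sum>i<n'. (cmod (A $$ (i, j0)))\<^sup>2)"
  have "c = of_real r"
    using HAd[OF ij0(2)] ij0(2) unfolding c r_def by simp
  have "0 < r"
    unfolding r_def using ij0 by (intro sum_pos2[of _ i0]) auto
  have "of_nat n * c = (\<Sum>j<n. (H * A) $$ (j, j))"
    unfolding c by simp
  also have "\<dots> = (\<Sum>i<n'. (A * H) $$ (i, i))"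
    using HAd AHd sum.swap[of "\<lambda>i j. complex_of_real ((cmod (A $$ (i, j)))\<^sup>2)" "{..<n}" "{..<n'}"] by simp
  also have "\<dots> = of_nat n' * c"
    unfolding c' cc' by simp
  finally have nn: "n' = n"
    using \<open>c = of_real r\<close> \<open>0 < r\<close> by simp
  define s where "s = 1 / sqrt r"
  have s: "s * (s * r) = 1"
    using \<open>0 < r\<close> by (simp add: s_def field_simps)
  define U where "U = complex_of_real s \<cdot>\<^sub>m A"
  have U: "U \<in> carrier_mat n n"
    using A nn by (simp add: U_def)
  have Uv: "U *\<^sub>v x = complex_of_real s \<cdot>\<^sub>v (A *\<^sub>v x)" if "x \<in> carrier_vec n" for x
    using that A by (intro eq_vecI) (auto simp: U_def scalar_prod_def sum_distrib_left mult.assoc)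
  have unit: "(U *\<^sub>v v) \<bullet>c (U *\<^sub>v w) = v \<bullet>c w" if vw: "v \<in> carrier_vec n" "w \<in> carrier_vec n" for v w
  proof -
    have Aw: "A *\<^sub>v v \<in> carrier_vec n'" "A *\<^sub>v w \<in> carrier_vec n'"
      using A vw by auto
    have "H *\<^sub>v (A *\<^sub>v w) = (H * A) *\<^sub>v w"
      using assoc_mult_mat_vec[OF H A vw(2)] by simp
    also have "\<dots> = c \<cdot>\<^sub>v w"
      unfolding c using vw by (intro eq_vecI) (auto simp: scalar_prod_def if_distrib if_distribR cong: if_cong)
    finally have "(A *\<^sub>v v) \<bullet>c (A *\<^sub>v w) = cnj c * (v \<bullet>c w)"
      using HA[OF vw(1) Aw(2)] cip_smult_right[OF vw, of c] by simp
    then have "(U *\<^sub>v v) \<bullet>c (U *\<^sub>v w) = of_real s * (of_real s * (of_real r * (v \<bullet>c w)))"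
      unfolding Uv[OF vw(1)] Uv[OF vw(2)] using Aw \<open>c = of_real r\<close>
      by (simp add: cip_smult_left[of _ n'] cip_smult_right[of _ n'])
    also have "\<dots> = of_real (s * (s * r)) * (v \<bullet>c w)"
      by (simp only: of_real_mult mult.assoc)
    finally show ?thesis
      by (simp add: s)
  qed
  have Uint: "U * \<pi> g = \<pi>' g * U" if g: "g \<in> carrier G" for g
    using int[OF g] A P[OF g] unfolding U_def
    by (simp add: mult_smult_assoc_mat[of A n' n "\<pi> g" n] mult_smult_distrib[of "\<pi>' g" n' n' A n])
  show thesis
    by (rule that[OF nn U unit Uint])
qed

end

context haar_group begin

lemma coef_CC: "unitary_rep G T n \<pi> \<Longrightarrow> v \<in> carrier_vec n \<Longrightarrow> w \<in> carrier_vec n \<Longrightarrow>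
    (\<lambda>g. (\<pi> g *\<^sub>v v) \<bullet>c w) \<in> CC"
  using rep_cip_continuous by blast

text \<open>\<open>B\<close> is the average over the group of \<pi>'(g)^-1 E \<pi>(g), where E sends
  x to \<langle>x, v\<rangle> v'; right invariance of the Haar measure makes it an intertwiner. It
  is handled through its sesquilinear form, so that all integrals are scalar.\<close>

lemma schur_integral_mat:
  assumes rep: "unitary_rep G T n \<pi>" and rep': "unitary_rep G T n' \<pi>'"
    and v: "v \<in> carrier_vec n" and v': "v' \<in> carrier_vec n'"
  obtains B where "B \<in> carrier_mat n' n"
    "\<And>u u'. u \<in> carrier_vec n \<Longrightarrow> u' \<in> carrier_vec n' \<Longrightarrow>
      (B *\<^sub>v u) \<bullet>c u' = (\<integral>g. ((\<pi> g *\<^sub>v u) \<bullet>c v) * cnj ((\<pi>' g *\<^sub>v u') \<bullet>c v') \<partial>m)"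
    "\<And>h. h \<in> carrier G \<Longrightarrow> B * \<pi> h = \<pi>' h * B"
proof -
  define B where "B = mat n' n (\<lambda>(i, j). \<integral>g. ((\<pi> g *\<^sub>v unit_vec n j) \<bullet>c v) * cnj ((\<pi>' g *\<^sub>v unit_vec n' i) \<bullet>c v') \<partial>m)"
  have B: "B \<in> carrier_mat n' n"
    by (simp add: B_def)
  have prod_CC: "(\<lambda>g. ((\<pi> g *\<^sub>v u) \<bullet>c v) * cnj ((\<pi>' g *\<^sub>v u') \<bullet>c v')) \<in> CC"
    if "u \<in> carrier_vec n" "u' \<in> carrier_vec n'" for u u'
    by (intro CC_mult CC_cnj coef_CC[OF rep] coef_CC[OF rep'] that v v')
  have Bu: "(B *\<^sub>v u) \<bullet>c u' = (\<integral>g. ((\<pi> g *\<^sub>v u) \<bullet>c v) * cnj ((\<pi>' g *\<^sub>v u') \<bullet>c v') \<partial>m)"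
    if u: "u \<in> carrier_vec n" and u': "u' \<in> carrier_vec n'" for u u'
  proof -
    have i: "integrable m (\<lambda>g. ((\<pi> g *\<^sub>v unit_vec n j) \<bullet>c v) * cnj ((\<pi>' g *\<^sub>v unit_vec n' i) \<bullet>c v'))" for i j
      by (rule haar_CC_integrable[OF prod_CC]) auto
    have "(B *\<^sub>v u) \<bullet>c u' = (\<Sum>i<n'. \<Sum>j<n. B $$ (i, j) * u $ j * cnj (u' $ i))"
      by (rule cip_mat[OF B u u'])
    also have "\<dots> = (\<integral>g. (\<Sum>i<n'. \<Sum>j<n. ((\<pi> g *\<^sub>v unit_vec n j) \<bullet>c v) * cnj ((\<pi>' g *\<^sub>v unit_vec n' i) \<bullet>c v')
        * u $ j * cnj (u' $ i)) \<partial>m)"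
      using i by (subst Bochner_Integration.integral_sum, simp)+ (simp add: B_def)
    also have "\<dots> = (\<integral>g. ((\<pi> g *\<^sub>v u) \<bullet>c v) * cnj ((\<pi>' g *\<^sub>v u') \<bullet>c v') \<partial>m)"
    proof (intro Bochner_Integration.integral_cong refl)
      fix g assume "g \<in> space m"
      then have g: "g \<in> carrier G"
        by (simp add: haar_space)
      show "(\<Sum>i<n'. \<Sum>j<n. ((\<pi> g *\<^sub>v unit_vec n j) \<bullet>c v) * cnj ((\<pi>' g *\<^sub>v unit_vec n' i) \<bullet>c v')
        * u $ j * cnj (u' $ i)) = ((\<pi> g *\<^sub>v u) \<bullet>c v) * cnj ((\<pi>' g *\<^sub>v u') \<bullet>c v')"
        unfolding cip_mat_expand_left[OF unitary_repD(1)[OF rep g] u v]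
          cip_mat_expand_left[OF unitary_repD(1)[OF rep' g] u' v'] cnj_sum complex_cnj_mult sum_product
        by (subst sum.swap) (simp add: mult_ac)
    qed
    finally show ?thesis .
  qed
  have "B * \<pi> h = \<pi>' h * B" if h: "h \<in> carrier G" for h
  proof (rule mat_eq_cipI)
    fix x y :: "complex vec" assume xy: "x \<in> carrier_vec n" "y \<in> carrier_vec n'"
    have P: "\<pi> h \<in> carrier_mat n n" "\<pi>' h \<in> carrier_mat n' n'"
      using unitary_repD(1)[OF rep h] unitary_repD(1)[OF rep' h] by auto
    have hx: "\<pi> h *\<^sub>v x \<in> carrier_vec n"
      using P xy by auto
    have hy: "\<pi>' (inv h) *\<^sub>v y \<in> carrier_vec n'"
      using unitary_repD(1)[OF rep' inv_closed[OF h]] xy by auto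
    have "((B * \<pi> h) *\<^sub>v x) \<bullet>c y = (\<integral>g. ((\<pi> g *\<^sub>v (\<pi> h *\<^sub>v x)) \<bullet>c v) * cnj ((\<pi>' g *\<^sub>v y) \<bullet>c v') \<partial>m)"
      using Bu[OF hx xy(2)] assoc_mult_mat_vec[OF B P(1) xy(1)] by simp
    also have "\<dots> = (\<integral>g. (\<lambda>g. ((\<pi> g *\<^sub>v x) \<bullet>c v) * cnj ((\<pi>' g *\<^sub>v (\<pi>' (inv h) *\<^sub>v y)) \<bullet>c v')) (g \<otimes> h) \<partial>m)"
    proof (intro Bochner_Integration.integral_cong refl)
      fix g assume "g \<in> space m"
      then have g: "g \<in> carrier G"
        by (simp add: haar_space)
      have "\<pi>' (g \<otimes> h) *\<^sub>v (\<pi>' (inv h) *\<^sub>v y) = \<pi>' (g \<otimes> h \<otimes> inv h) *\<^sub>v y"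
        using rep_mult_vec[OF rep' _ _ xy(2), of "g \<otimes> h" "inv h"] g h by simp
      also have "g \<otimes> h \<otimes> inv h = g"
        using g h by (simp add: m_assoc)
      finally show "((\<pi> g *\<^sub>v (\<pi> h *\<^sub>v x)) \<bullet>c v) * cnj ((\<pi>' g *\<^sub>v y) \<bullet>c v') =
        (\<lambda>g. ((\<pi> g *\<^sub>v x) \<bullet>c v) * cnj ((\<pi>' g *\<^sub>v (\<pi>' (inv h) *\<^sub>v y)) \<bullet>c v')) (g \<otimes> h)"
        using rep_mult_vec[OF rep g h xy(1)] by simp
    qed
    also have "\<dots> = (\<integral>g. ((\<pi> g *\<^sub>v x) \<bullet>c v) * cnj ((\<pi>' g *\<^sub>v (\<pi>' (inv h) *\<^sub>v y)) \<bullet>c v') \<partial>m)"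
      by (rule integral_right[OF h haar_CC_measurable[OF prod_CC[OF xy(1) hy]]])
    also have "\<dots> = (B *\<^sub>v x) \<bullet>c (\<pi>' (inv h) *\<^sub>v y)"
      by (rule Bu[OF xy(1) hy, symmetric])
    also have "\<dots> = (\<pi>' h *\<^sub>v (B *\<^sub>v x)) \<bullet>c y"
      by (rule rep_cip_inv[OF rep' h]) (use B xy in auto)
    finally show "((B * \<pi> h) *\<^sub>v x) \<bullet>c y = ((\<pi>' h * B) *\<^sub>v x) \<bullet>c y"
      using assoc_mult_mat_vec[OF P(2) B xy(1)] by simp
  qed (use B unitary_repD(1)[OF rep h] unitary_repD(1)[OF rep' h] in auto)
  then show thesis
    using that B Bu by blast
qed

text \<open>Schur's lemma makes the averaged matrix a scalar. Its value is read off from the trace,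
  because by unitarity the integrand summed over an orthonormal basis does not depend on
  \<open>g\<close>.\<close>

lemma schur_orthogonality_same:
  assumes irr: "irreducible_unitary_rep G T n \<pi>"
    and u: "u \<in> carrier_vec n" "u' \<in> carrier_vec n" and v: "v \<in> carrier_vec n" "v' \<in> carrier_vec n"
  shows "(\<integral>g. ((\<pi> g *\<^sub>v u) \<bullet>c v) * cnj ((\<pi> g *\<^sub>v u') \<bullet>c v') \<partial>m) = (u \<bullet>c u') * (v' \<bullet>c v) / of_nat n"
proof -
  have rep: "unitary_rep G T n \<pi>" and n: "0 < n"
    using irr by (auto simp: irreducible_unitary_rep_def)
  obtain B where B: "B \<in> carrier_mat n n"
    and Bu: "\<And>u u'. u \<in> carrier_vec n \<Longrightarrow> u' \<in> carrier_vec n \<Longrightarrow>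
      (B *\<^sub>v u) \<bullet>c u' = (\<integral>g. ((\<pi> g *\<^sub>v u) \<bullet>c v) * cnj ((\<pi> g *\<^sub>v u') \<bullet>c v') \<partial>m)"
    and int: "\<And>h. h \<in> carrier G \<Longrightarrow> B * \<pi> h = \<pi> h * B"
    using schur_integral_mat[OF rep rep v] by blast
  obtain c where c: "B = c \<cdot>\<^sub>m 1\<^sub>m n"
    using schur_scalar[OF irr B int] by blast
  have i: "integrable m (\<lambda>g. ((\<pi> g *\<^sub>v unit_vec n j) \<bullet>c v) * cnj ((\<pi> g *\<^sub>v unit_vec n j) \<bullet>c v'))" for j
    by (intro haar_CC_integrable CC_mult CC_cnj coef_CC[OF rep] v) auto
  have "of_nat n * c = (\<Sum>j<n. B $$ (j, j))"
    unfolding c by simp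
  also have "\<dots> = (\<Sum>j<n. \<integral>g. ((\<pi> g *\<^sub>v unit_vec n j) \<bullet>c v) * cnj ((\<pi> g *\<^sub>v unit_vec n j) \<bullet>c v') \<partial>m)"
    by (rule sum.cong) (use cip_mat_unit[OF B] Bu in auto)
  also have "\<dots> = (\<integral>g. (\<Sum>j<n. ((\<pi> g *\<^sub>v unit_vec n j) \<bullet>c v) * cnj ((\<pi> g *\<^sub>v unit_vec n j) \<bullet>c v')) \<partial>m)"
    using i by (subst Bochner_Integration.integral_sum) auto
  also have "\<dots> = (\<integral>g. v' \<bullet>c v \<partial>m)"
  proof (intro Bochner_Integration.integral_cong refl)
    fix g assume "g \<in> space m"
    then have g: "g \<in> carrier G" "inv g \<in> carrier G"
      by (auto simp: haar_space)
    have "(\<pi> g *\<^sub>v unit_vec n j) \<bullet>c w = cnj ((\<pi> (inv g) *\<^sub>v w) $ j)" if w: "w \<in> carrier_vec n" and j: "j < n" for w j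
    proof -
      have "(\<pi> g *\<^sub>v unit_vec n j) \<bullet>c w = unit_vec n j \<bullet>c (\<pi> (inv g) *\<^sub>v w)"
        by (rule rep_cip_inv[OF rep g(1), symmetric]) (use w in auto)
      also have "\<dots> = cnj ((\<pi> (inv g) *\<^sub>v w) \<bullet>c unit_vec n j)"
        by (rule cip_swap[symmetric]) (use rep_vec_carrier[OF rep g(2) w] in auto)
      also have "\<dots> = cnj ((\<pi> (inv g) *\<^sub>v w) $ j)"
        using cip_unit_right[OF rep_vec_carrier[OF rep g(2) w] j] by simp
      finally show ?thesis .
    qed
    then have "(\<Sum>j<n. ((\<pi> g *\<^sub>v unit_vec n j) \<bullet>c v) * cnj ((\<pi> g *\<^sub>v unit_vec n j) \<bullet>c v')) =
        (\<Sum>j<n. (\<pi> (inv g) *\<^sub>v v') $ j * cnj ((\<pi> (inv g) *\<^sub>v v) $ j))"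
      using v by (intro sum.cong) (auto simp: mult.commute)
    also have "\<dots> = (\<pi> (inv g) *\<^sub>v v') \<bullet>c (\<pi> (inv g) *\<^sub>v v)"
      by (rule cip_sum[symmetric]) (use rep_vec_carrier[OF rep g(2)] v in auto)
    also have "\<dots> = v' \<bullet>c v"
      by (rule unitary_repD(4)[OF rep g(2) v(2,1)])
    finally show "(\<Sum>j<n. ((\<pi> g *\<^sub>v unit_vec n j) \<bullet>c v) * cnj ((\<pi> g *\<^sub>v unit_vec n j) \<bullet>c v')) = v' \<bullet>c v" .
  qed
  also have "\<dots> = v' \<bullet>c v"
    by (simp add: prob_space)
  finally have c_val: "c = (v' \<bullet>c v) / of_nat n"
    using n by (simp add: field_simps)
  have "B *\<^sub>v u = c \<cdot>\<^sub>v u"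
    unfolding c using u by (intro eq_vecI) (auto simp: scalar_prod_def if_distrib if_distribR cong: if_cong)
  then show ?thesis
    using Bu[OF u] c_val cip_smult_left[OF u, of c] by simp
qed

lemma schur_orthogonality_different:
  assumes irr: "irreducible_unitary_rep G T n \<pi>" "irreducible_unitary_rep G T n' \<pi>'"
    and ne: "\<not> unitarily_equivalent G \<pi> \<pi>'"
    and u: "u \<in> carrier_vec n" "u' \<in> carrier_vec n'" and v: "v \<in> carrier_vec n" "v' \<in> carrier_vec n'"
  shows "(\<integral>g. ((\<pi> g *\<^sub>v u) \<bullet>c v) * cnj ((\<pi>' g *\<^sub>v u') \<bullet>c v') \<partial>m) = 0"
proof -
  have rep: "unitary_rep G T n \<pi>" "unitary_rep G T n' \<pi>'"
    using irr by (auto simp: irreducible_unitary_rep_def)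
  obtain B where B: "B \<in> carrier_mat n' n"
    and Bu: "\<And>u u'. u \<in> carrier_vec n \<Longrightarrow> u' \<in> carrier_vec n' \<Longrightarrow>
      (B *\<^sub>v u) \<bullet>c u' = (\<integral>g. ((\<pi> g *\<^sub>v u) \<bullet>c v) * cnj ((\<pi>' g *\<^sub>v u') \<bullet>c v') \<partial>m)"
    and int: "\<And>h. h \<in> carrier G \<Longrightarrow> B * \<pi> h = \<pi>' h * B"
    using schur_integral_mat[OF rep v] by blast
  have "B = 0\<^sub>m n' n"
  proof (rule ccontr)
    assume "B \<noteq> 0\<^sub>m n' n"
    then obtain U where U: "n' = n" "U \<in> carrier_mat n n"
      "\<And>v w. v \<in> carrier_vec n \<Longrightarrow> w \<in> carrier_vec n \<Longrightarrow> (U *\<^sub>v v) \<bullet>c (U *\<^sub>v w) = v \<bullet>c w"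
      "\<And>g. g \<in> carrier G \<Longrightarrow> U * \<pi> g = \<pi>' g * U"
      using schur_unitary[OF irr B _ int] by blast
    have "rep_dim G \<pi> = n" "rep_dim G \<pi>' = n"
      using unitary_repD(2)[OF rep(1)] unitary_repD(2)[OF rep(2)] U(1) by (simp_all add: rep_dim_def)
    then have "unitarily_equivalent G \<pi> \<pi>'"
      using U unfolding unitarily_equivalent_def by auto
    then show False
      using ne by simp
  qed
  then show ?thesis
    using Bu[OF u] u by (simp add: cip_mat[of _ n' n])
qed

end

section \<open>The Peter--Weyl theorem\<close>

lemma (in topological_group) rep_inv_entry:
  assumes "unitary_rep G T n \<pi>" "g \<in> carrier G" "i < n" "j < n"
  shows "\<pi> (inv g) $$ (i, j) = cnj (\<pi> g $$ (j, i))"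
proof -
  have "\<pi> (inv g) $$ (i, j) = (\<pi> (inv g) *\<^sub>v unit_vec n j) \<bullet>c unit_vec n i"
    using cip_mat_unit[OF unitary_repD(1)[OF assms(1)], of "inv g" j i] assms by simp
  also have "\<dots> = unit_vec n j \<bullet>c (\<pi> g *\<^sub>v unit_vec n i)"
    by (rule rep_inv_cip[OF assms(1,2)]) auto
  also have "\<dots> = cnj ((\<pi> g *\<^sub>v unit_vec n i) \<bullet>c unit_vec n j)"
    by (rule cip_swap[where n = n, symmetric]) (use rep_vec_carrier[OF assms(1,2)] in auto)
  also have "\<dots> = cnj (\<pi> g $$ (j, i))"
    using cip_mat_unit[OF unitary_repD(1)[OF assms(1)], of g i j] assms by simp
  finally show ?thesis .
qed

context haar_group begin

text \<open>Orthonormal families measure dimension here. A function on the whole type is not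
  determined by its values on the group, so linear independence of functions would count the wrong
  thing.\<close>

definition ons :: "('g \<Rightarrow> complex) set \<Rightarrow> nat \<Rightarrow> (nat \<Rightarrow> 'g \<Rightarrow> complex) \<Rightarrow> bool" where
  "ons V N w \<longleftrightarrow> (\<forall>i<N. w i \<in> V) \<and> (\<forall>i<N. \<forall>j<N. L2_inner m (w i) (w j) = (if i = j then 1 else 0))"

text \<open>The last two conditions: closure under change of values outside the group, and \<open>V \<noteq> 0\<close>.\<close>

definition invariant_space :: "('g \<Rightarrow> complex) set \<Rightarrow> bool" where
  "invariant_space V \<longleftrightarrow> V \<subseteq> CC \<and> (\<forall>f\<in>V. \<forall>g\<in>V. \<forall>a b. (\<lambda>x. a * f x + b * g x) \<in> V) \<and>
     (\<forall>f\<in>V. \<forall>g\<in>carrier G. (\<lambda>x. f (inv g \<otimes> x)) \<in> V) \<and>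
     (\<forall>f\<in>V. \<forall>f'. (\<forall>x\<in>carrier G. f' x = f x) \<longrightarrow> f' \<in> V) \<and> (\<exists>f\<in>V. L2_norm m f \<noteq> 0)"

lemma invariant_spaceD:
  assumes "invariant_space V"
  shows "V \<subseteq> CC" "\<And>f g a b. f \<in> V \<Longrightarrow> g \<in> V \<Longrightarrow> (\<lambda>x. a * f x + b * g x) \<in> V"
    "\<And>f g. f \<in> V \<Longrightarrow> g \<in> carrier G \<Longrightarrow> (\<lambda>x. f (inv g \<otimes> x)) \<in> V"
    "\<And>f f'. f \<in> V \<Longrightarrow> (\<And>x. x \<in> carrier G \<Longrightarrow> f' x = f x) \<Longrightarrow> f' \<in> V"
    "\<exists>f\<in>V. L2_norm m f \<noteq> 0"
  using assms unfolding invariant_space_def by blast+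

lemma invariant_space_sum:
  fixes N :: nat
  assumes V: "invariant_space V" and u: "\<And>i. i < N \<Longrightarrow> u i \<in> V"
  shows "(\<lambda>x. \<Sum>i<N. c i * u i x) \<in> V"
  using u
proof (induction N)
  case 0
  obtain f where "f \<in> V"
    using invariant_spaceD(5)[OF V] by blast
  from invariant_spaceD(2)[OF V this this, of 0 0] show ?case
    by simp
next
  case (Suc N)
  then have "(\<lambda>x. 1 * (\<Sum>i<N. c i * u i x) + c N * u N x) \<in> V"
    by (intro invariant_spaceD(2)[OF V]) auto
  then show ?case
    by simp
qed

text \<open>Otherwise the normalised remainder would extend the family. The expansion holds at every
  point of the group because the remainder is continuous.\<close>

lemma ons_maximal_span:
  assumes V: "invariant_space V" and w: "ons V N w" and max: "\<And>w'. \<not> ons V (Suc N) w'"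
    and f: "f \<in> V" and x: "x \<in> carrier G"
  shows "f x = (\<Sum>i<N. L2_inner m f (w i) * w i x)"
proof -
  define r where "r x = f x - (\<Sum>i<N. L2_inner m f (w i) * w i x)" for x
  have wV: "w i \<in> V" if "i < N" for i
    using w that by (simp add: ons_def)
  have s: "(\<lambda>x. \<Sum>i<N. L2_inner m f (w i) * w i x) \<in> V"
    by (rule invariant_space_sum[OF V wV])
  have rV: "r \<in> V"
    using invariant_spaceD(2)[OF V f s, of 1 "-1"] by (simp add: r_def[abs_def])
  have VL: "g \<in> L2 m" if "g \<in> V" for g
    using that invariant_spaceD(1)[OF V] haar_CC_L2 by blast
  have rw: "L2_inner m r (w j) = 0" if j: "j < N" for j
  proof -
    have "L2_inner m r (w j) = L2_inner m f (w j) - L2_inner m (\<lambda>x. \<Sum>i<N. L2_inner m f (w i) * w i x) (w j)"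
      unfolding r_def[abs_def] by (rule L2_inner_diff_left[OF VL[OF f] VL[OF s] VL[OF wV[OF j]]])
    also have "L2_inner m (\<lambda>x. \<Sum>i<N. L2_inner m f (w i) * w i x) (w j) = (\<Sum>i<N. L2_inner m f (w i) * L2_inner m (w i) (w j))"
      by (rule L2_inner_sum_left) (use VL wV j in auto)
    also have "\<dots> = (\<Sum>i<N. if i = j then L2_inner m f (w i) else 0)"
      by (rule sum.cong) (use w j in \<open>auto simp: ons_def\<close>)
    finally show ?thesis
      using j by simp
  qed
  have wr: "L2_inner m (w j) r = 0" if j: "j < N" for j
    using rw[OF j] L2_inner_cnj[of m r "w j"] by simp
  have "L2_norm m r = 0"
  proof (rule ccontr)
    assume nz: "L2_norm m r \<noteq> 0"
    define c where "c = complex_of_real (1 / L2_norm m r)"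
    define w' where "w' i = (if i < N then w i else (\<lambda>x. c * r x))" for i
    have "ons V (Suc N) w'"
      unfolding ons_def
    proof (intro conjI allI impI)
      show "w' i \<in> V" if "i < Suc N" for i
        using wV invariant_spaceD(2)[OF V rV rV, of c 0] by (simp add: w'_def)
      fix i j assume ij: "i < Suc N" "j < Suc N"
      have "L2_inner m (\<lambda>x. c * r x) (\<lambda>x. c * r x) = 1"
        unfolding L2_inner_mult_left L2_inner_mult_right unfolding L2_inner_self c_def
        using nz by (simp add: power2_eq_square)
      then show "L2_inner m (w' i) (w' j) = (if i = j then 1 else 0)"
        using ij w by (auto simp: w'_def ons_def L2_inner_mult_left L2_inner_mult_right rw wr)
    qed
    then show False
      using max by blast
  qed
  then have "r x = 0"
    using CC_norm_eq_0[of r x] rV invariant_spaceD(1)[OF V] x by blast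
  then show ?thesis
    by (simp add: r_def)
qed

lemma L2_inner_translate:
  assumes f: "f \<in> CC" and h: "h \<in> CC" and g: "g \<in> carrier G"
  shows "L2_inner m (\<lambda>x. f (inv g \<otimes> x)) (\<lambda>x. h (inv g \<otimes> x)) = L2_inner m f h"
  unfolding L2_inner_def
  using integral_left[of "inv g" "\<lambda>x. f x * cnj (h x)"] haar_CC_measurable[OF CC_mult[OF f CC_cnj[OF h]]] g by simp

text \<open>\<open>a g\<close> is the matrix of left translation by \<open>g\<close> in the basis
  \<open>w\<close>. The map \<open>F\<close> from coordinate vectors to functions is isometric and
  carries \<open>a g\<close> to translation, whence unitarity.\<close>

lemma ons_representation:
  assumes V: "invariant_space V" and w: "ons V N w"
    and span: "\<And>f x. f \<in> V \<Longrightarrow> x \<in> carrier G \<Longrightarrow> f x = (\<Sum>i<N. L2_inner m f (w i) * w i x)"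
    and a: "\<And>g. a g = mat N N (\<lambda>(j, i). L2_inner m (\<lambda>x. w i (inv g \<otimes> x)) (w j))"
  shows "unitary_rep G T N a"
    and "\<And>g i x. g \<in> carrier G \<Longrightarrow> i < N \<Longrightarrow> x \<in> carrier G \<Longrightarrow> w i (inv g \<otimes> x) = (\<Sum>j<N. a g $$ (j, i) * w j x)"
proof -
  have wV: "w i \<in> V" if "i < N" for i
    using w that by (simp add: ons_def)
  have VC: "f \<in> CC" and VL: "f \<in> L2 m" if "f \<in> V" for f
    using that invariant_spaceD(1)[OF V] haar_CC_L2 by blast+
  have on: "L2_inner m (w i) (w j) = (if i = j then 1 else 0)" if "i < N" "j < N" for i j
    using w that by (simp add: ons_def)
  show expand: "w i (inv g \<otimes> x) = (\<Sum>j<N. a g $$ (j, i) * w j x)" if "g \<in> carrier G" "i < N" "x \<in> carrier G" for g i x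
    using span[OF invariant_spaceD(3)[OF V wV[OF that(2)] that(1)] that(3)] that(2) by (simp add: a)
  have entry: "a g $$ (j, i) = L2_inner m (\<lambda>x. w i (inv g \<otimes> x)) (w j)" if "i < N" "j < N" for g i j
    using that by (simp add: a)
  show "unitary_rep G T N a"
    unfolding unitary_rep_def
  proof (intro conjI ballI allI impI)
    show ac: "a g \<in> carrier_mat N N" for g
      by (simp add: a)
    show "a \<one> = 1\<^sub>m N"
    proof (rule eq_matI)
      fix j i assume "j < dim_row (1\<^sub>m N :: complex mat)" "i < dim_col (1\<^sub>m N :: complex mat)"
      then have ij: "j < N" "i < N"
        by auto
      have "a \<one> $$ (j, i) = L2_inner m (w i) (w j)"
        unfolding entry[OF ij(2,1)] by (rule L2_inner_cong) auto
      then show "a \<one> $$ (j, i) = 1\<^sub>m N $$ (j, i)"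
        using ij on by simp
    qed (use ac in \<open>auto simp: a\<close>)
    show "a (g \<otimes> h) = a g * a h" if g: "g \<in> carrier G" and h: "h \<in> carrier G" for g h
    proof (rule eq_matI)
      fix j i assume "j < dim_row (a g * a h)" "i < dim_col (a g * a h)"
      then have ij: "j < N" "i < N"
        by (auto simp: a)
      have "a (g \<otimes> h) $$ (j, i) = L2_inner m (\<lambda>x. \<Sum>k<N. a h $$ (k, i) * w k (inv g \<otimes> x)) (w j)"
        unfolding entry[OF ij(2,1)]
      proof (rule L2_inner_cong)
        fix x assume x: "x \<in> carrier G"
        have "inv (g \<otimes> h) \<otimes> x = inv h \<otimes> (inv g \<otimes> x)"
          using g h x by (simp add: inv_mult_group m_assoc)
        then show "w i (inv (g \<otimes> h) \<otimes> x) = (\<Sum>k<N. a h $$ (k, i) * w k (inv g \<otimes> x))"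
          using expand[OF h ij(2), of "inv g \<otimes> x"] g x by simp
      qed simp
      also have "\<dots> = (\<Sum>k<N. a h $$ (k, i) * L2_inner m (\<lambda>x. w k (inv g \<otimes> x)) (w j))"
        by (rule L2_inner_sum_left) (use VL wV invariant_spaceD(3)[OF V] g ij in auto)
      also have "\<dots> = (\<Sum>k<N. a g $$ (j, k) * a h $$ (k, i))"
        using ij by (intro sum.cong) (auto simp: entry mult.commute)
      also have "\<dots> = (a g * a h) $$ (j, i)"
        using ij ac[of g] ac[of h] by (simp add: scalar_prod_def atLeast0LessThan)
      finally show "a (g \<otimes> h) $$ (j, i) = (a g * a h) $$ (j, i)" .
    qed (auto simp: a)
    show "continuous_map T euclidean (\<lambda>g. a g $$ (i, j))" if ij: "i < N" "j < N" for i j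
    proof -
      have wi: "(\<lambda>x. w j (inv x)) \<in> CC"
        by (rule CC_comp[OF VC[OF wV[OF ij(2)]] continuous_inv])
      \<comment> \<open>The matrix entries are continuous because they are convolutions.\<close>
      have "conv (\<lambda>h. cnj (w i h)) (\<lambda>x. w j (inv x)) \<in> CC"
        by (rule conv_CC[OF L2_cnj[OF VL[OF wV[OF ij(1)]]] wi])
      moreover have "a g $$ (i, j) = conv (\<lambda>h. cnj (w i h)) (\<lambda>x. w j (inv x)) g" if "g \<in> carrier G" for g
        unfolding entry[OF ij(2,1)] conv_def L2_inner_def
        by (rule Bochner_Integration.integral_cong) (use that in \<open>auto simp: haar_space inv_mult_group mult.commute\<close>)
      ultimately show ?thesis
        using CC_cong[of "conv (\<lambda>h. cnj (w i h)) (\<lambda>x. w j (inv x))" "\<lambda>g. a g $$ (i, j)"] by blast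
    qed
    fix g and v u :: "complex vec"
    assume g: "g \<in> carrier G" and v: "v \<in> carrier_vec N" and u: "u \<in> carrier_vec N"
    have av: "a g *\<^sub>v y \<in> carrier_vec N" if "y \<in> carrier_vec N" for y
      using ac[of g] that by auto
    define F where "F y x = (\<Sum>i<N. y $ i * w i x)" for y :: "complex vec" and x
    have FV: "F y \<in> V" for y
      unfolding F_def[abs_def] by (rule invariant_space_sum[OF V wV])
    have F_inner: "L2_inner m (F y) (F z) = y \<bullet>c z" if "y \<in> carrier_vec N" "z \<in> carrier_vec N" for y z
    proof -
      have 1: "L2_inner m (w i) (F z) = cnj (z $ i)" if "i < N" for i
      proof -
        have "L2_inner m (w i) (F z) = (\<Sum>k<N. cnj (z $ k) * L2_inner m (w i) (w k))"
          unfolding F_def[abs_def] by (rule L2_inner_sum_right) (use VL wV that in auto)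
        also have "\<dots> = (\<Sum>k<N. if k = i then cnj (z $ k) else 0)"
          by (rule sum.cong) (use on that in auto)
        finally show ?thesis
          using that by simp
      qed
      have "L2_inner m (F y) (F z) = (\<Sum>i<N. y $ i * L2_inner m (w i) (F z))"
        unfolding F_def[of y, abs_def] by (rule L2_inner_sum_left) (use VL wV FV in auto)
      then show ?thesis
        using 1 by (simp add: cip_sum[OF that])
    qed
    have F_transl: "F (a g *\<^sub>v y) x = F y (inv g \<otimes> x)" if "y \<in> carrier_vec N" "x \<in> carrier G" for y x
    proof -
      have "F y (inv g \<otimes> x) = (\<Sum>i<N. \<Sum>j<N. a g $$ (j, i) * y $ i * w j x)"
        unfolding F_def using expand[OF g _ that(2)] by (simp add: sum_distrib_left mult_ac)
      also have "\<dots> = (\<Sum>j<N. (\<Sum>i<N. a g $$ (j, i) * y $ i) * w j x)"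
        by (subst sum.swap) (simp add: sum_distrib_right)
      also have "\<dots> = F (a g *\<^sub>v y) x"
        unfolding F_def using ac[of g] that(1)
        by (intro sum.cong refl arg_cong2[where f=times]) (auto simp: scalar_prod_def atLeast0LessThan)
      finally show ?thesis ..
    qed
    have "(a g *\<^sub>v v) \<bullet>c (a g *\<^sub>v u) = L2_inner m (F (a g *\<^sub>v v)) (F (a g *\<^sub>v u))"
      using F_inner[OF av[OF v] av[OF u]] ..
    also have "\<dots> = L2_inner m (\<lambda>x. F v (inv g \<otimes> x)) (\<lambda>x. F u (inv g \<otimes> x))"
      by (rule L2_inner_cong) (use F_transl u v in auto)
    also have "\<dots> = L2_inner m (F v) (F u)"
      by (rule L2_inner_translate[OF VC[OF FV] VC[OF FV] g])
    also have "\<dots> = v \<bullet>c u"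
      by (rule F_inner[OF v u])
    finally show "(a g *\<^sub>v v) \<bullet>c (a g *\<^sub>v u) = v \<bullet>c u" .
  qed
qed

text \<open>Inside \<open>W\<close> an invariant space of least dimension is taken; the bound
  \<open>K\<close> makes dimensions finite. An invariant subspace of its coordinate space
  corresponds to an invariant space of functions, to which minimality applies.\<close>

lemma irreducible_subspace:
  assumes W: "invariant_space W" and bdd: "\<And>N w. ons W N w \<Longrightarrow> N \<le> K"
  obtains N w a where "ons W N w" "irreducible_unitary_rep G T N a"
    "\<And>g i x. g \<in> carrier G \<Longrightarrow> i < N \<Longrightarrow> x \<in> carrier G \<Longrightarrow> w i (inv g \<otimes> x) = (\<Sum>j<N. a g $$ (j, i) * w j x)"
proof -
  define dm where "dm V = (GREATEST N. \<exists>w. ons V N w)" for V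
  have ons_mono: "ons W N w" if "V \<subseteq> W" "ons V N w" for V N w
    using that by (auto simp: ons_def)
  have dm: "\<exists>w. ons V (dm V) w" "ons V N w \<Longrightarrow> N \<le> dm V" if V: "V \<subseteq> W" for V N w
  proof -
    have b: "\<forall>N. (\<exists>w. ons V N w) \<longrightarrow> N \<le> K"
      using bdd ons_mono[OF V] by blast
    have "\<exists>w. ons V 0 w"
      by (simp add: ons_def)
    then show "\<exists>w. ons V (dm V) w"
      unfolding dm_def using GreatestI_nat[of "\<lambda>N. \<exists>w. ons V N w" 0 K] b by blast
    show "ons V N w \<Longrightarrow> N \<le> dm V"
      unfolding dm_def using Greatest_le_nat[of "\<lambda>N. \<exists>w. ons V N w" N K] b by blast
  qed
  obtain V where V: "invariant_space V" "V \<subseteq> W"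
    and Vmin: "\<And>V'. invariant_space V' \<Longrightarrow> V' \<subseteq> W \<Longrightarrow> dm V \<le> dm V'"
    using exists_least_iff[of "\<lambda>k. \<exists>V. invariant_space V \<and> V \<subseteq> W \<and> dm V = k"] W
    by (metis linorder_not_le order_refl)
  define N where "N = dm V"
  obtain w where w: "ons V N w"
    using dm(1)[OF V(2)] by (auto simp: N_def)
  have max: "\<not> ons V (Suc N) w'" for w'
    using dm(2)[OF V(2), of "Suc N" w'] by (auto simp: N_def)
  note span = ons_maximal_span[OF V(1) _ max]
  define a where "a g = mat N N (\<lambda>(j, i). L2_inner m (\<lambda>x. w i (inv g \<otimes> x)) (w j))" for g
  have rep: "unitary_rep G T N a"
    and expand: "\<And>g i x. g \<in> carrier G \<Longrightarrow> i < N \<Longrightarrow> x \<in> carrier G \<Longrightarrow> w i (inv g \<otimes> x) = (\<Sum>j<N. a g $$ (j, i) * w j x)"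
    using ons_representation[OF V(1) w span[OF w] a_def] by blast+
  have VL: "f \<in> L2 m" if "f \<in> V" for f
    using that invariant_spaceD(1)[OF V(1)] haar_CC_L2 by blast
  have wV: "w i \<in> V" if "i < N" for i
    using w that by (simp add: ons_def)
  have "N \<noteq> 0"
  proof
    assume "N = 0"
    obtain f where f: "f \<in> V" "L2_norm m f \<noteq> 0"
      using invariant_spaceD(5)[OF V(1)] by blast
    have "L2_norm m f = L2_norm m (\<lambda>x. 0)"
      by (rule L2_norm_cong) (use span[OF w f(1)] \<open>N = 0\<close> in simp)
    then show False
      using f(2) by (simp add: L2_norm_def)
  qed
  moreover have "U = {0\<^sub>v N} \<or> U = carrier_vec N"
    if sub: "VectorSpace.subspace class_ring U (module_vec TYPE(complex) N)"
      and inv: "\<forall>g\<in>carrier G. \<forall>u\<in>U. a g *\<^sub>v u \<in> U" for U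
  proof (rule disjCI)
    assume "U \<noteq> carrier_vec N"
    have U: "U \<subseteq> carrier_vec N" "0\<^sub>v N \<in> U" "\<And>u v. u \<in> U \<Longrightarrow> v \<in> U \<Longrightarrow> u + v \<in> U"
      "\<And>c u. u \<in> U \<Longrightarrow> c \<cdot>\<^sub>v u \<in> U"
      using sub unfolding vec_subspace_iff by auto
    define F where "F y x = (\<Sum>i<N. y $ i * w i x)" for y :: "complex vec" and x
    have FV: "F y \<in> V" for y
      unfolding F_def[abs_def] by (rule invariant_space_sum[OF V(1) wV])
    have Fw: "L2_inner m (F y) (w j) = y $ j" if "j < N" for y j
    proof -
      have "L2_inner m (F y) (w j) = (\<Sum>i<N. y $ i * L2_inner m (w i) (w j))"
        unfolding F_def[abs_def] by (rule L2_inner_sum_left) (use VL wV that in auto)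
      also have "\<dots> = (\<Sum>i<N. if i = j then y $ i else 0)"
        by (rule sum.cong) (use w that in \<open>auto simp: ons_def\<close>)
      finally show ?thesis
        using that by simp
    qed
    \<comment> \<open>Membership asks for agreement on the group only, since an
      \<open>invariant_space\<close> has to be closed under changes elsewhere.\<close>
    define V' where "V' = {f. \<exists>u\<in>U. \<forall>x\<in>carrier G. f x = F u x}"
    have V'V: "V' \<subseteq> V"
      using invariant_spaceD(4)[OF V(1) FV] by (auto simp: V'_def)
    show "U = {0\<^sub>v N}"
    proof (rule ccontr)
      assume "U \<noteq> {0\<^sub>v N}"
      then obtain u where u: "u \<in> U" "u \<noteq> 0\<^sub>v N" "u \<in> carrier_vec N"
        using U(1,2) by blast
      have "invariant_space V'"
        unfolding invariant_space_def
      proof (intro conjI ballI allI impI)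
        show "V' \<subseteq> CC"
          using V'V invariant_spaceD(1)[OF V(1)] by blast
        show "(\<lambda>x. c * f x + d * g x) \<in> V'" if "f \<in> V'" "g \<in> V'" for f g c d
        proof -
          from that obtain y z where yz: "y \<in> U" "z \<in> U" "\<And>x. x \<in> carrier G \<Longrightarrow> f x = F y x" "\<And>x. x \<in> carrier G \<Longrightarrow> g x = F z x"
            by (auto simp: V'_def)
          have "c \<cdot>\<^sub>v y + d \<cdot>\<^sub>v z \<in> U"
            using yz U by blast
          moreover have "c * F y x + d * F z x = F (c \<cdot>\<^sub>v y + d \<cdot>\<^sub>v z) x" for x
          proof -
            have "y \<in> carrier_vec N" "z \<in> carrier_vec N"
              using yz U(1) by auto
            then show ?thesis
              unfolding F_def by (simp add: sum_distrib_left sum.distrib algebra_simps)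
          qed
          ultimately show ?thesis
            using yz by (auto simp: V'_def)
        qed
        show "(\<lambda>x. f (inv g \<otimes> x)) \<in> V'" if "f \<in> V'" "g \<in> carrier G" for f g
        proof -
          from that obtain y where y: "y \<in> U" "\<And>x. x \<in> carrier G \<Longrightarrow> f x = F y x"
            by (auto simp: V'_def)
          have yc: "y \<in> carrier_vec N"
            using y U(1) by auto
          have "F y (inv g \<otimes> x) = F (a g *\<^sub>v y) x" if x: "x \<in> carrier G" for x
          proof -
            have "F y (inv g \<otimes> x) = (\<Sum>i<N. \<Sum>j<N. a g $$ (j, i) * y $ i * w j x)"
              unfolding F_def using expand[OF \<open>g \<in> carrier G\<close> _ x] by (simp add: sum_distrib_left mult_ac)
            also have "\<dots> = (\<Sum>j<N. (\<Sum>i<N. a g $$ (j, i) * y $ i) * w j x)"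
              by (subst sum.swap) (simp add: sum_distrib_right)
            also have "\<dots> = F (a g *\<^sub>v y) x"
              unfolding F_def using yc
              by (intro sum.cong refl arg_cong2[where f=times]) (auto simp: a_def scalar_prod_def atLeast0LessThan)
            finally show ?thesis .
          qed
          moreover have "a g *\<^sub>v y \<in> U"
            using inv that(2) y(1) by blast
          ultimately show ?thesis
            using y(2) that(2) by (auto simp: V'_def)
        qed
        show "f' \<in> V'" if "f \<in> V'" "\<forall>x\<in>carrier G. f' x = f x" for f f'
          using that by (auto simp: V'_def)
        obtain j where j: "j < N" "u $ j \<noteq> 0"
          using u(2,3) by (metis carrier_vecD eq_vecI index_zero_vec(1) index_zero_vec(2))
        have "L2_norm m (F u) \<noteq> 0"
        proof
          assume "L2_norm m (F u) = 0"
          then have "cmod (L2_inner m (F u) (w j)) \<le> 0"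
            using L2_cauchy_schwarz[OF VL[OF FV] VL[OF wV[OF j(1)]], of u] by simp
          then show False
            using j Fw by simp
        qed
        then show "\<exists>f\<in>V'. L2_norm m f \<noteq> 0"
          using u(1) by (intro bexI[of _ "F u"]) (auto simp: V'_def)
      qed
      then have "N \<le> dm V'"
        using Vmin V'V V(2) by (auto simp: N_def)
      moreover obtain w' where "ons V' (dm V') w'"
        using dm(1)[of V'] V'V V(2) by auto
      ultimately have w': "ons V' N w'"
        by (auto simp: ons_def)
      then have w'V: "ons V N w'"
        using V'V by (auto simp: ons_def)
      \<comment> \<open>An orthonormal family of full length inside \<open>V'\<close> spans
        \<open>V\<close> by maximality, so \<open>F v\<close> comes from a vector of
        \<open>U\<close>; inner products with \<open>w\<close> identify that vector as
        \<open>v\<close>.\<close>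
      have "v \<in> U" if v: "v \<in> carrier_vec N" for v
      proof -
        have Fv: "F v x = (\<Sum>i<N. L2_inner m (F v) (w' i) * w' i x)" if "x \<in> carrier G" for x
          by (rule span[OF w'V FV that])
        have "\<exists>y\<in>U. \<forall>x\<in>carrier G. w' i x = F y x" if "i < N" for i
          using w' that by (auto simp: ons_def V'_def)
        then obtain y where y: "\<And>i. i < N \<Longrightarrow> y i \<in> U" "\<And>i x. i < N \<Longrightarrow> x \<in> carrier G \<Longrightarrow> w' i x = F (y i) x"
          by metis
        have comb: "\<exists>z\<in>U. \<forall>x. F z x = (\<Sum>i<k. d i * F (y i) x)" if "k \<le> N" for k and d :: "nat \<Rightarrow> complex"
          using that
        proof (induction k)
          case 0
          then show ?case
            using U(2) by (intro bexI[of _ "0\<^sub>v N"]) (auto simp: F_def)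
        next
          case (Suc k)
          then obtain z where z: "z \<in> U" "\<And>x. F z x = (\<Sum>i<k. d i * F (y i) x)"
            by auto
          have "z + d k \<cdot>\<^sub>v y k \<in> U"
            using z U y Suc.prems by auto
          moreover have "F (z + d k \<cdot>\<^sub>v y k) x = F z x + d k * F (y k) x" for x
          proof -
            have "z \<in> carrier_vec N" "y k \<in> carrier_vec N"
              using z y[of k] Suc.prems U(1) by auto
            then show ?thesis
              unfolding F_def by (simp add: sum_distrib_left sum.distrib algebra_simps)
          qed
          ultimately show ?case
            using z(2) by (intro bexI[of _ "z + d k \<cdot>\<^sub>v y k"]) auto
        qed
        obtain z where z: "z \<in> U" "\<And>x. F z x = (\<Sum>i<N. L2_inner m (F v) (w' i) * F (y i) x)"
          using comb[of N "\<lambda>i. L2_inner m (F v) (w' i)"] by auto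
        have "F v x = F z x" if "x \<in> carrier G" for x
          using Fv[OF that] z(2) y(2)[OF _ that] by simp
        then have "L2_inner m (F v) (w j) = L2_inner m (F z) (w j)" for j
          by (intro L2_inner_cong) auto
        then have "v $ j = z $ j" if "j < N" for j
          using Fw[OF that] by metis
        then have "v = z"
          using v z(1) U(1) by (intro eq_vecI) auto
        then show ?thesis
          using z(1) by simp
      qed
      then have "U = carrier_vec N"
        using U(1) by blast
      then show False
        using \<open>U \<noteq> carrier_vec N\<close> by simp
    qed
  qed
  ultimately have "irreducible_unitary_rep G T N a"
    using rep unfolding irreducible_unitary_rep_def by auto
  then show thesis
    using that[OF ons_mono[OF V(2) w] _ expand] by blast
qed

text \<open>The Hilbert--Schmidt bound for multiplicities. At each \<open>x\<close>, Bessel's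
  inequality for the function \<open>cnj (q (inv h \<otimes> x))\<close> of \<open>h\<close> bounds
  the sum of the |w_i(x)|^2; integrating over \<open>x\<close> counts the family.\<close>

lemma eigenspace_ons_bound:
  assumes q: "q \<in> CC" and \<rho>: "0 < \<rho>"
    and w: "ons {w \<in> CC. \<forall>x\<in>carrier G. conv w q x = of_real \<rho> * w x} N w"
  shows "real N \<le> (L2_norm m q / \<rho>)\<^sup>2"
proof -
  have wC: "w i \<in> CC" and eig: "\<And>x. x \<in> carrier G \<Longrightarrow> conv (w i) q x = of_real \<rho> * w i x" if "i < N" for i
    using w that by (auto simp: ons_def)
  have on: "L2_inner m (w i) (w j) = (if i = j then 1 else 0)" if "i < N" "j < N" for i j
    using w that by (simp add: ons_def)
  have b: "(\<Sum>i<N. (cmod (w i x))\<^sup>2) \<le> (L2_norm m q / \<rho>)\<^sup>2" if x: "x \<in> carrier G" for x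
  proof -
    let ?k = "\<lambda>h. cnj (q (inv h \<otimes> x))"
    have k: "?k \<in> L2 m" "L2_norm m ?k = L2_norm m q"
      using L2_norm_inv_mult[OF haar_CC_L2[OF q] x] L2_cnj by auto
    have "\<rho>\<^sup>2 * (cmod (w i x))\<^sup>2 = (cmod (L2_inner m ?k (w i)))\<^sup>2" if "i < N" for i
    proof -
      have "L2_inner m (w i) ?k = of_real \<rho> * w i x"
        using eig[OF that x] by (simp add: conv_inner)
      then have "L2_inner m ?k (w i) = cnj (of_real \<rho> * w i x)"
        using L2_inner_cnj by metis
      then show ?thesis
        by (simp add: norm_mult power_mult_distrib)
    qed
    then have "\<rho>\<^sup>2 * (\<Sum>i<N. (cmod (w i x))\<^sup>2) = (\<Sum>i<N. (cmod (L2_inner m ?k (w i)))\<^sup>2)"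
      by (simp add: sum_distrib_left)
    also have "\<dots> \<le> (L2_norm m ?k)\<^sup>2"
      by (rule L2_bessel) (use k wC haar_CC_L2 on in auto)
    finally show ?thesis
      using \<rho> k(2) by (simp add: power_divide le_divide_eq mult.commute)
  qed
  have "real N = (\<Sum>i<N. (L2_norm m (w i))\<^sup>2)"
    using on by (simp add: L2_norm_power2_inner)
  also have "\<dots> = (\<integral>x. (\<Sum>i<N. (cmod (w i x))\<^sup>2) \<partial>m)"
    unfolding L2_norm_power2 using L2D(2)[OF haar_CC_L2[OF wC]] by simp
  also have "\<dots> \<le> (\<integral>x. (L2_norm m q / \<rho>)\<^sup>2 \<partial>m)"
    by (rule Bochner_Integration.integral_mono) (use L2D(2)[OF haar_CC_L2[OF wC]] b in \<open>auto simp: haar_space\<close>)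
  finally show ?thesis
    by (simp add: prob_space)
qed

lemma adj_conv:
  assumes "a \<in> CC" "b \<in> CC" and x: "x \<in> carrier G"
  shows "adj (conv a b) x = conv (adj b) (adj a) x"
proof -
  have "conv (adj b) (adj a) x = (\<integral>h. cnj (b (inv h)) * cnj (a (inv x \<otimes> h)) \<partial>m)"
    unfolding conv_def adj_def
    by (rule Bochner_Integration.integral_cong) (use x in \<open>auto simp: haar_space inv_mult_group\<close>)
  also have "\<dots> = (\<integral>h. (\<lambda>h. cnj (b (inv h)) * cnj (a (inv x \<otimes> h))) (x \<otimes> h) \<partial>m)"
  proof (rule integral_left[OF x, symmetric])
    have "(\<lambda>h. cnj (b (inv h)) * cnj (a (inv x \<otimes> h))) \<in> CC"
      by (intro CC_mult CC_cnj CC_comp[OF assms(2) continuous_inv] CC_comp[OF assms(1) continuous_left_mult])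
        (use x in simp)
    then show "(\<lambda>h. cnj (b (inv h)) * cnj (a (inv x \<otimes> h))) \<in> borel_measurable m"
      by (rule haar_CC_measurable)
  qed
  also have "\<dots> = (\<integral>h. cnj (a h * b (inv h \<otimes> inv x)) \<partial>m)"
  proof (rule Bochner_Integration.integral_cong[OF refl])
    fix h assume "h \<in> space m"
    then have h: "h \<in> carrier G"
      by (simp add: haar_space)
    have "inv x \<otimes> (x \<otimes> h) = h"
      using x h by (simp flip: m_assoc)
    then show "(\<lambda>h. cnj (b (inv h)) * cnj (a (inv x \<otimes> h))) (x \<otimes> h) = cnj (a h * b (inv h \<otimes> inv x))"
      using x h by (simp add: inv_mult_group)
  qed
  also have "\<dots> = adj (conv a b) x"
    unfolding adj_def conv_def by (rule Bochner_Integration.integral_cnj)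
  finally show ?thesis ..
qed

text \<open>With \<open>q\<close> the convolution of \<open>adj r\<close> and \<open>r\<close>, an
  eigenspace of convolution by \<open>conv q q\<close> for a positive eigenvalue is
  finite-dimensional and translation-invariant, so it contains functions built from the entries of
  an irreducible representation. Their convolution with \<open>adj r\<close> vanishes because
  \<open>r\<close> is orthogonal to all entries; hence so does that with \<open>q\<close>, which
  contradicts the eigenvalue.\<close>

theorem peter_weyl_zero:
  assumes r: "r \<in> CC"
    and orth: "\<And>n \<pi> i j. irreducible_unitary_rep G T n \<pi> \<Longrightarrow> i < n \<Longrightarrow> j < n \<Longrightarrow> (\<integral>g. r g * \<pi> g $$ (i, j) \<partial>m) = 0"
    and x: "x \<in> carrier G"
  shows "r x = 0"
proof (rule ccontr)
  assume "r x \<noteq> 0"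
  then have rn: "L2_norm m r \<noteq> 0"
    using CC_norm_eq_0[OF r _ x] by blast
  have rt: "adj r \<in> CC"
    by (rule adj_CC[OF r])
  define q where "q = conv (adj r) r"
  have q: "q \<in> CC"
    unfolding q_def by (rule conv_CC[OF haar_CC_L2[OF rt] r])
  have sa: "adj q y = q y" if "y \<in> carrier G" for y
  proof -
    have "adj q y = conv (adj r) (adj (adj r)) y"
      unfolding q_def by (rule adj_conv[OF rt r that])
    also have "\<dots> = conv (adj r) r y"
      by (rule conv_cong) (use that in \<open>auto simp: adj_def\<close>)
    finally show ?thesis
      by (simp add: q_def)
  qed
  have "q \<one> = L2_inner m (adj r) (adj r)"
    unfolding q_def conv_inner by (rule L2_inner_cong) (auto simp: adj_def)
  moreover have "L2_norm m (adj r) = L2_norm m r"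
    using L2_inv(2)[OF L2_cnj[OF haar_CC_L2[OF r]]] by (simp add: adj_def[abs_def] L2_norm_def)
  ultimately have "q \<one> \<noteq> 0"
    using rn by (simp add: L2_inner_self)
  then have qn: "L2_norm m q \<noteq> 0"
    using CC_norm_eq_0[OF q, of \<one>] by auto
  obtain \<rho> v where \<rho>: "0 < \<rho>" and v: "v \<in> CC" "L2_norm m v \<noteq> 0"
    "\<And>x. x \<in> carrier G \<Longrightarrow> conv v (conv q q) x = of_real \<rho> * v x"
    using conv_eigenfunction[OF q sa qn] by blast
  have q2: "conv q q \<in> CC"
    by (rule conv_CC[OF haar_CC_L2[OF q] q])
  define W where "W = {w \<in> CC. \<forall>x\<in>carrier G. conv w (conv q q) x = of_real \<rho> * w x}"
  have W: "invariant_space W"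
    unfolding invariant_space_def
  proof (intro conjI ballI allI impI)
    show "W \<subseteq> CC"
      by (auto simp: W_def)
    show "\<exists>f\<in>W. L2_norm m f \<noteq> 0"
      using v by (auto simp: W_def)
    show "f' \<in> W" if "f \<in> W" "\<forall>x\<in>carrier G. f' x = f x" for f f'
    proof -
      have "f' \<in> CC"
        using CC_cong[of f f'] that by (auto simp: W_def)
      moreover have "conv f' (conv q q) x = conv f (conv q q) x" if "x \<in> carrier G" for x
        by (rule conv_cong) (use that \<open>\<forall>x\<in>carrier G. f' x = f x\<close> in auto)
      ultimately show ?thesis
        using that by (auto simp: W_def)
    qed
    show "(\<lambda>x. a * f x + b * g x) \<in> W" if "f \<in> W" "g \<in> W" for f g a b
    proof -
      have fg: "f \<in> CC" "g \<in> CC"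
        using that by (auto simp: W_def)
      have "(\<lambda>x. a * f x + b * g x) \<in> CC"
        by (intro CC_add CC_mult CC_const fg)
      moreover have "conv (\<lambda>x. a * f x + b * g x) (conv q q) x = a * conv f (conv q q) x + b * conv g (conv q q) x"
        if "x \<in> carrier G" for x
        using conv_integrable[OF haar_CC_L2[OF fg(1)] haar_CC_L2[OF q2] that]
          conv_integrable[OF haar_CC_L2[OF fg(2)] haar_CC_L2[OF q2] that]
        by (simp add: conv_def[of _ "conv q q"] distrib_right mult.assoc)
      ultimately show ?thesis
        using that by (auto simp: W_def distrib_left mult_ac)
    qed
    show "(\<lambda>x. f (inv g \<otimes> x)) \<in> W" if "f \<in> W" "g \<in> carrier G" for f g
    proof -
      have f: "f \<in> CC" and g: "g \<in> carrier G" "inv g \<in> carrier G"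
        using that by (auto simp: W_def)
      have "(\<lambda>x. f (inv g \<otimes> x)) \<in> CC"
        by (rule CC_comp[OF f continuous_left_mult[OF g(2)]])
      moreover have "conv (\<lambda>x. f (inv g \<otimes> x)) (conv q q) x = conv f (conv q q) (inv g \<otimes> x)" if x: "x \<in> carrier G" for x
      proof -
        have y: "inv g \<otimes> x \<in> carrier G"
          using g x by simp
        have "(\<lambda>h. f h * conv q q (inv h \<otimes> (inv g \<otimes> x))) \<in> borel_measurable m"
          by (intro haar_CC_measurable CC_mult f CC_inv_mult[OF q2 y])
        from integral_left[OF g(2) this]
        have "conv f (conv q q) (inv g \<otimes> x) = (\<integral>h. f (inv g \<otimes> h) * conv q q (inv (inv g \<otimes> h) \<otimes> (inv g \<otimes> x)) \<partial>m)"
          by (simp add: conv_def[of f])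
        also have "\<dots> = conv (\<lambda>x. f (inv g \<otimes> x)) (conv q q) x"
          unfolding conv_def[of "\<lambda>x. f (inv g \<otimes> x)"]
        proof (intro Bochner_Integration.integral_cong refl arg_cong2[where f=times] arg_cong[of _ _ "conv q q"])
          fix h assume "h \<in> space m"
          then have h: "h \<in> carrier G"
            by (simp add: haar_space)
          have "g \<otimes> (inv g \<otimes> x) = x"
            using g x by (simp flip: m_assoc)
          then show "inv (inv g \<otimes> h) \<otimes> (inv g \<otimes> x) = inv h \<otimes> x"
            using g h x by (simp add: inv_mult_group m_assoc)
        qed
        finally show ?thesis ..
      qed
      ultimately show ?thesis
        using that by (auto simp: W_def)
    qed
  qed
  have bdd: "N \<le> nat \<lceil>(L2_norm m (conv q q) / \<rho>)\<^sup>2\<rceil>" if "ons W N w" for N w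
    using eigenspace_ons_bound[OF q2 \<rho>, of N w] that by (simp add: W_def le_nat_iff le_ceiling_iff)
  obtain N w a where w: "ons W N w" and irr: "irreducible_unitary_rep G T N a"
    and expand: "\<And>g i x. g \<in> carrier G \<Longrightarrow> i < N \<Longrightarrow> x \<in> carrier G \<Longrightarrow> w i (inv g \<otimes> x) = (\<Sum>j<N. a g $$ (j, i) * w j x)"
    using irreducible_subspace[OF W, of "nat \<lceil>(L2_norm m (conv q q) / \<rho>)\<^sup>2\<rceil>"] bdd by blast
  have rep: "unitary_rep G T N a" and N: "0 < N"
    using irr by (auto simp: irreducible_unitary_rep_def)
  have w0: "w 0 \<in> CC" "\<And>x. x \<in> carrier G \<Longrightarrow> conv (w 0) (conv q q) x = of_real \<rho> * w 0 x"
    "L2_inner m (w 0) (w 0) = 1"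
    using w N by (auto simp: ons_def W_def)
  have wC: "w j \<in> CC" if "j < N" for j
    using w that by (auto simp: ons_def W_def)
  \<comment> \<open>The translation formula at the unit writes \<open>w j\<close> as a combination
    of conjugated matrix entries, which paired with \<open>cnj r\<close> give conjugates of the
    integrals in \<open>orth\<close>.\<close>
  have int0: "(\<integral>h. w j h * cnj (r h) \<partial>m) = 0" if j: "j < N" for j
  proof -
    have "(\<integral>h. w j h * cnj (r h) \<partial>m) = (\<integral>h. (\<Sum>k<N. w k \<one> * cnj (r h * a h $$ (j, k))) \<partial>m)"
    proof (rule Bochner_Integration.integral_cong[OF refl])
      fix h assume "h \<in> space m"
      then have h: "h \<in> carrier G"
        by (simp add: haar_space)
      have "w j h = (\<Sum>k<N. a (inv h) $$ (k, j) * w k \<one>)"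
        using expand[of "inv h" j \<one>] h j by simp
      also have "\<dots> = (\<Sum>k<N. cnj (a h $$ (j, k)) * w k \<one>)"
        by (rule sum.cong) (use rep_inv_entry[OF rep h _ j] in auto)
      finally show "w j h * cnj (r h) = (\<Sum>k<N. w k \<one> * cnj (r h * a h $$ (j, k)))"
        by (simp add: sum_distrib_left mult_ac)
    qed
    also have "\<dots> = (\<Sum>k<N. w k \<one> * cnj (\<integral>h. r h * a h $$ (j, k) \<partial>m))"
    proof (subst Bochner_Integration.integral_sum)
      fix k assume k: "k \<in> {..<N}"
      have "(\<lambda>h. w k \<one> * cnj (r h * a h $$ (j, k))) \<in> CC"
        by (intro CC_mult CC_const CC_cnj r) (use unitary_repD(5)[OF rep j] k in auto)
      then show "integrable m (\<lambda>h. w k \<one> * cnj (r h * a h $$ (j, k)))"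
        by (rule haar_CC_integrable)
    qed (simp only: integral_mult_right_zero Bochner_Integration.integral_cnj)
    also have "\<dots> = 0"
      using orth[OF irr j] by simp
    finally show ?thesis .
  qed
  have c0: "conv (w 0) (adj r) y = 0" if y: "y \<in> carrier G" for y
  proof -
    have yi: "inv y \<in> carrier G"
      using y by simp
    have "(\<lambda>h. w 0 h * cnj (r (inv y \<otimes> h))) \<in> CC"
      by (intro CC_mult CC_cnj w0 CC_comp[OF r continuous_left_mult[OF yi]])
    then have meas: "(\<lambda>h. w 0 h * cnj (r (inv y \<otimes> h))) \<in> borel_measurable m"
      by (rule haar_CC_measurable)
    have "conv (w 0) (adj r) y = (\<integral>h. w 0 h * cnj (r (inv y \<otimes> h)) \<partial>m)"
      unfolding conv_def adj_def
      by (rule Bochner_Integration.integral_cong) (use y in \<open>auto simp: haar_space inv_mult_group\<close>)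
    also have "\<dots> = (\<integral>h. w 0 (y \<otimes> h) * cnj (r (inv y \<otimes> (y \<otimes> h))) \<partial>m)"
      by (rule integral_left[OF y meas, symmetric])
    also have "\<dots> = (\<integral>h. (\<Sum>j<N. a (inv y) $$ (j, 0) * (w j h * cnj (r h))) \<partial>m)"
    proof (rule Bochner_Integration.integral_cong[OF refl])
      fix h assume "h \<in> space m"
      then have h: "h \<in> carrier G"
        by (simp add: haar_space)
      have "inv y \<otimes> (y \<otimes> h) = h"
        using y h by (simp flip: m_assoc)
      then show "w 0 (y \<otimes> h) * cnj (r (inv y \<otimes> (y \<otimes> h))) = (\<Sum>j<N. a (inv y) $$ (j, 0) * (w j h * cnj (r h)))"
        using expand[OF yi N h] y by (simp add: sum_distrib_right mult.assoc)
    qed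
    also have "\<dots> = (\<Sum>j<N. a (inv y) $$ (j, 0) * (\<integral>h. w j h * cnj (r h) \<partial>m))"
    proof (subst Bochner_Integration.integral_sum)
      fix j assume "j \<in> {..<N}"
      then have "(\<lambda>h. a (inv y) $$ (j, 0) * (w j h * cnj (r h))) \<in> CC"
        by (intro CC_mult CC_const CC_cnj r wC) auto
      then show "integrable m (\<lambda>h. a (inv y) $$ (j, 0) * (w j h * cnj (r h)))"
        by (rule haar_CC_integrable)
    qed (simp only: integral_mult_right_zero)
    also have "\<dots> = 0"
      using int0 by simp
    finally show ?thesis .
  qed
  have c1: "conv (w 0) q y = 0" if y: "y \<in> carrier G" for y
  proof -
    have "conv (w 0) q y = conv (conv (w 0) (adj r)) r y"
      unfolding q_def by (rule conv_assoc[OF haar_CC_L2[OF w0(1)] rt r y, symmetric])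
    also have "\<dots> = conv (\<lambda>x. 0) r y"
      by (rule conv_cong) (use c0 y in auto)
    finally show ?thesis
      by (simp add: conv_def)
  qed
  have "w 0 y = 0" if y: "y \<in> carrier G" for y
  proof -
    have "of_real \<rho> * w 0 y = conv (conv (w 0) q) q y"
      using w0(2)[OF y] conv_assoc[OF haar_CC_L2[OF w0(1)] q q y] by simp
    also have "\<dots> = conv (\<lambda>x. 0) q y"
      by (rule conv_cong) (use c1 y in auto)
    finally show ?thesis
      using \<rho> by (simp add: conv_def)
  qed
  then have "L2_inner m (w 0) (w 0) = L2_inner m (\<lambda>x. 0) (\<lambda>x. 0)"
    by (intro L2_inner_cong) auto
  then show False
    using w0(3) by (simp add: L2_inner_def)
qed

end

section \<open>The Gelfand property\<close>

context compact_group begin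

text \<open>\<open>\<psi>\<close> is the identity for a plain average. The Gelfand argument also
  averages over the image of K under an anti-automorphism.\<close>

lemma rep_integral:
  assumes rep: "unitary_rep G T n \<pi>" and M: "borel_prob T M" and \<psi>: "continuous_map T T \<psi>"
  obtains Q where "Q \<in> carrier_mat n n"
    "\<And>x y. x \<in> carrier_vec n \<Longrightarrow> y \<in> carrier_vec n \<Longrightarrow> (Q *\<^sub>v x) \<bullet>c y = (\<integral>k. (\<pi> (\<psi> k) *\<^sub>v x) \<bullet>c y \<partial>M)"
proof -
  define Q where "Q = mat n n (\<lambda>(i, j). \<integral>k. \<pi> (\<psi> k) $$ (i, j) \<partial>M)"
  have Q: "Q \<in> carrier_mat n n"
    by (simp add: Q_def)
  have \<psi>c: "\<psi> k \<in> carrier G" if "k \<in> carrier G" for k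
    using \<psi> that by (auto simp: continuous_map_def topspace_eq)
  have "(Q *\<^sub>v x) \<bullet>c y = (\<integral>k. (\<pi> (\<psi> k) *\<^sub>v x) \<bullet>c y \<partial>M)"
    if x: "x \<in> carrier_vec n" and y: "y \<in> carrier_vec n" for x y
  proof -
    have i: "integrable M (\<lambda>k. \<pi> (\<psi> k) $$ (i, j))" if "i < n" "j < n" for i j
      by (rule CC_integrable[OF M CC_comp[OF _ \<psi>]]) (use unitary_repD(5)[OF rep that] in simp)
    have "(Q *\<^sub>v x) \<bullet>c y = (\<Sum>i<n. \<Sum>j<n. Q $$ (i, j) * x $ j * cnj (y $ i))"
      by (rule cip_mat[OF Q x y])
    also have "\<dots> = (\<Sum>i<n. \<Sum>j<n. \<integral>k. \<pi> (\<psi> k) $$ (i, j) * x $ j * cnj (y $ i) \<partial>M)"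
      by (simp add: Q_def)
    also have "\<dots> = (\<Sum>i<n. \<integral>k. (\<Sum>j<n. \<pi> (\<psi> k) $$ (i, j) * x $ j * cnj (y $ i)) \<partial>M)"
      using i by (intro sum.cong refl Bochner_Integration.integral_sum[symmetric]) auto
    also have "\<dots> = (\<integral>k. (\<Sum>i<n. \<Sum>j<n. \<pi> (\<psi> k) $$ (i, j) * x $ j * cnj (y $ i)) \<partial>M)"
      using i by (intro Bochner_Integration.integral_sum[symmetric] Bochner_Integration.integrable_sum) auto
    also have "\<dots> = (\<integral>k. (\<pi> (\<psi> k) *\<^sub>v x) \<bullet>c y \<partial>M)"
      by (rule Bochner_Integration.integral_cong)
        (use borel_prob_space[OF M] in \<open>auto simp: cip_mat[OF unitary_repD(1)[OF rep \<psi>c] x y]\<close>)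
    finally show ?thesis .
  qed
  then show thesis
    using that Q by blast
qed

lemma bi_invariant_integral:
  fixes f :: "'g \<Rightarrow> complex"
  assumes M: "borel_prob T M" and bi: "bi_invariant G K M" and k: "k \<in> K" "k \<in> carrier G"
    and f: "f \<in> CC"
  shows "(\<integral>x. f (k \<otimes> x) \<partial>M) = (\<integral>x. f x \<partial>M)" "(\<integral>x. f (x \<otimes> k) \<partial>M) = (\<integral>x. f x \<partial>M)"
proof -
  have fm: "f \<in> borel_measurable M"
    by (rule CC_measurable[OF M f])
  have m: "(\<lambda>x. k \<otimes> x) \<in> M \<rightarrow>\<^sub>M M" "(\<lambda>x. x \<otimes> k) \<in> M \<rightarrow>\<^sub>M M"
    using left_measurable[OF k(2)] right_measurable[OF k(2)] by (simp_all add: measurable_borel_prob[OF M] measurable_borel_prob2[OF M])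
  have d: "distr M M (\<lambda>x. k \<otimes> x) = M" "distr M M (\<lambda>x. x \<otimes> k) = M"
    using bi k(1) by (auto simp: bi_invariant_def)
  show "(\<integral>x. f (k \<otimes> x) \<partial>M) = (\<integral>x. f x \<partial>M)"
    using integral_distr[OF m(1), of f] fm d(1) by simp
  show "(\<integral>x. f (x \<otimes> k) \<partial>M) = (\<integral>x. f x \<partial>M)"
    using integral_distr[OF m(2), of f] fm d(2) by simp
qed

lemma fixed_vector_inv:
  assumes rep: "unitary_rep G T n \<pi>" and K: "K \<subseteq> carrier G" and v: "v \<in> carrier_vec n" "fixed_vector K \<pi> v"
    and k: "k \<in> K"
  shows "\<pi> (inv k) *\<^sub>v v = v"
proof -
  have kc: "k \<in> carrier G"
    using k K by blast
  have "\<pi> (inv k) *\<^sub>v v = \<pi> (inv k) *\<^sub>v (\<pi> k *\<^sub>v v)"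
    using v(2) k by (simp add: fixed_vector_def)
  also have "\<dots> = v"
    using rep_mult_vec[OF rep _ kc v(1), of "inv k"] rep_one_vec[OF rep v(1)] kc by simp
  finally show ?thesis .
qed

lemma fixed_vector_cip:
  assumes rep: "unitary_rep G T n \<pi>" and K: "K \<subseteq> carrier G" and v: "v \<in> carrier_vec n" "fixed_vector K \<pi> v"
    and k: "k \<in> K" and x: "x \<in> carrier_vec n"
  shows "(\<pi> k *\<^sub>v x) \<bullet>c v = x \<bullet>c v"
  using rep_cip_inv[OF rep _ x v(1), of k] fixed_vector_inv[OF rep K v k] k K by auto

lemma fixed_vectorI_cip:
  assumes Q: "w \<in> carrier_vec n" and rep: "unitary_rep G T n \<pi>" and K: "K \<subseteq> carrier G"
    and eq: "\<And>k y. k \<in> K \<Longrightarrow> y \<in> carrier_vec n \<Longrightarrow> w \<bullet>c (\<pi> (inv k) *\<^sub>v y) = w \<bullet>c y"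
  shows "fixed_vector K \<pi> w"
  unfolding fixed_vector_def
proof
  fix k assume k: "k \<in> K"
  then have kc: "k \<in> carrier G"
    using K by blast
  show "\<pi> k *\<^sub>v w = w"
    by (rule cip_eqI[of _ n]) (use rep_vec_carrier[OF rep kc Q] Q rep_cip_inv[OF rep kc Q] eq[OF k] in auto)
qed

text \<open>The difference of the two vectors is itself fixed, so it may be taken as
  \<open>z\<close>.\<close>

lemma fixed_vector_eqI:
  assumes rep: "unitary_rep G T n \<pi>" and w: "w \<in> carrier_vec n" "fixed_vector K \<pi> w"
    and w': "w' \<in> carrier_vec n" "fixed_vector K \<pi> w'" and K: "K \<subseteq> carrier G"
    and eq: "\<And>z. z \<in> carrier_vec n \<Longrightarrow> fixed_vector K \<pi> z \<Longrightarrow> w \<bullet>c z = w' \<bullet>c z"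
  shows "w = w'"
proof -
  define d where "d = w - w'"
  have d: "d \<in> carrier_vec n"
    using w w' by (simp add: d_def)
  have "fixed_vector K \<pi> d"
    unfolding fixed_vector_def d_def
  proof
    fix k assume k: "k \<in> K"
    then show "\<pi> k *\<^sub>v (w - w') = w - w'"
      using mult_minus_distrib_mat_vec[OF unitary_repD(1)[OF rep], of k w w'] w w' K by (auto simp: fixed_vector_def)
  qed
  then have "w \<bullet>c d = w' \<bullet>c d"
    by (rule eq[OF d])
  moreover have "d \<bullet>c d = w \<bullet>c d - w' \<bullet>c d"
    using w(1) w'(1) d by (simp add: cip_sum[of _ n] d_def left_diff_distrib sum_subtractf)
  ultimately have "d = 0\<^sub>v n"
    using cip_self_0[OF d] by simp
  have "w $ i = w' $ i" if "i < n" for i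
  proof -
    have "d $ i = w $ i - w' $ i"
      using that w(1) w'(1) by (simp add: d_def)
    then show ?thesis
      using that \<open>d = 0\<^sub>v n\<close> by simp
  qed
  then show ?thesis
    using w(1) w'(1) by (intro eq_vecI) auto
qed

end

text \<open>All that the harmonic analysis takes from the geometry. \<open>local_inverse\<close>
  speaks of a neighbourhood of the unit only; \<open>connected\<close> is what lets its consequences
  spread.\<close>

locale symmetric_haar_group = haar_group G T m for G :: "('g, 'b) monoid_scheme" (structure) and T m +
  fixes K :: "'g set" and mK :: "'g measure" and \<sigma> :: "'g \<Rightarrow> 'g"
  assumes connected: "connected_space T"
    and K: "subgroup K G"
    and mK: "borel_prob T mK" "emeasure mK K = 1" "bi_invariant G K mK"
    and \<sigma>_hom: "\<sigma> \<in> hom G G" and \<sigma>_\<sigma>: "\<And>x. x \<in> carrier G \<Longrightarrow> \<sigma> (\<sigma> x) = x"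
    and \<sigma>_cont: "continuous_map T T \<sigma>" and \<sigma>_K: "\<sigma> ` K \<subseteq> K"
    and local_inverse: "\<exists>U. openin T U \<and> \<one> \<in> U \<and> (\<forall>g\<in>U. \<exists>k\<in>K. k \<in> carrier G \<and> \<sigma> g = k \<otimes> inv g \<otimes> k)"
begin

lemma K_carrier: "K \<subseteq> carrier G"
  using K by (rule subgroup.subset)

sublocale \<sigma>: group_hom G G \<sigma>
  using \<sigma>_hom by (simp add: group_hom_def group_hom_axioms_def group_axioms)

lemma AE_mK: "AE k in mK. k \<in> K"
proof -
  interpret MK: prob_space mK
    by (rule borel_prob_prob_space[OF mK(1)])
  have "K \<in> sets mK"
    using mK(2) emeasure_notin_sets by fastforce
  then show ?thesis
    using MK.AE_in_set_eq_1[of K] mK(2) by (simp add: MK.emeasure_eq_measure)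
qed

text \<open>Near the unit \<open>local_inverse\<close> gives the identity, the factors from K being
  absorbed by \<open>u\<close> and \<open>v\<close>. The difference of the two sides lies in the
  span of the entries of \<open>\<pi> (\<sigma> g)\<close> and \<open>\<pi> (inv g)\<close>, which
  is stable under left translation, so unique continuation applies.\<close>

lemma fixed_cip_involution:
  assumes rep: "unitary_rep G T n \<pi>" and u: "u \<in> carrier_vec n" "fixed_vector K \<pi> u"
    and v: "v \<in> carrier_vec n" "fixed_vector K \<pi> v" and g: "g \<in> carrier G"
  shows "(\<pi> (\<sigma> g) *\<^sub>v u) \<bullet>c v = (\<pi> (inv g) *\<^sub>v u) \<bullet>c v"
proof -
  \<comment> \<open>The Boolean separates the entries of \<open>\<pi> (\<sigma> g)\<close> from
    those of \<open>\<pi> (inv g)\<close>. Left translation mixes the first index of the former and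
    the second index of the latter.\<close>
  define I where "I = (UNIV :: bool set) \<times> {..<n} \<times> {..<n}"
  define f where "f = (\<lambda>(b, i, j) g. if b then \<pi> (\<sigma> g) $$ (i, j) else \<pi> (inv g) $$ (i, j))"
  define c where "c = (\<lambda>(b, i, j). if b then u $ j * cnj (v $ i) else - (u $ j * cnj (v $ i)))"
  have Ib: "(\<Sum>x\<in>I. F x) = (\<Sum>i<n. \<Sum>j<n. F (True, i, j)) + (\<Sum>i<n. \<Sum>j<n. F (False, i, j))" for F :: "_ \<Rightarrow> complex"
    unfolding I_def sum.cartesian_product' UNIV_bool by simp
  have val: "(\<Sum>x\<in>I. c x * f x g) = (\<pi> (\<sigma> g) *\<^sub>v u) \<bullet>c v - (\<pi> (inv g) *\<^sub>v u) \<bullet>c v" if g: "g \<in> carrier G" for g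
    unfolding Ib cip_mat[OF unitary_repD(1)[OF rep \<sigma>.hom_closed[OF g]] u(1) v(1)]
      cip_mat[OF unitary_repD(1)[OF rep inv_closed[OF g]] u(1) v(1)]
    by (simp add: c_def f_def mult_ac sum_negf)
  obtain U where U: "openin T U" "\<one> \<in> U" "\<And>g. g \<in> U \<Longrightarrow> \<exists>k\<in>K. k \<in> carrier G \<and> \<sigma> g = k \<otimes> inv g \<otimes> k"
    using local_inverse by blast
  have "(\<Sum>x\<in>I. c x * f x g) = 0"
  proof (rule unique_continuation[OF connected _ _ U(1,2) _ g])
    show "finite I"
      by (simp add: I_def)
    show "\<exists>d. \<forall>g\<in>carrier G. f x (a \<otimes> g) = (\<Sum>y\<in>I. d y * f y g)" if a: "a \<in> carrier G" and x: "x \<in> I" for a x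
    proof -
      obtain b i j where b: "x = (b, i, j)" "i < n" "j < n"
        using x by (auto simp: I_def)
      define d where "d = (\<lambda>(b', i', j'). if b then (if b' \<and> j' = j then \<pi> (\<sigma> a) $$ (i, i') else 0)
          else (if \<not> b' \<and> i' = i then \<pi> (inv a) $$ (j', j) else 0))"
      have "f x (a \<otimes> g) = (\<Sum>y\<in>I. d y * f y g)" if g: "g \<in> carrier G" for g
      proof (cases b)
        case True
        have "f x (a \<otimes> g) = (\<pi> (\<sigma> a) * \<pi> (\<sigma> g)) $$ (i, j)"
          using a g b True by (simp add: f_def unitary_repD(3)[OF rep])
        also have "\<dots> = (\<Sum>k<n. \<pi> (\<sigma> a) $$ (i, k) * \<pi> (\<sigma> g) $$ (k, j))"
          using unitary_repD(1)[OF rep \<sigma>.hom_closed[OF a]] unitary_repD(1)[OF rep \<sigma>.hom_closed[OF g]] b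
          by (simp add: scalar_prod_def atLeast0LessThan)
        also have "\<dots> = (\<Sum>y\<in>I. d y * f y g)"
          unfolding Ib using True b by (simp add: d_def f_def if_distribR if_distrib[of "\<lambda>x. x * _"] cong: if_cong)
        finally show ?thesis .
      next
        case False
        have "f x (a \<otimes> g) = (\<pi> (inv g) * \<pi> (inv a)) $$ (i, j)"
          using a g b False by (simp add: f_def inv_mult_group unitary_repD(3)[OF rep])
        also have "\<dots> = (\<Sum>k<n. \<pi> (inv g) $$ (i, k) * \<pi> (inv a) $$ (k, j))"
          using unitary_repD(1)[OF rep inv_closed[OF a]] unitary_repD(1)[OF rep inv_closed[OF g]] b
          by (simp add: scalar_prod_def atLeast0LessThan)
        also have "\<dots> = (\<Sum>i'<n. if i' = i then (\<Sum>k<n. \<pi> (inv a) $$ (k, j) * \<pi> (inv g) $$ (i', k)) else 0)"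
          using b by (simp add: mult.commute)
        also have "\<dots> = (\<Sum>i'<n. \<Sum>k<n. (if i' = i then \<pi> (inv a) $$ (k, j) else 0) * \<pi> (inv g) $$ (i', k))"
          by (intro sum.cong) auto
        also have "\<dots> = (\<Sum>y\<in>I. d y * f y g)"
          unfolding Ib using False by (simp add: d_def f_def)
        finally show ?thesis .
      qed
      then show ?thesis
        by blast
    qed
    show "\<forall>x\<in>U. (\<Sum>i\<in>I. c i * f i x) = 0"
    proof
      fix x assume x: "x \<in> U"
      then have xc: "x \<in> carrier G"
        using openin_carrier[OF U(1)] by blast
      obtain k where k: "k \<in> K" "k \<in> carrier G" "\<sigma> x = k \<otimes> inv x \<otimes> k"
        using U(3)[OF x] by blast
      have "\<pi> (\<sigma> x) *\<^sub>v u = \<pi> k *\<^sub>v (\<pi> (inv x) *\<^sub>v (\<pi> k *\<^sub>v u))"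
        using k xc rep_mult_vec[OF rep _ k(2) u(1), of "k \<otimes> inv x"]
          rep_mult_vec[OF rep k(2) inv_closed[OF xc], of "\<pi> k *\<^sub>v u"] rep_vec_carrier[OF rep k(2) u(1)] by simp
      also have "\<pi> k *\<^sub>v u = u"
        using u(2) k(1) by (simp add: fixed_vector_def)
      finally have "(\<pi> (\<sigma> x) *\<^sub>v u) \<bullet>c v = (\<pi> (inv x) *\<^sub>v u) \<bullet>c v"
        using fixed_vector_cip[OF rep K_carrier v k(1) rep_vec_carrier[OF rep inv_closed[OF xc] u(1)]] by simp
      then show "(\<Sum>i\<in>I. c i * f i x) = 0"
        using val[OF xc] by simp
    qed
  qed
  then show ?thesis
    using val[OF g] by simp
qed

text \<open>\<open>\<tau>(g) = \<sigma>(g)\<inverse>\<close> is an anti-automorphism that does not change the compressions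
  \<open>P \<pi>(g) P\<close> to the space of \<open>K\<close>-fixed vectors; so these commute, and Schur orthogonality makes
  that space at most one-dimensional.\<close>

theorem fixed_vectors_orthogonal_zero:
  assumes irr: "irreducible_unitary_rep G T n \<pi>" and u: "u \<in> carrier_vec n" "fixed_vector K \<pi> u"
    and v: "v \<in> carrier_vec n" "fixed_vector K \<pi> v" and uv: "u \<bullet>c v = 0" and u0: "u \<noteq> 0\<^sub>v n"
  shows "v = 0\<^sub>v n"
proof -
  have rep: "unitary_rep G T n \<pi>" and n: "0 < n"
    using irr by (auto simp: irreducible_unitary_rep_def)
  interpret MK: prob_space mK
    by (rule borel_prob_prob_space[OF mK(1)])
  define \<tau> where "\<tau> g = inv (\<sigma> g)" for g
  have \<tau>c: "\<tau> g \<in> carrier G" if "g \<in> carrier G" for g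
    using that by (simp add: \<tau>_def)
  have \<tau>m: "\<tau> (g \<otimes> h) = \<tau> h \<otimes> \<tau> g" if "g \<in> carrier G" "h \<in> carrier G" for g h
    using that by (simp add: \<tau>_def inv_mult_group)
  have \<tau>\<tau>: "\<tau> (\<tau> g) = g" if "g \<in> carrier G" for g
    using that by (simp add: \<tau>_def \<sigma>_\<sigma>)
  have \<tau>K: "\<tau> k \<in> K" if "k \<in> K" for k
    using that \<sigma>_K subgroup.m_inv_closed[OF K] by (auto simp: \<tau>_def)
  have \<tau>_cont: "continuous_map T T \<tau>"
    unfolding \<tau>_def[abs_def] by (rule continuous_inv_fun[OF \<sigma>_cont])
  have \<tau>_fixed: "(\<pi> (\<tau> g) *\<^sub>v y) \<bullet>c z = (\<pi> g *\<^sub>v y) \<bullet>c z"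
    if "y \<in> carrier_vec n" "fixed_vector K \<pi> y" "z \<in> carrier_vec n" "fixed_vector K \<pi> z" "g \<in> carrier G" for y z g
    using fixed_cip_involution[OF rep that(1-4) inv_closed[OF that(5)]] that(5) by (simp add: \<tau>_def)
  obtain P where P: "P \<in> carrier_mat n n"
    and Pxy: "\<And>x y. x \<in> carrier_vec n \<Longrightarrow> y \<in> carrier_vec n \<Longrightarrow> (P *\<^sub>v x) \<bullet>c y = (\<integral>k. (\<pi> k *\<^sub>v x) \<bullet>c y \<partial>mK)"
    using rep_integral[OF rep mK(1), of "\<lambda>k. k"] by auto
  \<comment> \<open>\<open>Q\<close> averages over the image of \<open>mK\<close> under
    \<open>\<tau>\<close>. It will turn out to be \<open>P\<close>: both map into the fixed vectors
    and have the same inner products with them. This stands in for invariance of \<open>mK\<close>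
    under \<open>\<tau>\<close>.\<close>
  obtain Q where Q: "Q \<in> carrier_mat n n"
    and Qxy: "\<And>x y. x \<in> carrier_vec n \<Longrightarrow> y \<in> carrier_vec n \<Longrightarrow> (Q *\<^sub>v x) \<bullet>c y = (\<integral>k. (\<pi> (\<tau> k) *\<^sub>v x) \<bullet>c y \<partial>mK)"
    using rep_integral[OF rep mK(1) \<tau>_cont] by blast
  have Pc: "P *\<^sub>v x \<in> carrier_vec n" and Qc: "Q *\<^sub>v x \<in> carrier_vec n" if "x \<in> carrier_vec n" for x
    using P Q that by auto
  have Pfix: "fixed_vector K \<pi> (P *\<^sub>v x)" if x: "x \<in> carrier_vec n" for x
  proof (rule fixed_vectorI_cip[OF Pc[OF x] rep K_carrier])
    fix k and y :: "complex vec" assume k: "k \<in> K" and y: "y \<in> carrier_vec n"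
    have kc: "k \<in> carrier G"
      using k K_carrier by blast
    have "(P *\<^sub>v x) \<bullet>c (\<pi> (inv k) *\<^sub>v y) = (\<integral>h. (\<pi> h *\<^sub>v x) \<bullet>c (\<pi> (inv k) *\<^sub>v y) \<partial>mK)"
      by (rule Pxy[OF x rep_vec_carrier[OF rep inv_closed[OF kc] y]])
    also have "\<dots> = (\<integral>h. (\<pi> (k \<otimes> h) *\<^sub>v x) \<bullet>c y \<partial>mK)"
      by (rule Bochner_Integration.integral_cong)
        (use borel_prob_space[OF mK(1)] rep_vec_carrier[OF rep _ x] y in
          \<open>auto simp: rep_mult_vec[OF rep kc _ x] rep_cip_inv[OF rep kc _ y]\<close>)
    also have "\<dots> = (\<integral>h. (\<pi> h *\<^sub>v x) \<bullet>c y \<partial>mK)"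
      by (rule bi_invariant_integral(1)[OF mK(1,3) k kc coef_CC[OF rep x y]])
    also have "\<dots> = (P *\<^sub>v x) \<bullet>c y"
      by (rule Pxy[OF x y, symmetric])
    finally show "(P *\<^sub>v x) \<bullet>c (\<pi> (inv k) *\<^sub>v y) = (P *\<^sub>v x) \<bullet>c y" .
  qed
  have Qfix: "fixed_vector K \<pi> (Q *\<^sub>v x)" if x: "x \<in> carrier_vec n" for x
  proof (rule fixed_vectorI_cip[OF Qc[OF x] rep K_carrier])
    fix k and y :: "complex vec" assume k: "k \<in> K" and y: "y \<in> carrier_vec n"
    have kc: "k \<in> carrier G" and tk: "\<tau> k \<in> K" "\<tau> k \<in> carrier G"
      using k K_carrier \<tau>K by blast+
    have "(Q *\<^sub>v x) \<bullet>c (\<pi> (inv k) *\<^sub>v y) = (\<integral>h. (\<pi> (\<tau> h) *\<^sub>v x) \<bullet>c (\<pi> (inv k) *\<^sub>v y) \<partial>mK)"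
      by (rule Qxy[OF x rep_vec_carrier[OF rep inv_closed[OF kc] y]])
    also have "\<dots> = (\<integral>h. (\<pi> (\<tau> (h \<otimes> \<tau> k)) *\<^sub>v x) \<bullet>c y \<partial>mK)"
      by (rule Bochner_Integration.integral_cong)
        (use borel_prob_space[OF mK(1)] rep_vec_carrier[OF rep _ x] y \<tau>c tk in
          \<open>auto simp: \<tau>m \<tau>\<tau> kc rep_mult_vec[OF rep kc _ x] rep_cip_inv[OF rep kc _ y]\<close>)
    also have "\<dots> = (\<integral>h. (\<pi> (\<tau> h) *\<^sub>v x) \<bullet>c y \<partial>mK)"
      by (rule bi_invariant_integral(2)[OF mK(1,3) tk CC_comp[OF coef_CC[OF rep x y] \<tau>_cont]])
    also have "\<dots> = (Q *\<^sub>v x) \<bullet>c y"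
      by (rule Qxy[OF x y, symmetric])
    finally show "(Q *\<^sub>v x) \<bullet>c (\<pi> (inv k) *\<^sub>v y) = (Q *\<^sub>v x) \<bullet>c y" .
  qed
  have Pz: "(P *\<^sub>v x) \<bullet>c z = x \<bullet>c z" if "x \<in> carrier_vec n" "z \<in> carrier_vec n" "fixed_vector K \<pi> z" for x z
  proof -
    have "(P *\<^sub>v x) \<bullet>c z = (\<integral>k. x \<bullet>c z \<partial>mK)"
      unfolding Pxy[OF that(1,2)]
    proof (rule integral_cong_AE)
      show "AE k in mK. (\<pi> k *\<^sub>v x) \<bullet>c z = x \<bullet>c z"
        using AE_mK fixed_vector_cip[OF rep K_carrier that(2,3) _ that(1)] by auto
      show "(\<lambda>k. (\<pi> k *\<^sub>v x) \<bullet>c z) \<in> borel_measurable mK"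
        by (rule CC_measurable[OF mK(1) coef_CC[OF rep that(1,2)]])
    qed simp
    then show ?thesis
      by (simp add: MK.prob_space)
  qed
  have Qz: "(Q *\<^sub>v x) \<bullet>c z = x \<bullet>c z" if "x \<in> carrier_vec n" "z \<in> carrier_vec n" "fixed_vector K \<pi> z" for x z
  proof -
    have "(Q *\<^sub>v x) \<bullet>c z = (\<integral>k. x \<bullet>c z \<partial>mK)"
      unfolding Qxy[OF that(1,2)]
    proof (rule integral_cong_AE)
      show "AE k in mK. (\<pi> (\<tau> k) *\<^sub>v x) \<bullet>c z = x \<bullet>c z"
        using AE_mK fixed_vector_cip[OF rep K_carrier that(2,3) _ that(1)] \<tau>K by auto
      show "(\<lambda>k. (\<pi> (\<tau> k) *\<^sub>v x) \<bullet>c z) \<in> borel_measurable mK"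
        by (rule CC_measurable[OF mK(1) CC_comp[OF coef_CC[OF rep that(1,2)] \<tau>_cont]])
    qed simp
    then show ?thesis
      by (simp add: MK.prob_space)
  qed
  have PQ: "Q *\<^sub>v x = P *\<^sub>v x" if x: "x \<in> carrier_vec n" for x
    by (rule fixed_vector_eqI[OF rep Qc[OF x] Qfix[OF x] Pc[OF x] Pfix[OF x] K_carrier]) (simp add: Pz Qz x)
  \<comment> \<open>The compressions of \<open>\<pi> g\<close> and \<open>\<pi> h\<close> commute,
    tested on \<open>u\<close> and \<open>v\<close>: \<open>\<tau>\<close> reverses the product g k
    h, and its invisibility on fixed vectors then removes it from each factor.\<close>
  have sym: "(\<pi> g *\<^sub>v (P *\<^sub>v (\<pi> h *\<^sub>v u))) \<bullet>c v = (\<pi> h *\<^sub>v (P *\<^sub>v (\<pi> g *\<^sub>v u))) \<bullet>c v"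
    if g: "g \<in> carrier G" and h: "h \<in> carrier G" for g h
  proof -
    have hu: "\<pi> h *\<^sub>v u \<in> carrier_vec n" "\<pi> g *\<^sub>v u \<in> carrier_vec n" "\<pi> (\<tau> g) *\<^sub>v u \<in> carrier_vec n"
      using rep_vec_carrier[OF rep _ u(1)] g h \<tau>c by auto
    have gv: "\<pi> (inv g) *\<^sub>v v \<in> carrier_vec n" "\<pi> (inv (\<tau> h)) *\<^sub>v v \<in> carrier_vec n"
      using rep_vec_carrier[OF rep _ v(1)] g h \<tau>c by auto
    have "(\<pi> g *\<^sub>v (P *\<^sub>v (\<pi> h *\<^sub>v u))) \<bullet>c v = (P *\<^sub>v (\<pi> h *\<^sub>v u)) \<bullet>c (\<pi> (inv g) *\<^sub>v v)"
      by (rule rep_cip_inv[OF rep g Pc[OF hu(1)] v(1), symmetric])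
    also have "\<dots> = (\<integral>k. (\<pi> k *\<^sub>v (\<pi> h *\<^sub>v u)) \<bullet>c (\<pi> (inv g) *\<^sub>v v) \<partial>mK)"
      by (rule Pxy[OF hu(1) gv(1)])
    also have "\<dots> = (\<integral>k. (\<pi> (\<tau> k) *\<^sub>v (\<pi> (\<tau> g) *\<^sub>v u)) \<bullet>c (\<pi> (inv (\<tau> h)) *\<^sub>v v) \<partial>mK)"
    proof (rule Bochner_Integration.integral_cong[OF refl])
      fix k assume "k \<in> space mK"
      then have k: "k \<in> carrier G"
        using borel_prob_space[OF mK(1)] by simp
      have 1: "\<pi> (a \<otimes> (b \<otimes> c)) *\<^sub>v u = \<pi> a *\<^sub>v (\<pi> b *\<^sub>v (\<pi> c *\<^sub>v u))"
        if "a \<in> carrier G" "b \<in> carrier G" "c \<in> carrier G" for a b c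
        using that rep_mult_vec[OF rep _ _ u(1)] by simp
      have "(\<pi> k *\<^sub>v (\<pi> h *\<^sub>v u)) \<bullet>c (\<pi> (inv g) *\<^sub>v v) = (\<pi> g *\<^sub>v (\<pi> k *\<^sub>v (\<pi> h *\<^sub>v u))) \<bullet>c v"
        by (rule rep_cip_inv[OF rep g _ v(1)]) (rule rep_vec_carrier[OF rep k hu(1)])
      also have "\<dots> = (\<pi> (g \<otimes> (k \<otimes> h)) *\<^sub>v u) \<bullet>c v"
        using 1[OF g k h] by simp
      also have "\<dots> = (\<pi> (\<tau> (g \<otimes> (k \<otimes> h))) *\<^sub>v u) \<bullet>c v"
        by (rule \<tau>_fixed[OF u v, symmetric]) (use g k h in simp)
      also have "\<tau> (g \<otimes> (k \<otimes> h)) = \<tau> h \<otimes> (\<tau> k \<otimes> \<tau> g)"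
        using g k h \<tau>c by (simp add: \<tau>m m_assoc)
      also have "(\<pi> (\<tau> h \<otimes> (\<tau> k \<otimes> \<tau> g)) *\<^sub>v u) \<bullet>c v = (\<pi> (\<tau> h) *\<^sub>v (\<pi> (\<tau> k) *\<^sub>v (\<pi> (\<tau> g) *\<^sub>v u))) \<bullet>c v"
        using 1[OF \<tau>c[OF h] \<tau>c[OF k] \<tau>c[OF g]] by simp
      also have "\<dots> = (\<pi> (\<tau> k) *\<^sub>v (\<pi> (\<tau> g) *\<^sub>v u)) \<bullet>c (\<pi> (inv (\<tau> h)) *\<^sub>v v)"
        by (rule rep_cip_inv[OF rep \<tau>c[OF h] _ v(1), symmetric]) (rule rep_vec_carrier[OF rep \<tau>c[OF k] hu(3)])
      finally show "(\<pi> k *\<^sub>v (\<pi> h *\<^sub>v u)) \<bullet>c (\<pi> (inv g) *\<^sub>v v) = (\<pi> (\<tau> k) *\<^sub>v (\<pi> (\<tau> g) *\<^sub>v u)) \<bullet>c (\<pi> (inv (\<tau> h)) *\<^sub>v v)" .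
    qed
    also have "\<dots> = (Q *\<^sub>v (\<pi> (\<tau> g) *\<^sub>v u)) \<bullet>c (\<pi> (inv (\<tau> h)) *\<^sub>v v)"
      by (rule Qxy[OF hu(3) gv(2), symmetric])
    also have "\<dots> = (\<pi> (\<tau> h) *\<^sub>v (P *\<^sub>v (\<pi> (\<tau> g) *\<^sub>v u))) \<bullet>c v"
      unfolding PQ[OF hu(3)] by (rule rep_cip_inv[OF rep \<tau>c[OF h] Pc[OF hu(3)] v(1)])
    also have "\<dots> = (\<pi> h *\<^sub>v (P *\<^sub>v (\<pi> (\<tau> g) *\<^sub>v u))) \<bullet>c v"
      by (rule \<tau>_fixed[OF Pc[OF hu(3)] Pfix[OF hu(3)] v h])
    also have "P *\<^sub>v (\<pi> (\<tau> g) *\<^sub>v u) = P *\<^sub>v (\<pi> g *\<^sub>v u)"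
      by (rule fixed_vector_eqI[OF rep Pc[OF hu(3)] Pfix[OF hu(3)] Pc[OF hu(2)] Pfix[OF hu(2)] K_carrier])
        (simp add: Pz hu \<tau>_fixed[OF u _ _ g])
    finally show ?thesis .
  qed
  have zero: "(\<pi> h *\<^sub>v u) \<bullet>c v * (v \<bullet>c v) = 0" if h: "h \<in> carrier G" for h
  proof -
    have hu: "\<pi> h *\<^sub>v u \<in> carrier_vec n"
      by (rule rep_vec_carrier[OF rep h u(1)])
    \<comment> \<open>The adjoint moves everything except \<open>\<pi> g\<close> into the second
      slot, so that Schur orthogonality applies to both sides of \<open>sym\<close>: one side yields
      the coefficient at \<open>h\<close>, the other the factor
      \<open>u \<bullet>c v\<close>.\<close>
    define y where "y = madj (\<pi> h * P) *\<^sub>v v"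
    have hP: "\<pi> h * P \<in> carrier_mat n n"
      using unitary_repD(1)[OF rep h] P by simp
    have y: "y \<in> carrier_vec n"
      unfolding y_def by (rule mult_mat_vec_carrier[OF madj_carrier[OF hP] v(1)])
    have "((P *\<^sub>v (\<pi> h *\<^sub>v u)) \<bullet>c v) * (v \<bullet>c v) / of_nat n =
        (\<integral>g. ((\<pi> g *\<^sub>v (P *\<^sub>v (\<pi> h *\<^sub>v u))) \<bullet>c v) * cnj ((\<pi> g *\<^sub>v v) \<bullet>c v) \<partial>m)"
      by (rule schur_orthogonality_same[OF irr Pc[OF hu] v(1) v(1) v(1), symmetric])
    also have "\<dots> = (\<integral>g. ((\<pi> g *\<^sub>v u) \<bullet>c y) * cnj ((\<pi> g *\<^sub>v v) \<bullet>c v) \<partial>m)"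
    proof (rule Bochner_Integration.integral_cong[OF refl])
      fix g assume "g \<in> space m"
      then have g: "g \<in> carrier G"
        by (simp add: haar_space)
      have gu: "\<pi> g *\<^sub>v u \<in> carrier_vec n"
        by (rule rep_vec_carrier[OF rep g u(1)])
      have "(\<pi> h *\<^sub>v (P *\<^sub>v (\<pi> g *\<^sub>v u))) \<bullet>c v = ((\<pi> h * P) *\<^sub>v (\<pi> g *\<^sub>v u)) \<bullet>c v"
        using assoc_mult_mat_vec[OF unitary_repD(1)[OF rep h] P gu] by simp
      also have "\<dots> = (\<pi> g *\<^sub>v u) \<bullet>c y"
        unfolding y_def by (rule cip_madj[OF hP gu v(1)])
      finally show "((\<pi> g *\<^sub>v (P *\<^sub>v (\<pi> h *\<^sub>v u))) \<bullet>c v) * cnj ((\<pi> g *\<^sub>v v) \<bullet>c v) =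
          ((\<pi> g *\<^sub>v u) \<bullet>c y) * cnj ((\<pi> g *\<^sub>v v) \<bullet>c v)"
        using sym[OF g h] by simp
    qed
    also have "\<dots> = (u \<bullet>c v) * (v \<bullet>c y) / of_nat n"
      by (rule schur_orthogonality_same[OF irr u(1) v(1) y v(1)])
    finally show ?thesis
      using uv n Pz[OF hu v] by simp
  qed
  show ?thesis
  proof (rule ccontr)
    assume v0: "v \<noteq> 0\<^sub>v n"
    then have vv: "v \<bullet>c v \<noteq> 0"
      using cip_self_0[OF v(1)] by blast
    have uu: "u \<bullet>c u \<noteq> 0"
      using cip_self_0[OF u(1)] u0 by blast
    \<comment> \<open>The coefficient of \<open>u\<close> and \<open>v\<close> vanishes on the whole
      group, whereas Schur orthogonality computes its squared norm.\<close>
    have "(u \<bullet>c u) * (v \<bullet>c v) / of_nat n = (\<integral>g. ((\<pi> g *\<^sub>v u) \<bullet>c v) * cnj ((\<pi> g *\<^sub>v u) \<bullet>c v) \<partial>m)"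
      by (rule schur_orthogonality_same[OF irr u(1) u(1) v(1) v(1), symmetric])
    also have "\<dots> = (\<integral>g. 0 \<partial>m)"
      by (rule Bochner_Integration.integral_cong) (use zero vv in \<open>auto simp: haar_space\<close>)
    finally show False
      using uu vv n by simp
  qed
qed

text \<open>The component of \<open>w\<close> orthogonal to \<open>u\<close> is again fixed, hence
  zero.\<close>

lemma fixed_vector_multiple:
  assumes irr: "irreducible_unitary_rep G T n \<pi>" and u: "u \<in> carrier_vec n" "fixed_vector K \<pi> u" "u \<bullet>c u = 1"
    and w: "w \<in> carrier_vec n" "fixed_vector K \<pi> w"
  shows "w = (w \<bullet>c u) \<cdot>\<^sub>v u"
proof -
  have rep: "unitary_rep G T n \<pi>"
    using irr by (simp add: irreducible_unitary_rep_def)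
  define c where "c = w \<bullet>c u"
  define d where "d = w - c \<cdot>\<^sub>v u"
  have d: "d \<in> carrier_vec n"
    using w u by (simp add: d_def)
  have "fixed_vector K \<pi> d"
    unfolding fixed_vector_def
  proof
    fix k assume k: "k \<in> K"
    then have M: "\<pi> k \<in> carrier_mat n n"
      using unitary_repD(1)[OF rep] K_carrier by blast
    have "\<pi> k *\<^sub>v d = \<pi> k *\<^sub>v w - c \<cdot>\<^sub>v (\<pi> k *\<^sub>v u)"
      unfolding d_def using M w(1) u(1) by (simp add: mult_minus_distrib_mat_vec[OF M] mult_mat_vec[OF M])
    then show "\<pi> k *\<^sub>v d = d"
      using k u(2) w(2) by (simp add: fixed_vector_def d_def)
  qed
  moreover have "u \<bullet>c d = 0"
  proof -
    have "d \<bullet>c u = w \<bullet>c u - c * (u \<bullet>c u)"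
      using w(1) u(1) d by (simp add: cip_sum[of _ n] d_def left_diff_distrib sum_subtractf sum_distrib_left mult.assoc)
    then have "d \<bullet>c u = 0"
      by (simp add: c_def u(3))
    then show ?thesis
      using cip_swap[OF d u(1)] by simp
  qed
  moreover have "u \<noteq> 0\<^sub>v n"
    using u(3) by auto
  ultimately have "d = 0\<^sub>v n"
    using fixed_vectors_orthogonal_zero[OF irr u(1,2) d] by blast
  have "w $ i = (c \<cdot>\<^sub>v u) $ i" if "i < n" for i
  proof -
    have "d $ i = w $ i - (c \<cdot>\<^sub>v u) $ i"
      using that w(1) u(1) by (simp add: d_def)
    then show ?thesis
      using that \<open>d = 0\<^sub>v n\<close> by simp
  qed
  then show ?thesis
    unfolding c_def[symmetric] using w(1) u(1) by (intro eq_vecI) auto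
qed

end

section \<open>Matrix coefficients and the transition operators\<close>

text \<open>Orthonormality says that the matrix \<open>R\<close>, whose rows are the conjugated
  \<open>e j\<close>, satisfies \<open>R * madj R = 1\<^sub>m n\<close>. For square matrices the
  product in the other order is the identity too, and that is Parseval's identity.
  \<open>Suc\<close> translates to basis indices that start at 1.\<close>

lemma orthonormal_parseval:
  fixes e :: "nat \<Rightarrow> complex vec"
  assumes e: "\<And>j. j \<in> {1..n} \<Longrightarrow> e j \<in> carrier_vec n"
    and on: "\<And>i j. i \<in> {1..n} \<Longrightarrow> j \<in> {1..n} \<Longrightarrow> e i \<bullet>c e j = (if i = j then 1 else 0)"
    and a: "a \<in> carrier_vec n" and b: "b \<in> carrier_vec n"
  shows "a \<bullet>c b = (\<Sum>j=1..n. (a \<bullet>c e j) * cnj (b \<bullet>c e j))"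
proof -
  define R where "R = mat n n (\<lambda>(j, i). cnj (e (Suc j) $ i))"
  have R: "R \<in> carrier_mat n n"
    by (simp add: R_def)
  have eS: "e (Suc j) \<in> carrier_vec n" if "j < n" for j
    using e that by simp
  have Ra: "(R *\<^sub>v x) $ j = x \<bullet>c e (Suc j)" if "x \<in> carrier_vec n" "j < n" for x j
  proof -
    have "(R *\<^sub>v x) $ j = (\<Sum>i<n. x $ i * cnj (e (Suc j) $ i))"
      using that R by (auto simp: R_def scalar_prod_def atLeast0LessThan mult.commute intro!: sum.cong)
    then show ?thesis
      by (simp only: cip_sum[OF that(1) eS[OF that(2)]])
  qed
  have "R * madj R = 1\<^sub>m n"
  proof (rule eq_matI)
    fix j k assume "j < dim_row (1\<^sub>m n :: complex mat)" "k < dim_col (1\<^sub>m n :: complex mat)"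
    then have jk: "j < n" "k < n"
      by auto
    have "(R * madj R) $$ (j, k) = (\<Sum>i<n. e (Suc k) $ i * cnj (e (Suc j) $ i))"
      using jk by (auto simp: R_def madj_def scalar_prod_def atLeast0LessThan mult.commute intro!: sum.cong)
    also have "\<dots> = e (Suc k) \<bullet>c e (Suc j)"
      by (rule cip_sum[symmetric]) (use eS jk in auto)
    also have "\<dots> = 1\<^sub>m n $$ (j, k)"
      using on[of "Suc k" "Suc j"] jk by auto
    finally show "(R * madj R) $$ (j, k) = 1\<^sub>m n $$ (j, k)" .
  qed (use R in \<open>auto simp: madj_def\<close>)
  then have inv: "madj R * R = 1\<^sub>m n"
    by (rule mat_mult_left_right_inverse[OF R madj_carrier[OF R]])
  have Rb: "R *\<^sub>v b \<in> carrier_vec n" and Rac: "R *\<^sub>v a \<in> carrier_vec n"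
    using mult_mat_vec_carrier[OF R] a b by auto
  have "(R *\<^sub>v a) \<bullet>c (R *\<^sub>v b) = a \<bullet>c (madj R *\<^sub>v (R *\<^sub>v b))"
    by (rule cip_madj[OF R a Rb])
  also have "madj R *\<^sub>v (R *\<^sub>v b) = b"
    using assoc_mult_mat_vec[OF madj_carrier[OF R] R b] inv b by simp
  finally have "a \<bullet>c b = (\<Sum>j<n. (a \<bullet>c e (Suc j)) * cnj (b \<bullet>c e (Suc j)))"
    using Ra a b by (simp add: cip_sum[OF Rac Rb])
  also have "\<dots> = (\<Sum>j=1..n. (a \<bullet>c e j) * cnj (b \<bullet>c e j))"
    using sum.atLeast1_atMost_eq[of "\<lambda>j. (a \<bullet>c e j) * cnj (b \<bullet>c e j)" n] by simp
  finally show ?thesis .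
qed

context compact_group begin

text \<open>Left invariance puts the range of \<open>Q\<close> into the fixed vectors. Right
  invariance does the same for its adjoint, which means that \<open>Q\<close> vanishes on their
  orthogonal complement.\<close>

lemma bi_invariant_fixed:
  assumes rep: "unitary_rep G T n \<pi>" and K: "subgroup K G" and M: "borel_prob T M" "bi_invariant G K M"
    and Q: "Q \<in> carrier_mat n n"
    and Qxy: "\<And>x y. x \<in> carrier_vec n \<Longrightarrow> y \<in> carrier_vec n \<Longrightarrow> (Q *\<^sub>v x) \<bullet>c y = (\<integral>h. (\<pi> h *\<^sub>v x) \<bullet>c y \<partial>M)"
    and x: "x \<in> carrier_vec n"
  shows "fixed_vector K \<pi> (Q *\<^sub>v x)" "fixed_vector K \<pi> (madj Q *\<^sub>v x)"
proof -
  have KG: "K \<subseteq> carrier G"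
    by (rule subgroup.subset[OF K])
  have CCxy: "(\<lambda>h. (\<pi> h *\<^sub>v x) \<bullet>c y) \<in> CC" if "x \<in> carrier_vec n" "y \<in> carrier_vec n" for x y
    using rep_cip_continuous[OF rep that] by simp
  have Qx: "Q *\<^sub>v x \<in> carrier_vec n" "madj Q *\<^sub>v x \<in> carrier_vec n"
    using mult_mat_vec_carrier[OF Q x] mult_mat_vec_carrier[OF madj_carrier[OF Q] x] by auto
  show "fixed_vector K \<pi> (Q *\<^sub>v x)"
  proof (rule fixed_vectorI_cip[OF Qx(1) rep KG])
    fix k and y :: "complex vec" assume k: "k \<in> K" and y: "y \<in> carrier_vec n"
    have kc: "k \<in> carrier G"
      using k KG by blast
    have "(Q *\<^sub>v x) \<bullet>c (\<pi> (inv k) *\<^sub>v y) = (\<integral>h. (\<pi> h *\<^sub>v x) \<bullet>c (\<pi> (inv k) *\<^sub>v y) \<partial>M)"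
      by (rule Qxy[OF x rep_vec_carrier[OF rep inv_closed[OF kc] y]])
    also have "\<dots> = (\<integral>h. (\<pi> (k \<otimes> h) *\<^sub>v x) \<bullet>c y \<partial>M)"
      by (rule Bochner_Integration.integral_cong)
        (use borel_prob_space[OF M(1)] rep_vec_carrier[OF rep _ x] y in
          \<open>auto simp: rep_mult_vec[OF rep kc _ x] rep_cip_inv[OF rep kc _ y]\<close>)
    also have "\<dots> = (\<integral>h. (\<pi> h *\<^sub>v x) \<bullet>c y \<partial>M)"
      by (rule bi_invariant_integral(1)[OF M k kc CCxy[OF x y]])
    also have "\<dots> = (Q *\<^sub>v x) \<bullet>c y"
      by (rule Qxy[OF x y, symmetric])
    finally show "(Q *\<^sub>v x) \<bullet>c (\<pi> (inv k) *\<^sub>v y) = (Q *\<^sub>v x) \<bullet>c y" .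
  qed
  have Hxy: "(madj Q *\<^sub>v x) \<bullet>c y = cnj (\<integral>h. (\<pi> h *\<^sub>v y) \<bullet>c x \<partial>M)" if y: "y \<in> carrier_vec n" for y
    using cip_swap[OF y Qx(2)] cip_madj[OF Q y x] Qxy[OF y x] by simp
  show "fixed_vector K \<pi> (madj Q *\<^sub>v x)"
  proof (rule fixed_vectorI_cip[OF Qx(2) rep KG])
    fix k and y :: "complex vec" assume k: "k \<in> K" and y: "y \<in> carrier_vec n"
    have kc: "inv k \<in> K" "inv k \<in> carrier G"
      using subgroup.m_inv_closed[OF K k] KG by auto
    have "(\<integral>h. (\<pi> h *\<^sub>v (\<pi> (inv k) *\<^sub>v y)) \<bullet>c x \<partial>M) = (\<integral>h. (\<pi> (h \<otimes> inv k) *\<^sub>v y) \<bullet>c x \<partial>M)"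
      by (rule Bochner_Integration.integral_cong)
        (use borel_prob_space[OF M(1)] in \<open>auto simp: rep_mult_vec[OF rep _ kc(2) y]\<close>)
    also have "\<dots> = (\<integral>h. (\<pi> h *\<^sub>v y) \<bullet>c x \<partial>M)"
      by (rule bi_invariant_integral(2)[OF M kc CCxy[OF y x]])
    finally show "(madj Q *\<^sub>v x) \<bullet>c (\<pi> (inv k) *\<^sub>v y) = (madj Q *\<^sub>v x) \<bullet>c y"
      unfolding Hxy[OF y] Hxy[OF rep_vec_carrier[OF rep kc(2) y]] by simp
  qed
qed

end

context symmetric_haar_group begin

lemma translate_coef_integral:
  assumes rep: "unitary_rep G T n \<pi>" and x: "x \<in> carrier_vec n" and y: "y \<in> carrier_vec n" and g: "g \<in> carrier G"
    and M: "borel_prob T M" and Q: "Q \<in> carrier_mat n n"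
    and Qxy: "\<And>x y. x \<in> carrier_vec n \<Longrightarrow> y \<in> carrier_vec n \<Longrightarrow> (Q *\<^sub>v x) \<bullet>c y = (\<integral>h. (\<pi> h *\<^sub>v x) \<bullet>c y \<partial>M)"
  shows "(\<integral>h. (\<pi> (g \<otimes> h) *\<^sub>v x) \<bullet>c y \<partial>M) = (\<pi> g *\<^sub>v (Q *\<^sub>v x)) \<bullet>c y"
proof -
  have gy: "\<pi> (inv g) *\<^sub>v y \<in> carrier_vec n"
    by (rule rep_vec_carrier[OF rep inv_closed[OF g] y])
  have "(\<integral>h. (\<pi> (g \<otimes> h) *\<^sub>v x) \<bullet>c y \<partial>M) = (\<integral>h. (\<pi> h *\<^sub>v x) \<bullet>c (\<pi> (inv g) *\<^sub>v y) \<partial>M)"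
    by (rule Bochner_Integration.integral_cong)
      (use borel_prob_space[OF M] rep_vec_carrier[OF rep _ x] y in
        \<open>auto simp: rep_mult_vec[OF rep g _ x] rep_cip_inv[OF rep g _ y]\<close>)
  also have "\<dots> = (Q *\<^sub>v x) \<bullet>c (\<pi> (inv g) *\<^sub>v y)"
    by (rule Qxy[OF x gy, symmetric])
  also have "\<dots> = (\<pi> g *\<^sub>v (Q *\<^sub>v x)) \<bullet>c y"
    by (rule rep_cip_inv[OF rep g mult_mat_vec_carrier[OF Q x] y])
  finally show ?thesis .
qed

text \<open>Both \<open>Q *\<^sub>v x\<close> and \<open>madj Q *\<^sub>v u\<close> are multiples of
  the unit vector \<open>u\<close>, so \<open>Q\<close> is a multiple of the projection onto
  it.\<close>

lemma bi_invariant_coef_spherical: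
  assumes irr: "irreducible_unitary_rep G T n \<pi>" and M: "borel_prob T M" "bi_invariant G K M"
    and u: "u \<in> carrier_vec n" "fixed_vector K \<pi> u" "u \<bullet>c u = 1"
    and x: "x \<in> carrier_vec n" and y: "y \<in> carrier_vec n" and g: "g \<in> carrier G"
  shows "(\<integral>h. (\<pi> (g \<otimes> h) *\<^sub>v x) \<bullet>c y \<partial>M) = (x \<bullet>c u) * (\<integral>h. (\<pi> h *\<^sub>v u) \<bullet>c u \<partial>M) * ((\<pi> g *\<^sub>v u) \<bullet>c y)"
proof -
  have rep: "unitary_rep G T n \<pi>"
    using irr by (simp add: irreducible_unitary_rep_def)
  obtain Q where Q: "Q \<in> carrier_mat n n"
    and Qxy: "\<And>x y. x \<in> carrier_vec n \<Longrightarrow> y \<in> carrier_vec n \<Longrightarrow> (Q *\<^sub>v x) \<bullet>c y = (\<integral>h. (\<pi> h *\<^sub>v x) \<bullet>c y \<partial>M)"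
    using rep_integral[OF rep M(1), of "\<lambda>h. h"] by auto
  have Qx: "Q *\<^sub>v x \<in> carrier_vec n" and Hu: "madj Q *\<^sub>v u \<in> carrier_vec n"
    using mult_mat_vec_carrier[OF Q x] mult_mat_vec_carrier[OF madj_carrier[OF Q] u(1)] by auto
  have eqQ: "Q *\<^sub>v x = ((Q *\<^sub>v x) \<bullet>c u) \<cdot>\<^sub>v u"
    by (rule fixed_vector_multiple[OF irr u Qx bi_invariant_fixed(1)[OF rep K M Q Qxy x]])
  have eqH: "madj Q *\<^sub>v u = ((madj Q *\<^sub>v u) \<bullet>c u) \<cdot>\<^sub>v u"
    by (rule fixed_vector_multiple[OF irr u Hu bi_invariant_fixed(2)[OF rep K M Q Qxy u(1)]])
  have "(Q *\<^sub>v x) \<bullet>c u = x \<bullet>c (madj Q *\<^sub>v u)"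
    by (rule cip_madj[OF Q x u(1)])
  also have "\<dots> = x \<bullet>c (((madj Q *\<^sub>v u) \<bullet>c u) \<cdot>\<^sub>v u)"
    using eqH by simp
  also have "\<dots> = cnj ((madj Q *\<^sub>v u) \<bullet>c u) * (x \<bullet>c u)"
    by (rule cip_smult_right[OF x u(1)])
  also have "cnj ((madj Q *\<^sub>v u) \<bullet>c u) = (Q *\<^sub>v u) \<bullet>c u"
    using cip_swap[OF Hu u(1)] cip_madj[OF Q u(1) u(1)] by simp
  also have "\<dots> = (\<integral>h. (\<pi> h *\<^sub>v u) \<bullet>c u \<partial>M)"
    by (rule Qxy[OF u(1) u(1)])
  finally have c: "(Q *\<^sub>v x) \<bullet>c u = (\<integral>h. (\<pi> h *\<^sub>v u) \<bullet>c u \<partial>M) * (x \<bullet>c u)" .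
  have "(\<integral>h. (\<pi> (g \<otimes> h) *\<^sub>v x) \<bullet>c y \<partial>M) = (\<pi> g *\<^sub>v (((Q *\<^sub>v x) \<bullet>c u) \<cdot>\<^sub>v u)) \<bullet>c y"
    using translate_coef_integral[OF rep x y g M(1) Q Qxy] eqQ by simp
  also have "\<pi> g *\<^sub>v (((Q *\<^sub>v x) \<bullet>c u) \<cdot>\<^sub>v u) = ((Q *\<^sub>v x) \<bullet>c u) \<cdot>\<^sub>v (\<pi> g *\<^sub>v u)"
    by (rule mult_mat_vec[OF unitary_repD(1)[OF rep g] u(1)])
  also have "\<dots> \<bullet>c y = ((Q *\<^sub>v x) \<bullet>c u) * ((\<pi> g *\<^sub>v u) \<bullet>c y)"
    by (rule cip_smult_left[OF rep_vec_carrier[OF rep g u(1)] y])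
  finally show ?thesis
    unfolding c by (simp only: mult_ac)
qed

lemma bi_invariant_coef_nonspherical:
  assumes irr: "irreducible_unitary_rep G T n \<pi>" and M: "borel_prob T M" "bi_invariant G K M"
    and ns: "\<And>v. v \<in> carrier_vec n \<Longrightarrow> fixed_vector K \<pi> v \<Longrightarrow> v = 0\<^sub>v n"
    and x: "x \<in> carrier_vec n" and y: "y \<in> carrier_vec n" and g: "g \<in> carrier G"
  shows "(\<integral>h. (\<pi> (g \<otimes> h) *\<^sub>v x) \<bullet>c y \<partial>M) = 0"
proof -
  have rep: "unitary_rep G T n \<pi>"
    using irr by (simp add: irreducible_unitary_rep_def)
  obtain Q where Q: "Q \<in> carrier_mat n n"
    and Qxy: "\<And>x y. x \<in> carrier_vec n \<Longrightarrow> y \<in> carrier_vec n \<Longrightarrow> (Q *\<^sub>v x) \<bullet>c y = (\<integral>h. (\<pi> h *\<^sub>v x) \<bullet>c y \<partial>M)"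
    using rep_integral[OF rep M(1), of "\<lambda>h. h"] by auto
  have "Q *\<^sub>v x = 0\<^sub>v n"
    by (rule ns[OF mult_mat_vec_carrier[OF Q x] bi_invariant_fixed(1)[OF rep K M Q Qxy x]])
  then have "(\<integral>h. (\<pi> (g \<otimes> h) *\<^sub>v x) \<bullet>c y \<partial>M) = (\<pi> g *\<^sub>v 0\<^sub>v n) \<bullet>c y"
    using translate_coef_integral[OF rep x y g M(1) Q Qxy] by simp
  also have "\<dots> = 0"
    by (simp add: cip_mat[OF unitary_repD(1)[OF rep g] zero_carrier_vec y])
  finally show ?thesis .
qed

end

locale spherical_dual = symmetric_haar_group G T m K mK \<sigma>
  for G :: "('g, 'b) monoid_scheme" (structure) and T m K mK \<sigma> +
  fixes D :: "('g \<Rightarrow> complex mat) set" and e :: "('g \<Rightarrow> complex mat) \<Rightarrow> nat \<Rightarrow> complex vec"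
  assumes dual: "is_unitary_dual G T D" and bases: "adapted_bases G K D e"
begin

abbreviation d :: "('g \<Rightarrow> complex mat) \<Rightarrow> nat" where "d \<pi> \<equiv> rep_dim G \<pi>"

definition SD :: "('g \<Rightarrow> complex mat) set" where "SD = {\<pi> \<in> D. spherical G K \<pi>}"

lemma irr: "\<pi> \<in> D \<Longrightarrow> irreducible_unitary_rep G T (d \<pi>) \<pi>"
  using dual by (simp add: is_unitary_dual_def)

lemma rep: "\<pi> \<in> D \<Longrightarrow> unitary_rep G T (d \<pi>) \<pi>"
  using irr by (simp add: irreducible_unitary_rep_def)

lemma d_pos: "\<pi> \<in> D \<Longrightarrow> 0 < d \<pi>"
  using irr by (simp add: irreducible_unitary_rep_def)

lemma e_carrier: "\<pi> \<in> D \<Longrightarrow> j \<in> {1..d \<pi>} \<Longrightarrow> e \<pi> j \<in> carrier_vec (d \<pi>)"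
  using bases unfolding adapted_bases_def by blast

lemma e_orthonormal:
  "\<pi> \<in> D \<Longrightarrow> i \<in> {1..d \<pi>} \<Longrightarrow> j \<in> {1..d \<pi>} \<Longrightarrow> e \<pi> i \<bullet>c e \<pi> j = (if i = j then 1 else 0)"
  using bases unfolding adapted_bases_def by blast

lemma SD_D: "\<pi> \<in> SD \<Longrightarrow> \<pi> \<in> D"
  by (simp add: SD_def)

lemma one_in_d: "\<pi> \<in> D \<Longrightarrow> 1 \<in> {1..d \<pi>}"
  using d_pos by fastforce

lemma e1: "\<pi> \<in> D \<Longrightarrow> e \<pi> 1 \<in> carrier_vec (d \<pi>)" "\<pi> \<in> D \<Longrightarrow> e \<pi> 1 \<bullet>c e \<pi> 1 = 1"
  using e_carrier[OF _ one_in_d] e_orthonormal[OF _ one_in_d one_in_d] by auto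

lemma e1_fixed: "\<pi> \<in> SD \<Longrightarrow> fixed_vector K \<pi> (e \<pi> 1)"
  using bases unfolding adapted_bases_def SD_def by blast

text \<open>By reflexivity \<open>\<pi>\<close> represents its own class; an equivalent
  \<open>\<pi>'\<close> in \<open>D\<close> would be a second representative.\<close>

lemma not_equivalent: "\<pi> \<in> D \<Longrightarrow> \<pi>' \<in> D \<Longrightarrow> \<pi> \<noteq> \<pi>' \<Longrightarrow> \<not> unitarily_equivalent G \<pi> \<pi>'"
proof
  assume \<pi>: "\<pi> \<in> D" "\<pi>' \<in> D" "\<pi> \<noteq> \<pi>'" and eq: "unitarily_equivalent G \<pi> \<pi>'"
  have "unitarily_equivalent G \<pi> \<pi>"
  proof -
    have "1\<^sub>m (d \<pi>) * \<pi> g = \<pi> g * 1\<^sub>m (d \<pi>)" if "g \<in> carrier G" for g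
      using left_mult_one_mat[OF unitary_repD(1)[OF rep[OF \<pi>(1)] that]]
        right_mult_one_mat[OF unitary_repD(1)[OF rep[OF \<pi>(1)] that]] by simp
    then show ?thesis
      unfolding unitarily_equivalent_def by (intro conjI bexI[of _ "1\<^sub>m (d \<pi>)"]) auto
  qed
  then show False
    using dual irr[OF \<pi>(1)] \<pi> eq unfolding is_unitary_dual_def by blast
qed

text \<open>The conjugate appears because \<open>spherical_fun\<close> has the representation in the
  conjugate-linear slot and so is the conjugate of a matrix coefficient.\<close>

lemma bi_invariant_transition:
  assumes \<pi>: "\<pi> \<in> D" and M: "borel_prob T M" "bi_invariant G K M"
    and x: "x \<in> carrier_vec (d \<pi>)" and y: "y \<in> carrier_vec (d \<pi>)" and g: "g \<in> carrier G"
  shows "(\<integral>h. (\<pi> (g \<otimes> h) *\<^sub>v x) \<bullet>c y \<partial>M) =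
    (if \<pi> \<in> SD then (x \<bullet>c e \<pi> 1) * cnj (\<integral>h. spherical_fun e \<pi> h \<partial>M) * ((\<pi> g *\<^sub>v e \<pi> 1) \<bullet>c y) else 0)"
proof (cases "\<pi> \<in> SD")
  case True
  have "cnj (\<integral>h. spherical_fun e \<pi> h \<partial>M) = (\<integral>h. cnj (spherical_fun e \<pi> h) \<partial>M)"
    by (rule Bochner_Integration.integral_cnj[symmetric])
  also have "\<dots> = (\<integral>h. (\<pi> h *\<^sub>v e \<pi> 1) \<bullet>c e \<pi> 1 \<partial>M)"
    by (rule Bochner_Integration.integral_cong)
      (use borel_prob_space[OF M(1)] cip_swap[OF e1(1)[OF \<pi>] rep_vec_carrier[OF rep[OF \<pi>] _ e1(1)[OF \<pi>]]] in
        \<open>auto simp: spherical_fun_def\<close>)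
  finally show ?thesis
    using bi_invariant_coef_spherical[OF irr[OF \<pi>] M e1(1)[OF \<pi>] e1_fixed[OF True] e1(2)[OF \<pi>] x y g] True
    by simp
next
  case False
  then show ?thesis
    using bi_invariant_coef_nonspherical[OF irr[OF \<pi>] M _ x y g] \<pi> by (auto simp: SD_def spherical_def)
qed

end

section \<open>Operators with spherical kernels\<close>

lemma has_sum_eqI: "(f has_sum S) A \<Longrightarrow> (\<And>x. x \<in> A \<Longrightarrow> f x = g x) \<Longrightarrow> S = S' \<Longrightarrow> (g has_sum S') A"
  using has_sum_cong[of A f g] by simp

lemma has_sum_finite_sum:
  fixes f :: "'i \<Rightarrow> 'a \<Rightarrow> 'b::topological_comm_monoid_add"
  assumes "\<And>i. i \<in> I \<Longrightarrow> (f i has_sum s i) A"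
  shows "((\<lambda>x. \<Sum>i\<in>I. f i x) has_sum (\<Sum>i\<in>I. s i)) A"
  using assms by (induction I rule: infinite_finite_induct) (auto intro: has_sum_add)

context haar_group begin

lemma CC_infsum:
  assumes f: "\<And>i. i \<in> I \<Longrightarrow> f i \<in> CC" and M: "\<And>i x. i \<in> I \<Longrightarrow> x \<in> carrier G \<Longrightarrow> cmod (f i x) \<le> M i"
    and summ: "M summable_on I"
  shows "uniform_limit (carrier G) (\<lambda>X x. \<Sum>i\<in>X. f i x) (\<lambda>x. \<Sum>\<^sub>\<infinity>i\<in>I. f i x) (finite_subsets_at_top I)"
    and "(\<lambda>x. \<Sum>\<^sub>\<infinity>i\<in>I. f i x) \<in> CC"
proof -
  show u: "uniform_limit (carrier G) (\<lambda>X x. \<Sum>i\<in>X. f i x) (\<lambda>x. \<Sum>\<^sub>\<infinity>i\<in>I. f i x) (finite_subsets_at_top I)"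
    by (rule Weierstrass_m_test_general[OF M summ])
  have "\<forall>\<^sub>F X in finite_subsets_at_top I. (\<lambda>x. \<Sum>i\<in>X. f i x) \<in> CC"
    by (rule eventually_finite_subsets_at_top_weakI) (use f in \<open>auto intro!: CC_sum[simplified]\<close>)
  then show "(\<lambda>x. \<Sum>\<^sub>\<infinity>i\<in>I. f i x) \<in> CC"
    by (rule CC_uniform_limit[OF _ u]) simp
qed

text \<open>Sums over the dual are unordered, so the limit runs along finite subsets rather than
  along a sequence. Uniform convergence from the Weierstrass test takes the place of dominated
  convergence.\<close>

lemma has_sum_integral:
  fixes a :: "'g \<Rightarrow> complex"
  assumes a: "integrable m a" and f: "\<And>i. i \<in> I \<Longrightarrow> f i \<in> CC"
    and M: "\<And>i x. i \<in> I \<Longrightarrow> x \<in> carrier G \<Longrightarrow> cmod (f i x) \<le> M i"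
    and summ: "M summable_on I"
  shows "((\<lambda>i. \<integral>x. a x * f i x \<partial>m) has_sum (\<integral>x. a x * (\<Sum>\<^sub>\<infinity>i\<in>I. f i x) \<partial>m)) I"
  unfolding has_sum_def
proof (rule tendstoI)
  fix \<epsilon> :: real assume \<epsilon>: "0 < \<epsilon>"
  define A where "A = (\<integral>x. cmod (a x) \<partial>m)"
  have A: "0 \<le> A"
    by (simp add: A_def)
  define \<delta> where "\<delta> = \<epsilon> / (A + 1)"
  have \<delta>: "0 < \<delta>" "A * \<delta> < \<epsilon>"
    using A \<epsilon> by (auto simp: \<delta>_def field_simps)
  define s where "s x = (\<Sum>\<^sub>\<infinity>i\<in>I. f i x)" for x
  have s: "s \<in> CC"
    unfolding s_def[abs_def] by (rule CC_infsum(2)[OF f M summ])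
  have int: "integrable m (\<lambda>x. a x * g x)" if g: "g \<in> CC" for g
  proof -
    obtain B where B: "\<And>x. x \<in> carrier G \<Longrightarrow> cmod (g x) \<le> B"
      using CC_bounded[OF g] by blast
    show ?thesis
    proof (rule Bochner_Integration.integrable_bound)
      show "integrable m (\<lambda>x. a x * of_real B)"
        using a by simp
      show "(\<lambda>x. a x * g x) \<in> borel_measurable m"
        using a haar_CC_measurable[OF g] by measurable
      show "AE x in m. norm (a x * g x) \<le> norm (a x * of_real B)"
        using B by (intro AE_I2) (auto simp: haar_space norm_mult intro!: mult_left_mono order_trans[OF B abs_ge_self])
    qed
  qed
  have "\<forall>\<^sub>F X in finite_subsets_at_top I. \<forall>x\<in>carrier G. dist (\<Sum>i\<in>X. f i x) (s x) < \<delta>"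
    using CC_infsum(1)[OF f M summ] \<delta>(1) unfolding uniform_limit_iff s_def by blast
  moreover have "\<forall>\<^sub>F X in finite_subsets_at_top I. finite X \<and> X \<subseteq> I"
    by (rule eventually_finite_subsets_at_top_weakI) auto
  ultimately have "\<forall>\<^sub>F X in finite_subsets_at_top I. dist (\<Sum>i\<in>X. \<integral>x. a x * f i x \<partial>m) (\<integral>x. a x * s x \<partial>m) < \<epsilon>"
  proof eventually_elim
    case (elim X)
    have SC: "(\<lambda>x. \<Sum>i\<in>X. f i x) \<in> CC"
      by (rule CC_sum) (use f elim in auto)
    have "(\<Sum>i\<in>X. \<integral>x. a x * f i x \<partial>m) = (\<integral>x. a x * (\<Sum>i\<in>X. f i x) \<partial>m)"
      unfolding sum_distrib_left
      by (rule Bochner_Integration.integral_sum[symmetric]) (use elim f int in blast)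
    then have "(\<Sum>i\<in>X. \<integral>x. a x * f i x \<partial>m) - (\<integral>x. a x * s x \<partial>m) = (\<integral>x. a x * ((\<Sum>i\<in>X. f i x) - s x) \<partial>m)"
      using int[OF SC] int[OF s] by (simp add: right_diff_distrib)
    also have "cmod \<dots> \<le> (\<integral>x. cmod (a x) * \<delta> \<partial>m)"
    proof (rule norm_integral_le)
      show "integrable m (\<lambda>x. a x * ((\<Sum>i\<in>X. f i x) - s x))"
        by (rule int[OF CC_diff[OF SC s]])
      show "integrable m (\<lambda>x. cmod (a x) * \<delta>)"
        using a by simp
      show "norm (a x * ((\<Sum>i\<in>X. f i x) - s x)) \<le> cmod (a x) * \<delta>" if "x \<in> space m" for x
        unfolding norm_mult
        by (rule mult_left_mono) (use elim that in \<open>auto simp: haar_space dist_norm intro: less_imp_le\<close>)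
    qed
    also have "\<dots> = A * \<delta>"
      by (simp add: A_def)
    finally show ?case
      using \<delta>(2) by (simp add: dist_norm)
  qed
  then show "\<forall>\<^sub>F X in finite_subsets_at_top I. dist (\<Sum>i\<in>X. \<integral>x. a x * f i x \<partial>m) (\<integral>x. a x * (\<Sum>\<^sub>\<infinity>i\<in>I. f i x) \<partial>m) < \<epsilon>"
    by (simp add: s_def)
qed

end

context spherical_dual begin

abbreviation \<phi> :: "('g \<Rightarrow> complex mat) \<Rightarrow> 'g \<Rightarrow> complex" where "\<phi> \<equiv> spherical_fun e"

text \<open>The factor is the one that makes these coefficients orthonormal under Schur's
  relations.\<close>

definition u :: "('g \<Rightarrow> complex mat) \<Rightarrow> nat \<Rightarrow> 'g \<Rightarrow> complex" where
  "u \<pi> j g = of_real (sqrt (d \<pi>)) * matrix_coeff e \<pi> 1 j g"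

text \<open>Kernel of the operator that multiplies the span of the \<open>u \<pi> j\<close> by
  \<open>c \<pi>\<close> for each spherical \<open>\<pi>\<close> and vanishes on the orthogonal
  complement of these spans.\<close>

definition kern :: "(('g \<Rightarrow> complex mat) \<Rightarrow> complex) \<Rightarrow> 'g \<Rightarrow> complex" where
  "kern c x = (\<Sum>\<^sub>\<infinity>\<pi>\<in>SD. of_nat (d \<pi>) * c \<pi> * \<phi> \<pi> x)"

definition kern_op :: "(('g \<Rightarrow> complex mat) \<Rightarrow> complex) \<Rightarrow> ('g \<Rightarrow> complex) \<Rightarrow> 'g \<Rightarrow> complex" where
  "kern_op c f g = (\<integral>h. f h * kern c (inv g \<otimes> h) \<partial>m)"

definition coeff_summable :: "(('g \<Rightarrow> complex mat) \<Rightarrow> complex) \<Rightarrow> bool" where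
  "coeff_summable c \<longleftrightarrow> (\<lambda>\<pi>. real (d \<pi>) * cmod (c \<pi>)) summable_on SD"

lemma coef_e_CC: "\<pi> \<in> D \<Longrightarrow> j \<in> {1..d \<pi>} \<Longrightarrow> matrix_coeff e \<pi> 1 j \<in> CC"
  unfolding matrix_coeff_def[abs_def] by (rule coef_CC[OF rep e1(1) e_carrier])

lemma u_CC: "\<pi> \<in> D \<Longrightarrow> j \<in> {1..d \<pi>} \<Longrightarrow> u \<pi> j \<in> CC"
  unfolding u_def[abs_def] by (intro CC_mult CC_const coef_e_CC)

lemma \<phi>_cnj: "\<pi> \<in> D \<Longrightarrow> x \<in> carrier G \<Longrightarrow> \<phi> \<pi> x = cnj (matrix_coeff e \<pi> 1 1 x)"
  unfolding spherical_fun_def matrix_coeff_def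
  by (rule cip_swap[where n = "d \<pi>", symmetric]) (use rep_vec_carrier[OF rep _ e1(1)] e1(1) in auto)

lemma \<phi>_CC: "\<pi> \<in> D \<Longrightarrow> \<phi> \<pi> \<in> CC"
  by (rule CC_cong[OF CC_cnj[OF coef_e_CC[OF _ one_in_d]] \<phi>_cnj])

lemma \<phi>_one:
  assumes "\<pi> \<in> D"
  shows "\<phi> \<pi> \<one> = 1"
  unfolding spherical_fun_def rep_one_vec[OF rep[OF assms] e1(1)[OF assms]] by (rule e1(2)[OF assms])

lemma \<phi>_le_1:
  assumes \<pi>: "\<pi> \<in> D" and x: "x \<in> carrier G"
  shows "cmod (\<phi> \<pi> x) \<le> 1"
proof -
  let ?a = "\<pi> x *\<^sub>v e \<pi> 1"
  have a: "?a \<in> carrier_vec (d \<pi>)"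
    by (rule rep_vec_carrier[OF rep[OF \<pi>] x e1(1)[OF \<pi>]])
  have "?a \<bullet>c ?a = (\<Sum>j=1..d \<pi>. (?a \<bullet>c e \<pi> j) * cnj (?a \<bullet>c e \<pi> j))"
    by (rule orthonormal_parseval[OF e_carrier[OF \<pi>] e_orthonormal[OF \<pi>] a a])
  also have "\<dots> = of_real (\<Sum>j=1..d \<pi>. (cmod (?a \<bullet>c e \<pi> j))\<^sup>2)"
    unfolding of_real_sum complex_norm_square ..
  finally have "of_real (\<Sum>j=1..d \<pi>. (cmod (?a \<bullet>c e \<pi> j))\<^sup>2) = (1 :: complex)"
    using unitary_repD(4)[OF rep[OF \<pi>] x e1(1)[OF \<pi>] e1(1)[OF \<pi>]] e1(2)[OF \<pi>] by simp
  then have "(\<Sum>j=1..d \<pi>. (cmod (?a \<bullet>c e \<pi> j))\<^sup>2) = 1"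
    using of_real_eq_1_iff by blast
  moreover have "(cmod (?a \<bullet>c e \<pi> 1))\<^sup>2 \<le> (\<Sum>j=1..d \<pi>. (cmod (?a \<bullet>c e \<pi> j))\<^sup>2)"
    by (rule member_le_sum) (use one_in_d[OF \<pi>] in auto)
  ultimately have "(cmod (?a \<bullet>c e \<pi> 1))\<^sup>2 \<le> 1\<^sup>2"
    by simp
  then have "cmod (?a \<bullet>c e \<pi> 1) \<le> 1"
    by (rule power2_le_imp_le) simp
  then show ?thesis
    using \<phi>_cnj[OF \<pi> x] by (simp add: matrix_coeff_def)
qed

text \<open>The reproducing kernel of the span of the \<open>u \<pi> j\<close>. By Parseval it is an
  inner product of two translates of \<open>e \<pi> 1\<close>, so it depends on
  \<open>inv g \<otimes> h\<close> alone.\<close>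

lemma u_kernel:
  assumes \<pi>: "\<pi> \<in> D" and g: "g \<in> carrier G" and h: "h \<in> carrier G"
  shows "(\<Sum>j=1..d \<pi>. u \<pi> j g * cnj (u \<pi> j h)) = of_nat (d \<pi>) * \<phi> \<pi> (inv g \<otimes> h)"
proof -
  let ?a = "\<pi> g *\<^sub>v e \<pi> 1" and ?b = "\<pi> h *\<^sub>v e \<pi> 1"
  have a: "?a \<in> carrier_vec (d \<pi>)" and b: "?b \<in> carrier_vec (d \<pi>)"
    using rep_vec_carrier[OF rep[OF \<pi>] _ e1(1)[OF \<pi>]] g h by auto
  have s: "complex_of_real (sqrt (d \<pi>)) * complex_of_real (sqrt (d \<pi>)) = of_nat (d \<pi>)"
    by (simp flip: of_real_mult)
  have "(\<Sum>j=1..d \<pi>. u \<pi> j g * cnj (u \<pi> j h)) =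
      (\<Sum>j=1..d \<pi>. complex_of_real (sqrt (d \<pi>)) * complex_of_real (sqrt (d \<pi>)) * ((?a \<bullet>c e \<pi> j) * cnj (?b \<bullet>c e \<pi> j)))"
    by (rule sum.cong) (auto simp: u_def matrix_coeff_def)
  also have "\<dots> = of_nat (d \<pi>) * (?a \<bullet>c ?b)"
    unfolding s sum_distrib_left[symmetric]
    by (subst orthonormal_parseval[OF e_carrier[OF \<pi>] e_orthonormal[OF \<pi>] a b]) auto
  also have "?a \<bullet>c ?b = e \<pi> 1 \<bullet>c (\<pi> (inv g) *\<^sub>v ?b)"
    by (rule rep_cip_inv[OF rep[OF \<pi>] g e1(1)[OF \<pi>] b, symmetric])
  also have "\<pi> (inv g) *\<^sub>v ?b = \<pi> (inv g \<otimes> h) *\<^sub>v e \<pi> 1"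
    using rep_mult_vec[OF rep[OF \<pi>] inv_closed[OF g] h e1(1)[OF \<pi>]] by simp
  finally show ?thesis
    by (simp add: spherical_fun_def)
qed

lemma u_orthonormal:
  assumes "\<pi> \<in> D" "\<pi>' \<in> D" "j \<in> {1..d \<pi>}" "k \<in> {1..d \<pi>'}"
  shows "L2_inner m (u \<pi> j) (u \<pi>' k) = (if \<pi> = \<pi>' \<and> j = k then 1 else 0)"
proof -
  have "L2_inner m (u \<pi> j) (u \<pi>' k) = of_real (sqrt (d \<pi>)) * (of_real (sqrt (d \<pi>')) *
      (\<integral>g. ((\<pi> g *\<^sub>v e \<pi> 1) \<bullet>c e \<pi> j) * cnj ((\<pi>' g *\<^sub>v e \<pi>' 1) \<bullet>c e \<pi>' k) \<partial>m))"
    unfolding u_def[abs_def] L2_inner_mult_left L2_inner_mult_right by (simp add: L2_inner_def matrix_coeff_def)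
  also have "\<dots> = (if \<pi> = \<pi>' \<and> j = k then 1 else 0)"
  proof (cases "\<pi> = \<pi>'")
    case True
    have "(\<integral>g. ((\<pi> g *\<^sub>v e \<pi> 1) \<bullet>c e \<pi> j) * cnj ((\<pi> g *\<^sub>v e \<pi> 1) \<bullet>c e \<pi> k) \<partial>m) = (e \<pi> 1 \<bullet>c e \<pi> 1) * (e \<pi> k \<bullet>c e \<pi> j) / of_nat (d \<pi>)"
      by (rule schur_orthogonality_same[OF irr]) (use assms True e1 e_carrier in auto)
    then show ?thesis
      using True assms e1(2) e_orthonormal[of \<pi> k j] d_pos by (auto simp flip: of_real_mult mult.assoc)
  next
    case False
    have "(\<integral>g. ((\<pi> g *\<^sub>v e \<pi> 1) \<bullet>c e \<pi> j) * cnj ((\<pi>' g *\<^sub>v e \<pi>' 1) \<bullet>c e \<pi>' k) \<partial>m) = 0"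
      by (rule schur_orthogonality_different[OF irr irr not_equivalent]) (use assms False e1 e_carrier in auto)
    then show ?thesis
      using False by simp
  qed
  finally show ?thesis .
qed

lemma kern_term:
  assumes "\<pi> \<in> SD" "x \<in> carrier G"
  shows "cmod (of_nat (d \<pi>) * c \<pi> * \<phi> \<pi> x) \<le> real (d \<pi>) * cmod (c \<pi>)"
  using mult_left_mono[OF \<phi>_le_1[OF SD_D[OF assms(1)] assms(2)], of "real (d \<pi>) * cmod (c \<pi>)"]
  by (simp add: norm_mult)

lemma kern_term_CC: "\<pi> \<in> SD \<Longrightarrow> (\<lambda>x. of_nat (d \<pi>) * c \<pi> * \<phi> \<pi> x) \<in> CC"
  by (intro CC_mult CC_const \<phi>_CC SD_D)

lemma kern_CC: "coeff_summable c \<Longrightarrow> kern c \<in> CC"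
  unfolding kern_def[abs_def] coeff_summable_def by (rule CC_infsum(2)[OF kern_term_CC kern_term])

lemma kern_op_conv:
  assumes g: "g \<in> carrier G"
  shows "kern_op c f g = conv f (\<lambda>x. kern c (inv x)) g"
  unfolding kern_op_def conv_def
  by (rule Bochner_Integration.integral_cong) (use g in \<open>auto simp: haar_space inv_mult_group\<close>)

lemma kern_op_CC:
  assumes c: "coeff_summable c" and f: "f \<in> L2 m"
  shows "kern_op c f \<in> CC"
  by (rule CC_cong[OF conv_CC[OF f CC_comp[OF kern_CC[OF c] continuous_inv]] kern_op_conv])

lemma kern_op_bounded:
  assumes c: "coeff_summable c"
  shows "L2_bounded_operator m (kern_op c)"
  unfolding L2_bounded_operator_def
proof (intro conjI ballI allI exI[of _ "L2_norm m (kern c)"])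
  let ?k = "\<lambda>x. kern c (inv x)"
  have k: "?k \<in> CC"
    by (rule CC_comp[OF kern_CC[OF c] continuous_inv])
  have kn: "L2_norm m ?k = L2_norm m (kern c)"
    by (rule L2_inv(2)[OF haar_CC_L2[OF kern_CC[OF c]]])
  show "kern_op c f \<in> L2 m" if "f \<in> L2 m" for f
    by (rule haar_CC_L2[OF kern_op_CC[OF c that]])
  show "L2_norm m (kern_op c f) \<le> L2_norm m (kern c) * L2_norm m f" if f: "f \<in> L2 m" for f
  proof -
    have "cmod (kern_op c f g) \<le> L2_norm m f * L2_norm m (kern c)" if "g \<in> space m" for g
      using conv_bound[OF f haar_CC_L2[OF k], of g] kern_op_conv[of g] that kn by (simp add: haar_space)
    then have "L2_norm m (kern_op c f) \<le> \<bar>L2_norm m f * L2_norm m (kern c)\<bar>"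
      by (rule L2_bounded(2)[OF haar_CC_measurable[OF kern_op_CC[OF c f]]])
    then show ?thesis
      by (simp add: L2_norm_nonneg mult.commute)
  qed
  show "AE x in m. kern_op c (\<lambda>y. a * f y + b * g y) x = a * kern_op c f x + b * kern_op c g x"
    if f: "f \<in> L2 m" and g: "g \<in> L2 m" for f g a b
  proof (rule AE_I2)
    fix x assume "x \<in> space m"
    then have x: "x \<in> carrier G"
      by (simp add: haar_space)
    have i: "integrable m (\<lambda>h. f' h * ?k (inv h \<otimes> x))" if "f' \<in> L2 m" for f'
      by (rule conv_integrable[OF that haar_CC_L2[OF k] x])
    show "kern_op c (\<lambda>y. a * f y + b * g y) x = a * kern_op c f x + b * kern_op c g x"
      unfolding kern_op_conv[OF x] conv_def using i[OF f] i[OF g] by (simp add: distrib_right mult.assoc)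
  qed
qed

lemma projection_integral:
  assumes \<pi>: "\<pi> \<in> D" and f: "f \<in> L2 m" and g: "g \<in> carrier G"
  shows "(\<integral>h. f h * (of_nat (d \<pi>) * a * \<phi> \<pi> (inv g \<otimes> h)) \<partial>m) = a * (\<Sum>j=1..d \<pi>. L2_inner m f (u \<pi> j) * u \<pi> j g)"
proof -
  have i: "integrable m (\<lambda>h. f h * cnj (u \<pi> j h))" if "j \<in> {1..d \<pi>}" for j
    by (rule L2_inner_integrable[OF f haar_CC_L2[OF u_CC[OF \<pi> that]]])
  have "(\<integral>h. f h * (of_nat (d \<pi>) * a * \<phi> \<pi> (inv g \<otimes> h)) \<partial>m) = (\<integral>h. (\<Sum>j=1..d \<pi>. a * u \<pi> j g * (f h * cnj (u \<pi> j h))) \<partial>m)"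
  proof (rule Bochner_Integration.integral_cong[OF refl])
    fix h assume "h \<in> space m"
    then have h: "h \<in> carrier G"
      by (simp add: haar_space)
    have "f h * (of_nat (d \<pi>) * a * \<phi> \<pi> (inv g \<otimes> h)) = f h * a * (of_nat (d \<pi>) * \<phi> \<pi> (inv g \<otimes> h))"
      by (simp add: mult_ac)
    also have "\<dots> = f h * a * (\<Sum>j=1..d \<pi>. u \<pi> j g * cnj (u \<pi> j h))"
      by (simp only: u_kernel[OF \<pi> g h])
    finally show "f h * (of_nat (d \<pi>) * a * \<phi> \<pi> (inv g \<otimes> h)) = (\<Sum>j=1..d \<pi>. a * u \<pi> j g * (f h * cnj (u \<pi> j h)))"
      by (simp add: sum_distrib_left mult_ac)
  qed
  also have "\<dots> = (\<Sum>j=1..d \<pi>. \<integral>h. a * u \<pi> j g * (f h * cnj (u \<pi> j h)) \<partial>m)"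
    by (rule Bochner_Integration.integral_sum) (use i in auto)
  also have "\<dots> = (\<Sum>j=1..d \<pi>. a * u \<pi> j g * L2_inner m f (u \<pi> j))"
    by (simp add: L2_inner_def)
  finally show ?thesis
    by (simp add: sum_distrib_left mult_ac)
qed

lemma kern_op_has_sum:
  assumes c: "coeff_summable c" and f: "f \<in> L2 m" and g: "g \<in> carrier G"
  shows "((\<lambda>\<pi>. c \<pi> * (\<Sum>j=1..d \<pi>. L2_inner m f (u \<pi> j) * u \<pi> j g)) has_sum kern_op c f g) SD"
proof -
  have "((\<lambda>\<pi>. \<integral>h. f h * (of_nat (d \<pi>) * c \<pi> * \<phi> \<pi> (inv g \<otimes> h)) \<partial>m) has_sum
      (\<integral>h. f h * (\<Sum>\<^sub>\<infinity>\<pi>\<in>SD. of_nat (d \<pi>) * c \<pi> * \<phi> \<pi> (inv g \<otimes> h)) \<partial>m)) SD"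
  proof (rule has_sum_integral[OF L2_integrable[OF f]])
    show "(\<lambda>h. of_nat (d \<pi>) * c \<pi> * \<phi> \<pi> (inv g \<otimes> h)) \<in> CC" if "\<pi> \<in> SD" for \<pi>
      by (rule CC_comp[OF kern_term_CC[OF that] continuous_left_mult]) (use g in simp)
    show "cmod (of_nat (d \<pi>) * c \<pi> * \<phi> \<pi> (inv g \<otimes> x)) \<le> real (d \<pi>) * cmod (c \<pi>)" if "\<pi> \<in> SD" "x \<in> carrier G" for \<pi> x
      by (rule kern_term) (use that g in auto)
  qed (use c in \<open>simp add: coeff_summable_def\<close>)
  then show ?thesis
  proof (rule has_sum_eqI)
    show "(\<integral>h. f h * (of_nat (d \<pi>) * c \<pi> * \<phi> \<pi> (inv g \<otimes> h)) \<partial>m) =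
      c \<pi> * (\<Sum>j=1..d \<pi>. L2_inner m f (u \<pi> j) * u \<pi> j g)" if "\<pi> \<in> SD" for \<pi>
    by (rule projection_integral[OF SD_D[OF that] f g])
  qed (simp add: kern_op_def kern_def)
qed

lemma kern_op_inner:
  assumes c: "coeff_summable c" and f: "f \<in> L2 m" and f': "f' \<in> L2 m"
  shows "((\<lambda>\<pi>. c \<pi> * (\<Sum>j=1..d \<pi>. L2_inner m f (u \<pi> j) * L2_inner m (u \<pi> j) f')) has_sum
    L2_inner m (kern_op c f) f') SD"
proof -
  define F where "F \<pi> g = c \<pi> * (\<Sum>j=1..d \<pi>. L2_inner m f (u \<pi> j) * u \<pi> j g)" for \<pi> g
  have FC: "F \<pi> \<in> CC" if "\<pi> \<in> SD" for \<pi>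
    unfolding F_def[abs_def] by (intro CC_mult CC_const CC_sum u_CC SD_D that)
  \<comment> \<open>The bound is independent of \<open>g\<close> and summable over the dual, as
    \<open>has_sum_integral\<close> requires; it comes from reading \<open>F\<close> as an integral
    against one term of the kernel.\<close>
  have Fb: "cmod (F \<pi> g) \<le> real (d \<pi>) * cmod (c \<pi>) * L2_norm m f" if \<pi>: "\<pi> \<in> SD" and g: "g \<in> carrier G" for \<pi> g
  proof -
    let ?h = "\<lambda>h. of_nat (d \<pi>) * c \<pi> * \<phi> \<pi> (inv g \<otimes> h)"
    have hC: "?h \<in> CC"
      by (rule CC_comp[OF kern_term_CC[OF \<pi>] continuous_left_mult]) (use g in simp)
    have "cmod (\<integral>h. f h * ?h h \<partial>m) \<le> (\<integral>h. cmod (f h) * (real (d \<pi>) * cmod (c \<pi>)) \<partial>m)"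
    proof (rule norm_integral_le)
      show "integrable m (\<lambda>h. f h * ?h h)"
        using L2_inner_integrable[OF f haar_CC_L2[OF CC_cnj[OF hC]]] by simp
      show "integrable m (\<lambda>h. cmod (f h) * (real (d \<pi>) * cmod (c \<pi>)))"
        using L2_integrable[OF f] by simp
      show "norm (f h * ?h h) \<le> cmod (f h) * (real (d \<pi>) * cmod (c \<pi>))" if "h \<in> space m" for h
        unfolding norm_mult[of "f h"]
        by (rule mult_left_mono[OF kern_term[OF \<pi>]]) (use that g in \<open>auto simp: haar_space\<close>)
    qed
    also have "\<dots> = (\<integral>h. cmod (f h) \<partial>m) * (real (d \<pi>) * cmod (c \<pi>))"
      by simp
    also have "\<dots> \<le> L2_norm m f * (real (d \<pi>) * cmod (c \<pi>))"
      by (intro mult_right_mono L1_le_L2_norm f) simp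
    finally show ?thesis
      unfolding projection_integral[OF SD_D[OF \<pi>] f g] F_def by (simp add: mult_ac)
  qed
  have hs: "((\<lambda>\<pi>. \<integral>g. cnj (f' g) * F \<pi> g \<partial>m) has_sum (\<integral>g. cnj (f' g) * (\<Sum>\<^sub>\<infinity>\<pi>\<in>SD. F \<pi> g) \<partial>m)) SD"
  proof (rule has_sum_integral[OF _ FC Fb])
    show "integrable m (\<lambda>g. cnj (f' g))"
      using L2_integrable[OF f'] by simp
    show "(\<lambda>\<pi>. real (d \<pi>) * cmod (c \<pi>) * L2_norm m f) summable_on SD"
      by (rule summable_on_cmult_left) (use c in \<open>simp add: coeff_summable_def\<close>)
  qed
  have eq: "(\<integral>g. cnj (f' g) * (\<Sum>\<^sub>\<infinity>\<pi>\<in>SD. F \<pi> g) \<partial>m) = L2_inner m (kern_op c f) f'"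
    unfolding L2_inner_def
  proof (rule Bochner_Integration.integral_cong[OF refl])
    fix g assume "g \<in> space m"
    then have "(\<Sum>\<^sub>\<infinity>\<pi>\<in>SD. F \<pi> g) = kern_op c f g"
      using infsumI[OF kern_op_has_sum[OF c f, of g]] by (simp add: F_def haar_space)
    then show "cnj (f' g) * (\<Sum>\<^sub>\<infinity>\<pi>\<in>SD. F \<pi> g) = kern_op c f g * cnj (f' g)"
      by (simp add: mult.commute)
  qed
  have teq: "(\<integral>g. cnj (f' g) * F \<pi> g \<partial>m) = c \<pi> * (\<Sum>j=1..d \<pi>. L2_inner m f (u \<pi> j) * L2_inner m (u \<pi> j) f')"
    if \<pi>: "\<pi> \<in> SD" for \<pi>
  proof -
    have uL: "u \<pi> j \<in> L2 m" if "j \<in> {1..d \<pi>}" for j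
      by (rule haar_CC_L2[OF u_CC[OF SD_D[OF \<pi>] that]])
    have "(\<integral>g. cnj (f' g) * F \<pi> g \<partial>m) = L2_inner m (\<lambda>g. c \<pi> * (\<Sum>j=1..d \<pi>. L2_inner m f (u \<pi> j) * u \<pi> j g)) f'"
      unfolding L2_inner_def[of _ "\<lambda>g. c \<pi> * _ g"] F_def by (simp only: mult.commute)
    also have "\<dots> = c \<pi> * (\<Sum>j=1..d \<pi>. L2_inner m f (u \<pi> j) * L2_inner m (u \<pi> j) f')"
      unfolding L2_inner_mult_left by (subst L2_inner_sum_left) (use uL f' in auto)
    finally show ?thesis .
  qed
  show ?thesis
    by (rule has_sum_eqI[OF hs teq eq])
qed

lemma kern_op_coeff:
  assumes c: "coeff_summable c" and f: "f \<in> L2 m" and \<pi>: "\<pi> \<in> SD" and k: "k \<in> {1..d \<pi>}"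
  shows "L2_inner m (kern_op c f) (u \<pi> k) = c \<pi> * L2_inner m f (u \<pi> k)"
proof -
  have uL: "u \<pi> k \<in> L2 m"
    by (rule haar_CC_L2[OF u_CC[OF SD_D[OF \<pi>] k]])
  have "((\<lambda>\<pi>'. c \<pi>' * (\<Sum>j=1..d \<pi>'. L2_inner m f (u \<pi>' j) * L2_inner m (u \<pi>' j) (u \<pi> k))) has_sum
      L2_inner m (kern_op c f) (u \<pi> k)) SD"
    by (rule kern_op_inner[OF c f uL])
  moreover have "((\<lambda>\<pi>'. c \<pi>' * (\<Sum>j=1..d \<pi>'. L2_inner m f (u \<pi>' j) * L2_inner m (u \<pi>' j) (u \<pi> k))) has_sum
      c \<pi> * (\<Sum>j=1..d \<pi>. L2_inner m f (u \<pi> j) * L2_inner m (u \<pi> j) (u \<pi> k))) SD"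
  proof (rule has_sum_finite_neutralI[of "{\<pi>}"])
    show "c \<pi>' * (\<Sum>j=1..d \<pi>'. L2_inner m f (u \<pi>' j) * L2_inner m (u \<pi>' j) (u \<pi> k)) = 0" if "\<pi>' \<in> SD - {\<pi>}" for \<pi>'
    proof -
      have "L2_inner m (u \<pi>' j) (u \<pi> k) = 0" if "j \<in> {1..d \<pi>'}" for j
        using u_orthonormal[OF _ SD_D[OF \<pi>] that k] \<open>\<pi>' \<in> SD - {\<pi>}\<close> SD_D by auto
      then show ?thesis
        by simp
    qed
  qed (use \<pi> in auto)
  ultimately have "L2_inner m (kern_op c f) (u \<pi> k) = c \<pi> * (\<Sum>j=1..d \<pi>. L2_inner m f (u \<pi> j) * L2_inner m (u \<pi> j) (u \<pi> k))"
    by (rule has_sum_unique)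
  also have "(\<Sum>j=1..d \<pi>. L2_inner m f (u \<pi> j) * L2_inner m (u \<pi> j) (u \<pi> k)) = (\<Sum>j=1..d \<pi>. if j = k then L2_inner m f (u \<pi> j) else 0)"
    by (rule sum.cong) (use u_orthonormal[OF SD_D[OF \<pi>] SD_D[OF \<pi>] _ k] in auto)
  also have "\<dots> = L2_inner m f (u \<pi> k)"
    using k by simp
  finally show ?thesis .
qed

text \<open>Expanded over the dual, the diagonal entry at \<open>f\<close> is the sum of
  \<open>c \<pi>\<close> times squared coefficients of the \<open>u \<pi> j\<close> along
  \<open>f\<close>. Summing over \<open>E\<close> first, each of these unit vectors contributes 1 by
  Parseval, which is why the basis does not matter.\<close>

lemma kern_op_trace:
  assumes c: "coeff_summable c" and E: "L2_orthonormal_basis m E"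
  shows "((\<lambda>f. L2_inner m (kern_op c f) f) has_sum (\<Sum>\<^sub>\<infinity>\<pi>\<in>SD. of_nat (d \<pi>) * c \<pi>)) E"
proof -
  define a where "a \<pi> f = (\<Sum>j=1..d \<pi>. (cmod (L2_inner m (u \<pi> j) f))\<^sup>2)" for \<pi> f
  have as: "(a \<pi> has_sum real (d \<pi>)) E" if \<pi>: "\<pi> \<in> SD" for \<pi>
  proof -
    have "((\<lambda>f. (cmod (L2_inner m (u \<pi> j) f))\<^sup>2) has_sum 1) E" if j: "j \<in> {1..d \<pi>}" for j
      using L2_parseval[OF E haar_CC_L2[OF u_CC[OF SD_D[OF \<pi>] j]]] u_orthonormal[OF SD_D[OF \<pi>] SD_D[OF \<pi>] j j]
      by (simp add: L2_norm_power2_inner)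
    then have "(a \<pi> has_sum (\<Sum>j=1..d \<pi>. 1)) E"
      unfolding a_def[abs_def] by (rule has_sum_finite_sum)
    then show ?thesis
      by simp
  qed
  have "((\<lambda>f. \<Sum>\<^sub>\<infinity>\<pi>\<in>SD. c \<pi> * of_real (a \<pi> f)) has_sum (\<Sum>\<^sub>\<infinity>\<pi>\<in>SD. c \<pi> * of_real (real (d \<pi>)))) E"
    by (rule has_sum_weighted_swap[OF _ as])
      (use c in \<open>auto simp: a_def coeff_summable_def mult.commute intro: sum_nonneg\<close>)
  then show ?thesis
  proof (rule has_sum_eqI)
    fix f assume "f \<in> E"
    then have f: "f \<in> L2 m"
      using E by (auto simp: L2_orthonormal_basis_def)
    have "(\<Sum>j=1..d \<pi>. L2_inner m f (u \<pi> j) * L2_inner m (u \<pi> j) f) = of_real (a \<pi> f)" for \<pi>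
      unfolding a_def of_real_sum
    proof (rule sum.cong[OF refl])
      fix j
      show "L2_inner m f (u \<pi> j) * L2_inner m (u \<pi> j) f = of_real ((cmod (L2_inner m (u \<pi> j) f))\<^sup>2)"
        using L2_inner_cnj[of m "u \<pi> j" f] by (simp only: complex_norm_square mult.commute)
    qed
    then show "(\<Sum>\<^sub>\<infinity>\<pi>\<in>SD. c \<pi> * of_real (a \<pi> f)) = L2_inner m (kern_op c f) f"
      using infsumI[OF kern_op_inner[OF c f f]] by simp
  qed (simp add: mult.commute)
qed

text \<open>Kernel operators are diagonal on the \<open>u \<pi> j\<close> and zero on the
  complement, so the modulus is obtained from the absolute values of the coefficients: |c|^2 is c
  times its conjugate.\<close>

lemma kern_op_modulus:
  assumes c: "coeff_summable c"
  shows "L2_modulus m (kern_op c) (kern_op (\<lambda>\<pi>. of_real (cmod (c \<pi>))))"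
proof -
  define b where "b \<pi> = complex_of_real (cmod (c \<pi>))" for \<pi>
  have b: "coeff_summable b"
    using c by (simp add: coeff_summable_def b_def)
  have L: "kern_op a f \<in> L2 m" if "coeff_summable a" "f \<in> L2 m" for a f
    by (rule haar_CC_L2[OF kern_op_CC[OF that]])
  show ?thesis
    unfolding L2_modulus_def b_def[abs_def, symmetric]
  proof (intro conjI ballI)
    show "L2_bounded_operator m (kern_op b)"
      by (rule kern_op_bounded[OF b])
    show "L2_inner m (kern_op b f) f \<in> \<real>\<^sub>\<ge>\<^sub>0" if f: "f \<in> L2 m" for f
    proof -
      define r where "r \<pi> = cmod (c \<pi>) * (\<Sum>j=1..d \<pi>. (cmod (L2_inner m (u \<pi> j) f))\<^sup>2)" for \<pi>
      have "b \<pi> * (\<Sum>j=1..d \<pi>. L2_inner m f (u \<pi> j) * L2_inner m (u \<pi> j) f) = of_real (r \<pi>)" for \<pi>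
        unfolding r_def b_def of_real_mult of_real_sum
      proof (rule arg_cong2[where f=times, OF refl], rule sum.cong[OF refl])
        fix j
        show "L2_inner m f (u \<pi> j) * L2_inner m (u \<pi> j) f = of_real ((cmod (L2_inner m (u \<pi> j) f))\<^sup>2)"
          using L2_inner_cnj[of m "u \<pi> j" f] by (simp only: complex_norm_square mult.commute)
      qed
      then have hs: "((\<lambda>\<pi>. complex_of_real (r \<pi>)) has_sum L2_inner m (kern_op b f) f) SD"
        using kern_op_inner[OF b f f] by simp
      have "(r has_sum Re (L2_inner m (kern_op b f) f)) SD"
        using has_sum_Re[OF hs] by simp
      then have "0 \<le> Re (L2_inner m (kern_op b f) f)"
        by (rule has_sum_nonneg) (simp add: r_def sum_nonneg)
      moreover have "((\<lambda>\<pi>. 0) has_sum Im (L2_inner m (kern_op b f) f)) SD"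
        using has_sum_Im[OF hs] by simp
      then have "Im (L2_inner m (kern_op b f) f) = 0"
        using has_sum_unique[OF _ has_sum_0] by blast
      ultimately show ?thesis
        by (simp add: complex_nonneg_Reals_iff)
    qed
    show "L2_inner m (kern_op b (kern_op b f)) g = L2_inner m (kern_op c f) (kern_op c g)"
      if f: "f \<in> L2 m" and g: "g \<in> L2 m" for f g
    proof -
      have hs1: "((\<lambda>\<pi>. b \<pi> * (\<Sum>j=1..d \<pi>. L2_inner m (kern_op b f) (u \<pi> j) * L2_inner m (u \<pi> j) g)) has_sum
          L2_inner m (kern_op b (kern_op b f)) g) SD"
        by (rule kern_op_inner[OF b L[OF b f] g])
      have hs2: "((\<lambda>\<pi>. c \<pi> * (\<Sum>j=1..d \<pi>. L2_inner m f (u \<pi> j) * L2_inner m (u \<pi> j) (kern_op c g))) has_sum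
          L2_inner m (kern_op c f) (kern_op c g)) SD"
        by (rule kern_op_inner[OF c f L[OF c g]])
      have teq: "b \<pi> * (\<Sum>j=1..d \<pi>. L2_inner m (kern_op b f) (u \<pi> j) * L2_inner m (u \<pi> j) g) =
          c \<pi> * (\<Sum>j=1..d \<pi>. L2_inner m f (u \<pi> j) * L2_inner m (u \<pi> j) (kern_op c g))" if \<pi>: "\<pi> \<in> SD" for \<pi>
        unfolding sum_distrib_left
      proof (rule sum.cong[OF refl])
        fix j assume j: "j \<in> {1..d \<pi>}"
        have "L2_inner m (u \<pi> j) (kern_op c g) = cnj (c \<pi>) * L2_inner m (u \<pi> j) g"
          using arg_cong[OF kern_op_coeff[OF c g \<pi> j], of cnj] by (simp add: L2_inner_cnj)
        moreover have "b \<pi> * b \<pi> = c \<pi> * cnj (c \<pi>)"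
          unfolding b_def complex_norm_square[symmetric] by (simp add: power2_eq_square)
        ultimately show "b \<pi> * (L2_inner m (kern_op b f) (u \<pi> j) * L2_inner m (u \<pi> j) g) =
            c \<pi> * (L2_inner m f (u \<pi> j) * L2_inner m (u \<pi> j) (kern_op c g))"
          unfolding kern_op_coeff[OF b f \<pi> j] by (metis mult.assoc mult.commute)
      qed
      show ?thesis
        by (rule has_sum_unique[OF has_sum_eqI[OF hs1 teq refl] hs2])
    qed
  qed
qed

end

section \<open>Semigroups with continuous densities\<close>

context haar_group begin

text \<open>Operators act on functions on the whole type; only their values on the group matter for
  the norm and almost everywhere.\<close>

lemma L2_bounded_operator_cong:
  assumes P: "L2_bounded_operator m P" and eq: "\<And>f x. f \<in> L2 m \<Longrightarrow> x \<in> carrier G \<Longrightarrow> Q f x = P f x"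
  shows "L2_bounded_operator m Q"
  unfolding L2_bounded_operator_def
proof (intro conjI ballI allI)
  have PL: "P f \<in> L2 m" if "f \<in> L2 m" for f
    using P that by (simp add: L2_bounded_operator_def)
  show "Q f \<in> L2 m" if f: "f \<in> L2 m" for f
  proof -
    have "Q f \<in> borel_measurable m"
      using L2D(1)[OF PL[OF f]] measurable_cong[of m "Q f" "P f"] eq[OF f] by (simp add: haar_space)
    moreover have "integrable m (\<lambda>x. (cmod (Q f x))\<^sup>2)"
      using L2D(2)[OF PL[OF f]] Bochner_Integration.integrable_cong[of m m "\<lambda>x. (cmod (Q f x))\<^sup>2"] eq[OF f]
      by (simp add: haar_space)
    ultimately show ?thesis
      by (simp add: L2_def)
  qed
  have "L2_norm m (Q f) = L2_norm m (P f)" if "f \<in> L2 m" for f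
    by (rule L2_norm_cong[OF eq[OF that]])
  then show "\<exists>C. \<forall>f\<in>L2 m. L2_norm m (Q f) \<le> C * L2_norm m f"
    using P by (simp add: L2_bounded_operator_def)
  show "AE x in m. Q (\<lambda>y. a * f y + b * g y) x = a * Q f x + b * Q g x"
    if f: "f \<in> L2 m" and g: "g \<in> L2 m" for f g a b
  proof -
    have "AE x in m. P (\<lambda>y. a * f y + b * g y) x = a * P f x + b * P g x"
      using P f g unfolding L2_bounded_operator_def by blast
    then show ?thesis
      by (rule AE_mp) (auto simp: haar_space eq[OF f] eq[OF g] eq[OF L2_add[OF L2_mult_left[OF f] L2_mult_left[OF g]]] intro!: AE_I2)
  qed
qed

lemma integral_density_continuous:
  fixes f :: "'g \<Rightarrow> real"
  assumes f: "continuous_map T euclideanreal f" "\<And>x. x \<in> carrier G \<Longrightarrow> 0 \<le> f x"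
    and h: "h \<in> borel_measurable m"
  shows "(\<integral>x. h x \<partial>density m f) = (\<integral>x. complex_of_real (f x) * h x \<partial>m)"
proof -
  have "f \<in> borel_measurable m"
    using continuous_map_borel_measurable[OF f(1)] by (simp add: haar_measurable)
  moreover have "AE x in m. 0 \<le> f x"
    using f(2) by (intro AE_I2) (simp add: haar_space)
  ultimately show ?thesis
    using integral_density[OF h] by (simp add: scaleR_conv_of_real)
qed

lemma CC_of_real: "continuous_map T euclideanreal f \<Longrightarrow> (\<lambda>x. complex_of_real (f x)) \<in> CC"
  using continuous_map_compose[of T euclideanreal f euclidean complex_of_real]
  by (simp add: o_def continuous_on_of_real continuous_on_id)

end

locale spherical_density = spherical_dual G T m K mK \<sigma> D e
  for G :: "('g, 'b) monoid_scheme" (structure) and T m K mK \<sigma> D e +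
  fixes M :: "'g measure" and f :: "'g \<Rightarrow> real"
  assumes M_prob: "borel_prob T M" and M_bi_invariant: "bi_invariant G K M"
    and f_cont: "continuous_map T euclideanreal f" and f_nonneg: "\<And>x. x \<in> carrier G \<Longrightarrow> 0 \<le> f x"
    and M_density: "M = density m f"
begin

text \<open>The eigenvalue of the transition operator of \<open>M\<close> on the span of the
  \<open>u \<pi> j\<close>.\<close>

definition \<Lambda> :: "('g \<Rightarrow> complex mat) \<Rightarrow> complex" where
  "\<Lambda> \<pi> = cnj (\<integral>h. \<phi> \<pi> h \<partial>M)"

lemma f_CC: "(\<lambda>x. complex_of_real (f x)) \<in> CC"
  by (rule CC_of_real[OF f_cont])

lemma coef_integral:
  assumes \<pi>: "\<pi> \<in> D" and x: "x \<in> carrier_vec (d \<pi>)" and y: "y \<in> carrier_vec (d \<pi>)"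
  shows "(\<integral>h. of_real (f h) * ((\<pi> h *\<^sub>v x) \<bullet>c y) \<partial>m) =
    (if \<pi> \<in> SD then (x \<bullet>c e \<pi> 1) * \<Lambda> \<pi> * (e \<pi> 1 \<bullet>c y) else 0)"
proof -
  have "(\<integral>h. of_real (f h) * ((\<pi> h *\<^sub>v x) \<bullet>c y) \<partial>m) = (\<integral>h. (\<pi> h *\<^sub>v x) \<bullet>c y \<partial>M)"
    unfolding M_density
    by (rule integral_density_continuous[OF f_cont f_nonneg haar_CC_measurable[OF coef_CC[OF rep[OF \<pi>] x y]], symmetric])
  also have "\<dots> = (\<integral>h. (\<pi> (\<one> \<otimes> h) *\<^sub>v x) \<bullet>c y \<partial>M)"
    by (rule Bochner_Integration.integral_cong) (auto simp: borel_prob_space[OF M_prob])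
  also have "\<dots> = (if \<pi> \<in> SD then (x \<bullet>c e \<pi> 1) * \<Lambda> \<pi> * (e \<pi> 1 \<bullet>c y) else 0)"
    using bi_invariant_transition[OF \<pi> M_prob M_bi_invariant x y one_closed]
    unfolding rep_one_vec[OF rep[OF \<pi>] e1(1)[OF \<pi>]] \<Lambda>_def .
  finally show ?thesis .
qed

text \<open>Bessel's inequality for the density against the orthonormal functions
  \<open>cnj (u \<pi> 1 x)\<close>; the inner products are \<open>\<Lambda> \<pi>\<close> times the
  square root of \<open>d \<pi>\<close>. The square stays inside \<open>coeff_summable\<close>
  because at time t/2 it is the eigenvalue for time t.\<close>

lemma \<Lambda>_square_summable: "coeff_summable (\<lambda>\<pi>. (\<Lambda> \<pi>)\<^sup>2)"
  unfolding coeff_summable_def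
proof (rule nonneg_bdd_above_summable_on)
  let ?F = "\<lambda>x. complex_of_real (f x)"
  define w where "w \<pi> x = cnj (u \<pi> 1 x)" for \<pi> x
  have wC: "w \<pi> \<in> CC" if "\<pi> \<in> D" for \<pi>
    unfolding w_def[abs_def] by (rule CC_cnj[OF u_CC[OF that one_in_d[OF that]]])
  have on: "L2_inner m (w \<pi>) (w \<pi>') = (if \<pi> = \<pi>' then 1 else 0)" if "\<pi> \<in> D" "\<pi>' \<in> D" for \<pi> \<pi>'
  proof -
    have "L2_inner m (w \<pi>) (w \<pi>') = L2_inner m (u \<pi>' 1) (u \<pi> 1)"
      by (simp add: L2_inner_def w_def mult.commute)
    then show ?thesis
      using u_orthonormal[OF that(2,1) one_in_d[OF that(2)] one_in_d[OF that(1)]] by auto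
  qed
  have ip: "L2_inner m ?F (w \<pi>) = of_real (sqrt (d \<pi>)) * \<Lambda> \<pi>" if \<pi>: "\<pi> \<in> SD" for \<pi>
  proof -
    have "L2_inner m ?F (w \<pi>) = (\<integral>h. of_real (sqrt (d \<pi>)) * (of_real (f h) * ((\<pi> h *\<^sub>v e \<pi> 1) \<bullet>c e \<pi> 1)) \<partial>m)"
      unfolding L2_inner_def
      by (rule Bochner_Integration.integral_cong) (simp_all add: w_def u_def matrix_coeff_def mult_ac)
    also have "\<dots> = of_real (sqrt (d \<pi>)) * \<Lambda> \<pi>"
      using coef_integral[OF SD_D[OF \<pi>] e1(1)[OF SD_D[OF \<pi>]] e1(1)[OF SD_D[OF \<pi>]]] e1(2)[OF SD_D[OF \<pi>]] \<pi>
      by (simp del: One_nat_def)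
    finally show ?thesis .
  qed
  have "(\<Sum>\<pi>\<in>X. real (d \<pi>) * cmod ((\<Lambda> \<pi>)\<^sup>2)) \<le> (L2_norm m ?F)\<^sup>2" if X: "X \<subseteq> SD" "finite X" for X
  proof -
    have XD: "\<pi> \<in> D" if "\<pi> \<in> X" for \<pi>
      using that X(1) SD_D by blast
    have "(\<Sum>\<pi>\<in>X. (cmod (L2_inner m ?F (w \<pi>)))\<^sup>2) \<le> (L2_norm m ?F)\<^sup>2"
      by (rule L2_bessel[OF X(2) haar_CC_L2[OF wC[OF XD]] haar_CC_L2[OF f_CC] on[OF XD XD]])
    moreover have "(\<Sum>\<pi>\<in>X. (cmod (L2_inner m ?F (w \<pi>)))\<^sup>2) = (\<Sum>\<pi>\<in>X. real (d \<pi>) * cmod ((\<Lambda> \<pi>)\<^sup>2))"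
    proof (rule sum.cong[OF refl])
      fix \<pi> assume "\<pi> \<in> X"
      then have "\<pi> \<in> SD"
        using X by blast
      then show "(cmod (L2_inner m ?F (w \<pi>)))\<^sup>2 = real (d \<pi>) * cmod ((\<Lambda> \<pi>)\<^sup>2)"
        unfolding ip[OF \<open>\<pi> \<in> SD\<close>] by (simp add: norm_mult norm_power power_mult_distrib)
    qed
    ultimately show ?thesis
      by simp
  qed
  then show "bdd_above (sum (\<lambda>\<pi>. real (d \<pi>) * cmod ((\<Lambda> \<pi>)\<^sup>2)) ` {F. F \<subseteq> SD \<and> finite F})"
    by (intro bdd_aboveI[where M="(L2_norm m ?F)\<^sup>2"]) auto
qed simp

text \<open>Orthogonality leaves only the term of \<open>\<pi>\<close> itself. For
  \<open>c = \<Lambda>\<close> the result matches \<open>coef_integral\<close>, so kernel and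
  density have the same coefficients.\<close>

lemma kern_coef_integral:
  assumes c: "coeff_summable c" and \<pi>: "\<pi> \<in> D" and x: "x \<in> carrier_vec (d \<pi>)" and y: "y \<in> carrier_vec (d \<pi>)"
  shows "(\<integral>h. kern c h * ((\<pi> h *\<^sub>v x) \<bullet>c y) \<partial>m) =
    (if \<pi> \<in> SD then (x \<bullet>c e \<pi> 1) * c \<pi> * (e \<pi> 1 \<bullet>c y) else 0)"
proof -
  let ?a = "\<lambda>h. (\<pi> h *\<^sub>v x) \<bullet>c y"
  let ?s = "if \<pi> \<in> SD then (x \<bullet>c e \<pi> 1) * c \<pi> * (e \<pi> 1 \<bullet>c y) else 0"
  have hs: "((\<lambda>\<pi>'. \<integral>h. ?a h * (of_nat (d \<pi>') * c \<pi>' * \<phi> \<pi>' h) \<partial>m) has_sum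
      (\<integral>h. ?a h * (\<Sum>\<^sub>\<infinity>\<pi>'\<in>SD. of_nat (d \<pi>') * c \<pi>' * \<phi> \<pi>' h) \<partial>m)) SD"
    by (rule has_sum_integral[OF haar_CC_integrable[OF coef_CC[OF rep[OF \<pi>] x y]] kern_term_CC kern_term])
      (use c in \<open>simp_all add: coeff_summable_def\<close>)
  have eq: "(\<integral>h. ?a h * (of_nat (d \<pi>') * c \<pi>' * \<phi> \<pi>' h) \<partial>m) = (if \<pi>' = \<pi> then ?s else 0)"
    if \<pi>': "\<pi>' \<in> SD" for \<pi>'
  proof -
    have D': "\<pi>' \<in> D"
      by (rule SD_D[OF \<pi>'])
    have "(\<integral>h. ?a h * (of_nat (d \<pi>') * c \<pi>' * \<phi> \<pi>' h) \<partial>m) =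
        (\<integral>h. of_nat (d \<pi>') * c \<pi>' * (?a h * cnj ((\<pi>' h *\<^sub>v e \<pi>' 1) \<bullet>c e \<pi>' 1)) \<partial>m)"
      by (rule Bochner_Integration.integral_cong) (auto simp: haar_space \<phi>_cnj[OF D'] matrix_coeff_def)
    also have "\<dots> = of_nat (d \<pi>') * c \<pi>' * (\<integral>h. ?a h * cnj ((\<pi>' h *\<^sub>v e \<pi>' 1) \<bullet>c e \<pi>' 1) \<partial>m)"
      by simp
    also have "\<dots> = (if \<pi>' = \<pi> then ?s else 0)"
    proof (cases "\<pi>' = \<pi>")
      case True
      show ?thesis
        unfolding True schur_orthogonality_same[OF irr[OF \<pi>] x e1(1)[OF \<pi>] y e1(1)[OF \<pi>]]
        using True \<pi>' d_pos[OF \<pi>] by simp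
    next
      case False
      show ?thesis
        unfolding schur_orthogonality_different[OF irr[OF \<pi>] irr[OF D'] not_equivalent[OF \<pi> D'] x e1(1)[OF D'] y e1(1)[OF D'], OF False[symmetric]]
        using False by simp
    qed
    finally show ?thesis .
  qed
  have "((\<lambda>\<pi>'. if \<pi>' = \<pi> then ?s else 0) has_sum (\<integral>h. ?a h * kern c h \<partial>m)) SD"
    unfolding kern_def by (rule has_sum_eqI[OF hs eq refl])
  moreover have "((\<lambda>\<pi>'. if \<pi>' = \<pi> then ?s else 0) has_sum ?s) SD"
    by (rule has_sum_finite_neutralI[of "SD \<inter> {\<pi>}"]) auto
  ultimately have "(\<integral>h. ?a h * kern c h \<partial>m) = ?s"
    by (rule has_sum_unique)
  then show ?thesis
    by (simp only: mult.commute[of "kern c _"])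
qed

lemma density_expansion:
  assumes c: "coeff_summable \<Lambda>" and x: "x \<in> carrier G"
  shows "of_real (f x) = kern \<Lambda> x"
proof -
  define r where "r x = of_real (f x) - kern \<Lambda> x" for x
  have rC: "r \<in> CC"
    unfolding r_def[abs_def] by (rule CC_diff[OF f_CC kern_CC[OF c]])
  have coef0: "(\<integral>h. r h * ((\<pi> h *\<^sub>v v) \<bullet>c w) \<partial>m) = 0"
    if \<pi>: "\<pi> \<in> D" and v: "v \<in> carrier_vec (d \<pi>)" and w: "w \<in> carrier_vec (d \<pi>)" for \<pi> v w
  proof -
    have aC: "(\<lambda>h. (\<pi> h *\<^sub>v v) \<bullet>c w) \<in> CC"
      by (rule coef_CC[OF rep[OF \<pi>] v w])
    show ?thesis
      unfolding r_def left_diff_distrib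
      using haar_CC_integrable[OF CC_mult[OF f_CC aC]] haar_CC_integrable[OF CC_mult[OF kern_CC[OF c] aC]]
      by (simp add: coef_integral[OF \<pi> v w] kern_coef_integral[OF c \<pi> v w])
  qed
  have "r x = 0"
  proof (rule peter_weyl_zero[OF rC _ x])
    fix n \<pi> i j assume irr\<pi>: "irreducible_unitary_rep G T n \<pi>" and ij: "i < n" "j < n"
    have rep\<pi>: "unitary_rep G T n \<pi>"
      using irr\<pi> by (simp add: irreducible_unitary_rep_def)
    have dn: "rep_dim G \<pi> = n"
      using unitary_repD(2)[OF rep\<pi>] by (simp add: rep_dim_def)
    \<comment> \<open>Orthogonality is known for the representatives in \<open>D\<close>; the
      unitary \<open>U\<close> turns the entries of an arbitrary irreducible representation into
      coefficients of its representative.\<close>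
    obtain \<pi>' where \<pi>': "\<pi>' \<in> D" "unitarily_equivalent G \<pi> \<pi>'"
      using dual irr\<pi> unfolding is_unitary_dual_def by blast
    then obtain U where d': "d \<pi>' = n" and U: "U \<in> carrier_mat n n"
      "\<And>v w. v \<in> carrier_vec n \<Longrightarrow> w \<in> carrier_vec n \<Longrightarrow> (U *\<^sub>v v) \<bullet>c (U *\<^sub>v w) = v \<bullet>c w"
      "\<And>g. g \<in> carrier G \<Longrightarrow> U * \<pi> g = \<pi>' g * U"
      unfolding unitarily_equivalent_def dn by auto
    have rep': "unitary_rep G T n \<pi>'"
      using rep[OF \<pi>'(1)] by (simp add: d')
    let ?v = "unit_vec n j" and ?w = "unit_vec n i"
    have vw: "?v \<in> carrier_vec n" "?w \<in> carrier_vec n"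
      by auto
    have Uvw: "U *\<^sub>v ?v \<in> carrier_vec n" "U *\<^sub>v ?w \<in> carrier_vec n"
      using mult_mat_vec_carrier[OF U(1)] by auto
    have "(\<integral>h. r h * \<pi> h $$ (i, j) \<partial>m) = (\<integral>h. r h * ((\<pi>' h *\<^sub>v (U *\<^sub>v ?v)) \<bullet>c (U *\<^sub>v ?w)) \<partial>m)"
    proof (rule Bochner_Integration.integral_cong[OF refl])
      fix h assume "h \<in> space m"
      then have h: "h \<in> carrier G"
        by (simp add: haar_space)
      have "\<pi> h $$ (i, j) = (\<pi> h *\<^sub>v ?v) \<bullet>c ?w"
        by (rule cip_mat_unit[OF unitary_repD(1)[OF rep\<pi> h] ij(2,1), symmetric])
      also have "\<dots> = (U *\<^sub>v (\<pi> h *\<^sub>v ?v)) \<bullet>c (U *\<^sub>v ?w)"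
        by (rule U(2)[OF rep_vec_carrier[OF rep\<pi> h vw(1)] vw(2), symmetric])
      also have "U *\<^sub>v (\<pi> h *\<^sub>v ?v) = \<pi>' h *\<^sub>v (U *\<^sub>v ?v)"
        using assoc_mult_mat_vec[OF U(1) unitary_repD(1)[OF rep\<pi> h] vw(1)]
          assoc_mult_mat_vec[OF unitary_repD(1)[OF rep' h] U(1) vw(1)] U(3)[OF h] by simp
      finally show "r h * \<pi> h $$ (i, j) = r h * ((\<pi>' h *\<^sub>v (U *\<^sub>v ?v)) \<bullet>c (U *\<^sub>v ?w))"
        by simp
    qed
    also have "\<dots> = 0"
      by (rule coef0[OF \<pi>'(1)]) (use Uvw d' in auto)
    finally show "(\<integral>h. r h * \<pi> h $$ (i, j) \<partial>m) = 0" .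
  qed
  then show ?thesis
    by (simp add: r_def)
qed

lemma transition_kern_op:
  assumes c: "coeff_summable \<Lambda>" and a: "a \<in> L2 m" and g: "g \<in> carrier G"
  shows "(\<integral>h. a (g \<otimes> h) \<partial>M) = kern_op \<Lambda> a g"
proof -
  have am: "a \<in> borel_measurable m"
    by (rule L2D(1)[OF a])
  have "(\<integral>h. a (g \<otimes> h) \<partial>M) = (\<integral>h. of_real (f h) * a (g \<otimes> h) \<partial>m)"
    unfolding M_density
    by (rule integral_density_continuous[OF f_cont f_nonneg L2D(1)[OF L2_left(1)[OF g a]]])
  also have "\<dots> = (\<integral>h. a (g \<otimes> h) * kern \<Lambda> (inv g \<otimes> (g \<otimes> h)) \<partial>m)"
    by (rule Bochner_Integration.integral_cong)
      (use g in \<open>auto simp: haar_space density_expansion[OF c] simp flip: m_assoc\<close>)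
  also have "\<dots> = (\<integral>h. a h * kern \<Lambda> (inv g \<otimes> h) \<partial>m)"
  proof (rule integral_left[OF g, of "\<lambda>h. a h * kern \<Lambda> (inv g \<otimes> h)"])
    have "(\<lambda>h. kern \<Lambda> (inv g \<otimes> h)) \<in> CC"
      by (rule CC_comp[OF kern_CC[OF c] continuous_left_mult]) (use g in simp)
    then show "(\<lambda>h. a h * kern \<Lambda> (inv g \<otimes> h)) \<in> borel_measurable m"
      using am haar_CC_measurable by measurable
  qed
  finally show ?thesis
    by (simp add: kern_op_def)
qed

lemma transition_trace:
  assumes c: "coeff_summable \<Lambda>" and P: "\<And>a g. P a g = (\<integral>h. a (g \<otimes> h) \<partial>M)"
  shows "L2_trace_class m P"
    and "L2_has_trace m P (\<Sum>\<^sub>\<infinity>\<pi>\<in>SD. of_nat (d \<pi>) * \<Lambda> \<pi>)"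
proof -
  have eq: "P a g = kern_op \<Lambda> a g" if "a \<in> L2 m" "g \<in> carrier G" for a g
    unfolding P by (rule transition_kern_op[OF c that])
  have ipeq: "L2_inner m (P a) b = L2_inner m (kern_op \<Lambda> a) b" if "a \<in> L2 m" for a b
    by (rule L2_inner_cong[OF eq[OF that] refl])
  have ipeq2: "L2_inner m (P a) (P b) = L2_inner m (kern_op \<Lambda> a) (kern_op \<Lambda> b)" if "a \<in> L2 m" "b \<in> L2 m" for a b
    by (rule L2_inner_cong[OF eq[OF that(1)] eq[OF that(2)]])
  let ?c = "\<lambda>\<pi>. complex_of_real (cmod (\<Lambda> \<pi>))"
  have c': "coeff_summable ?c"
    using c by (simp add: coeff_summable_def)
  show "L2_trace_class m P"
    unfolding L2_trace_class_def
  proof (intro conjI exI[of _ "kern_op ?c"] allI impI)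
    show "L2_bounded_operator m P"
      by (rule L2_bounded_operator_cong[OF kern_op_bounded[OF c] eq])
    show "L2_modulus m P (kern_op ?c)"
      using kern_op_modulus[OF c] by (simp add: L2_modulus_def ipeq2)
    show "(\<lambda>f. L2_inner m (kern_op ?c f) f) summable_on E" if "L2_orthonormal_basis m E" for E
      using kern_op_trace[OF c' that] by (rule has_sum_imp_summable)
  qed
  show "L2_has_trace m P (\<Sum>\<^sub>\<infinity>\<pi>\<in>SD. of_nat (d \<pi>) * \<Lambda> \<pi>)"
    unfolding L2_has_trace_def
  proof (intro allI impI)
    fix E assume E: "L2_orthonormal_basis m E"
    show "((\<lambda>a. L2_inner m (P a) a) has_sum (\<Sum>\<^sub>\<infinity>\<pi>\<in>SD. of_nat (d \<pi>) * \<Lambda> \<pi>)) E"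
      by (rule has_sum_eqI[OF kern_op_trace[OF c E] _ refl])
        (use E ipeq in \<open>auto simp: L2_orthonormal_basis_def\<close>)
  qed
qed

text \<open>At the unit every spherical function is 1, so the sum is a value of the real density.
  This trades the conjugated exponents of the eigenvalues for the plain ones of the trace
  formula.\<close>

lemma trace_real:
  assumes c: "coeff_summable \<Lambda>"
  shows "(\<Sum>\<^sub>\<infinity>\<pi>\<in>SD. of_nat (d \<pi>) * \<Lambda> \<pi>) = (\<Sum>\<^sub>\<infinity>\<pi>\<in>SD. of_nat (d \<pi>) * cnj (\<Lambda> \<pi>))"
proof -
  have "kern \<Lambda> \<one> = (\<Sum>\<^sub>\<infinity>\<pi>\<in>SD. of_nat (d \<pi>) * \<Lambda> \<pi>)"
    unfolding kern_def by (rule infsum_cong) (simp add: \<phi>_one[OF SD_D])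
  then have "(\<Sum>\<^sub>\<infinity>\<pi>\<in>SD. of_nat (d \<pi>) * \<Lambda> \<pi>) = of_real (f \<one>)"
    using density_expansion[OF c one_closed] by simp
  moreover have "(\<Sum>\<^sub>\<infinity>\<pi>\<in>SD. of_nat (d \<pi>) * cnj (\<Lambda> \<pi>)) = cnj (\<Sum>\<^sub>\<infinity>\<pi>\<in>SD. of_nat (d \<pi>) * \<Lambda> \<pi>)"
    by (simp flip: infsum_cnj)
  ultimately show ?thesis
    by simp
qed

end

section \<open>Isometry groups of symmetric spaces\<close>

lemma topspace_compact_open_topology [simp]: "topspace compact_open_topology = UNIV"
proof -
  have "(\<lambda>_. undefined) ` {} \<subseteq> {}" "compact {}" "open {}"
    by auto
  then show ?thesis
    unfolding compact_open_topology_def topology_generated_by_topspace by blast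
qed

lemma openin_compact_open_evaluation:
  assumes "open U"
  shows "openin compact_open_topology {f. f x \<in> U}"
proof -
  have "{f. f x \<in> U} = {f. f ` {x} \<subseteq> U}"
    by auto
  then show ?thesis
    using assms unfolding compact_open_topology_def
    by (intro topology_generated_by_Basis) (auto intro!: exI[of _ "{x}"])
qed

text \<open>The preimage of the subbasic set of \<open>C\<close> and \<open>U\<close> is the
  subbasic set of the image of \<open>C\<close> and the preimage of \<open>U\<close> under
  \<open>s\<close>.\<close>

lemma continuous_compact_open_conjugate:
  fixes s :: "'x::topological_space \<Rightarrow> 'x"
  assumes s: "continuous_on UNIV s"
  shows "continuous_map compact_open_topology compact_open_topology (\<lambda>f. s \<circ> f \<circ> s)"
  unfolding compact_open_topology_def
proof (rule continuous_on_generated_topo)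
  fix W :: "('x \<Rightarrow> 'x) set"
  assume "W \<in> {{f. f ` C \<subseteq> U} |C U. compact C \<and> open U}"
  then obtain C U where CU: "W = {f. f ` C \<subseteq> U}" "compact C" "open U"
    by blast
  have "(\<lambda>f. s \<circ> f \<circ> s) -` W = {f. f ` (s ` C) \<subseteq> s -` U}"
    unfolding CU(1) by auto
  moreover have "compact (s ` C)" "open (s -` U)"
    using compact_continuous_image[OF continuous_on_subset[OF s] CU(2)] open_vimage[OF CU(3) s] by auto
  ultimately show "openin (topology_generated_by {{f. f ` C \<subseteq> U} |C U. compact C \<and> open U})
      ((\<lambda>f. s \<circ> f \<circ> s) -` W \<inter> topspace (topology_generated_by {{f. f ` C \<subseteq> U} |C U. compact C \<and> open U}))"
    using topspace_compact_open_topology[where 'a='x and 'b='x]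
    unfolding compact_open_topology_def by (auto intro!: topology_generated_by_Basis)
next
  show "(\<lambda>f. s \<circ> f \<circ> s) ` topspace (topology_generated_by {{f. f ` C \<subseteq> U} |C U. compact C \<and> open U})
      \<subseteq> \<Union> {{f. f ` C \<subseteq> U} |C U. compact C \<and> open U}"
    using topspace_compact_open_topology[where 'a='x and 'b='x]
    unfolding compact_open_topology_def topology_generated_by_topspace by blast
qed

lemma isometry_component_connected:
  "connectedin compact_open_topology (carrier (isometry_component A \<rho>))"
  using connectedin_connected_component_of[of "subtopology compact_open_topology (Collect (isometry A \<rho>))" id]
  by (simp add: isometry_component_def connectedin_subtopology)

lemma isometry_component_isometry: "g \<in> carrier (isometry_component A \<rho>) \<Longrightarrow> isometry A \<rho> g"
  using connected_component_of_subset_topspace[of "subtopology compact_open_topology (Collect (isometry A \<rho>))" id]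
  by (auto simp: isometry_component_def)

text \<open>Conjugation is continuous and fixes \<open>id\<close>, so it maps the component of
  \<open>id\<close> onto a connected set of isometries through \<open>id\<close>.\<close>

lemma isometry_component_conjugate:
  assumes M: "smooth_manifold euclidean A" and s: "isometry A \<rho> s" "s \<circ> s = id"
    and id: "id \<in> carrier (isometry_component A \<rho>)" and g: "g \<in> carrier (isometry_component A \<rho>)"
  shows "s \<circ> g \<circ> s \<in> carrier (isometry_component A \<rho>)"
proof -
  let ?C = "carrier (isometry_component A \<rho>)" and ?\<sigma> = "\<lambda>f. s \<circ> f \<circ> s"
  have "continuous_on UNIV s"
    using s(1) by (simp add: isometry_def smooth_map_def)
  then have "connectedin compact_open_topology (?\<sigma> ` ?C)"
    by (rule connectedin_continuous_map_image[OF continuous_compact_open_conjugate isometry_component_connected])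
  moreover have "?\<sigma> ` ?C \<subseteq> Collect (isometry A \<rho>)"
    using isometry_compose[OF M s(1) isometry_compose[OF M isometry_component_isometry s(1)]]
    by (auto simp: comp_assoc)
  ultimately have "connectedin (subtopology compact_open_topology (Collect (isometry A \<rho>))) (?\<sigma> ` ?C)"
    by (simp add: connectedin_subtopology)
  moreover have "id \<in> ?\<sigma> ` ?C"
    using id s(2) by (intro image_eqI[of _ _ id]) auto
  ultimately have "?\<sigma> ` ?C \<subseteq> ?C"
    using connected_component_of_maximal unfolding isometry_component_def by fastforce
  then show ?thesis
    using g by blast
qed

lemma lie_group_topological_group:
  assumes "lie_group G T A"
  shows "topological_group G T"
  using assms unfolding lie_group_def topological_group_def topological_group_axioms_def smooth_map_def by blast

lemma symmetric_space_haar_group: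
  assumes X: "riemannian_symmetric_space A \<rho>"
    and G: "G = isometry_component A \<rho>"
    and T: "T = subtopology compact_open_topology (carrier G)"
    and K: "K = {g \<in> carrier G. g x0 = x0}"
    and lie: "lie_group G T AG" "compact_space T"
    and haar: "normalised_haar G T (carrier G) m"
    and mK: "normalised_haar G T K mK" "bi_invariant G K mK"
  obtains \<sigma> where "symmetric_haar_group G T m K mK \<sigma>"
proof -
  interpret topological_group G T
    by (rule lie_group_topological_group[OF lie(1)])
  have mult: "g \<otimes>\<^bsub>G\<^esub> h = g \<circ> h" and one: "\<one>\<^bsub>G\<^esub> = id" for g h
    by (simp_all add: G isometry_component_def)
  obtain s U where s: "isometry A \<rho> s" "s \<circ> s = id" "s x0 = x0"
    and U: "open U" "x0 \<in> U" "\<And>q. q \<in> U \<Longrightarrow> s q = q \<Longrightarrow> q = x0"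
    using X unfolding riemannian_symmetric_space_def by metis
  have M: "smooth_manifold euclidean A"
    using X by (simp add: riemannian_symmetric_space_def riemannian_manifold_def)
  have ss: "s (s x) = x" for x
    using s(2) by (metis comp_apply id_apply)
  have scont: "continuous_on UNIV s"
    using s(1) by (simp add: isometry_def smooth_map_def)
  define \<sigma> where "\<sigma> = (\<lambda>f. s \<circ> f \<circ> s)"
  have \<sigma>c: "\<sigma> g \<in> carrier G" if "g \<in> carrier G" for g
    using isometry_component_conjugate[OF M s(1,2)] that one_closed unfolding \<sigma>_def G one[unfolded G] by blast
  have \<sigma>_hom: "\<sigma> \<in> hom G G"
    by (rule homI) (auto simp: \<sigma>c mult, auto simp: \<sigma>_def ss fun_eq_iff)
  have \<sigma>_\<sigma>: "\<sigma> (\<sigma> x) = x" for x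
    by (simp add: \<sigma>_def fun_eq_iff ss)
  have \<sigma>_cont: "continuous_map T T \<sigma>"
    unfolding T using \<sigma>c continuous_compact_open_conjugate[OF scont]
    by (auto simp: continuous_map_in_subtopology continuous_map_from_subtopology \<sigma>_def[symmetric])
  obtain V where V: "openin T V" "\<one>\<^bsub>G\<^esub> \<in> V" "inj_on (\<lambda>x. x \<otimes>\<^bsub>G\<^esub> x) V"
    "\<And>W. openin T W \<Longrightarrow> W \<subseteq> V \<Longrightarrow> openin T ((\<lambda>x. x \<otimes>\<^bsub>G\<^esub> x) ` W)"
    using lie_group_square_local_homeo[OF lie(1)] by blast
  define N where "N = {g \<in> carrier G. g x0 \<in> U}"
  have N: "openin T N" "\<one>\<^bsub>G\<^esub> \<in> N"
    unfolding N_def T using openin_compact_open_evaluation[OF U(1), of x0] one_closed U(2)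
    by (auto simp: openin_subtopology one intro!: exI[of _ "{f. f x0 \<in> U}"])
  have NK: "h \<in> K" if h: "h \<in> N" "\<sigma> h = h" for h
  proof -
    \<comment> \<open>As \<open>h\<close> commutes with \<open>s\<close>, it maps the fixed point
      \<open>x0\<close> to a fixed point of \<open>s\<close>; membership in \<open>N\<close> places
      that point in \<open>U\<close>.\<close>
    have "s (h x0) = h x0"
      using fun_cong[OF h(2), of x0] s(3) by (simp add: \<sigma>_def)
    then show ?thesis
      using U(3) h(1) by (simp add: N_def K)
  qed
  have subK: "subgroup K G"
  proof (rule subgroupI)
    show "inv\<^bsub>G\<^esub> g \<in> K" if g: "g \<in> K" for g
    proof -
      have "(inv\<^bsub>G\<^esub> g) \<circ> g = id"
        using g l_inv[of g] by (simp add: K mult one)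
      then have "(inv\<^bsub>G\<^esub> g) (g x0) = x0"
        by (metis comp_apply id_apply)
      then show ?thesis
        using g by (simp add: K)
    qed
    show "K \<noteq> {}"
      using one_closed by (auto simp: K one)
    show "g \<otimes>\<^bsub>G\<^esub> h \<in> K" if "g \<in> K" "h \<in> K" for g h
      using that m_closed[of g h] by (simp add: K mult)
  qed (simp add: K)
  have "symmetric_haar_group G T m K mK \<sigma>"
  proof (intro_locales)
    show "compact_group_axioms T"
      using lie by (simp add: compact_group_axioms_def lie_group_def smooth_manifold_def)
    show "haar_group_axioms G T m"
      using haar by (simp add: haar_group_axioms_def)
    show "symmetric_haar_group_axioms G T K mK \<sigma>"
    proof (rule symmetric_haar_group_axioms.intro)
      show "connected_space T"
        using isometry_component_connected unfolding T G connectedin_def by blast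
      show "borel_prob T mK" "emeasure mK K = 1" "bi_invariant G K mK"
        using mK by (auto simp: normalised_haar_def)
      show "\<sigma> ` K \<subseteq> K"
        using \<sigma>c s(3) by (auto simp: K) (simp add: \<sigma>_def)
      show "\<exists>U. openin T U \<and> \<one>\<^bsub>G\<^esub> \<in> U \<and>
          (\<forall>g\<in>U. \<exists>k\<in>K. k \<in> carrier G \<and> \<sigma> g = k \<otimes>\<^bsub>G\<^esub> inv\<^bsub>G\<^esub> g \<otimes>\<^bsub>G\<^esub> k)"
        by (rule involution_local_inverse[OF \<sigma>_hom \<sigma>_\<sigma> \<sigma>_cont V N NK])
    qed (rule subK \<sigma>_hom \<sigma>_\<sigma> \<sigma>_cont)+
  qed
  then show thesis
    by (rule that)
qed

section \<open>The transition semigroup\<close>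

context spherical_dual begin

lemma coeff_summable_cong: "(\<And>\<pi>. \<pi> \<in> SD \<Longrightarrow> c \<pi> = c' \<pi>) \<Longrightarrow> coeff_summable c = coeff_summable c'"
  unfolding coeff_summable_def by (rule summable_on_cong) simp

lemma matrix_coeff_transition:
  assumes M: "borel_prob T (\<mu> t)" "bi_invariant G K (\<mu> t)"
    and \<pi>: "\<pi> \<in> D" and ij: "i \<in> {1..d \<pi>}" "j \<in> {1..d \<pi>}" and g: "g \<in> carrier G"
  shows "transition_op G \<mu> t (matrix_coeff e \<pi> i j) g =
    (if i = 1 \<and> \<pi> \<in> SD then cnj (\<integral>h. \<phi> \<pi> h \<partial>\<mu> t) * matrix_coeff e \<pi> i j g else 0)"
  using bi_invariant_transition[OF \<pi> M e_carrier[OF \<pi> ij(1)] e_carrier[OF \<pi> ij(2)] g]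
    e_orthonormal[OF \<pi> ij(1) one_in_d[OF \<pi>]]
  by (auto simp: transition_op_def matrix_coeff_def)

lemma semigroup_trace:
  fixes \<mu> :: "real \<Rightarrow> 'g measure"
  assumes \<mu>: "\<And>t. 0 \<le> t \<Longrightarrow> borel_prob T (\<mu> t)" "\<And>t. 0 \<le> t \<Longrightarrow> bi_invariant G K (\<mu> t)"
    and \<eta>: "\<And>\<pi> t. \<pi> \<in> SD \<Longrightarrow> 0 \<le> t \<Longrightarrow> (\<integral>g. \<phi> \<pi> g \<partial>\<mu> t) = exp (- of_real t * \<eta> \<pi>)"
    and dens: "\<And>t. 0 < t \<Longrightarrow> has_continuous_density T m (\<mu> t)" and t: "0 < t"
  shows "L2_trace_class m (transition_op G \<mu> t)"
    and "(\<lambda>\<pi>. of_nat (d \<pi>) * exp (- of_real t * \<eta> \<pi>)) summable_on SD"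
    and "L2_has_trace m (transition_op G \<mu> t) (\<Sum>\<^sub>\<infinity>\<pi>\<in>SD. of_nat (d \<pi>) * exp (- of_real t * \<eta> \<pi>))"
proof -
  \<comment> \<open>The eigenvalues are the conjugates of the integrals of spherical functions,
    hence the conjugated exponent.\<close>
  define \<theta> where "\<theta> t \<pi> = exp (- of_real t * cnj (\<eta> \<pi>))" for t :: real and \<pi>
  have cnj\<theta>: "cnj (\<theta> t \<pi>) = exp (- of_real t * \<eta> \<pi>)" for t \<pi>
    by (simp add: \<theta>_def exp_cnj)
  have \<Lambda>: "spherical_density.\<Lambda> e (\<mu> t) \<pi> = \<theta> t \<pi>" if "spherical_density G T m K mK \<sigma> D e (\<mu> t) f" "\<pi> \<in> SD" "0 \<le> t" for t f \<pi>
    unfolding spherical_density.\<Lambda>_def[OF that(1)] \<eta>[OF that(2,3)] cnj\<theta>[symmetric] by simp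
  have density: "\<exists>f. spherical_density G T m K mK \<sigma> D e (\<mu> t) f" if "0 < t" for t
  proof -
    from dens[OF that] obtain f where "continuous_map T euclideanreal f" "\<forall>x\<in>topspace T. 0 \<le> f x"
        "\<mu> t = density m (\<lambda>x. ennreal (f x))"
      unfolding has_continuous_density_def by blast
    then show ?thesis
      using \<mu>[of t] that spherical_dual_axioms
      by (auto simp: spherical_density_def spherical_density_axioms_def topspace_eq)
  qed
  obtain f' where f': "spherical_density G T m K mK \<sigma> D e (\<mu> (t / 2)) f'"
    using density[of "t / 2"] t by auto
  obtain f where f: "spherical_density G T m K mK \<sigma> D e (\<mu> t) f"
    using density[OF t] by auto
  interpret F: spherical_density G T m K mK \<sigma> D e "\<mu> t" f
    by (rule f)
  have F\<theta>: "F.\<Lambda> \<pi> = \<theta> t \<pi>" if "\<pi> \<in> SD" for \<pi>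
    using \<Lambda>[OF f that] t by simp
  have sq: "coeff_summable (\<lambda>\<pi>. (spherical_density.\<Lambda> e (\<mu> (t / 2)) \<pi>)\<^sup>2)"
    by (rule spherical_density.\<Lambda>_square_summable[OF f'])
  \<comment> \<open>Doubling the time squares the eigenvalue; this turns square summability at
    \<open>t / 2\<close> into summability at \<open>t\<close>.\<close>
  have eq: "(spherical_density.\<Lambda> e (\<mu> (t / 2)) \<pi>)\<^sup>2 = F.\<Lambda> \<pi>" if \<pi>: "\<pi> \<in> SD" for \<pi>
  proof -
    have "(\<theta> (t / 2) \<pi>)\<^sup>2 = \<theta> t \<pi>"
      unfolding \<theta>_def exp_double[symmetric] by simp
    then show ?thesis
      unfolding F\<theta>[OF \<pi>] using \<Lambda>[OF f' \<pi>] t by simp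
  qed
  have c: "coeff_summable F.\<Lambda>"
    by (rule iffD1[OF coeff_summable_cong[OF eq] sq])
  have P: "transition_op G \<mu> t a g = (\<integral>h. a (g \<otimes> h) \<partial>\<mu> t)" for a g
    by (simp add: transition_op_def)
  show "L2_trace_class m (transition_op G \<mu> t)"
    by (rule F.transition_trace(1)[OF c P])
  have "(\<Sum>\<^sub>\<infinity>\<pi>\<in>SD. of_nat (d \<pi>) * F.\<Lambda> \<pi>) = (\<Sum>\<^sub>\<infinity>\<pi>\<in>SD. of_nat (d \<pi>) * cnj (F.\<Lambda> \<pi>))"
    by (rule F.trace_real[OF c])
  also have "\<dots> = (\<Sum>\<^sub>\<infinity>\<pi>\<in>SD. of_nat (d \<pi>) * exp (- of_real t * \<eta> \<pi>))"
    by (rule infsum_cong) (simp only: F\<theta> cnj\<theta>)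
  finally show "L2_has_trace m (transition_op G \<mu> t) (\<Sum>\<^sub>\<infinity>\<pi>\<in>SD. of_nat (d \<pi>) * exp (- of_real t * \<eta> \<pi>))"
    using F.transition_trace(2)[OF c P] by simp
  show "(\<lambda>\<pi>. of_nat (d \<pi>) * exp (- of_real t * \<eta> \<pi>)) summable_on SD"
  proof (rule abs_summable_summable)
    have "cmod (of_nat (d \<pi>) * exp (- of_real t * \<eta> \<pi>)) = real (d \<pi>) * cmod (F.\<Lambda> \<pi>)" if "\<pi> \<in> SD" for \<pi>
      unfolding norm_mult F\<theta>[OF that] cnj\<theta>[symmetric] by simp
    then show "(\<lambda>\<pi>. cmod (of_nat (d \<pi>) * exp (- of_real t * \<eta> \<pi>))) summable_on SD"
      using c unfolding coeff_summable_def by (simp cong: summable_on_cong)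
  qed
qed

end

theorem theorem5p1:
  fixes A :: "('x::topological_space, 'e::euclidean_space) chart set"
    and \<rho> :: "('x, 'e) local_metric"
    and x0 :: 'x
    and G :: "('x \<Rightarrow> 'x) monoid"
    and T :: "('x \<Rightarrow> 'x) topology"
    and AG :: "('x \<Rightarrow> 'x, 'f::euclidean_space) chart set"
    and K :: "('x \<Rightarrow> 'x) set"
    and m :: "('x \<Rightarrow> 'x) measure"
    and \<mu> :: "real \<Rightarrow> ('x \<Rightarrow> 'x) measure"
    and D :: "(('x \<Rightarrow> 'x) \<Rightarrow> complex mat) set"
    and e :: "(('x \<Rightarrow> 'x) \<Rightarrow> complex mat) \<Rightarrow> nat \<Rightarrow> complex vec"
    and \<eta> :: "(('x \<Rightarrow> 'x) \<Rightarrow> complex mat) \<Rightarrow> complex"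
  assumes X: "riemannian_symmetric_space A \<rho>" "compact (UNIV :: 'x set)"
    and G: "G = isometry_component A \<rho>"
    and T: "T = subtopology compact_open_topology (carrier G)"
    and K: "K = {g \<in> carrier G. g x0 = x0}"
    and lie: "lie_group G T AG" "compact_space T"
    and irr: "irreducible_pair G T AG K"
    and haar: "normalised_haar G T (carrier G) m"
    and mu: "convolution_semigroup G T \<mu>" "\<forall>t\<ge>0. bi_invariant G K (\<mu> t)"
      "normalised_haar G T K (\<mu> 0)"
    and dual: "is_unitary_dual G T D" "adapted_bases G K D e"
    and chi: "\<forall>\<pi>\<in>D. spherical G K \<pi> \<longrightarrow>
      (\<forall>t\<ge>0. (\<integral>g. spherical_fun e \<pi> g \<partial>\<mu> t) = exp (- of_real t * \<eta> \<pi>))"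
  shows "(\<forall>t\<ge>0. \<forall>\<pi>\<in>D. \<forall>i\<in>{1..rep_dim G \<pi>}. \<forall>j\<in>{1..rep_dim G \<pi>}. \<forall>g\<in>carrier G.
      transition_op G \<mu> t (matrix_coeff e \<pi> i j) g =
      (if i = 1 \<and> spherical G K \<pi>
       then exp (- of_real t * cnj (\<eta> \<pi>)) * matrix_coeff e \<pi> i j g else 0)) \<and>
    ((\<forall>t>0. has_continuous_density T m (\<mu> t)) \<longrightarrow>
      (\<forall>t>0. L2_trace_class m (transition_op G \<mu> t) \<and>
        (\<lambda>\<pi>. of_nat (rep_dim G \<pi>) * exp (- of_real t * \<eta> \<pi>))
          summable_on {\<pi> \<in> D. spherical G K \<pi>} \<and>
        L2_has_trace m (transition_op G \<mu> t)
          (\<Sum>\<^sub>\<infinity>\<pi>\<in>{\<pi> \<in> D. spherical G K \<pi>}. of_nat (rep_dim G \<pi>) * exp (- of_real t * \<eta> \<pi>))))"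
proof -
  have \<mu>: "borel_prob T (\<mu> t)" "bi_invariant G K (\<mu> t)" if "0 \<le> t" for t
    using mu(1,2) that by (auto simp: convolution_semigroup_def)
  \<comment> \<open>The measure at time 0 is the Haar measure of K and is bi-invariant under K, so
    it serves as the averaging measure over K.\<close>
  obtain \<sigma> where "symmetric_haar_group G T m K (\<mu> 0) \<sigma>"
    using symmetric_space_haar_group[OF X(1) G T K lie haar mu(3) \<mu>(2)] by auto
  then interpret spherical_dual G T m K "\<mu> 0" \<sigma> D e
    using dual by (simp add: spherical_dual_def spherical_dual_axioms_def)
  have SD: "{\<pi> \<in> D. spherical G K \<pi>} = SD"
    by (simp add: SD_def)
  have \<eta>: "(\<integral>g. spherical_fun e \<pi> g \<partial>\<mu> t) = exp (- of_real t * \<eta> \<pi>)" if "\<pi> \<in> SD" "0 \<le> t" for \<pi> t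
    using chi that by (simp add: SD_def)
  show ?thesis
    unfolding SD
  proof (intro conjI allI impI ballI)
    fix t :: real and \<pi> i j g
    assume t: "0 \<le> t" and \<pi>: "\<pi> \<in> D" and ij: "i \<in> {1..rep_dim G \<pi>}" "j \<in> {1..rep_dim G \<pi>}" and g: "g \<in> carrier G"
    have "cnj (exp (- of_real t * \<eta> \<pi>)) = exp (- of_real t * cnj (\<eta> \<pi>))"
      by (simp add: exp_cnj)
    then show "transition_op G \<mu> t (matrix_coeff e \<pi> i j) g =
        (if i = 1 \<and> spherical G K \<pi> then exp (- of_real t * cnj (\<eta> \<pi>)) * matrix_coeff e \<pi> i j g else 0)"
      using matrix_coeff_transition[of \<mu> t, OF \<mu>[OF t] \<pi> ij g] \<eta>[OF _ t] \<pi> by (simp add: SD_def)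
  next
    fix t :: real
    assume "\<forall>t>0. has_continuous_density T m (\<mu> t)" and t: "0 < t"
    then have dens: "\<And>t. 0 < t \<Longrightarrow> has_continuous_density T m (\<mu> t)"
      by blast
    note tr = semigroup_trace[of \<mu>, OF \<mu> \<eta> dens t]
    show "L2_trace_class m (transition_op G \<mu> t)"
      by (rule tr(1))
    show "(\<lambda>\<pi>. of_nat (rep_dim G \<pi>) * exp (- of_real t * \<eta> \<pi>)) summable_on SD"
      by (rule tr(2))
    show "L2_has_trace m (transition_op G \<mu> t) (\<Sum>\<^sub>\<infinity>\<pi>\<in>SD. of_nat (rep_dim G \<pi>) * exp (- of_real t * \<eta> \<pi>))"
      by (rule tr(3))
  qed
qed

end
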